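(* Let $\mathbf{F}_q$ be the finite field with $q$ elements, let $\lambda\in\mathbf{F}_q$, and let $X_0$ be the hypersurface of dimension $n-1$ $$x_0^{n+1}+\cdots+x_n^{n+1}+\lambda x_0\cdots x_n=0$$ in $\mathbf{P}^n_{\mathbf{F}_q}$, assumed to be smooth. Let $$G=\Bigl\{(\zeta_0,\ldots,\zeta_n)\ \Big|\ \zeta_i\in\mathbf{F}_q,\ \zeta_i^{n+1}=1,\ \prod_{i=0}^n\zeta_i=1\Bigr\},$$ and consider the action $G\times X_0\to X_0$ defined by $$(\zeta_0,\ldots,\zeta_n)\times[x_0:\ldots:x_n]\mapsto[\zeta_0x_0:\ldots:\zeta_nx_n].$$ Then for any natural number $k\ge 1$, $$\#X_0(\mathbf{F}_{q^k})\equiv\#(X_0/G)(\mathbf{F}_{q^k})\pmod{q^k}.$$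
   Context: $X_0/G$ denotes the quotient scheme of $X_0$ by the action of the finite group $G$ (it exists since $X_0$ is projective). For an $\mathbf{F}_q$-scheme $Z$, $\#Z(\mathbf{F}_{q^k})$ denotes the number of $\mathbf{F}_{q^k}$-rational points of $Z$. *)

theory Defs
  imports
    "HOL-Analysis.Abstract_Topology"
    "HOL-Library.Poly_Mapping"
    "HOL-Library.Cardinality"
    "HOL-Algebra.Algebraic_Closure_Type"
    "HOL-Combinatorics.Permutations"
    "HOL-Number_Theory.Cong"
begin

section \<open>Ringed spaces over a field\<close>

text \<open>
  A space with a sheaf of algebras over the field \<open>'f\<close>. \<open>scalar\<close> is the structure map from
  \<open>'f\<close> into the ring of global sections; for a locally ringed space this is the same datum as
  a morphism to the spectrum of \<open>'f\<close>. Only \<open>sections Z U\<close> with \<open>U\<close> open matters.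
\<close>

record ('p, 's, 'f) ringed_space =
  underlying :: "'p topology"
  sections :: "'p set \<Rightarrow> 's ring"
  restr :: "'p set \<Rightarrow> 'p set \<Rightarrow> 's \<Rightarrow> 's"
  scalar :: "'f \<Rightarrow> 's"

abbreviation points :: "('p, 's, 'f) ringed_space \<Rightarrow> 'p set" where
  "points Z \<equiv> topspace (underlying Z)"

definition preimage :: "('p, 's, 'f) ringed_space \<Rightarrow> ('p \<Rightarrow> 'r) \<Rightarrow> 'r set \<Rightarrow> 'p set" where
  "preimage Z f V = {x \<in> points Z. f x \<in> V}"

text \<open>The germ at \<open>x\<close> of a section \<open>s\<close> over \<open>U\<close> is a unit of the stalk at \<open>x\<close>.\<close>

definition germ_unit :: "('p, 's, 'f) ringed_space \<Rightarrow> 'p set \<Rightarrow> 'p \<Rightarrow> 's \<Rightarrow> bool" where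
  "germ_unit Z U x s \<longleftrightarrow>
     (\<exists>W. openin (underlying Z) W \<and> x \<in> W \<and> W \<subseteq> U \<and> restr Z U W s \<in> Units (sections Z W))"

text \<open>
  Morphisms \<open>Z \<rightarrow> Y\<close> of locally ringed spaces over \<open>'f\<close>: a continuous map \<open>f\<close> with the maps
  \<open>h V : O\<^sub>Y(V) \<rightarrow> O\<^sub>Z(f\<^sup>-\<^sup>1 V)\<close>. The last condition says that the induced maps on stalks
  are local, i.e. reflect units. All functions are taken extensional, so that each morphism is
  represented exactly once and morphisms can be counted.
\<close>

definition Mor ::
  "('p, 's, 'f) ringed_space \<Rightarrow> ('r, 't, 'f) ringed_space \<Rightarrow> (('p \<Rightarrow> 'r) \<times> ('r set \<Rightarrow> 't \<Rightarrow> 's)) set"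
where
  "Mor Z Y = {(f, h).
     f \<in> extensional (points Z) \<and>
     continuous_map (underlying Z) (underlying Y) f \<and>
     h \<in> extensional {V. openin (underlying Y) V} \<and>
     (\<forall>V. openin (underlying Y) V \<longrightarrow>
        h V \<in> extensional (carrier (sections Y V)) \<and>
        h V \<in> ring_hom (sections Y V) (sections Z (preimage Z f V))) \<and>
     (\<forall>V W. openin (underlying Y) V \<longrightarrow> openin (underlying Y) W \<longrightarrow> W \<subseteq> V \<longrightarrow>
        (\<forall>s \<in> carrier (sections Y V).
           h W (restr Y V W s) = restr Z (preimage Z f V) (preimage Z f W) (h V s))) \<and>
     (\<forall>c. h (points Y) (scalar Y c) = scalar Z c) \<and>
     (\<forall>V. openin (underlying Y) V \<longrightarrow> (\<forall>s \<in> carrier (sections Y V). \<forall>x \<in> preimage Z f V.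
        germ_unit Z (preimage Z f V) x (h V s) \<longrightarrow> germ_unit Y V (f x) s))}"

definition isomorphic ::
  "('p, 's, 'f) ringed_space \<Rightarrow> ('r, 't, 'f) ringed_space \<Rightarrow> bool" where
  "isomorphic Z Y \<longleftrightarrow> (\<exists>(f, h) \<in> Mor Z Y.
     homeomorphic_map (underlying Z) (underlying Y) f \<and>
     (\<forall>V. openin (underlying Y) V \<longrightarrow>
        h V \<in> ring_iso (sections Y V) (sections Z (preimage Z f V))))"

definition open_subspace ::
  "('p, 's, 'f) ringed_space \<Rightarrow> 'p set \<Rightarrow> ('p, 's, 'f) ringed_space" where
  "open_subspace Z U =
     \<lparr>underlying = subtopology (underlying Z) U, sections = sections Z, restr = restr Z,
      scalar = (\<lambda>c. restr Z (points Z) U (scalar Z c))\<rparr>"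

section \<open>Spec and Proj\<close>

text \<open>
  Both are instances of one construction: for a ring \<open>R\<close> with graded pieces \<open>D i\<close>, localise at a
  prime \<open>p\<close> by inverting the homogeneous elements outside \<open>p\<close> and keep the fractions of degree
  zero. For \<open>Spec R\<close> the grading is the trivial one, with the single piece \<open>carrier R\<close>.
  \<open>fraction R D p a b\<close> is the class of \<open>a/b\<close>, as a set of pairs.
\<close>

definition homogeneous :: "('i \<Rightarrow> 'a set) \<Rightarrow> 'a set" where
  "homogeneous D = (\<Union>i. D i)"

definition fraction ::
  "'a ring \<Rightarrow> ('i \<Rightarrow> 'a set) \<Rightarrow> 'a set \<Rightarrow> 'a \<Rightarrow> 'a \<Rightarrow> ('a \<times> 'a) set" where
  "fraction R D p a b = {(a', b'). (\<exists>i. a' \<in> D i \<and> b' \<in> D i) \<and> b' \<notin> p \<and>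
     (\<exists>t \<in> homogeneous D - p. t \<otimes>\<^bsub>R\<^esub> (a \<otimes>\<^bsub>R\<^esub> b') = t \<otimes>\<^bsub>R\<^esub> (a' \<otimes>\<^bsub>R\<^esub> b))}"

definition fraction_mult ::
  "'a ring \<Rightarrow> ('i \<Rightarrow> 'a set) \<Rightarrow> 'a set \<Rightarrow> ('a \<times> 'a) set \<Rightarrow> ('a \<times> 'a) set \<Rightarrow> ('a \<times> 'a) set" where
  "fraction_mult R D p x y =
     (\<Union>(a, b) \<in> x. \<Union>(a', b') \<in> y. fraction R D p (a \<otimes>\<^bsub>R\<^esub> a') (b \<otimes>\<^bsub>R\<^esub> b'))"

definition fraction_add ::
  "'a ring \<Rightarrow> ('i \<Rightarrow> 'a set) \<Rightarrow> 'a set \<Rightarrow> ('a \<times> 'a) set \<Rightarrow> ('a \<times> 'a) set \<Rightarrow> ('a \<times> 'a) set" where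
  "fraction_add R D p x y =
     (\<Union>(a, b) \<in> x. \<Union>(a', b') \<in> y.
        fraction R D p (a \<otimes>\<^bsub>R\<^esub> b' \<oplus>\<^bsub>R\<^esub> a' \<otimes>\<^bsub>R\<^esub> b) (b \<otimes>\<^bsub>R\<^esub> b'))"

definition zariski :: "('i \<Rightarrow> 'a set) \<Rightarrow> 'a set set \<Rightarrow> 'a set topology" where
  "zariski D P = topology_generated_by ((\<lambda>a. {p \<in> P. a \<notin> p}) ` homogeneous D)"

text \<open>Sections over \<open>U\<close> are the families of fractions that are locally given by one fraction.\<close>

definition structure_sections ::
  "'a ring \<Rightarrow> ('i \<Rightarrow> 'a set) \<Rightarrow> 'a set set \<Rightarrow> 'a set set \<Rightarrow> ('a set \<Rightarrow> ('a \<times> 'a) set) ring" where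
  "structure_sections R D P U =
     \<lparr>carrier = {s \<in> extensional U. \<forall>p \<in> U. \<exists>V i. openin (zariski D P) V \<and> p \<in> V \<and> V \<subseteq> U \<and>
        (\<exists>a \<in> D i. \<exists>b \<in> D i. \<forall>r \<in> V. b \<notin> r \<and> s r = fraction R D r a b)},
      monoid.mult = (\<lambda>s t. \<lambda>p \<in> U. fraction_mult R D p (s p) (t p)),
      one = (\<lambda>p \<in> U. fraction R D p \<one>\<^bsub>R\<^esub> \<one>\<^bsub>R\<^esub>),
      zero = (\<lambda>p \<in> U. fraction R D p \<zero>\<^bsub>R\<^esub> \<one>\<^bsub>R\<^esub>),
      add = (\<lambda>s t. \<lambda>p \<in> U. fraction_add R D p (s p) (t p))\<rparr>"

definition prime_space ::
  "'a ring \<Rightarrow> ('i \<Rightarrow> 'a set) \<Rightarrow> 'a set set \<Rightarrow> ('f \<Rightarrow> 'a)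
   \<Rightarrow> ('a set, 'a set \<Rightarrow> ('a \<times> 'a) set, 'f) ringed_space" where
  "prime_space R D P \<kappa> =
     \<lparr>underlying = zariski D P, sections = structure_sections R D P,
      restr = (\<lambda>U V s. restrict s V),
      scalar = (\<lambda>c. \<lambda>p \<in> P. fraction R D p (\<kappa> c) \<one>\<^bsub>R\<^esub>)\<rparr>"

text \<open>The argument \<open>\<kappa>\<close> is the structure map of the \<open>'f\<close>-algebra \<open>R\<close>.\<close>

definition Spec ::
  "'a ring \<Rightarrow> ('f \<Rightarrow> 'a) \<Rightarrow> ('a set, 'a set \<Rightarrow> ('a \<times> 'a) set, 'f) ringed_space" where
  "Spec R \<kappa> = prime_space R (\<lambda>_ :: unit. carrier R) {p. primeideal p R} \<kappa>"

definition Proj ::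
  "'a ring \<Rightarrow> (nat \<Rightarrow> 'a set) \<Rightarrow> ('f \<Rightarrow> 'a)
   \<Rightarrow> ('a set, 'a set \<Rightarrow> ('a \<times> 'a) set, 'f) ringed_space" where
  "Proj R D \<kappa> = prime_space R D
     {p. primeideal p R \<and> genideal R (p \<inter> homogeneous D) = p \<and> \<not> (\<Union>d \<in> {0<..}. D d) \<subseteq> p} \<kappa>"

text \<open>The automorphism of \<open>Proj R\<close> induced by a graded automorphism \<open>\<phi>\<close> of \<open>R\<close>.\<close>

definition Proj_map ::
  "'a ring \<Rightarrow> (nat \<Rightarrow> 'a set) \<Rightarrow> ('f \<Rightarrow> 'a) \<Rightarrow> ('a \<Rightarrow> 'a)
   \<Rightarrow> ('a set \<Rightarrow> 'a set)
      \<times> ('a set set \<Rightarrow> ('a set \<Rightarrow> ('a \<times> 'a) set) \<Rightarrow> ('a set \<Rightarrow> ('a \<times> 'a) set))" where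
  "Proj_map R D \<kappa> \<phi> =
     (let Z = Proj R D \<kappa>; f = (\<lambda>p \<in> points Z. {a \<in> carrier R. \<phi> a \<in> p})
      in (f,
          \<lambda>U \<in> {U. openin (underlying Z) U}. \<lambda>s \<in> carrier (sections Z U). \<lambda>p \<in> preimage Z f U.
            (\<Union>(a, b) \<in> s (f p). fraction R D p (\<phi> a) (\<phi> b))))"

section \<open>Quotient by a finite group\<close>

text \<open>
  For a group \<open>A\<close> of automorphisms of \<open>Z\<close>, the quotient \<open>\<pi> : Z \<rightarrow> Z/A\<close> is the orbit
  space with the quotient topology and with structure sheaf the invariants
  \<open>(\<pi>\<^sub>* O\<^sub>Z)\<^sup>A\<close>. For \<open>A\<close> finite and \<open>Z\<close> a scheme in which every orbit lies in an affine open
  set (e.g. \<open>Z\<close> quasi-projective) this is the quotient scheme (SGA 1, Exp. V, Sect. 1; Mumford,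
  Abelian Varieties, Sect. 7).
\<close>

definition orbit :: "(('p \<Rightarrow> 'p) \<times> 'h) set \<Rightarrow> 'p \<Rightarrow> 'p set" where
  "orbit A x = (\<lambda>(f, h). f x) ` A"

definition quotient_topology ::
  "('p, 's, 'f) ringed_space \<Rightarrow> (('p \<Rightarrow> 'p) \<times> 'h) set \<Rightarrow> 'p set topology" where
  "quotient_topology Z A = topology (\<lambda>V. V \<subseteq> orbit A ` points Z \<and>
     openin (underlying Z) {x \<in> points Z. orbit A x \<in> V})"

lemma openin_quotient_topology:
  "openin (quotient_topology Z A) V \<longleftrightarrow> V \<subseteq> orbit A ` points Z \<and>
     openin (underlying Z) {x \<in> points Z. orbit A x \<in> V}"
proof -
  have "istopology (\<lambda>V. V \<subseteq> orbit A ` points Z \<and> openin (underlying Z) {x \<in> points Z. orbit A x \<in> V})"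
    unfolding istopology_def
  proof (intro conjI allI impI)
    fix S T
    assume "S \<subseteq> orbit A ` points Z \<and> openin (underlying Z) {x \<in> points Z. orbit A x \<in> S}"
      and "T \<subseteq> orbit A ` points Z \<and> openin (underlying Z) {x \<in> points Z. orbit A x \<in> T}"
    moreover have "{x \<in> points Z. orbit A x \<in> S \<inter> T}
      = {x \<in> points Z. orbit A x \<in> S} \<inter> {x \<in> points Z. orbit A x \<in> T}" by blast
    ultimately show "S \<inter> T \<subseteq> orbit A ` points Z"
      "openin (underlying Z) {x \<in> points Z. orbit A x \<in> S \<inter> T}"
      by (auto intro: openin_Int)
  next
    fix \<K>
    assume K: "\<forall>S \<in> \<K>. S \<subseteq> orbit A ` points Z \<and> openin (underlying Z) {x \<in> points Z. orbit A x \<in> S}"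
    have "{x \<in> points Z. orbit A x \<in> \<Union>\<K>} = (\<Union>S \<in> \<K>. {x \<in> points Z. orbit A x \<in> S})" by blast
    with K show "\<Union>\<K> \<subseteq> orbit A ` points Z" "openin (underlying Z) {x \<in> points Z. orbit A x \<in> \<Union>\<K>}"
      by auto
  qed
  then show ?thesis
    unfolding quotient_topology_def by (simp add: topology_inverse')
qed

definition quotient_space ::
  "('p, 's, 'f) ringed_space \<Rightarrow> (('p \<Rightarrow> 'p) \<times> ('p set \<Rightarrow> 's \<Rightarrow> 's)) set
   \<Rightarrow> ('p set, 's, 'f) ringed_space" where
  "quotient_space Z A =
     \<lparr>underlying = quotient_topology Z A,
      sections = (\<lambda>V. (sections Z (\<Union>V))
        \<lparr>carrier := {s \<in> carrier (sections Z (\<Union>V)). \<forall>(f, h) \<in> A. h (\<Union>V) s = s}\<rparr>),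
      restr = (\<lambda>V W. restr Z (\<Union>V) (\<Union>W)),
      scalar = scalar Z\<rparr>"

section \<open>Polynomials and smoothness\<close>

type_synonym 'a mpoly = "(nat \<Rightarrow>\<^sub>0 nat) \<Rightarrow>\<^sub>0 'a"

definition ring_on :: "'a :: comm_ring_1 set \<Rightarrow> 'a ring" where
  "ring_on A = \<lparr>carrier = A, monoid.mult = (*), one = 1, zero = 0, add = (+)\<rparr>"

definition Var :: "nat \<Rightarrow> 'a :: comm_ring_1 mpoly" where
  "Var i = Poly_Mapping.single (Poly_Mapping.single i 1) 1"

definition Const :: "'a :: comm_ring_1 \<Rightarrow> 'a mpoly" where
  "Const c = Poly_Mapping.single 0 c"

definition mpolys :: "nat set \<Rightarrow> 'a :: comm_ring_1 mpoly set" where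
  "mpolys I = {P. \<forall>m \<in> Poly_Mapping.keys P. Poly_Mapping.keys m \<subseteq> I}"

definition mono_degree :: "(nat \<Rightarrow>\<^sub>0 nat) \<Rightarrow> nat" where
  "mono_degree m = (\<Sum>i \<in> Poly_Mapping.keys m. Poly_Mapping.lookup m i)"

definition partial :: "nat \<Rightarrow> 'a :: comm_ring_1 mpoly \<Rightarrow> 'a mpoly" where
  "partial j P = (\<Sum>m \<in> Poly_Mapping.keys P.
     Poly_Mapping.single (m - Poly_Mapping.single j 1)
       (of_nat (Poly_Mapping.lookup m j) * Poly_Mapping.lookup P m))"

text \<open>The substitution \<open>Var i \<mapsto> \<zeta> i * Var i\<close>.\<close>

definition scale_vars :: "(nat \<Rightarrow> 'a) \<Rightarrow> 'a :: comm_ring_1 mpoly \<Rightarrow> 'a mpoly" where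
  "scale_vars \<zeta> P = (\<Sum>m \<in> Poly_Mapping.keys P.
     Poly_Mapping.single m (Poly_Mapping.lookup P m *
       (\<Prod>i \<in> Poly_Mapping.keys m. \<zeta> i ^ Poly_Mapping.lookup m i)))"

definition quot_alg :: "nat set \<Rightarrow> 'a :: comm_ring_1 mpoly set \<Rightarrow> 'a mpoly set ring" where
  "quot_alg I E = ring_on (mpolys I) Quot genideal (ring_on (mpolys I)) E"

definition quot_class ::
  "nat set \<Rightarrow> 'a :: comm_ring_1 mpoly set \<Rightarrow> 'a mpoly \<Rightarrow> 'a mpoly set" where
  "quot_class I E P = genideal (ring_on (mpolys I)) E +>\<^bsub>ring_on (mpolys I)\<^esub> P"

text \<open>
  Standard smooth algebras: \<open>'a[x\<^sub>0, \<dots>, x\<^sub>m\<^sub>-\<^sub>1]/(f\<^sub>0, \<dots>, f\<^sub>c\<^sub>-\<^sub>1)\<close> with \<open>c \<le> m\<close> and the determinant of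
  \<open>(\<partial>f\<^sub>i/\<partial>x\<^sub>j)\<close>, \<open>i, j < c\<close>, invertible in the algebra.
\<close>

definition jacobian_det :: "'a :: comm_ring_1 mpoly list \<Rightarrow> 'a mpoly" where
  "jacobian_det fs = (\<Sum>\<pi> | \<pi> permutes {..<length fs}.
     of_int (sign \<pi>) * (\<Prod>i<length fs. partial (\<pi> i) (fs ! i)))"

definition standard_smooth :: "nat \<Rightarrow> 'a :: comm_ring_1 mpoly list \<Rightarrow> bool" where
  "standard_smooth m fs \<longleftrightarrow> set fs \<subseteq> mpolys {..<m} \<and> length fs \<le> m \<and>
     quot_class {..<m} (set fs) (jacobian_det fs) \<in> Units (quot_alg {..<m} (set fs))"

text \<open>A scheme is smooth over \<open>'f\<close> iff it is locally the spectrum of a standard smooth algebra.\<close>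

definition smooth :: "('p, 's, 'f :: field) ringed_space \<Rightarrow> bool" where
  "smooth Z \<longleftrightarrow> (\<forall>x \<in> points Z. \<exists>U (m :: nat) (fs :: 'f mpoly list).
     openin (underlying Z) U \<and> x \<in> U \<and> standard_smooth m fs \<and>
     isomorphic (open_subspace Z U)
       (Spec (quot_alg {..<m} (set fs)) (\<lambda>c. quot_class {..<m} (set fs) (Const c))))"

section \<open>Rational points over finite fields\<close>

text \<open>
  The extension of degree \<open>k\<close> of a finite field \<open>'f\<close> with \<open>q\<close> elements, as the subfield
  \<open>{x. x ^ (q ^ k) = x}\<close> of the algebraic closure.
\<close>

definition ext_field :: "nat \<Rightarrow> 'f :: {field, finite} alg_closure ring" where
  "ext_field k = ring_on {x. x ^ (CARD('f) ^ k) = x}"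

definition rational_points ::
  "('p, 's, 'f :: {field, finite}) ringed_space \<Rightarrow> nat
   \<Rightarrow> (('f alg_closure set \<Rightarrow> 'p)
       \<times> ('p set \<Rightarrow> 's \<Rightarrow> 'f alg_closure set \<Rightarrow> ('f alg_closure \<times> 'f alg_closure) set)) set" where
  "rational_points Z k = Mor (Spec (ext_field k) to_ac) Z"

section \<open>The hypersurface and the group action\<close>

definition dwork_poly :: "nat \<Rightarrow> 'f :: field \<Rightarrow> 'f mpoly" where
  "dwork_poly n lam = (\<Sum>i\<le>n. Var i ^ (n + 1)) + Const lam * (\<Prod>i\<le>n. Var i)"

abbreviation dwork_ring :: "nat \<Rightarrow> 'f :: field \<Rightarrow> 'f mpoly set ring" where
  "dwork_ring n lam \<equiv> quot_alg {..n} {dwork_poly n lam}"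

definition dwork_grading :: "nat \<Rightarrow> 'f :: field \<Rightarrow> nat \<Rightarrow> 'f mpoly set set" where
  "dwork_grading n lam d = quot_class {..n} {dwork_poly n lam} `
     {P \<in> mpolys {..n}. \<forall>m \<in> Poly_Mapping.keys P. mono_degree m = d}"

abbreviation dwork_scalar :: "nat \<Rightarrow> 'f :: field \<Rightarrow> 'f \<Rightarrow> 'f mpoly set" where
  "dwork_scalar n lam \<equiv> (\<lambda>c. quot_class {..n} {dwork_poly n lam} (Const c))"

definition dwork_hypersurface ::
  "nat \<Rightarrow> 'f :: field
   \<Rightarrow> ('f mpoly set set, 'f mpoly set set \<Rightarrow> ('f mpoly set \<times> 'f mpoly set) set, 'f) ringed_space"
where
  "dwork_hypersurface n lam = Proj (dwork_ring n lam) (dwork_grading n lam) (dwork_scalar n lam)"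

definition dwork_group :: "nat \<Rightarrow> (nat \<Rightarrow> 'f :: field) set" where
  "dwork_group n = {\<zeta> \<in> extensional {..n}. (\<forall>i\<le>n. \<zeta> i ^ (n + 1) = 1) \<and> (\<Prod>i\<le>n. \<zeta> i) = 1}"

text \<open>
  \<open>[x\<^sub>0 : \<dots> : x\<^sub>n] \<mapsto> [\<zeta>\<^sub>0 x\<^sub>0 : \<dots> : \<zeta>\<^sub>n x\<^sub>n]\<close> is induced by \<open>scale_vars \<zeta>\<close>, which fixes the equation
  and hence acts on the homogeneous coordinate ring, an element of which is a coset of polynomials.
\<close>

definition dwork_action ::
  "nat \<Rightarrow> 'f :: field \<Rightarrow> (nat \<Rightarrow> 'f)
   \<Rightarrow> ('f mpoly set set \<Rightarrow> 'f mpoly set set)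
      \<times> ('f mpoly set set set
         \<Rightarrow> ('f mpoly set set \<Rightarrow> ('f mpoly set \<times> 'f mpoly set) set)
         \<Rightarrow> ('f mpoly set set \<Rightarrow> ('f mpoly set \<times> 'f mpoly set) set))" where
  "dwork_action n lam \<zeta> =
     Proj_map (dwork_ring n lam) (dwork_grading n lam) (dwork_scalar n lam) ((`) (scale_vars \<zeta>))"

end

theory Submission
  imports Defs "HOL-Number_Theory.Residues"
    "HOL-Algebra.Sylow"
begin

text \<open>
  Let \<open>Q = q\<^sup>k\<close> with \<open>q = p\<^sup>m\<close>, let \<open>F\<close> be the \<open>Q\<close>-th power map on the algebraic closure, and let \<open>H\<close> be
  \<open>G\<close> or the trivial group, so that both sides of the congruence are counts of the rational points
  of \<open>X/H\<close>.

  \<^emph>\<open>Counting by twisted solutions.\<close> A rational point of \<open>X/H\<close> is an \<open>H\<close>-orbit of geometric points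
  of \<open>X\<close> that \<open>F\<close> maps to itself, that is, an orbit of a point \<open>[x]\<close> with \<open>F x = \<mu> \<zeta> x\<close> for some \<open>\<zeta> \<in> H\<close>
  and some scalar \<open>\<mu>\<close>. Rescaling \<open>x\<close> by a \<open>t\<close> with \<open>t\<^sup>Q\<^sup>-\<^sup>1 = 1/\<mu>\<close> removes \<open>\<mu>\<close>. So the rational points
  are covered by the pairs \<open>(\<zeta>, x)\<close> where \<open>\<zeta> \<in> H\<close> and \<open>x \<noteq> 0\<close> is a solution of the equation with
  \<open>x\<^sub>i\<^sup>Q = \<zeta>\<^sub>i x\<^sub>i\<close> for all \<open>i\<close>, and each is hit by exactly \<open>|H| (Q - 1)\<close> pairs. With \<open>M\<^sub>\<zeta>\<close> the number of
  these solutions, \<open>0\<close> included, this says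
  \<open>|H| (Q - 1) #(X/H) + |H| = (\<Sum>\<zeta>\<in>H. M\<^sub>\<zeta>)\<close>; see \<open>orbit_count\<close>.

  \<^emph>\<open>The twist does not matter modulo \<open>Q\<close>.\<close> The arithmetic core, \<open>twisted_zeros_cong\<close>, is
  \<open>M\<^sub>\<zeta> \<equiv> M\<^sub>1 (mod Q)\<close> for \<open>\<zeta> \<in> G\<close>. It gives \<open>|H| (Q - 1) #(X/H) + |H| \<equiv> |H| M\<^sub>1\<close>. As \<open>|G|\<close> and \<open>Q - 1\<close> are
  prime to \<open>p\<close>, they can be cancelled, and \<open>#(X/H)\<close> modulo \<open>Q\<close> is the same for both groups.
  For the proof of the core, write \<open>Q = p\<^sup>a\<close> and replace the coordinates by Teichmueller
  representatives in a ring of characteristic zero. The \<open>(Q - 1) p\<^sup>a\<^sup>-\<^sup>1\<close>-th power of the lifted equation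
  is modulo \<open>p\<^sup>a\<close> the indicator of the non-solutions. Expand it by the multinomial theorem and sum
  each coordinate over the line \<open>x\<^sup>Q = \<zeta>\<^sub>i x\<close>: the twist enters only through powers of the \<open>\<zeta>\<^sub>i\<close>. A count
  of base-\<open>p\<close> digits (\<open>prime_power_dvd_multinomial_or_cong\<close>) shows that, in every term that is not
  zero modulo \<open>Q\<close>, the exponents of these powers are congruent modulo \<open>n + 1\<close> for all \<open>i\<close>, so that
  the powers multiply to a power of \<open>\<Prod>\<zeta>\<^sub>i = 1\<close>.

  \<^emph>\<open>From morphisms to orbits.\<close> A morphism from the spectrum of a field \<open>K\<close> is a point \<open>z\<close> together
  with \<open>K\<close>-values of all sections near \<open>z\<close> (\<open>mor_in_Mor\<close>, \<open>Mor_cases\<close>). Three facts turn such data on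
  \<open>X/H\<close> into an orbit. A homogeneous prime over \<open>z\<close> consists of the forms that vanish at a geometric
  point \<open>x\<close> (\<open>closed_point\<close>), because the ratios of its coordinates are zero or roots of unity.
  The given values differ from those at \<open>x\<close> by a power of the \<open>q\<close>-Frobenius
  (\<open>finite_correspondence_is_frobenius\<close>), which can be moved onto \<open>x\<close>. Two geometric points at which
  all invariant fractions agree lie in one orbit (\<open>values_separate\<close>); this is character duality for a
  finite group of diagonal matrices (\<open>torus_duality\<close>).
\<close>

section \<open>Multinomial coefficients and digit sums\<close>

text \<open>
  Exponents of the monomials of degree \<open>D\<close> in the variables \<open>I\<close>; extensional, so that they form a
  finite set.
\<close>

definition compositions :: "'i set \<Rightarrow> nat \<Rightarrow> ('i \<Rightarrow> nat) set" where
  "compositions I D = {u \<in> extensional I. sum u I = D}"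

definition multinomial :: "'i set \<Rightarrow> ('i \<Rightarrow> nat) \<Rightarrow> nat" where
  "multinomial I u = fact (sum u I) div (\<Prod>i\<in>I. fact (u i))"

lemma finite_compositions: "finite I \<Longrightarrow> finite (compositions I D)"
proof (rule finite_subset)
  assume I: "finite I"
  show "compositions I D \<subseteq> PiE I (\<lambda>_. {..D})"
    using I by (auto simp: compositions_def PiE_iff extensional_def intro: member_le_sum)
  show "finite (PiE I (\<lambda>_. {..D}))"
    using I by (intro finite_PiE) auto
qed

lemma prod_fact_dvd_fact_sum: "finite I \<Longrightarrow> (\<Prod>i\<in>I. fact (u i)) dvd (fact (sum u I) :: nat)"
proof (induction I rule: finite_induct)
  case (insert i I)
  have "fact (u i) * (\<Prod>i\<in>I. fact (u i)) dvd fact (u i) * (fact (sum u I) :: nat)"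
    using insert by (intro mult_dvd_mono) auto
  also have "\<dots> dvd fact (u i + sum u I)"
    by (rule fact_fact_dvd_fact)
  finally show ?case using insert by simp
qed auto

lemma multinomial_mult_prod_fact:
  "finite I \<Longrightarrow> multinomial I u * (\<Prod>i\<in>I. fact (u i)) = fact (sum u I)"
  unfolding multinomial_def by (rule dvd_div_mult_self[OF prod_fact_dvd_fact_sum])

lemma multinomial_insert:
  assumes "finite I" "i \<notin> I"
  shows "multinomial (insert i I) u = ((u i + sum u I) choose u i) * multinomial I u"
proof -
  let ?P = "\<Prod>j\<in>insert i I. fact (u j) :: nat"
  have "multinomial (insert i I) u * ?P = fact (u i + sum u I)"
    using multinomial_mult_prod_fact[of "insert i I" u] assms by simp
  also have "\<dots> = ((u i + sum u I) choose u i) * (fact (u i) * fact (sum u I))"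
    using binomial_fact_lemma[of "u i" "u i + sum u I"] by (simp add: ac_simps)
  also have "\<dots> = ((u i + sum u I) choose u i) * multinomial I u * ?P"
    using multinomial_mult_prod_fact[of I u] assms by (simp add: ac_simps)
  finally have "multinomial (insert i I) u * ?P = (((u i + sum u I) choose u i) * multinomial I u) * ?P" .
  moreover have "?P \<noteq> 0" using assms by simp
  ultimately show ?thesis by (simp only: mult_cancel2) simp
qed

lemma multinomial_cong: "(\<And>i. i \<in> I \<Longrightarrow> u i = v i) \<Longrightarrow> multinomial I u = multinomial I v"
  unfolding multinomial_def by (simp cong: sum.cong prod.cong)

theorem multinomial_theorem:
  fixes z :: "'i \<Rightarrow> 'a :: comm_semiring_1"
  assumes "finite I"
  shows "(\<Sum>i\<in>I. z i) ^ D =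
           (\<Sum>u\<in>compositions I D. of_nat (multinomial I u) * (\<Prod>i\<in>I. z i ^ u i))"
  using assms
proof (induction I arbitrary: D rule: finite_induct)
  case empty
  have "compositions {} D = (if D = 0 then {\<lambda>_. undefined} else ({} :: ('i \<Rightarrow> nat) set))"
    by (auto simp: compositions_def extensional_def)
  thus ?case by (simp add: multinomial_def power_0_left)
next
  case (insert i I)
  let ?g = "\<lambda>u. of_nat (multinomial (insert i I) u) * (\<Prod>j\<in>insert i I. z j ^ u j)"
  let ?S = "SIGMA k:{..D}. compositions I (D - k)"
  have sum_upd: "sum (u(i := m)) I = sum u I" for u and m :: nat
    using insert by (intro sum.cong) auto
  have prod_upd: "(\<Prod>j\<in>I. z j ^ (u(i := m)) j) = (\<Prod>j\<in>I. z j ^ u j)" for u m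
    using insert by (intro prod.cong) auto
  have "(\<Sum>j\<in>insert i I. z j) ^ D = (z i + (\<Sum>j\<in>I. z j)) ^ D"
    using insert by simp
  also have "\<dots> = (\<Sum>k\<le>D. of_nat (D choose k) * z i ^ k * (\<Sum>j\<in>I. z j) ^ (D - k))"
    by (rule binomial_ring)
  also have "\<dots> = (\<Sum>k\<le>D. \<Sum>u\<in>compositions I (D - k).
      of_nat (D choose k) * z i ^ k * (of_nat (multinomial I u) * (\<Prod>j\<in>I. z j ^ u j)))"
    by (simp only: insert.IH sum_distrib_left)
  also have "\<dots> = (\<Sum>(k, u)\<in>?S. of_nat (D choose k) * z i ^ k *
      (of_nat (multinomial I u) * (\<Prod>j\<in>I. z j ^ u j)))"
    using insert by (subst sum.Sigma) (auto intro: finite_compositions)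
  also have "\<dots> = (\<Sum>u\<in>compositions (insert i I) D. ?g u)"
  proof (rule sum.reindex_bij_witness[of _ "\<lambda>u. (u i, u(i := undefined))" "\<lambda>(k, u). u(i := k)"])
    fix a assume "a \<in> ?S"
    then obtain k u where a: "a = (k, u)" "k \<le> D" "u \<in> extensional I" "sum u I = D - k"
      by (auto simp: compositions_def)
    show "(case a of (k, u) \<Rightarrow> u(i := k)) \<in> compositions (insert i I) D"
      using a insert sum_upd[of u k] by (auto simp: compositions_def extensional_def)
    show "((case a of (k, u) \<Rightarrow> u(i := k)) i, (case a of (k, u) \<Rightarrow> u(i := k))(i := undefined)) = a"
      using a insert by (auto simp: extensional_def fun_eq_iff)
    have "multinomial (insert i I) (u(i := k)) = (D choose k) * multinomial I u"
    proof -
      have "multinomial I (u(i := k)) = multinomial I u"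
        using insert by (intro multinomial_cong) auto
      thus ?thesis
        using multinomial_insert[of I i "u(i := k)"] insert.hyps a sum_upd[of u k] by simp
    qed
    thus "?g (case a of (k, u) \<Rightarrow> u(i := k)) = (case a of (k, u) \<Rightarrow> of_nat (D choose k) * z i ^ k *
            (of_nat (multinomial I u) * (\<Prod>j\<in>I. z j ^ u j)))"
      using a insert prod_upd[of u k] by (simp add: ac_simps)
  next
    fix u assume u: "u \<in> compositions (insert i I) D"
    show "(u i, u(i := undefined)) \<in> ?S"
      using u insert sum_upd[of u undefined] by (auto simp: compositions_def extensional_def)
    show "(case (u i, u(i := undefined)) of (k, u) \<Rightarrow> u(i := k)) = u" by simp
  qed
  finally show ?case .
qed

subsection \<open>Base-\<open>p\<close> digits and multinomial coefficients\<close>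

definition digit :: "nat \<Rightarrow> nat \<Rightarrow> nat \<Rightarrow> nat" where
  "digit p i n = n div p ^ i mod p"

lemma sum_digits_shift: "(\<Sum>i<Suc B. digit p i n * f i) = n mod p * f 0 + (\<Sum>i<B. digit p i (n div p) * f (Suc i))"
  unfolding digit_def by (subst sum.lessThan_Suc_shift) (simp add: div_mult2_eq)

lemma sum_digits: "p > 0 \<Longrightarrow> n < p ^ B \<Longrightarrow> (\<Sum>i<B. digit p i n * p ^ i) = n"
proof (induction B arbitrary: n)
  case (Suc B)
  have "n div p < p ^ B" using Suc.prems by (simp add: less_mult_imp_div_less mult.commute)
  hence "(\<Sum>i<B. digit p i (n div p) * p ^ i) = n div p" by (intro Suc.IH Suc.prems)
  moreover have "(\<Sum>i<B. digit p i (n div p) * p ^ Suc i) = p * (\<Sum>i<B. digit p i (n div p) * p ^ i)"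
    by (simp add: sum_distrib_left ac_simps)
  ultimately show ?case by (simp only: sum_digits_shift) (simp add: mult.commute)
qed auto

text \<open>
  Only the multiples of \<open>p\<close> among \<open>1, \<dots>, n\<close> contribute, and they are \<open>p\<close> times the numbers up to
  \<open>n div p\<close>.
\<close>

lemma multiplicity_fact_div:
  assumes p: "prime (p :: nat)"
  shows "multiplicity p (fact n :: nat) = n div p + multiplicity p (fact (n div p) :: nat)"
proof -
  have F: "multiplicity p (fact m :: nat) = (\<Sum>k\<in>{1..m}. multiplicity p k)" for m
    unfolding fact_prod of_nat_id using p by (subst prime_elem_multiplicity_prod_distrib) auto
  have "multiplicity p (fact n :: nat) = (\<Sum>k\<in>(\<lambda>j. p * j) ` {1..n div p}. multiplicity p k)"
    unfolding F
  proof (rule sum.mono_neutral_right)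
    show "\<forall>k\<in>{1..n} - (\<lambda>j. p * j) ` {1..n div p}. multiplicity p k = 0"
    proof
      fix k assume k: "k \<in> {1..n} - (\<lambda>j. p * j) ` {1..n div p}"
      have "\<not> p dvd k"
      proof
        assume "p dvd k"
        then obtain j where j: "k = p * j" ..
        hence "j \<in> {1..n div p}"
          using k prime_gt_0_nat[OF p] by (auto simp: less_eq_div_iff_mult_less_eq mult.commute Suc_le_eq)
        thus False using k j by blast
      qed
      thus "multiplicity p k = 0" by (rule not_dvd_imp_multiplicity_0)
    qed
  next
    show "(\<lambda>j. p * j) ` {1..n div p} \<subseteq> {1..n}"
      using prime_gt_0_nat[OF p] by (auto simp: less_eq_div_iff_mult_less_eq mult.commute Suc_le_eq)
  qed auto
  also have "\<dots> = (\<Sum>j\<in>{1..n div p}. multiplicity p (p * j))"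
    using prime_gt_0_nat[OF p] by (subst sum.reindex) (auto simp: inj_on_def)
  also have "\<dots> = (\<Sum>j\<in>{1..n div p}. 1 + multiplicity p j)"
    using p by (intro sum.cong) (auto simp: multiplicity_times_same prime_nat_iff)
  also have "\<dots> = n div p + multiplicity p (fact (n div p) :: nat)"
    by (simp add: F sum.distrib del: One_nat_def)
  finally show ?thesis .
qed

text \<open>
  Legendre's formula. Each step of the recursion \<open>multiplicity_fact_div\<close> splits off the last digit.
\<close>

lemma legendre_digit_sum:
  assumes p: "prime (p :: nat)"
  shows "n < p ^ B \<Longrightarrow> (p - 1) * multiplicity p (fact n :: nat) + (\<Sum>i<B. digit p i n) = n"
proof (induction B arbitrary: n)
  case (Suc B)
  define m where "m = n div p"
  have "m < p ^ B" using Suc.prems by (simp add: m_def less_mult_imp_div_less mult.commute)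
  hence IH: "(p - 1) * multiplicity p (fact m :: nat) + (\<Sum>i<B. digit p i m) = m" by (rule Suc.IH)
  have "(p - 1) * multiplicity p (fact n :: nat) = (p - 1) * m + (p - 1) * multiplicity p (fact m :: nat)"
    by (subst multiplicity_fact_div[OF p]) (simp add: m_def algebra_simps)
  moreover have "(\<Sum>i<Suc B. digit p i n) = n mod p + (\<Sum>i<B. digit p i m)"
    using sum_digits_shift[of p n "\<lambda>_. 1" B] by (simp add: m_def)
  moreover have "(p - 1) * m + m = p * m" using prime_gt_0_nat[OF p] by (cases p) auto
  moreover have "n mod p + p * m = n" by (simp add: m_def)
  ultimately show ?case using IH by linarith
qed auto

text \<open>
  Kummer's theorem: \<open>p - 1\<close> times the number of carries is the loss of digit sum in adding the \<open>u j\<close>.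
\<close>

lemma multiplicity_multinomial:
  assumes p: "prime (p :: nat)" and I: "finite I" and B: "sum u I < p ^ B"
  shows "(p - 1) * multiplicity p (multinomial I u) + (\<Sum>i<B. digit p i (sum u I))
           = (\<Sum>j\<in>I. \<Sum>i<B. digit p i (u j))"
proof -
  have nz: "multinomial I u \<noteq> 0"
    using multinomial_mult_prod_fact[OF I, of u] by (metis fact_nonzero mult_eq_0_iff)
  have "multiplicity p (fact (sum u I) :: nat) = multiplicity p (multinomial I u * (\<Prod>j\<in>I. fact (u j)))"
    by (simp only: multinomial_mult_prod_fact[OF I])
  also have "\<dots> = multiplicity p (multinomial I u) + (\<Sum>j\<in>I. multiplicity p (fact (u j) :: nat))"
    using p I nz
    by (subst prime_elem_multiplicity_mult_distrib)
       (auto simp: prime_elem_multiplicity_prod_distrib image_iff)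
  finally have m: "multiplicity p (fact (sum u I) :: nat) = \<dots>" .
  have le: "u j < p ^ B" if "j \<in> I" for j
    using member_le_sum[of j I u] that I B by simp
  have "(\<Sum>j\<in>I. (p - 1) * multiplicity p (fact (u j) :: nat) + (\<Sum>i<B. digit p i (u j))) = sum u I"
    using legendre_digit_sum[OF p le] by (intro sum.cong) auto
  hence "(p - 1) * (\<Sum>j\<in>I. multiplicity p (fact (u j) :: nat)) + (\<Sum>j\<in>I. \<Sum>i<B. digit p i (u j)) = sum u I"
    by (simp add: sum.distrib sum_distrib_left)
  thus ?thesis
    using legendre_digit_sum[OF p B] unfolding m by (simp add: distrib_left)
qed

subsection \<open>Cyclic shifts of digits\<close>

text \<open>
  The digits of \<open>n\<close>, shifted cyclically by \<open>j\<close> places in blocks of length \<open>a\<close> and then added up. Modulo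
  \<open>p ^ a - 1\<close> this is multiplication by \<open>p ^ j\<close>, but it is positive whenever \<open>n\<close> is, and summing over
  all shifts recovers the digit sum.
\<close>

definition rotate_digits :: "nat \<Rightarrow> nat \<Rightarrow> nat \<Rightarrow> nat \<Rightarrow> nat \<Rightarrow> nat" where
  "rotate_digits p a B j n = (\<Sum>i<B. digit p i n * p ^ ((i + j) mod a))"

lemma cong_power_mod_exponent:
  fixes p a :: nat assumes "p > 0"
  shows "[p ^ m = p ^ (m mod a)] (mod (p ^ a - 1))"
proof -
  have "[p ^ a = 1] (mod (p ^ a - 1))"
    using assms by (simp add: cong_altdef_nat)
  hence "[(p ^ a) ^ (m div a) * p ^ (m mod a) = 1 ^ (m div a) * p ^ (m mod a)] (mod (p ^ a - 1))"
    by (intro cong_mult cong_pow cong_refl)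
  moreover have "(p ^ a) ^ (m div a) * p ^ (m mod a) = p ^ m"
    by (simp flip: power_mult power_add)
  ultimately show ?thesis by simp
qed

lemma rotate_digits_cong:
  assumes "p > 0" "n < p ^ B"
  shows "[rotate_digits p a B j n = p ^ j * n] (mod (p ^ a - 1))"
proof -
  have "[rotate_digits p a B j n = (\<Sum>i<B. digit p i n * p ^ (i + j))] (mod (p ^ a - 1))"
    unfolding rotate_digits_def
    by (intro cong_sum cong_mult cong_refl cong_sym[OF cong_power_mod_exponent] assms)
  moreover have "(\<Sum>i<B. digit p i n * p ^ (i + j)) = p ^ j * (\<Sum>i<B. digit p i n * p ^ i)"
    by (simp add: sum_distrib_left power_add ac_simps)
  ultimately show ?thesis using assms by (simp add: sum_digits)
qed

lemma rotate_digits_pos: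
  assumes "p > 0" "n < p ^ B" "n > 0"
  shows "rotate_digits p a B j n > 0"
proof (rule ccontr)
  assume "\<not> ?thesis"
  hence "digit p i n = 0" if "i < B" for i
    using that assms by (auto simp: rotate_digits_def)
  hence "(\<Sum>i<B. digit p i n * p ^ i) = 0" by simp
  thus False using sum_digits[OF assms(1,2)] assms(3) by simp
qed

lemma sum_power_shift:
  fixes p a :: nat assumes "p > 0"
  shows "(\<Sum>j<a. p ^ ((i + j) mod a)) * (p - 1) = p ^ a - 1"
proof -
  have "(\<Sum>j<a. p ^ ((i + j) mod a)) = (\<Sum>j<a. p ^ j)"
  proof (cases "a = 0")
    case False
    have inj: "inj_on (\<lambda>j. (i + j) mod a) {..<a}"
    proof (rule inj_onI)
      fix x y assume "x \<in> {..<a}" "y \<in> {..<a}" "(i + x) mod a = (i + y) mod a"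
      hence "[i + x = i + y] (mod a)" by (simp add: cong_def)
      hence "[x = y] (mod a)" by (simp add: cong_add_lcancel_nat)
      thus "x = y" using \<open>x \<in> _\<close> \<open>y \<in> _\<close> by (simp add: cong_def)
    qed
    have "(\<lambda>j. (i + j) mod a) ` {..<a} = {..<a}"
      using inj False by (intro card_subset_eq) (auto simp: card_image)
    thus ?thesis using sum.reindex[OF inj, of "\<lambda>j. p ^ j"] by simp
  qed auto
  moreover have "(\<Sum>j<a. p ^ j) * (p - 1) = p ^ a - 1"
  proof -
    have "(\<Sum>j<a. p ^ j) * (p - 1) + 1 = p ^ a" for a
    proof (induction a)
      case (Suc a)
      have "p ^ a * (p - 1) + p ^ a = p ^ Suc a" using assms by (cases p) auto
      thus ?case using Suc by (simp add: distrib_right)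
    qed auto
    from this[of a] show ?thesis by linarith
  qed
  ultimately show ?thesis by simp
qed

text \<open>
  Each digit occurs once in every one of the \<open>a\<close> places, so it is multiplied by \<open>1 + p + \<dots> + p\<^sup>a\<^sup>-\<^sup>1\<close>.
\<close>

lemma sum_rotate_digits:
  assumes "p > 0"
  shows "(\<Sum>j<a. rotate_digits p a B j n) * (p - 1) = (\<Sum>i<B. digit p i n) * (p ^ a - 1)"
proof -
  have "(\<Sum>j<a. rotate_digits p a B j n) * (p - 1)
      = (\<Sum>i<B. digit p i n * ((\<Sum>j<a. p ^ ((i + j) mod a)) * (p - 1)))"
    unfolding rotate_digits_def
    by (subst sum.swap, unfold sum_distrib_left sum_distrib_right mult.assoc) (rule refl)
  thus ?thesis unfolding sum_power_shift[OF assms] by (simp only: sum_distrib_right)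
qed

text \<open>
  For every shift \<open>j\<close>, the sum \<open>t\<^sub>j\<close> of the rotated \<open>u i\<close> is divisible by \<open>Q - 1\<close>, because the sum of the
  \<open>u i\<close> is. Write \<open>W i\<close> for the rotated form of the \<open>i\<close>-th hypothesis. It is positive and divisible by
  \<open>Q - 1\<close>, and the sum of the \<open>W i\<close> is \<open>(n + 1) t\<^sub>j\<close>. So \<open>t\<^sub>j \<ge> Q - 1\<close>, and equality forces all \<open>W i\<close> to be
  \<open>Q - 1\<close>, which makes the \<open>u i\<close> congruent. Otherwise \<open>t\<^sub>j \<ge> 2 (Q - 1)\<close> for all \<open>j\<close>. Averaging over \<open>j\<close>,
  the digit sums of the \<open>u i\<close> add up to at least \<open>2 a (p - 1)\<close>, while the total \<open>(Q - 1) p\<^sup>a\<^sup>-\<^sup>1\<close> has digit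
  sum at most \<open>a (p - 1)\<close>. By Kummer's theorem the difference makes \<open>p\<^sup>a\<close> divide the multinomial
  coefficient.
\<close>

lemma prime_power_dvd_multinomial_or_cong:
  fixes u :: "nat \<Rightarrow> nat"
  assumes p: "prime (p :: nat)" and a: "a > 0" and Q: "Q = p ^ a"
    and sum_u: "(\<Sum>i\<le>n. u i) + u (Suc n) = (Q - 1) * p ^ (a - 1)"
    and pos: "\<And>i. i \<le> n \<Longrightarrow> (n + 1) * u i + u (Suc n) > 0"
    and dvd: "\<And>i. i \<le> n \<Longrightarrow> (Q - 1) dvd (n + 1) * u i + u (Suc n)"
  shows "Q dvd multinomial {..Suc n} u \<or> (\<forall>i\<le>n. [u i = u 0] (mod (Q - 1)))"
proof (rule disjCI)
  assume ncong: "\<not> (\<forall>i\<le>n. [u i = u 0] (mod (Q - 1)))"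
  define D where "D = (Q - 1) * p ^ (a - 1)"
  define B where "B = 2 * a - 1"
  define R where "R = rotate_digits p a B"
  have p0: "p > 0" using p by (rule prime_gt_0_nat)
  have Q1: "Q > 1" unfolding Q using prime_gt_1_nat[OF p] a by (rule one_less_power)
  have B: "D < p ^ B"
  proof -
    have "D < p ^ a * p ^ (a - 1)" unfolding D_def using p0 Q by (intro mult_strict_right_mono) auto
    also have "\<dots> = p ^ B" using a by (simp add: B_def flip: power_add) (simp add: mult_2)
    finally show ?thesis .
  qed
  have le: "u i \<le> D" if "i \<le> Suc n" for i
    using that sum_u member_le_sum[of i "{..n}" u] by (cases "i = Suc n") (auto simp: D_def)
  have lt: "u i < p ^ B" if "i \<le> Suc n" for i using le[OF that] B by simp
  have R_cong: "[R j (u i) = p ^ j * u i] (mod (Q - 1))" if "i \<le> Suc n" for i j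
    using rotate_digits_cong[OF p0 lt[OF that]] by (simp add: R_def Q)
  have cop: "coprime (p ^ j) (Q - 1)" for j
  proof -
    have "coprime Q (Q - 1)" using Q1 by (metis coprime_diff_one_right_nat order_less_trans zero_less_one)
    thus ?thesis using a by (simp add: Q)
  qed
  \<comment> \<open>For each shift the sum is a positive multiple of \<open>Q - 1\<close>; the value \<open>Q - 1\<close> itself is excluded.\<close>
  have big: "2 * (Q - 1) \<le> (\<Sum>i\<le>Suc n. R j (u i))" if j: "j < a" for j
  proof (rule ccontr)
    define t where "t = (\<Sum>i\<le>Suc n. R j (u i))"
    define W where "W i = (n + 1) * R j (u i) + R j (u (Suc n))" for i
    assume "\<not> 2 * (Q - 1) \<le> (\<Sum>i\<le>Suc n. R j (u i))"
    hence t2: "t < 2 * (Q - 1)" by (simp add: t_def)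
    have "[t = (\<Sum>i\<le>Suc n. p ^ j * u i)] (mod (Q - 1))"
      unfolding t_def by (intro cong_sum R_cong) auto
    also have "(\<Sum>i\<le>Suc n. p ^ j * u i) = p ^ j * D"
      unfolding sum_distrib_left[symmetric] using sum_u by (simp add: D_def)
    also have "[p ^ j * D = 0] (mod (Q - 1))" by (simp add: D_def cong_0_iff)
    finally have t_dvd: "(Q - 1) dvd t" by (simp add: cong_0_iff)
    have W_ge: "W i \<ge> Q - 1" if i: "i \<le> n" for i
    proof -
      have "[W i = (n + 1) * (p ^ j * u i) + p ^ j * u (Suc n)] (mod (Q - 1))"
        unfolding W_def using i by (intro cong_add cong_mult cong_refl R_cong) auto
      also have "(n + 1) * (p ^ j * u i) + p ^ j * u (Suc n) = p ^ j * ((n + 1) * u i + u (Suc n))"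
        by (simp add: algebra_simps)
      also have "[\<dots> = 0] (mod (Q - 1))" using dvd[OF i] by (simp add: cong_0_iff)
      finally have "(Q - 1) dvd W i" by (simp add: cong_0_iff)
      moreover have "W i > 0"
      proof (cases "u i = 0")
        case True
        hence "u (Suc n) > 0" using pos[OF i] by simp
        thus ?thesis using rotate_digits_pos[OF p0 lt[of "Suc n"]] by (simp add: W_def R_def)
      next
        case False
        thus ?thesis using rotate_digits_pos[OF p0 lt[of i]] i by (simp add: W_def R_def)
      qed
      ultimately show ?thesis by (rule dvd_imp_le)
    qed
    have sum_W: "(\<Sum>i\<le>n. W i) = (n + 1) * t"
      by (simp add: W_def t_def sum.distrib algebra_simps flip: sum_distrib_left)
    have "(n + 1) * (Q - 1) \<le> (\<Sum>i\<le>n. W i)"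
      using sum_bounded_below[of "{..n}" "Q - 1" W] W_ge by simp
    hence "(n + 1) * (Q - 1) \<le> (n + 1) * t" unfolding sum_W .
    hence "Q - 1 \<le> t" by (simp only: mult_le_cancel1)
    hence t: "t = Q - 1" using t2 t_dvd by (auto elim!: dvdE)
    have "W i = Q - 1" if i: "i \<le> n" for i
    proof (rule ccontr)
      assume "W i \<noteq> Q - 1"
      hence "(\<Sum>i\<le>n. Q - 1) < (\<Sum>i\<le>n. W i)"
        using W_ge i by (intro sum_strict_mono_ex1) (auto intro!: bexI[of _ i] le_neq_implies_less)
      thus False unfolding sum_W t by simp
    qed
    hence "(n + 1) * R j (u i) = (n + 1) * R j (u 0)" if "i \<le> n" for i
      using that unfolding W_def by (metis add_right_cancel le0)
    hence R_eq: "R j (u i) = R j (u 0)" if "i \<le> n" for i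
      using that by (metis mult_cancel1 add_is_0 one_neq_zero)
    have "[u i = u 0] (mod (Q - 1))" if i: "i \<le> n" for i
    proof -
      have "[p ^ j * u i = R j (u i)] (mod (Q - 1))" using R_cong[of i j] i by (simp add: cong_sym)
      also have "R j (u i) = R j (u 0)" by (rule R_eq[OF i])
      also have "[R j (u 0) = p ^ j * u 0] (mod (Q - 1))" by (rule R_cong) simp
      finally show ?thesis using cop by (simp add: cong_mult_lcancel_nat)
    qed
    thus False using ncong by blast
  qed
  have "a * (2 * (Q - 1)) \<le> (\<Sum>j<a. \<Sum>i\<le>Suc n. R j (u i))"
    using sum_bounded_below[of "{..<a}" "2 * (Q - 1)" "\<lambda>j. \<Sum>i\<le>Suc n. R j (u i)"] big by simp
  hence "a * (2 * (Q - 1)) * (p - 1) \<le> (\<Sum>j<a. \<Sum>i\<le>Suc n. R j (u i)) * (p - 1)"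
    by (rule mult_le_mono1)
  also have "\<dots> = (\<Sum>i\<le>Suc n. (\<Sum>j<a. R j (u i)) * (p - 1))"
    by (subst sum.swap) (rule sum_distrib_right)
  also have "\<dots> = (\<Sum>i\<le>Suc n. (\<Sum>l<B. digit p l (u i)) * (Q - 1))"
    unfolding R_def sum_rotate_digits[OF p0] Q ..
  also have "\<dots> = (\<Sum>i\<le>Suc n. \<Sum>l<B. digit p l (u i)) * (Q - 1)"
    by (rule sum_distrib_right[symmetric])
  finally have "(2 * a * (p - 1)) * (Q - 1) \<le> (\<Sum>i\<le>Suc n. \<Sum>l<B. digit p l (u i)) * (Q - 1)"
    by (simp only: ac_simps)
  \<comment> \<open>Summing over the shifts turns rotated sums into digit sums.\<close>
  hence dig_u: "2 * a * (p - 1) \<le> (\<Sum>i\<le>Suc n. \<Sum>l<B. digit p l (u i))"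
    using Q1 by (simp only: mult_le_cancel2)
  \<comment> \<open>The total ends in \<open>a - 1\<close> zeros and has at most \<open>2 a - 1\<close> digits.\<close>
  have dig_D: "(\<Sum>l<B. digit p l D) \<le> a * (p - 1)"
  proof -
    have "digit p l D = 0" if "l < a - 1" for l
    proof -
      have "a - 1 = l + Suc (a - 1 - l - 1)" using that by simp
      hence "p ^ (a - 1) = p ^ l * (p * p ^ (a - 1 - l - 1))" by (metis power_add power_Suc)
      hence "D = p ^ l * (p * ((Q - 1) * p ^ (a - 1 - l - 1)))"
        unfolding D_def by (simp only: ac_simps)
      thus ?thesis using p0 by (simp add: digit_def)
    qed
    hence "(\<Sum>l<B. digit p l D) = (\<Sum>l\<in>{a - 1..<B}. digit p l D)"
      by (intro sum.mono_neutral_right) auto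
    also have "\<dots> \<le> (\<Sum>l\<in>{a - 1..<B}. p - 1)"
    proof (rule sum_mono)
      fix l
      have "digit p l D < p" unfolding digit_def using p0 by (rule mod_less_divisor)
      thus "digit p l D \<le> p - 1" by simp
    qed
    also have "\<dots> = card {a - 1..<B} * (p - 1)" by simp
    also have "card {a - 1..<B} = a" using a by (simp add: B_def)
    finally show ?thesis .
  qed
  have sD: "sum u {..Suc n} = D" using sum_u by (simp add: D_def)
  have "(p - 1) * multiplicity p (multinomial {..Suc n} u) + (\<Sum>l<B. digit p l D)
      = (\<Sum>i\<le>Suc n. \<Sum>l<B. digit p l (u i))"
    using multiplicity_multinomial[OF p, of "{..Suc n}" u B] B unfolding sD by simp
  moreover have "2 * a * (p - 1) = a * (p - 1) + (p - 1) * a" by simp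
  ultimately have "(p - 1) * a \<le> (p - 1) * multiplicity p (multinomial {..Suc n} u)"
    using dig_u dig_D by linarith
  hence "a \<le> multiplicity p (multinomial {..Suc n} u)"
    using prime_gt_1_nat[OF p] by (simp only: mult_le_cancel1)
  thus "Q dvd multinomial {..Suc n} u"
    unfolding Q by (rule multiplicity_dvd')
qed

section \<open>Lifting finite fields to characteristic zero\<close>

text \<open>
  A ring with a decreasing filtration that behaves like the powers of a maximal ideal with residue
  characteristic \<open>p\<close>. It serves as a substitute for the ring of Witt vectors modulo \<open>p ^ a\<close>: what
  matters is that \<open>p\<close>-th powers improve congruences, and that a congruence between integers
  modulo \<open>J i\<close> is one modulo \<open>p ^ i\<close>.
\<close>

locale power_filtration =
  fixes p :: nat and J :: "nat \<Rightarrow> 'r :: comm_ring_1 set" and \<theta> :: "'r \<Rightarrow> 'k :: field"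
  assumes prime_p: "prime p"
    and J_0: "J 0 = UNIV"
    and J_add: "x \<in> J i \<Longrightarrow> y \<in> J i \<Longrightarrow> x + y \<in> J i"
    and J_mult: "x \<in> J i \<Longrightarrow> y \<in> J j \<Longrightarrow> x * y \<in> J (i + j)"
    and J_Suc: "J (Suc i) \<subseteq> J i"
    and p_in_J: "of_nat p \<in> J 1"
    and of_int_in_J: "of_int m \<in> J i \<Longrightarrow> int p ^ i dvd m"
    and hom_add: "\<theta> (x + y) = \<theta> x + \<theta> y"
    and hom_mult: "\<theta> (x * y) = \<theta> x * \<theta> y"
    and hom_1: "\<theta> 1 = 1"
    and hom_eq_0_iff: "\<theta> x = 0 \<longleftrightarrow> x \<in> J 1"
begin

lemma J_mult_left: "y \<in> J j \<Longrightarrow> x * y \<in> J j"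
  using J_mult[of x 0 y j] J_0 by simp

lemma J_mult_right: "x \<in> J j \<Longrightarrow> x * y \<in> J j"
  using J_mult_left[of x j y] by (simp add: mult.commute)

lemma J_uminus: "x \<in> J j \<Longrightarrow> - x \<in> J j"
  using J_mult_left[of x j "-1"] by simp

lemma J_diff: "x \<in> J j \<Longrightarrow> y \<in> J j \<Longrightarrow> x - y \<in> J j"
  using J_add[of x j "- y"] J_uminus[of y j] by simp

lemma J_zero: "0 \<in> J j"
  by (induction j) (use J_0 p_in_J J_mult[of "of_nat p" 1 0] in auto)

lemma J_antimono: "i \<le> j \<Longrightarrow> J j \<subseteq> J i"
  by (rule lift_Suc_antimono_le) (rule J_Suc)

lemma J_power: "x \<in> J 1 \<Longrightarrow> x ^ n \<in> J n"
  by (induction n) (use J_0 J_mult[of x 1] in auto)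

definition cg :: "nat \<Rightarrow> 'r \<Rightarrow> 'r \<Rightarrow> bool" where
  "cg a x y \<longleftrightarrow> x - y \<in> J a"

lemma cg_refl [simp]: "cg a x x"
  by (simp add: cg_def J_zero)

lemma cg_sym: "cg a x y \<Longrightarrow> cg a y x"
  unfolding cg_def using J_uminus[of "x - y" a] by simp

lemma cg_trans [trans]: "cg a x y \<Longrightarrow> cg a y z \<Longrightarrow> cg a x z"
  unfolding cg_def using J_add[of "x - y" a "y - z"] by simp

lemma cg_add: "cg a x y \<Longrightarrow> cg a x' y' \<Longrightarrow> cg a (x + x') (y + y')"
  unfolding cg_def using J_add[of "x - y" a "x' - y'"] by (simp add: algebra_simps)

lemma cg_diff: "cg a x y \<Longrightarrow> cg a x' y' \<Longrightarrow> cg a (x - x') (y - y')"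
  unfolding cg_def using J_diff[of "x - y" a "x' - y'"] by (simp add: algebra_simps)

lemma cg_mult: "cg a x y \<Longrightarrow> cg a x' y' \<Longrightarrow> cg a (x * x') (y * y')"
  unfolding cg_def
  using J_add[OF J_mult_right[of "x - y" a x'] J_mult_left[of "x' - y'" a y]]
  by (simp add: algebra_simps)

lemma cg_power: "cg a x y \<Longrightarrow> cg a (x ^ n) (y ^ n)"
  by (induction n) (auto intro: cg_mult)

lemma cg_sum: "(\<And>i. i \<in> I \<Longrightarrow> cg a (f i) (g i)) \<Longrightarrow> cg a (sum f I) (sum g I)"
  by (induction I rule: infinite_finite_induct) (auto intro: cg_add)

lemma cg_prod: "(\<And>i. i \<in> I \<Longrightarrow> cg a (f i) (g i)) \<Longrightarrow> cg a (prod f I) (prod g I)"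
  by (induction I rule: infinite_finite_induct) (auto intro: cg_mult)

lemma hom_0: "\<theta> 0 = 0"
  using J_zero hom_eq_0_iff by blast

lemma hom_uminus: "\<theta> (- x) = - \<theta> x"
  using hom_add[of x "- x"] hom_0 by (simp add: eq_neg_iff_add_eq_0 add.commute)

lemma hom_diff: "\<theta> (x - y) = \<theta> x - \<theta> y"
  using hom_add[of x "- y"] hom_uminus by simp

lemma hom_power: "\<theta> (x ^ n) = \<theta> x ^ n"
  by (induction n) (auto simp: hom_1 hom_mult)

lemma hom_sum: "\<theta> (sum f I) = (\<Sum>i\<in>I. \<theta> (f i))"
  by (induction I rule: infinite_finite_induct) (auto simp: hom_0 hom_add)

lemma hom_prod: "\<theta> (prod f I) = (\<Prod>i\<in>I. \<theta> (f i))"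
  by (induction I rule: infinite_finite_induct) (auto simp: hom_1 hom_mult)

lemma cg_1_iff: "cg 1 x y \<longleftrightarrow> \<theta> x = \<theta> y"
  unfolding cg_def hom_eq_0_iff[symmetric] hom_diff by simp

text \<open>
  \<open>x\<^sup>p - y\<^sup>p\<close> is \<open>x - y\<close> times a sum of \<open>p\<close> terms that are congruent to each other modulo \<open>J 1\<close>; such a
  sum lies in \<open>J 1\<close>, since \<open>p\<close> does.
\<close>

lemma cg_power_prime:
  assumes "cg (Suc k) x y"
  shows "cg (Suc (Suc k)) (x ^ p) (y ^ p)"
proof -
  obtain n where n: "p = Suc n" using prime_gt_0_nat[OF prime_p] by (cases p) auto
  have "x - y \<in> J 1" using assms J_antimono[of 1 "Suc k"] by (auto simp: cg_def)
  hence xy: "cg 1 x y" by (simp add: cg_def)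
  have "cg 1 (\<Sum>i<Suc n. x ^ i * y ^ (n - i)) (\<Sum>i<Suc n. y ^ i * y ^ (n - i))"
    by (intro cg_sum cg_mult cg_power xy cg_refl)
  also have "(\<Sum>i<Suc n. y ^ i * y ^ (n - i)) = of_nat p * y ^ n"
    by (simp add: n flip: power_add)
  also have "cg 1 \<dots> 0" using J_mult_right[OF p_in_J] by (simp add: cg_def)
  finally have "(\<Sum>i<Suc n. x ^ i * y ^ (n - i)) \<in> J 1" by (simp add: cg_def)
  hence "(x - y) * (\<Sum>i<Suc n. x ^ i * y ^ (n - i)) \<in> J (Suc k + 1)"
    using assms unfolding cg_def by (intro J_mult)
  thus ?thesis unfolding cg_def n diff_power_eq_sum by simp
qed

lemma cg_power_prime_power: "cg 1 x y \<Longrightarrow> cg (Suc k) (x ^ p ^ k) (y ^ p ^ k)"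
  by (induction k) (auto simp: power_mult mult.commute[of p] intro: cg_power_prime)

lemma cg_power_prime_power': "cg 1 x y \<Longrightarrow> a \<le> Suc k \<Longrightarrow> cg a (x ^ p ^ k) (y ^ p ^ k)"
  using cg_power_prime_power[of x y k] J_antimono[of a "Suc k"] by (auto simp: cg_def)

end

text \<open>
  The residue ring is the field with \<open>p ^ b\<close> elements, and \<open>a\<close> is the precision. The Teichmueller
  representative is computed from any lift by a \<open>p\<close>-th power so high that the choice of the lift is
  invisible modulo \<open>J a\<close>; the exponent is a multiple of \<open>b\<close>, so that the residue is unchanged.
\<close>

locale teichmueller_lift = power_filtration p J \<theta>
  for p and J :: "nat \<Rightarrow> 'r :: comm_ring_1 set" and \<theta> :: "'r \<Rightarrow> 'k :: field" +
  fixes b a :: nat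
  assumes b_pos: "b > 0"
    and range_hom: "range \<theta> = {x. x ^ (p ^ b) = x}"
begin

definition "lift y = (SOME x. \<theta> x = y)"
definition "T y = lift y ^ (p ^ (b * a))"

abbreviation "S \<equiv> {x :: 'k. x ^ (p ^ b) = x}"

lemma hom_lift: "y \<in> S \<Longrightarrow> \<theta> (lift y) = y"
proof -
  assume "y \<in> S"
  hence "y \<in> range \<theta>" unfolding range_hom .
  hence "\<exists>x. \<theta> x = y" by auto
  thus "\<theta> (lift y) = y" unfolding lift_def by (rule someI_ex)
qed

lemma S_power: "y \<in> S \<Longrightarrow> y ^ (p ^ (b * n)) = y"
  by (induction n) (auto simp: power_add power_mult)

lemma hom_T: "y \<in> S \<Longrightarrow> \<theta> (T y) = y"
  unfolding T_def hom_power using hom_lift S_power by simp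

lemma hom_in_S: "\<theta> x ^ (p ^ b) = \<theta> x"
  using range_hom by blast

lemma exponent_bound: "a \<le> Suc (b * a)"
  using b_pos by (cases b) auto

lemma T_mult: "x \<in> S \<Longrightarrow> y \<in> S \<Longrightarrow> cg a (T (x * y)) (T x * T y)"
  unfolding T_def power_mult_distrib[symmetric]
  by (intro cg_power_prime_power' exponent_bound)
     (auto simp: cg_1_iff hom_lift hom_mult power_mult_distrib simp del: One_nat_def)

lemma T_1: "cg a (T 1) 1"
proof -
  have "cg a (T 1) (1 ^ (p ^ (b * a)))"
    unfolding T_def by (intro cg_power_prime_power' exponent_bound) (auto simp: cg_1_iff hom_lift hom_1 simp del: One_nat_def)
  thus ?thesis by simp
qed

lemma T_0: "cg a (T 0) 0"
proof -
  have "(0 :: 'r) ^ (p ^ (b * a)) = 0" using prime_gt_0_nat[OF prime_p] by (simp add: power_0_left)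
  moreover have "cg a (T 0) (0 ^ (p ^ (b * a)))"
    unfolding T_def using prime_gt_0_nat[OF prime_p]
    by (intro cg_power_prime_power' exponent_bound) (auto simp: cg_1_iff hom_lift hom_0 simp del: One_nat_def)
  ultimately show ?thesis by simp
qed

lemma S_pow: "x \<in> S \<Longrightarrow> x ^ n \<in> S"
  by (induction n) (auto simp: power_mult_distrib)

lemma T_power: "x \<in> S \<Longrightarrow> cg a (T (x ^ n)) (T x ^ n)"
proof (induction n)
  case (Suc n)
  have "cg a (T (x * x ^ n)) (T x * T (x ^ n))" by (intro T_mult Suc.prems S_pow)
  also have "cg a \<dots> (T x * T x ^ n)" by (intro cg_mult Suc.IH Suc.prems cg_refl)
  finally show ?case by simp
qed (simp add: T_1)

lemma T_prod: "(\<And>i. i \<in> I \<Longrightarrow> f i \<in> S) \<Longrightarrow> cg a (T (prod f I)) (\<Prod>i\<in>I. T (f i))"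
proof (induction I rule: infinite_finite_induct)
  case (insert i I)
  have "prod f I \<in> S"
    using insert.prems by (auto simp: prod_power_distrib)
  hence "cg a (T (f i * prod f I)) (T (f i) * T (prod f I))" using insert.prems by (intro T_mult) auto
  also have "cg a \<dots> (T (f i) * (\<Prod>i\<in>I. T (f i)))" using insert by (intro cg_mult) auto
  finally show ?case using insert by simp
qed (auto simp: T_1)

text \<open>
  An element with nonzero residue is invertible modulo \<open>J a\<close>: its \<open>(p ^ b - 1) p ^ a\<close>-th power is \<open>1\<close>.
\<close>

lemma cg_cancel:
  assumes "\<theta> u \<noteq> 0" "cg a (u * x) (u * y)"
  shows "cg a x y"
proof -
  define r where "r = p ^ b - 1"
  have r: "p ^ b = Suc r" using prime_gt_0_nat[OF prime_p] by (simp add: r_def)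
  have "\<theta> u * \<theta> u ^ r = \<theta> u" using hom_in_S[of u] by (simp add: r)
  hence "\<theta> (u ^ r) = 1" using assms by (simp add: hom_power)
  hence "cg a ((u ^ r) ^ p ^ a) (1 ^ p ^ a)"
    by (intro cg_power_prime_power') (auto simp: cg_1_iff hom_1 simp del: One_nat_def)
  hence inv: "cg a (u * v) 1" if "v = u ^ (r * p ^ a - 1)" for v
  proof -
    have "r > 0" using b_pos prime_gt_1_nat[OF prime_p] r by (metis One_nat_def neq0_conv one_less_power less_irrefl)
    hence "r * p ^ a > 0" using prime_gt_0_nat[OF prime_p] by simp
    hence "u * v = (u ^ r) ^ p ^ a" by (simp add: that power_mult[symmetric] power_Suc[symmetric] del: power_Suc)
    thus ?thesis using \<open>cg a ((u ^ r) ^ p ^ a) _\<close> by simp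
  qed
  define v where "v = u ^ (r * p ^ a - 1)"
  have "cg a x (v * (u * x))" using cg_mult[OF inv[OF v_def] cg_refl[of _ x]] cg_sym by (simp add: ac_simps)
  also have "cg a \<dots> (v * (u * y))" by (intro cg_mult assms cg_refl)
  also have "cg a \<dots> y" using cg_mult[OF inv[OF v_def] cg_refl[of _ y]] by (simp add: ac_simps)
  finally show ?thesis .
qed

end

subsection \<open>Finite subfields\<close>

lemma ring_on_sel [simp]:
  "carrier (ring_on A) = A" "monoid.mult (ring_on A) = (*)" "one (ring_on A) = 1"
  "zero (ring_on A) = 0" "add (ring_on A) = (+)"
  by (simp_all add: ring_on_def)

lemma ring_on_cring:
  assumes "0 \<in> A" "1 \<in> A" "\<And>x y. x \<in> A \<Longrightarrow> y \<in> A \<Longrightarrow> x + y \<in> A"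
    "\<And>x y. x \<in> A \<Longrightarrow> y \<in> A \<Longrightarrow> x * y \<in> A" "\<And>x. x \<in> A \<Longrightarrow> - x \<in> A"
  shows "cring (ring_on A)"
proof (rule cringI)
  show "abelian_group (ring_on A)"
    using assms by (intro abelian_groupI) (auto simp: algebra_simps intro: bexI[of _ "- x" for x])
  show "comm_monoid (ring_on A)"
    using assms by (intro comm_monoidI) (auto simp: algebra_simps)
qed (auto simp: algebra_simps)

lemma ring_on_field:
  fixes A :: "'k :: field set"
  assumes "0 \<in> A" "1 \<in> A" "\<And>x y. x \<in> A \<Longrightarrow> y \<in> A \<Longrightarrow> x + y \<in> A"
    "\<And>x y. x \<in> A \<Longrightarrow> y \<in> A \<Longrightarrow> x * y \<in> A" "\<And>x. x \<in> A \<Longrightarrow> - x \<in> A"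
    "\<And>x. x \<in> A \<Longrightarrow> inverse x \<in> A"
  shows "field (ring_on A)"
proof -
  interpret cring "ring_on A" using assms by (intro ring_on_cring)
  show ?thesis
  proof (rule cring_fieldI)
    show "Units (ring_on A) = carrier (ring_on A) - {\<zero>\<^bsub>ring_on A\<^esub>}"
    proof (intro equalityI subsetI)
      fix x assume x: "x \<in> carrier (ring_on A) - {\<zero>\<^bsub>ring_on A\<^esub>}"
      hence "inverse x \<in> A" "inverse x * x = 1" "x * inverse x = 1" using assms by auto
      thus "x \<in> Units (ring_on A)" using x unfolding Units_def ring_on_sel by blast
    qed (auto simp: Units_def)
  qed
qed

lemma ring_on_pow: "x [^]\<^bsub>ring_on A\<^esub> (n :: nat) = x ^ n"
  by (induction n) (auto simp: nat_pow_def)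

lemma finite_subfield_cyclic:
  fixes A :: "'k :: field set"
  assumes "field (ring_on A)" "finite A"
  shows "\<exists>g\<in>A - {0}. A - {0} = range (\<lambda>i :: nat. g ^ i)"
  using field.finite_field_mult_group_has_gen[OF assms(1)] assms(2)
  by (auto simp: ring_on_pow full_SetCompr_eq carrier_mult_of)

lemma finite_power_eq_self:
  assumes "r > 1"
  shows "finite {x :: 'k :: field. x ^ r = x}"
proof -
  have "Polynomial.monom 1 r - [:0, 1 :: 'k:] \<noteq> 0"
  proof
    assume "Polynomial.monom 1 r - [:0, 1 :: 'k:] = 0"
    hence "Polynomial.coeff (Polynomial.monom 1 r - [:0, 1 :: 'k:]) r = 0" by simp
    thus False using assms by (cases r) (auto simp: coeff_pCons split: nat.splits)
  qed
  from poly_roots_finite[OF this] show ?thesis by (simp add: poly_monom)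
qed

lemma frobenius_fixed_field:
  assumes "prime CHAR('k :: field)" "r = CHAR('k) ^ b"
  shows "field (ring_on {x :: 'k. x ^ r = x})"
proof (rule ring_on_field)
  have r: "r > 0" using assms prime_gt_0_nat[of "CHAR('k)"] by simp
  fix x y :: 'k assume xy: "x \<in> {x. x ^ r = x}" 
  show "- x \<in> {x. x ^ r = x}"
  proof -
    have "(x + - x) ^ r = x ^ r + (- x) ^ r"
      by (rule freshmans_dream'[OF assms])
    hence "x + (- x) ^ r = 0" using r xy by (simp add: power_0_left)
    thus ?thesis by (simp add: add_eq_0_iff)
  qed
  show "inverse x \<in> {x. x ^ r = x}" using xy by (simp add: power_inverse)
  assume "y \<in> {x. x ^ r = x}"
  thus "x + y \<in> {x. x ^ r = x}" "x * y \<in> {x. x ^ r = x}"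
    using xy freshmans_dream'[OF assms, of x y] by (auto simp: power_mult_distrib)
qed (use assms prime_gt_0_nat[of "CHAR('k)"] in \<open>auto simp: power_0_left\<close>)

subsection \<open>Existence of the lift\<close>

text \<open>
  The powers of the ideal generated by \<open>s\<close> and \<open>h\<close>.
\<close>

primrec ideal_power :: "'r :: comm_ring_1 \<Rightarrow> 'r \<Rightarrow> nat \<Rightarrow> 'r set" where
  "ideal_power s h 0 = UNIV"
| "ideal_power s h (Suc k) = {s * x + h * y | x y. x \<in> ideal_power s h k \<and> y \<in> ideal_power s h k}"

lemma ideal_power_add:
  "x \<in> ideal_power s h k \<Longrightarrow> y \<in> ideal_power s h k \<Longrightarrow> x + y \<in> ideal_power s h k"
proof (induction k arbitrary: x y)
  case (Suc k)
  then obtain x1 x2 y1 y2 where *: "x = s * x1 + h * x2" "y = s * y1 + h * y2"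
    "x1 \<in> ideal_power s h k" "x2 \<in> ideal_power s h k" "y1 \<in> ideal_power s h k" "y2 \<in> ideal_power s h k"
    by auto
  hence "x + y = s * (x1 + y1) + h * (x2 + y2)" by (simp add: algebra_simps)
  thus ?case using * Suc.IH by auto
qed auto

lemma ideal_power_mult_left: "y \<in> ideal_power s h k \<Longrightarrow> x * y \<in> ideal_power s h k"
proof (induction k arbitrary: y)
  case (Suc k)
  then obtain y1 y2 where *: "y = s * y1 + h * y2" "y1 \<in> ideal_power s h k" "y2 \<in> ideal_power s h k"
    by auto
  hence "x * y = s * (x * y1) + h * (x * y2)" by (simp add: algebra_simps)
  thus ?case using * Suc.IH by auto
qed auto

lemma ideal_power_mult:
  "x \<in> ideal_power s h i \<Longrightarrow> y \<in> ideal_power s h j \<Longrightarrow> x * y \<in> ideal_power s h (i + j)"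
proof (induction i arbitrary: x)
  case (Suc i)
  then obtain x1 x2 where *: "x = s * x1 + h * x2" "x1 \<in> ideal_power s h i" "x2 \<in> ideal_power s h i"
    by auto
  hence "x * y = s * (x1 * y) + h * (x2 * y)" by (simp add: algebra_simps)
  thus ?case using * Suc by auto
qed (auto intro: ideal_power_mult_left)

lemma ideal_power_Suc: "ideal_power s h (Suc i) \<subseteq> ideal_power s h i"
  by (induction i) fastforce+

lemma ideal_power_decomp: "x \<in> ideal_power s h k \<Longrightarrow> \<exists>y z. x = s ^ k * y + h * z"
proof (induction k arbitrary: x)
  case 0
  have "x = s ^ 0 * x + h * 0" by simp
  thus ?case by blast
next
  case (Suc k)
  then obtain x1 x2 where *: "x = s * x1 + h * x2" "x1 \<in> ideal_power s h k" by auto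
  then obtain y z where "x1 = s ^ k * y + h * z" using Suc.IH by blast
  hence "x = s ^ Suc k * y + h * (s * z + x2)" using * by (simp add: algebra_simps)
  thus ?case by blast
qed

definition int_eval :: "'k :: comm_ring_1 \<Rightarrow> int Polynomial.poly \<Rightarrow> 'k" where
  "int_eval g P = Polynomial.poly (Polynomial.map_poly of_int P) g"

lemma int_eval_0 [simp]: "int_eval g 0 = 0"
  by (simp add: int_eval_def)

lemma int_eval_pCons [simp]: "int_eval g (pCons c P) = of_int c + g * int_eval g P"
  by (simp add: int_eval_def map_poly_pCons)

lemma int_eval_1 [simp]: "int_eval g 1 = 1"
  by (simp add: one_pCons)

lemma int_eval_add: "int_eval g (P + Q) = int_eval g P + int_eval g Q"
  by (induction P Q rule: poly_induct2) (auto simp: algebra_simps)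

lemma int_eval_smult: "int_eval g (Polynomial.smult c P) = of_int c * int_eval g P"
  by (induction P) (auto simp: algebra_simps)

lemma int_eval_mult: "int_eval g (P * Q) = int_eval g P * int_eval g Q"
  by (induction P) (auto simp: algebra_simps int_eval_add int_eval_smult)

lemma int_eval_diff: "int_eval g (P - Q) = int_eval g P - int_eval g Q"
  using int_eval_add[of g "P - Q" Q] by (simp add: algebra_simps)

lemma int_eval_monom: "int_eval g (Polynomial.monom c n) = of_int c * g ^ n"
  by (induction n) (auto simp: Polynomial.monom_Suc monom_0 mult_ac)

lemma monic_int_division:
  fixes f h :: "int Polynomial.poly"
  assumes "Polynomial.lead_coeff h = 1"
  shows "\<exists>q r. f = h * q + r \<and> (r = 0 \<or> Polynomial.degree r < Polynomial.degree h)"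
proof -
  obtain q r where "pseudo_divmod f h = (q, r)" by force
  moreover have "h \<noteq> 0" using assms by auto
  ultimately show ?thesis using pseudo_divmod[of h f q r] assms by auto
qed

text \<open>
  The kernel of \<open>X \<mapsto> g\<close> on integer polynomials is generated by \<open>p\<close> and a monic \<open>h\<close> of least degree
  in it. Division by \<open>h\<close> leaves the polynomials of smaller degree. If such a polynomial is in the kernel
  and its leading coefficient is invertible modulo \<open>p\<close>, then it can be made monic by adding a multiple
  of \<open>p\<close>, against minimality; so \<open>p\<close> divides the leading term, which can be split off.
\<close>

lemma exists_kernel_generator:
  fixes g :: "'k :: field"
  assumes p: "prime p" "p = CHAR('k)" and g: "g ^ N = 1" "N > 0"
  shows "\<exists>h. Polynomial.lead_coeff h = 1 \<and> Polynomial.degree h > 0 \<and> int_eval g h = 0 \<and>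
    (\<forall>r. int_eval g r = 0 \<longrightarrow> Polynomial.degree r < Polynomial.degree h \<longrightarrow> [:int p:] dvd r)"
proof -
  define A where "A = {h. Polynomial.lead_coeff h = 1 \<and> int_eval g h = 0}"
  let ?h0 = "Polynomial.monom 1 N - 1 :: int Polynomial.poly"
  have "Polynomial.coeff ?h0 N = 1" using g by (cases N) auto
  moreover have "Polynomial.degree ?h0 \<le> N"
    by (intro Polynomial.degree_diff_le) (auto simp: Polynomial.degree_monom_le)
  ultimately have "Polynomial.lead_coeff ?h0 = 1"
    by (metis le_degree le_antisym zero_neq_one)
  hence "?h0 \<in> A" using g by (simp add: A_def int_eval_diff int_eval_monom)
  then obtain h where h: "h \<in> A" and min: "\<And>y. y \<in> A \<Longrightarrow> Polynomial.degree h \<le> Polynomial.degree y"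
    using ex_has_least_nat[of "\<lambda>x. x \<in> A" ?h0 Polynomial.degree] by blast
  have "Polynomial.degree h > 0"
  proof (rule ccontr)
    assume "\<not> ?thesis"
    then obtain c where "h = [:c:]" using degree_eq_zeroE by auto
    hence "h = 1" using h by (simp add: A_def)
    thus False using h by (simp add: A_def)
  qed
  moreover have "[:int p:] dvd r"
    if "int_eval g r = 0" "Polynomial.degree r < Polynomial.degree h" for r
    using that
  proof (induction "Polynomial.degree r" arbitrary: r rule: less_induct)
    case (less r)
    let ?c = "Polynomial.lead_coeff r" and ?n = "Polynomial.degree r"
    have of_int_p: "of_nat p = (0 :: 'k)" using p by simp
    show ?case
    proof (cases "int p dvd ?c")
      case True
      then obtain c' where c': "?c = int p * c'" ..
      define r1 where "r1 = r - Polynomial.monom ?c ?n"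
      have ev: "int_eval g r1 = 0"
        using less.prems by (simp add: r1_def int_eval_diff int_eval_monom c' of_int_p)
      have r: "r = r1 + [:int p:] * Polynomial.monom c' ?n"
        by (simp add: r1_def c' smult_monom)
      have "r1 = 0 \<or> Polynomial.degree r1 < ?n"
      proof (cases "?n = 0")
        case True
        then obtain c where "r = [:c:]" using degree_eq_zeroE by blast
        thus ?thesis by (simp add: r1_def monom_0)
      next
        case False
        have "Polynomial.degree r1 \<le> ?n"
          unfolding r1_def by (intro Polynomial.degree_diff_le) (auto simp: Polynomial.degree_monom_le)
        moreover have "Polynomial.coeff r1 ?n = 0" by (simp add: r1_def)
        ultimately show ?thesis
          by (metis le_neq_implies_less leading_coeff_0_iff)
      qed
      hence "[:int p:] dvd r1"
        using less.hyps[of r1] less.prems ev by auto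
      thus ?thesis by (subst r) (intro dvd_add dvd_triv_left)
    next
      case False
      hence "coprime (int p) ?c" using p by (intro prime_imp_coprime) auto
      then obtain u where "[?c * u = 1] (mod int p)"
        using coprime_iff_invertible_int[of ?c "int p"] by (auto simp: coprime_commute)
      then obtain w where w: "u * ?c = 1 + int p * w"
        by (metis cong_iff_lin mult.commute cong_sym)
      define m where "m = Polynomial.smult u r - Polynomial.monom (int p * w) ?n"
      have "Polynomial.coeff m ?n = 1" using w by (simp add: m_def)
      moreover have "Polynomial.degree m \<le> ?n"
        unfolding m_def by (intro Polynomial.degree_diff_le) (auto simp: Polynomial.degree_monom_le)
      ultimately have deg: "Polynomial.degree m = ?n"
        by (metis le_degree le_antisym zero_neq_one)
      have "m \<in> A" using deg \<open>Polynomial.coeff m ?n = 1\<close> less.prems of_int_p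
        by (simp add: A_def m_def int_eval_diff int_eval_monom int_eval_smult)
      from min[OF this] show ?thesis using less.prems deg by simp
    qed
  qed
  ultimately show ?thesis using h unfolding A_def by blast
qed

text \<open>
  Take \<open>\<int>[X] \<rightarrow> k\<close>, \<open>X \<mapsto> g\<close>, for a generator \<open>g\<close> of the cyclic group of the finite field, filtered by the
  powers of its kernel \<open>(p, h)\<close>. Modulo \<open>h\<close> the \<open>i\<close>-th power of the kernel is \<open>(p\<^sup>i)\<close>, and \<open>\<int>[X]/(h)\<close> is free
  over the integers with \<open>1\<close> in a basis, as \<open>h\<close> is monic of positive degree; so an integer
  in the \<open>i\<close>-th power is divisible by \<open>p\<^sup>i\<close>.
\<close>

theorem exists_teichmueller_lift:
  assumes p: "prime p" "p = CHAR('k :: field)" and b: "b > 0"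
  shows "\<exists>J (\<theta> :: int Polynomial.poly \<Rightarrow> 'k). teichmueller_lift p J \<theta> b"
proof -
  define S where "S = {x :: 'k. x ^ (p ^ b) = x}"
  have r: "p ^ b > 1" using prime_gt_1_nat[OF p(1)] b by (rule one_less_power)
  have F: "field (ring_on S)" unfolding S_def using p by (intro frobenius_fixed_field) auto
  obtain g where g: "g \<in> S" "g \<noteq> 0" "S - {0} = range (\<lambda>i :: nat. g ^ i)"
    using finite_subfield_cyclic[OF F] finite_power_eq_self[OF r] by (auto simp: S_def)
  have "g * g ^ (p ^ b - 1) = g * 1"
  proof -
    have "Suc (p ^ b - 1) = p ^ b" using r by simp
    hence "g * g ^ (p ^ b - 1) = g ^ (p ^ b)" by (metis power_Suc)
    thus ?thesis using g by (simp add: S_def)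
  qed
  hence "g ^ (p ^ b - 1) = 1" using g by simp
  then obtain h where h: "Polynomial.lead_coeff h = 1" "Polynomial.degree h > 0" "int_eval g h = 0"
    and ker: "\<And>r. int_eval g r = 0 \<Longrightarrow> Polynomial.degree r < Polynomial.degree h \<Longrightarrow> [:int p:] dvd r"
    using exists_kernel_generator[OF p, of g "p ^ b - 1"] r by auto
  define J where "J = ideal_power [:int p:] h"
  have pp: "of_nat p = [:int p:]" by (simp add: of_nat_poly)
  have p0: "of_nat p = (0 :: 'k)" using p by simp
  have "power_filtration p J (int_eval g)"
  proof
    have "[:int p:] = [:int p:] * 1 + h * 0" by simp
    thus "of_nat p \<in> J 1" unfolding J_def pp One_nat_def ideal_power.simps by blast
  next
    fix m :: int and i assume "of_int m \<in> J i"
    hence "[:m:] \<in> ideal_power [:int p:] h i" by (simp add: J_def of_int_poly)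
    then obtain y z where yz: "[:m:] = [:int p:] ^ i * y + h * z"
      using ideal_power_decomp by blast
    obtain q r where qr: "y = h * q + r" "r = 0 \<or> Polynomial.degree r < Polynomial.degree h"
      using monic_int_division[OF h(1)] by blast
    let ?l = "[:m:] - Polynomial.smult (int p ^ i) r"
    have pow: "[:int p:] ^ i = [:int p ^ i:]" by (induction i) (auto simp: one_pCons)
    have l: "?l = h * (z + [:int p ^ i:] * q)"
      using yz unfolding qr pow by (simp add: algebra_simps smult_add_right)
    \<comment> \<open>A multiple of the monic \<open>h\<close> of smaller degree is zero; compare constant terms.\<close>
    have deg: "Polynomial.degree ?l < Polynomial.degree h"
      using qr h by (intro degree_diff_less) (auto intro: le_less_trans[OF Polynomial.degree_smult_le])
    have "z + [:int p ^ i:] * q = 0"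
    proof (rule ccontr)
      assume nz: "z + [:int p ^ i:] * q \<noteq> 0"
      have "h \<noteq> 0" using h by auto
      hence "Polynomial.degree ?l = Polynomial.degree h + Polynomial.degree (z + [:int p ^ i:] * q)"
        unfolding l using nz by (rule degree_mult_eq)
      thus False using deg by simp
    qed
    hence "?l = 0" using l by simp
    hence "Polynomial.coeff [:m:] 0 = Polynomial.coeff (Polynomial.smult (int p ^ i) r) 0" by simp
    hence "m = int p ^ i * Polynomial.coeff r 0" by simp
    thus "int p ^ i dvd m" by simp
  next
    fix x
    show "int_eval g x = 0 \<longleftrightarrow> x \<in> J 1"
    proof
      assume "x \<in> J 1"
      thus "int_eval g x = 0" using h p0 by (auto simp: J_def int_eval_add int_eval_mult int_eval_smult)
    next
      assume x: "int_eval g x = 0"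
      obtain q r where qr: "x = h * q + r" "r = 0 \<or> Polynomial.degree r < Polynomial.degree h"
        using monic_int_division[OF h(1)] by blast
      hence "int_eval g r = 0" using x h by (simp add: int_eval_add int_eval_mult)
      hence "[:int p:] dvd r" using ker qr by auto
      then obtain r' where "r = [:int p:] * r'" ..
      hence "x = [:int p:] * r' + h * q" using qr by simp
      thus "x \<in> J 1" unfolding J_def by auto
    qed
  qed (use p in \<open>auto simp: J_def int_eval_add int_eval_mult
        intro: ideal_power_add ideal_power_mult ideal_power_Suc[THEN subsetD] simp del: ideal_power.simps(2)\<close>)
  moreover have "range (int_eval g) = S"
  proof (intro equalityI subsetI)
    fix x assume "x \<in> S"
    show "x \<in> range (int_eval g)"
    proof (cases "x = 0")
      case True
      thus ?thesis by (auto intro!: image_eqI[of _ _ 0])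
    next
      case False
      then obtain i where "x = g ^ i" using g \<open>x \<in> S\<close> by auto
      thus ?thesis by (auto intro!: image_eqI[of _ _ "Polynomial.monom 1 i"] simp: int_eval_monom)
    qed
  next
    interpret cring "ring_on S" using F by (simp add: field_def domain_def)
    have add: "x + y \<in> S" and mult: "x * y \<in> S" if "x \<in> S" "y \<in> S" for x y
      using a_closed[of x y] m_closed[of x y] that by auto
    have "of_int m \<in> S" for m
    proof -
      have nat: "of_nat n \<in> S" for n by (induction n) (use add zero_closed one_closed in auto)
      have "- of_nat n \<in> S" for n
      proof -
        have "a_inv (ring_on S) (of_nat n) \<in> S" "of_nat n + a_inv (ring_on S) (of_nat n) = 0"
          using a_inv_closed[of "of_nat n"] r_neg[of "of_nat n"] nat by auto
        thus ?thesis by (metis add_eq_0_iff)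
      qed
      thus ?thesis using nat by (cases m rule: int_cases2) auto
    qed
    fix x assume "x \<in> range (int_eval g)"
    then obtain P where "x = int_eval g P" by blast
    moreover have "int_eval g P \<in> S"
      by (induction P) (use \<open>\<And>m. of_int m \<in> S\<close> add mult g prime_gt_0_nat[OF p(1)] in \<open>auto simp: S_def power_0_left\<close>)
    ultimately show "x \<in> S" by simp
  qed
  ultimately have "teichmueller_lift p J (int_eval g) b"
    using b by (auto simp: teichmueller_lift_def teichmueller_lift_axioms_def S_def)
  thus ?thesis by blast
qed

section \<open>Twisted point counts\<close>

text \<open>
  Otherwise the remainder \<open>v\<close> of \<open>w\<close> modulo \<open>e\<close> gives a nonzero polynomial \<open>X\<^sup>v - 1\<close> with \<open>e > v\<close> roots.
\<close>

lemma roots_of_unity_exponent_dvd: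
  fixes A :: "'k :: field set"
  assumes "finite A" "card A = e" "e > 0" "\<And>c. c \<in> A \<Longrightarrow> c ^ e = 1" "\<And>c. c \<in> A \<Longrightarrow> c ^ w = 1"
  shows "e dvd w"
proof (rule ccontr)
  assume "\<not> e dvd w"
  define v where "v = w mod e"
  have v: "0 < v" "v < e" using \<open>\<not> e dvd w\<close> assms(3) by (auto simp: v_def mod_greater_zero_iff_not_dvd)
  define R where "R = Polynomial.monom 1 v - [:1 :: 'k:]"
  have cv: "Polynomial.coeff R v = 1" using v by (simp add: R_def coeff_pCons split: nat.splits)
  hence R0: "R \<noteq> 0" by auto
  have "Polynomial.degree R \<le> v"
    unfolding R_def by (intro Polynomial.degree_diff_le) (auto simp: Polynomial.degree_monom_le)
  moreover have "A \<subseteq> {x. Polynomial.poly R x = 0}"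
  proof
    fix c assume c: "c \<in> A"
    have "c ^ w = (c ^ e) ^ (w div e) * c ^ v" by (simp add: v_def flip: power_mult power_add)
    hence "c ^ v = 1" using assms(4,5)[OF c] by simp
    thus "c \<in> {x. Polynomial.poly R x = 0}" by (simp add: R_def poly_monom)
  qed
  hence "card A \<le> card {x. Polynomial.poly R x = 0}" by (intro card_mono poly_roots_finite R0)
  ultimately show False using card_poly_roots_bound[OF R0] v assms(2) by simp
qed

lemma degree_monom_minus:
  fixes R :: "'k :: comm_ring_1 Polynomial.poly"
  assumes "Polynomial.degree R < m"
  shows "Polynomial.degree (Polynomial.monom 1 m - R) = m"
proof (rule antisym)
  show "Polynomial.degree (Polynomial.monom 1 m - R) \<le> m"
    using assms by (intro Polynomial.degree_diff_le) (auto simp: Polynomial.degree_monom_le)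
  show "m \<le> Polynomial.degree (Polynomial.monom 1 m - R)"
    using assms by (intro le_degree) (simp add: coeff_eq_0)
qed

text \<open>
  \<open>X\<^sup>Q - X\<close> splits and has derivative \<open>-1\<close>, so its roots are simple.
\<close>

lemma card_frobenius_fixed:
  assumes p: "prime CHAR('k :: alg_closed_field)" and Q: "Q = CHAR('k) ^ a" "a > 0"
  shows "card {x :: 'k. x ^ Q = x} = Q"
proof -
  have Q1: "Q > 1" unfolding Q using prime_gt_1_nat[OF p] Q(2) by (rule one_less_power)
  define P where "P = Polynomial.monom 1 Q - [:0, 1 :: 'k:]"
  have deg: "Polynomial.degree P = Q"
    unfolding P_def using Q1 by (intro degree_monom_minus) auto
  hence P0: "P \<noteq> 0" using Q1 by auto
  have poly_P: "Polynomial.poly P x = x ^ Q - x" for x by (simp add: P_def poly_monom)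
  have "of_nat Q = (0 :: 'k)" using Q by simp
  hence pd: "Polynomial.pderiv P = [:-1:]" by (simp add: P_def pderiv_diff pderiv_monom pderiv_pCons)
  obtain A where A: "size A = Polynomial.degree P"
    "P = Polynomial.smult (Polynomial.lead_coeff P) (\<Prod>x\<in>#A. [:-x, 1:])"
    using alg_closed_imp_factorization[OF P0] by blast
  have "count A x \<le> 1" for x
  proof (rule ccontr)
    assume "\<not> count A x \<le> 1"
    hence "{#x, x#} \<subseteq># A" by (auto simp: subseteq_mset_def)
    then obtain B where B: "A = {#x, x#} + B" by (metis subset_mset.add_diff_inverse)
    define R where "R = Polynomial.smult (Polynomial.lead_coeff P) (\<Prod>x\<in>#B. [:-x, 1:])"
    have "P = [:-x, 1:] * ([:-x, 1:] * R)"
      by (subst A(2)) (simp only: B R_def, simp add: ac_simps)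
    hence "Polynomial.pderiv P = Polynomial.pderiv ([:-x, 1:] * ([:-x, 1:] * R))" by (rule arg_cong)
    hence "Polynomial.poly (Polynomial.pderiv P) x = 0"
      by (simp only: pderiv_mult poly_add poly_mult) simp
    thus False by (simp add: pd)
  qed
  hence "size A = (\<Sum>x\<in>set_mset A. 1)"
    unfolding size_multiset_overloaded_eq
    by (intro sum.cong) (auto intro!: le_antisym simp: Suc_le_eq)
  hence "size A = card (set_mset A)" by simp
  moreover have "set_mset A = {x. Polynomial.poly P x = 0}"
    by (subst A(2)) (use P0 in \<open>auto simp: poly_prod_mset prod_mset_zero_iff\<close>)
  ultimately show ?thesis using A(1) deg by (simp add: poly_P)
qed

text \<open>
  The solutions of \<open>F x = z x\<close> for the \<open>Q\<close>-Frobenius \<open>F\<close>: a form of the line over the field with \<open>Q\<close>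
  elements.
\<close>

definition twisted_line :: "nat \<Rightarrow> 'k :: field \<Rightarrow> 'k set" where
  "twisted_line Q z = {x. x ^ Q = z * x}"

definition twisted_zeros :: "nat \<Rightarrow> 'k :: field \<Rightarrow> nat \<Rightarrow> (nat \<Rightarrow> 'k) \<Rightarrow> (nat \<Rightarrow> 'k) set" where
  "twisted_zeros n lam Q \<zeta> = {x \<in> PiE {..n} (\<lambda>i. twisted_line Q (\<zeta> i)).
     (\<Sum>i\<le>n. x i ^ (n + 1)) + lam * (\<Prod>i\<le>n. x i) = 0}"

lemma card_twisted_line:
  assumes p: "prime CHAR('k :: alg_closed_field)" and Q: "Q = CHAR('k) ^ a" "a > 0" and z: "z \<noteq> 0"
  shows "card (twisted_line Q (z :: 'k)) = Q"
proof -
  have Q1: "Q > 1" unfolding Q using prime_gt_1_nat[OF p] Q(2) by (rule one_less_power)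
  obtain c where c: "c ^ (Q - 1) = z" using nth_root_exists[of "Q - 1" z] Q1 by auto
  hence c0: "c \<noteq> 0" using z Q1 by (auto simp: power_0_left)
  have cQ: "c ^ Q = z * c" using c Q1 by (metis Suc_diff_1 less_trans power_Suc2 zero_less_one)
  have "bij_betw (\<lambda>x. c * x) {x. x ^ Q = x} (twisted_line Q z)"
  proof (rule bij_betw_byWitness[where f' = "\<lambda>x. x / c"])
    show "(\<lambda>x. c * x) ` {x. x ^ Q = x} \<subseteq> twisted_line Q z"
      by (auto simp: twisted_line_def power_mult_distrib cQ)
    show "(\<lambda>x. x / c) ` twisted_line Q z \<subseteq> {x. x ^ Q = x}"
      using z c0 by (auto simp: twisted_line_def power_divide cQ)
  qed (use c0 in auto)
  thus ?thesis using card_frobenius_fixed[OF p Q] by (metis bij_betw_same_card)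
qed

text \<open>
  The residue field is taken large enough to contain all twisted lines \<open>x\<^sup>Q = z x\<close> with \<open>z\<^sup>Q\<^sup>-\<^sup>1 = 1\<close>, whose
  nonzero elements satisfy \<open>x ^ (Q - 1)\<^sup>2 = 1\<close>.
\<close>

locale twisted_count = teichmueller_lift p J \<theta> b a
  for p and J :: "nat \<Rightarrow> 'r :: comm_ring_1 set" and \<theta> :: "'r \<Rightarrow> 'k :: alg_closed_field" and b a +
  fixes Q n :: nat and lam :: 'k
  assumes char: "p = CHAR('k)" and a_pos: "a > 0" and Q_def: "Q = p ^ a"
    and S_big: "\<And>x :: 'k. x ^ (Q - 1) ^ 2 = 1 \<Longrightarrow> x ^ p ^ b = x"
    and lam: "lam ^ Q = lam"
begin

lemma Q_gt_1: "Q > 1"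
  unfolding Q_def using prime_gt_1_nat[OF prime_p] a_pos by (rule one_less_power)

lemma Q_eq: "Q = Suc (Q - 1)" using Q_gt_1 by simp

lemma of_nat_Q: "cg a (of_nat Q * x) 0"
proof -
  have "of_nat Q = (of_nat p :: 'r) ^ a" by (simp add: Q_def)
  hence "of_nat Q \<in> J a" using J_power[OF p_in_J] by simp
  thus ?thesis using J_mult_right by (simp add: cg_def)
qed

definition twist :: "'k \<Rightarrow> bool" where "twist z \<longleftrightarrow> z \<noteq> 0 \<and> z ^ Q = z"

lemma twist_pow: "twist z \<Longrightarrow> z ^ (Q - 1) = 1"
proof -
  assume z: "twist z"
  obtain m where "Q = Suc m" using Q_gt_1 by (cases Q) auto
  moreover have "z \<noteq> 0" "z ^ Q = z" using z by (auto simp: twist_def)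
  ultimately show "z ^ (Q - 1) = 1" by simp
qed

lemma twisted_line_pow:
  assumes "twist z" "x \<in> twisted_line Q z" "x \<noteq> 0"
  shows "x ^ (Q - 1) = z"
  using assms(2,3) unfolding twisted_line_def mem_Collect_eq by (subst (asm) Q_eq) simp

lemma in_S:
  assumes "x \<noteq> 0" "x ^ (Q - 1) ^ 2 = 1"
  shows "x \<in> S"
  using S_big[OF assms(2)] by simp

lemma zero_in_S: "0 \<in> S"
  using prime_gt_0_nat[OF prime_p] by (simp add: power_0_left)

lemma twist_in_S: "twist z \<Longrightarrow> z \<in> S"
  using twist_pow[of z] by (intro in_S) (auto simp: twist_def power2_eq_square power_mult)

lemma twisted_line_in_S:
  assumes "twist z" "x \<in> twisted_line Q z"
  shows "x \<in> S"
proof (cases "x = 0")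
  case False
  thus ?thesis using twisted_line_pow[OF assms False] twist_pow[OF assms(1)]
    by (intro in_S) (auto simp: power2_eq_square power_mult)
qed (use zero_in_S in simp)

lemma lam_in_S: "lam \<in> S"
proof (cases "lam = 0")
  case False
  hence "twist lam" using lam by (simp add: twist_def)
  thus ?thesis by (rule twist_in_S)
qed (use zero_in_S in simp)

lemma card_line:
  assumes "twist z"
  shows "card (twisted_line Q z) = Q"
proof -
  have "Q = CHAR('k) ^ a" "prime CHAR('k)" using Q_def char prime_p by auto
  thus ?thesis using card_twisted_line[of Q a z] a_pos assms unfolding twist_def by blast
qed

lemma finite_twisted_line: "twist z \<Longrightarrow> finite (twisted_line Q z)"
  using card_line[of z] Q_gt_1 by (intro card_ge_0_finite) simp

definition power_sum :: "'k \<Rightarrow> nat \<Rightarrow> 'r" where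
  "power_sum z w = (\<Sum>x\<in>twisted_line Q z. T x ^ w)"

lemma zero_in_line: "0 \<in> twisted_line Q z"
  using Q_gt_1 by (simp add: twisted_line_def power_0_left)

lemma power_sum_0: "twist z \<Longrightarrow> cg a (power_sum z 0) 0"
  using of_nat_Q[of 1] by (simp add: power_sum_def card_line)

lemma power_sum_nonzero:
  assumes "twist z" "w > 0"
  shows "cg a (power_sum z w) (\<Sum>x\<in>twisted_line Q z - {0}. T x ^ w)"
proof -
  have "power_sum z w = T 0 ^ w + (\<Sum>x\<in>twisted_line Q z - {0}. T x ^ w)"
    unfolding power_sum_def using finite_twisted_line[OF assms(1)] zero_in_line by (rule sum.remove)
  moreover have "cg a (T 0 ^ w) (0 ^ w)" by (intro cg_power T_0)
  ultimately show ?thesis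
    using assms(2) cg_add[of a "T 0 ^ w" 0 "\<Sum>x\<in>twisted_line Q z - {0}. T x ^ w"]
    by (simp add: power_0_left)
qed

text \<open>
  On the nonzero part of the line the \<open>(Q - 1)\<close>-th power is constantly \<open>z\<close>.
\<close>

lemma power_sum_dvd:
  assumes z: "twist z" and w: "w = (Q - 1) * k" "w > 0"
  shows "cg a (power_sum z w) (of_nat (Q - 1) * T (z ^ k))"
proof -
  note power_sum_nonzero[OF z w(2)]
  also have "cg a (\<Sum>x\<in>twisted_line Q z - {0}. T x ^ w) (\<Sum>x\<in>twisted_line Q z - {0}. T (z ^ k))"
  proof (rule cg_sum)
    fix x assume x: "x \<in> twisted_line Q z - {0}"
    have "x ^ w = z ^ k" using twisted_line_pow[OF z] x by (simp add: w power_mult)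
    thus "cg a (T x ^ w) (T (z ^ k))" using T_power[of x w] twisted_line_in_S[OF z] x cg_sym by auto
  qed
  also have "(\<Sum>x\<in>twisted_line Q z - {0}. T (z ^ k)) = of_nat (Q - 1) * T (z ^ k)"
    using card_Diff_singleton[OF zero_in_line[of z]] card_line[OF z] by simp
  finally show ?thesis .
qed

lemma exists_nontrivial_power:
  assumes "\<not> (Q - 1) dvd w"
  shows "\<exists>c. twist c \<and> c ^ w \<noteq> 1"
proof (rule ccontr)
  assume none: "\<not> ?thesis"
  have "Q = CHAR('k) ^ a" "prime CHAR('k)" using Q_def char prime_p by auto
  hence card: "card {x :: 'k. x ^ Q = x} = Q" using a_pos by (intro card_frobenius_fixed)
  have "(Q - 1) dvd w"
  proof (rule roots_of_unity_exponent_dvd[of "{x :: 'k. x ^ Q = x} - {0}"])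
    show "finite ({x :: 'k. x ^ Q = x} - {0})" using finite_power_eq_self[OF Q_gt_1] by simp
    show "card ({x :: 'k. x ^ Q = x} - {0}) = Q - 1"
      using Q_gt_1 card by (subst card_Diff_singleton) (auto simp: power_0_left)
    show "Q - 1 > 0" using Q_gt_1 by simp
    fix c assume "c \<in> {x :: 'k. x ^ Q = x} - {0}"
    hence c: "twist c" by (simp add: twist_def)
    thus "c ^ (Q - 1) = 1" "c ^ w = 1" using twist_pow none by blast+
  qed
  thus False using assms by simp
qed

text \<open>
  The substitution \<open>x \<mapsto> c x\<close> with \<open>c\<^sup>Q\<^sup>-\<^sup>1 = 1\<close> permutes the line and multiplies the sum by \<open>c\<^sup>w\<close>, which
  for a suitable \<open>c\<close> differs from \<open>1\<close> already in the residue field.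
\<close>

lemma power_sum_not_dvd:
  assumes z: "twist z" and w: "\<not> (Q - 1) dvd w"
  shows "cg a (power_sum z w) 0"
proof -
  obtain c where c: "twist c" "c ^ w \<noteq> 1" using exists_nontrivial_power[OF w] by blast
  have cS: "c \<in> S" "c \<noteq> 0" using twist_in_S c by (auto simp: twist_def)
  have "cg a (T c ^ w * power_sum z w) (\<Sum>x\<in>twisted_line Q z. T (c * x) ^ w)"
    unfolding power_sum_def sum_distrib_left power_mult_distrib[symmetric]
    using T_mult[OF cS(1)] twisted_line_in_S[OF z] cg_sym by (intro cg_sum cg_power) blast
  also have "(\<Sum>x\<in>twisted_line Q z. T (c * x) ^ w) = power_sum z w"
    unfolding power_sum_def
    by (rule sum.reindex_bij_witness[of _ "\<lambda>x. x / c" "\<lambda>x. c * x"])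
       (use c cS in \<open>auto simp: twisted_line_def twist_def power_mult_distrib power_divide\<close>)
  finally have "cg a ((T c ^ w - 1) * power_sum z w) ((T c ^ w - 1) * 0)"
    by (simp add: cg_def algebra_simps)
  moreover have "\<theta> (T c ^ w - 1) \<noteq> 0" using c hom_T[OF cS(1)] by (simp add: hom_diff hom_power hom_1)
  ultimately show ?thesis by (rule cg_cancel[rotated])
qed

definition lifted_form :: "(nat \<Rightarrow> 'k) \<Rightarrow> 'r" where
  "lifted_form x = (\<Sum>i\<le>n. T (x i) ^ (n + 1)) + T lam * (\<Prod>i\<le>n. T (x i))"

text \<open>
  The exponent is large enough to push a lift of \<open>0\<close> into \<open>J a\<close>, divisible by \<open>Q - 1\<close>, and divisible by
  \<open>p ^ (a - 1)\<close>, which moves a congruence with \<open>1\<close> from level \<open>1\<close> to level \<open>a\<close>.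
\<close>

abbreviation "exponent \<equiv> (Q - 1) * p ^ (a - 1)"

lemma exponent_ge: "a \<le> exponent"
proof -
  have "a < 2 ^ a" by (rule less_exp)
  also have "2 ^ a \<le> Q" unfolding Q_def using prime_ge_2_nat[OF prime_p] by (rule power_mono) simp
  finally have "a \<le> Q - 1" by simp
  also have "\<dots> \<le> exponent" using prime_gt_0_nat[OF prime_p] by simp
  finally show ?thesis .
qed

definition "box \<zeta> = PiE {..n} (\<lambda>i. twisted_line Q (\<zeta> i))"

definition admissible :: "(nat \<Rightarrow> 'k) \<Rightarrow> bool" where
  "admissible \<zeta> \<longleftrightarrow> (\<forall>i\<le>n. twist (\<zeta> i) \<and> \<zeta> i ^ (n + 1) = 1) \<and> (\<Prod>i\<le>n. \<zeta> i) = 1"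

text \<open>
  The value \<open>f\<close> of the form at a twisted point lies in the field with \<open>Q\<close> elements, because the form is
  invariant under \<open>\<zeta>\<close>: \<open>f(x)\<^sup>Q = f(\<zeta> x) = f(x)\<close>. So \<open>f\<^sup>Q\<^sup>-\<^sup>1\<close> is \<open>0\<close> or \<open>1\<close>.
\<close>

lemma indicator_cg:
  assumes \<zeta>: "admissible \<zeta>" and x: "x \<in> box \<zeta>"
  shows "cg a (lifted_form x ^ exponent) (if (\<Sum>i\<le>n. x i ^ (n + 1)) + lam * (\<Prod>i\<le>n. x i) = 0 then 0 else 1)"
proof -
  define f where "f = (\<Sum>i\<le>n. x i ^ (n + 1)) + lam * (\<Prod>i\<le>n. x i)"
  have xi: "x i ^ Q = \<zeta> i * x i" "x i \<in> S" if "i \<le> n" for i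
    using x \<zeta> that twisted_line_in_S[of "\<zeta> i" "x i"] by (auto simp: box_def PiE_iff twisted_line_def admissible_def)
  have F: "\<theta> (lifted_form x) = f"
    unfolding lifted_form_def f_def using xi hom_T lam_in_S by (simp add: hom_add hom_mult hom_sum hom_prod hom_power)
  have fQ: "f ^ Q = f"
  proof -
    have frob: "(u + v) ^ Q = u ^ Q + v ^ Q" for u v :: 'k
      using char Q_def prime_p by (intro freshmans_dream'[of Q a]) auto
    have frob_sum: "(\<Sum>i\<le>n. g i) ^ Q = (\<Sum>i\<le>n. g i ^ Q)" for g :: "nat \<Rightarrow> 'k"
      using char Q_def prime_p by (intro freshmans_dream_sum'[of Q a]) auto
    have "(x i ^ (n + 1)) ^ Q = x i ^ (n + 1)" if "i \<le> n" for i
    proof -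
      have "(x i ^ (n + 1)) ^ Q = (x i ^ Q) ^ (n + 1)" by (simp only: power_mult[symmetric] mult.commute)
      also have "\<dots> = \<zeta> i ^ (n + 1) * x i ^ (n + 1)" by (simp only: xi[OF that] power_mult_distrib)
      finally show ?thesis using \<zeta> that by (simp add: admissible_def)
    qed
    moreover have "(\<Prod>i\<le>n. x i) ^ Q = (\<Prod>i\<le>n. \<zeta> i) * (\<Prod>i\<le>n. x i)"
      unfolding prod_power_distrib prod.distrib[symmetric] using xi by (intro prod.cong) auto
    ultimately show ?thesis
      unfolding f_def frob frob_sum power_mult_distrib lam using \<zeta> by (simp add: admissible_def del: power_Suc)
  qed
  show ?thesis
  proof (cases "f = 0")
    case True
    hence "lifted_form x \<in> J 1" using F hom_eq_0_iff by simp
    hence "lifted_form x ^ exponent \<in> J exponent" by (rule J_power)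
    hence "lifted_form x ^ exponent \<in> J a" using J_antimono[OF exponent_ge] by blast
    thus ?thesis using True by (simp add: cg_def f_def)
  next
    case False
    have "f ^ (Q - 1) = 1" using fQ False by (subst (asm) Q_eq) simp
    hence "cg 1 (lifted_form x ^ (Q - 1)) 1" by (simp add: cg_1_iff hom_power F hom_1 del: One_nat_def)
    hence "cg a ((lifted_form x ^ (Q - 1)) ^ p ^ (a - 1)) (1 ^ p ^ (a - 1))"
      by (rule cg_power_prime_power') simp
    thus ?thesis using False by (simp add: f_def power_mult)
  qed
qed

text \<open>
  The contribution of the monomial with exponents \<open>u\<close> to the sum of the powers of the form; the last
  exponent, at \<open>Suc n\<close>, belongs to the product of all coordinates.
\<close>

definition expansion_term :: "(nat \<Rightarrow> 'k) \<Rightarrow> (nat \<Rightarrow> nat) \<Rightarrow> 'r" where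
  "expansion_term \<zeta> u = of_nat (multinomial {..Suc n} u) * T lam ^ u (Suc n) *
     (\<Prod>i\<le>n. power_sum (\<zeta> i) ((n + 1) * u i + u (Suc n)))"

lemma sum_lifted_form:
  assumes "admissible \<zeta>"
  shows "(\<Sum>x\<in>box \<zeta>. lifted_form x ^ exponent) = (\<Sum>u\<in>compositions {..Suc n} exponent. expansion_term \<zeta> u)"
proof -
  define z where "z x i = (if i \<le> n then T (x i) ^ (n + 1) else T lam * (\<Prod>i\<le>n. T (x i)))" for x i
  have form: "lifted_form x = (\<Sum>i\<le>Suc n. z x i)" for x
    by (simp add: lifted_form_def z_def)
  have mono: "(\<Prod>i\<le>Suc n. z x i ^ u i) = T lam ^ u (Suc n) * (\<Prod>i\<le>n. T (x i) ^ ((n + 1) * u i + u (Suc n)))" for x u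
  proof -
    have "(\<Prod>i\<le>Suc n. z x i ^ u i) = (\<Prod>i\<le>n. (T (x i) ^ (n + 1)) ^ u i) * (T lam * (\<Prod>i\<le>n. T (x i))) ^ u (Suc n)"
      by (simp add: z_def)
    also have "\<dots> = T lam ^ u (Suc n) * ((\<Prod>i\<le>n. T (x i) ^ ((n + 1) * u i)) * (\<Prod>i\<le>n. T (x i) ^ u (Suc n)))"
      by (simp only: power_mult power_mult_distrib prod_power_distrib mult.left_commute)
    also have "\<dots> = T lam ^ u (Suc n) * (\<Prod>i\<le>n. T (x i) ^ ((n + 1) * u i + u (Suc n)))"
      by (simp only: power_add prod.distrib)
    finally show ?thesis .
  qed
  have "(\<Sum>x\<in>box \<zeta>. lifted_form x ^ exponent) = (\<Sum>x\<in>box \<zeta>. \<Sum>u\<in>compositions {..Suc n} exponent.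
      of_nat (multinomial {..Suc n} u) * (\<Prod>i\<le>Suc n. z x i ^ u i))"
    unfolding form by (intro sum.cong refl multinomial_theorem) simp
  also have "\<dots> = (\<Sum>u\<in>compositions {..Suc n} exponent. of_nat (multinomial {..Suc n} u) * T lam ^ u (Suc n) *
      (\<Sum>x\<in>box \<zeta>. \<Prod>i\<le>n. T (x i) ^ ((n + 1) * u i + u (Suc n))))"
    unfolding mono by (subst sum.swap) (simp only: sum_distrib_left mult.assoc)
  also have "\<dots> = (\<Sum>u\<in>compositions {..Suc n} exponent. expansion_term \<zeta> u)"
  proof (intro sum.cong refl)
    fix u
    have "(\<Sum>x\<in>box \<zeta>. \<Prod>i\<le>n. T (x i) ^ ((n + 1) * u i + u (Suc n))) =
        (\<Prod>i\<le>n. \<Sum>y\<in>twisted_line Q (\<zeta> i). T y ^ ((n + 1) * u i + u (Suc n)))"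
      unfolding box_def using assms finite_twisted_line
      by (intro prod_sum_PiE[symmetric]) (auto simp: admissible_def)
    thus "of_nat (multinomial {..Suc n} u) * T lam ^ u (Suc n) *
      (\<Sum>x\<in>box \<zeta>. \<Prod>i\<le>n. T (x i) ^ ((n + 1) * u i + u (Suc n))) = expansion_term \<zeta> u"
      by (simp only: expansion_term_def power_sum_def)
  qed
  finally show ?thesis .
qed

lemma admissible_1: "admissible (\<lambda>_. 1)"
  by (simp add: admissible_def twist_def)

lemma expansion_term_zero:
  assumes "i \<le> n" "cg a (power_sum (\<zeta> i) ((n + 1) * u i + u (Suc n))) 0"
  shows "cg a (expansion_term \<zeta> u) 0"
proof -
  let ?g = "\<lambda>i. power_sum (\<zeta> i) ((n + 1) * u i + u (Suc n))"
  have "(\<Prod>i\<le>n. ?g i) = ?g i * (\<Prod>i\<in>{..n} - {i}. ?g i)"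
    using assms by (intro prod.remove) auto
  hence "cg a (\<Prod>i\<le>n. ?g i) (0 * (\<Prod>i\<in>{..n} - {i}. ?g i))"
    using assms by (simp only:) (intro cg_mult cg_refl)
  hence "cg a (expansion_term \<zeta> u) (of_nat (multinomial {..Suc n} u) * T lam ^ u (Suc n) * (0 * (\<Prod>i\<in>{..n} - {i}. ?g i)))"
    unfolding expansion_term_def by (intro cg_mult cg_refl)
  thus ?thesis by simp
qed

text \<open>
  Both terms vanish modulo \<open>J a\<close> unless all \<open>w i = (n + 1) u i + u (Suc n)\<close> are positive multiples of
  \<open>Q - 1\<close>. Then either the multinomial coefficient is divisible by \<open>Q\<close>, or the \<open>u i\<close> are congruent
  modulo \<open>Q - 1\<close>. In the second case the \<open>k i = w i / (Q - 1)\<close> are congruent modulo \<open>n + 1\<close>, and the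
  twist appears as the product of the \<open>\<zeta> i ^ k i = \<zeta> i ^ k 0\<close>, which is \<open>1\<close>.
\<close>

lemma expansion_term_untwist:
  assumes \<zeta>: "admissible \<zeta>" and u: "u \<in> compositions {..Suc n} exponent"
  shows "cg a (expansion_term \<zeta> u) (expansion_term (\<lambda>_. 1) u)"
proof -
  define w where "w i = (n + 1) * u i + u (Suc n)" for i
  have tw: "twist (\<zeta> i)" if "i \<le> n" for i using \<zeta> that by (auto simp: admissible_def)
  have tw1: "twist 1" by (simp add: twist_def)
  consider (zero) i where "i \<le> n" "w i = 0" | (ndvd) i where "i \<le> n" "\<not> (Q - 1) dvd w i"
    | (dvd) "\<And>i. i \<le> n \<Longrightarrow> w i > 0 \<and> (Q - 1) dvd w i"
    by blast
  thus ?thesis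
  proof cases
    case zero
    hence "cg a (expansion_term \<zeta> u) 0" "cg a (expansion_term (\<lambda>_. 1) u) 0"
      using power_sum_0[OF tw] power_sum_0[OF tw1] by (auto intro!: expansion_term_zero[of i] simp: w_def)
    thus ?thesis using cg_sym cg_trans by blast
  next
    case ndvd
    hence "cg a (expansion_term \<zeta> u) 0" "cg a (expansion_term (\<lambda>_. 1) u) 0"
      using power_sum_not_dvd[OF tw] power_sum_not_dvd[OF tw1] by (auto intro!: expansion_term_zero[of i] simp: w_def)
    thus ?thesis using cg_sym cg_trans by blast
  next
    case dvd
    have "Q dvd multinomial {..Suc n} u \<or> (\<forall>i\<le>n. [u i = u 0] (mod (Q - 1)))"
      using u dvd by (intro prime_power_dvd_multinomial_or_cong[OF prime_p a_pos Q_def]) (auto simp: compositions_def w_def)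
    thus ?thesis
    proof
      assume "Q dvd multinomial {..Suc n} u"
      then obtain c where "multinomial {..Suc n} u = Q * c" ..
      hence "cg a (expansion_term \<xi> u) 0" for \<xi>
        using of_nat_Q by (simp add: expansion_term_def mult.assoc)
      thus ?thesis using cg_sym cg_trans by blast
    next
      assume cong: "\<forall>i\<le>n. [u i = u 0] (mod (Q - 1))"
      define k where "k i = w i div (Q - 1)" for i
      have k: "w i = (Q - 1) * k i" if "i \<le> n" for i using dvd[OF that] by (simp add: k_def)
      have "cg a (\<Prod>i\<le>n. power_sum (\<xi> i) (w i)) (\<Prod>i\<le>n. of_nat (Q - 1))" if \<xi>: "admissible \<xi>" for \<xi>
      proof -
        have tw: "twist (\<xi> i)" if "i \<le> n" for i using \<xi> that by (auto simp: admissible_def)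
        have "cg a (\<Prod>i\<le>n. power_sum (\<xi> i) (w i)) (\<Prod>i\<le>n. of_nat (Q - 1) * T (\<xi> i ^ k i))"
          using power_sum_dvd[OF tw k] dvd by (intro cg_prod) auto
        also have "(\<Prod>i\<le>n. of_nat (Q - 1) * T (\<xi> i ^ k i)) = (\<Prod>i\<le>n. of_nat (Q - 1)) * (\<Prod>i\<le>n. T (\<xi> i ^ k i))"
          by (rule prod.distrib)
        also have "(\<Prod>i\<le>n. T (\<xi> i ^ k i)) = (\<Prod>i\<le>n. T (\<xi> i ^ k 0))"
        proof (intro prod.cong refl)
          fix i assume i: "i \<in> {..n}"
          obtain s where s: "int (u i) = int (u 0) + int (Q - 1) * s"
            using cong i cong_iff_lin[of "int (u 0)" "int (u i)" "int (Q - 1)"] by (auto simp: cong_int_iff cong_sym_eq)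
          define m where "m = Q - 1"
          have "int (m * k i) = int ((n + 1) * u i + u (Suc n))" "int (m * k 0) = int ((n + 1) * u 0 + u (Suc n))"
            using k[of i] k[of 0] i by (simp_all only: w_def m_def atMost_iff le0)
          hence "int m * int (k i) = int m * (int (k 0) + int (n + 1) * s)"
          proof -
            have "M * K = N * U + V \<Longrightarrow> M * K0 = N * U0 + V \<Longrightarrow> U = U0 + M * s \<Longrightarrow> M * K = M * (K0 + N * s)"
              for M K N U U0 V K0 :: int by (simp add: algebra_simps)
            moreover assume "int (m * k i) = int ((n + 1) * u i + u (Suc n))"
              "int (m * k 0) = int ((n + 1) * u 0 + u (Suc n))"
            ultimately show ?thesis
              using s unfolding of_nat_add[of "(n + 1) * u j" for j] of_nat_mult m_def[symmetric] by blast
          qed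
          moreover have "m > 0" using Q_gt_1 by (simp add: m_def)
          ultimately have "int (k i) = int (k 0) + int (n + 1) * s" by simp
          hence "[int (k 0) = int (k i)] (mod int (n + 1))" unfolding cong_iff_lin by blast
          hence k_cong: "k 0 mod (n + 1) = k i mod (n + 1)" by (simp only: cong_int_iff) (simp add: cong_def)
          have "\<xi> i ^ (n + 1) = 1" using \<xi> i by (auto simp: admissible_def)
          moreover have "\<xi> i ^ j = (\<xi> i ^ (n + 1)) ^ (j div (n + 1)) * \<xi> i ^ (j mod (n + 1))" for j
            by (simp only: power_mult[symmetric] power_add[symmetric] mult_div_mod_eq)
          ultimately have "\<xi> i ^ j = \<xi> i ^ (j mod (n + 1))" for j by (metis power_one mult_1)
          hence "\<xi> i ^ k i = \<xi> i ^ k 0" using k_cong by metis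
          thus "T (\<xi> i ^ k i) = T (\<xi> i ^ k 0)" by simp
        qed
        also have "cg a ((\<Prod>i\<le>n. of_nat (Q - 1)) * (\<Prod>i\<le>n. T (\<xi> i ^ k 0))) ((\<Prod>i\<le>n. of_nat (Q - 1)) * T (\<Prod>i\<le>n. \<xi> i ^ k 0))"
          using S_pow twist_in_S[OF tw] by (intro cg_mult cg_refl cg_sym[OF T_prod]) auto
        also have "(\<Prod>i\<le>n. \<xi> i ^ k 0) = 1"
          using \<xi> by (simp add: admissible_def flip: prod_power_distrib)
        also have "cg a ((\<Prod>i\<le>n. of_nat (Q - 1)) * T 1) ((\<Prod>i\<le>n. of_nat (Q - 1)) * 1)"
          by (intro cg_mult cg_refl T_1)
        finally show ?thesis by simp
      qed
      from this[OF \<zeta>] this[OF admissible_1]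
      have "cg a (\<Prod>i\<le>n. power_sum (\<zeta> i) (w i)) (\<Prod>i\<le>n. power_sum 1 (w i))"
        using cg_sym cg_trans by blast
      thus ?thesis unfolding expansion_term_def w_def by (intro cg_mult cg_refl)
    qed
  qed
qed

text \<open>
  The box has \<open>Q ^ (n + 1)\<close> points, a multiple of \<open>Q\<close>, so counting zeros is minus counting non-zeros.
\<close>

lemma card_twisted_zeros_cg:
  assumes "admissible \<zeta>"
  shows "cg a (of_nat (card (twisted_zeros n lam Q \<zeta>))) (- (\<Sum>u\<in>compositions {..Suc n} exponent. expansion_term \<zeta> u))"
proof -
  define N where "N = twisted_zeros n lam Q \<zeta>"
  have fin: "finite (box \<zeta>)"
    unfolding box_def using assms finite_twisted_line by (intro finite_PiE) (auto simp: admissible_def)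
  have sub: "N \<subseteq> box \<zeta>" by (auto simp: N_def twisted_zeros_def box_def)
  have "card (box \<zeta>) = Q ^ (n + 1)"
    unfolding box_def using assms card_line by (subst card_PiE) (auto simp: admissible_def)
  hence card_box: "cg a (of_nat (card (box \<zeta>))) 0" using of_nat_Q[of "of_nat Q ^ n"] by simp
  have "cg a (\<Sum>x\<in>box \<zeta>. lifted_form x ^ exponent) (\<Sum>x\<in>box \<zeta>. if x \<in> N then 0 else 1)"
    using indicator_cg[OF assms] by (intro cg_sum) (auto simp: N_def twisted_zeros_def box_def)
  also have "(\<Sum>x\<in>box \<zeta>. if x \<in> N then 0 else 1 :: 'r) = (\<Sum>x\<in>box \<zeta> - N. 1)"
    using fin by (intro sum.mono_neutral_cong_right) auto
  also have "\<dots> = of_nat (card (box \<zeta>)) - of_nat (card N)"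
    using sub fin finite_subset[OF sub fin] by (simp add: card_Diff_subset card_mono of_nat_diff)
  also have "cg a (of_nat (card (box \<zeta>)) - of_nat (card N)) (0 - of_nat (card N))"
    by (intro cg_diff card_box cg_refl)
  finally have "cg a (0 - (\<Sum>x\<in>box \<zeta>. lifted_form x ^ exponent)) (0 - (0 - of_nat (card N)))"
    by (intro cg_diff cg_refl)
  thus ?thesis using cg_sym unfolding sum_lifted_form[OF assms] N_def by simp
qed

lemma card_twisted_zeros_cong:
  assumes "admissible \<zeta>"
  shows "[card (twisted_zeros n lam Q \<zeta>) = card (twisted_zeros n lam Q (\<lambda>_. 1))] (mod Q)"
proof -
  have "cg a (\<Sum>u\<in>compositions {..Suc n} exponent. expansion_term \<zeta> u)
             (\<Sum>u\<in>compositions {..Suc n} exponent. expansion_term (\<lambda>_. 1) u)"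
    by (intro cg_sum expansion_term_untwist assms)
  hence "cg a (0 - (\<Sum>u\<in>compositions {..Suc n} exponent. expansion_term \<zeta> u))
             (0 - (\<Sum>u\<in>compositions {..Suc n} exponent. expansion_term (\<lambda>_. 1) u))"
    by (intro cg_diff cg_refl)
  hence "cg a (of_nat (card (twisted_zeros n lam Q \<zeta>))) (of_nat (card (twisted_zeros n lam Q (\<lambda>_. 1))))"
    using cg_trans[OF card_twisted_zeros_cg[OF assms] cg_trans[OF _ cg_sym[OF card_twisted_zeros_cg[OF admissible_1]]]]
    by simp
  hence "of_int (int (card (twisted_zeros n lam Q \<zeta>)) - int (card (twisted_zeros n lam Q (\<lambda>_. 1)))) \<in> J a"
    by (simp add: cg_def)
  hence "int p ^ a dvd int (card (twisted_zeros n lam Q \<zeta>)) - int (card (twisted_zeros n lam Q (\<lambda>_. 1)))"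
    by (rule of_int_in_J)
  hence "[int (card (twisted_zeros n lam Q \<zeta>)) = int (card (twisted_zeros n lam Q (\<lambda>_. 1)))] (mod (int Q))"
    by (simp add: cong_iff_dvd_diff Q_def)
  thus ?thesis by (simp only: cong_int_iff)
qed

end

text \<open>
  It remains to choose a residue field: \<open>p ^ b - 1\<close> is divisible by \<open>(Q - 1)\<^sup>2\<close> for \<open>b\<close> the totient of
  \<open>(Q - 1)\<^sup>2\<close>.
\<close>

theorem twisted_zeros_cong:
  fixes \<zeta> :: "nat \<Rightarrow> 'k :: alg_closed_field"
  assumes p: "prime CHAR('k)" and Q: "Q = CHAR('k) ^ a" "a > 0" and lam: "lam ^ Q = lam"
    and \<zeta>: "\<And>i. i \<le> n \<Longrightarrow> \<zeta> i ^ Q = \<zeta> i" "\<And>i. i \<le> n \<Longrightarrow> \<zeta> i ^ (n + 1) = 1" "(\<Prod>i\<le>n. \<zeta> i) = 1"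
  shows "[card (twisted_zeros n lam Q \<zeta>) = card (twisted_zeros n lam Q (\<lambda>_. 1))] (mod Q)"
proof -
  define p where "p = CHAR('k)"
  have Q1: "Q > 1" unfolding Q using prime_gt_1_nat[OF p] Q(2) by (rule one_less_power)
  define N where "N = (Q - 1) ^ 2"
  define b where "b = totient N"
  have "coprime Q (Q - 1)" using Q1 by (intro coprime_diff_one_right_nat) simp
  hence "coprime (p ^ a) ((Q - 1) ^ 2)" by (simp add: Q(1) p_def[symmetric])
  hence "coprime p N" unfolding N_def coprime_power_left_iff using Q(2) by simp
  hence pb: "[p ^ b = 1] (mod N)" unfolding b_def by (rule euler_theorem)
  have "N > 0" using Q1 by (simp add: N_def)
  hence b: "b > 0" by (simp add: b_def)
  obtain J and \<theta> :: "int Polynomial.poly \<Rightarrow> 'k" where "teichmueller_lift p J \<theta> b"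
    using exists_teichmueller_lift[OF p[folded p_def] p_def b] by (elim exE)
  then have lift: "teichmueller_lift p J \<theta> b" .
  have "x ^ p ^ b = x" if x: "x ^ (Q - 1) ^ 2 = 1" for x :: 'k
  proof -
    have "N dvd p ^ b - 1" using pb prime_gt_0_nat[OF p] by (simp add: p_def cong_altdef_nat)
    then obtain m where m: "p ^ b - 1 = N * m" ..
    have "p ^ b > 0" using prime_gt_0_nat[OF p] by (simp add: p_def)
    hence pb_eq: "p ^ b = Suc (N * m)" using m by linarith
    have "x ^ p ^ b = x * (x ^ N) ^ m" unfolding pb_eq by (simp only: power_Suc power_mult)
    thus ?thesis using x by (simp add: N_def)
  qed
  with lift have "twisted_count_axioms p b a Q (lam :: 'k)"
    using Q lam by (intro twisted_count_axioms.intro) (auto simp: p_def)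
  with lift have count: "twisted_count p J \<theta> b a Q lam"
    by (rule twisted_count.intro)
  have "\<zeta> i \<noteq> 0" if "i \<le> n" for i
  proof (rule notI)
    assume "\<zeta> i = 0"
    with \<zeta>(2)[OF that] show False by (simp add: power_0_left)
  qed
  hence "twisted_count.admissible Q n \<zeta>"
    using \<zeta> unfolding twisted_count.admissible_def[OF count] twisted_count.twist_def[OF count] by blast
  thus ?thesis by (rule twisted_count.card_twisted_zeros_cong[OF count])
qed

section \<open>Morphisms from the spectrum of a field\<close>

lemma UN_constant_nonempty:
  assumes "\<And>p. p \<in> M \<Longrightarrow> g p = c" "p \<in> M"
  shows "(\<Union>p\<in>M. g p) = c"
  using assms by blast

lemma UN_pairs_constant:
  assumes const: "\<And>u v u' v'. (u, v) \<in> M \<Longrightarrow> (u', v') \<in> N \<Longrightarrow> g u v u' v' = c"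
    and ne: "(u0, v0) \<in> M" "(u1, v1) \<in> N"
  shows "(\<Union>(u, v)\<in>M. \<Union>(u', v')\<in>N. g u v u' v') = c"
proof (rule UN_constant_nonempty[OF _ ne(1)])
  fix p assume p: "p \<in> M"
  show "(case p of (u, v) \<Rightarrow> \<Union>(u', v')\<in>N. g u v u' v') = c"
    using const p by (cases p, simp only: prod.case, intro UN_constant_nonempty[OF _ ne(2)]) auto
qed

definition sections_closed :: "('p, 's, 'f) ringed_space \<Rightarrow> bool" where
  "sections_closed Y \<longleftrightarrow>
     (\<forall>V. openin (underlying Y) V \<longrightarrow> \<one>\<^bsub>sections Y V\<^esub> \<in> carrier (sections Y V) \<and>
        (\<forall>s\<in>carrier (sections Y V).
           (\<forall>t\<in>carrier (sections Y V). s \<otimes>\<^bsub>sections Y V\<^esub> t \<in> carrier (sections Y V) \<and>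
              s \<oplus>\<^bsub>sections Y V\<^esub> t \<in> carrier (sections Y V)) \<and>
           (\<forall>W. openin (underlying Y) W \<longrightarrow> W \<subseteq> V \<longrightarrow> restr Y V W s \<in> carrier (sections Y W)))) \<and>
     (\<forall>c. scalar Y c \<in> carrier (sections Y (points Y)))"

text \<open>
  The spectrum of \<open>K\<close> is the single point \<open>pt\<close>. Its local ring is \<open>K\<close>, in the shape of fractions: \<open>frac v\<close> is
  the set of pairs of quotient \<open>v\<close>, and \<open>sec U v\<close> is the section with value \<open>v\<close>.
\<close>

locale spec_of_field =
  fixes K :: "'k :: field set" and \<kappa> :: "'f \<Rightarrow> 'k"
  assumes field_K: "field (ring_on K)" and \<kappa>_in: "\<kappa> c \<in> K"
begin

sublocale K: field "ring_on K" by (rule field_K)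

lemma one_K: "1 \<in> K"
  using K.one_closed by simp

lemma mult_K: "v \<in> K \<Longrightarrow> w \<in> K \<Longrightarrow> v * w \<in> K" and add_K: "v \<in> K \<Longrightarrow> w \<in> K \<Longrightarrow> v + w \<in> K"
  using K.m_closed[of v w] K.a_closed[of v w] by auto

lemma divide_K:
  assumes "v \<in> K" "w \<in> K" "w \<noteq> 0"
  shows "v / w \<in> K"
proof -
  have "w \<in> Units (ring_on K)" using K.field_Units assms by auto
  then obtain u where u: "u \<in> K" "u * w = 1" unfolding Units_def by auto
  hence "v / w = v * u" using assms by (simp add: field_simps)
  thus ?thesis using mult_K assms u by simp
qed

abbreviation "SK \<equiv> Spec (ring_on K) \<kappa>"
abbreviation "pt \<equiv> {0 :: 'k}"
abbreviation "DK \<equiv> (\<lambda>_ :: unit. K)"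

definition frac :: "'k \<Rightarrow> ('k \<times> 'k) set" where
  "frac v = {(a, b). a \<in> K \<and> b \<in> K \<and> b \<noteq> 0 \<and> a = v * b}"

definition sec :: "'k set set \<Rightarrow> 'k \<Rightarrow> 'k set \<Rightarrow> ('k \<times> 'k) set" where
  "sec U v = (\<lambda>p\<in>U. frac v)"

lemma frac_inj:
  assumes "v \<in> K" "w \<in> K"
  shows "frac v = frac w \<longleftrightarrow> v = w"
proof
  assume eq: "frac v = frac w"
  have "(v, 1) \<in> frac v" using assms one_K by (simp add: frac_def)
  hence "(v, 1) \<in> frac w" unfolding eq .
  thus "v = w" by (simp add: frac_def)
qed simp

lemma prime_ideals: "{p. primeideal p (ring_on K)} = {pt}"
proof (intro equalityI subsetI)
  fix p assume "p \<in> {p. primeideal p (ring_on K)}"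
  hence p: "primeideal p (ring_on K)" by simp
  hence "p \<in> {I. ideal I (ring_on K)}" by (simp add: primeideal.axioms)
  hence "p = pt \<or> p = K" using K.all_ideals by auto
  moreover have "p \<noteq> K" using primeideal.I_notcarr[OF p] by auto
  ultimately show "p \<in> {pt}" by simp
qed (use K.zeroprimeideal in auto)

lemma homogeneous_DK: "homogeneous DK = K"
  by (simp add: homogeneous_def)

lemma topspace_zariski_K: "topspace (zariski DK {pt}) = {pt}"
  using one_K by (auto simp: zariski_def homogeneous_DK)

lemma openin_zariski_K: "openin (zariski DK {pt}) U \<longleftrightarrow> U = {} \<or> U = {pt}"
  using openin_subset[of "zariski DK {pt}" U] openin_topspace[of "zariski DK {pt}"] topspace_zariski_K
  by auto

lemma SK_simps:
  "underlying SK = zariski DK {pt}" "sections SK = structure_sections (ring_on K) DK {pt}"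
  "restr SK = (\<lambda>U V s. restrict s V)" "scalar SK = (\<lambda>c. \<lambda>p\<in>{pt}. fraction (ring_on K) DK p (\<kappa> c) 1)"
  by (simp_all add: Spec_def prime_space_def prime_ideals)

lemma points_SK: "points SK = {pt}"
  by (simp add: SK_simps topspace_zariski_K)

lemma openin_SK: "openin (underlying SK) U \<longleftrightarrow> U = {} \<or> U = {pt}"
  by (simp add: SK_simps openin_zariski_K)

lemma fraction_K:
  assumes "a \<in> K" "b \<in> K" "b \<noteq> 0"
  shows "fraction (ring_on K) DK pt a b = frac (a / b)"
proof -
  have "(\<exists>t\<in>K - pt. t * (a * b') = t * (a' * b)) \<longleftrightarrow> a' = a / b * b'" for a' b'
    using one_K assms by (auto simp: field_simps intro!: bexI[of _ 1])
  thus ?thesis by (auto simp: fraction_def frac_def homogeneous_DK)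
qed

lemma fraction_mult_K:
  assumes "v \<in> K" "w \<in> K"
  shows "fraction_mult (ring_on K) DK pt (frac v) (frac w) = frac (v * w)"
proof -
  have "fraction (ring_on K) DK pt (a * a') (b * b') = frac (v * w)"
    if "(a, b) \<in> frac v" "(a', b') \<in> frac w" for a b a' b'
    using that mult_K by (subst fraction_K) (auto simp: frac_def)
  moreover have "(v, 1) \<in> frac v" "(w, 1) \<in> frac w" using assms one_K by (auto simp: frac_def)
  ultimately show ?thesis unfolding fraction_mult_def ring_on_sel by (rule UN_pairs_constant)
qed

lemma fraction_add_K:
  assumes "v \<in> K" "w \<in> K"
  shows "fraction_add (ring_on K) DK pt (frac v) (frac w) = frac (v + w)"
proof -
  have "fraction (ring_on K) DK pt (a * b' + a' * b) (b * b') = frac (v + w)"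
    if "(a, b) \<in> frac v" "(a', b') \<in> frac w" for a b a' b'
  proof -
    have *: "a * b' + a' * b \<in> K" "b * b' \<in> K" "b * b' \<noteq> 0" "(a * b' + a' * b) / (b * b') = v + w"
      using that assms by (auto simp: frac_def field_simps intro!: mult_K add_K)
    show ?thesis unfolding fraction_K[OF *(1-3)] *(4) ..
  qed
  moreover have "(v, 1) \<in> frac v" "(w, 1) \<in> frac w" using assms one_K by (auto simp: frac_def)
  ultimately show ?thesis unfolding fraction_add_def ring_on_sel by (rule UN_pairs_constant)
qed

lemma sections_SK:
  assumes U: "openin (underlying SK) U"
  shows "carrier (sections SK U) = sec U ` K"
    and "\<And>v w. v \<in> K \<Longrightarrow> w \<in> K \<Longrightarrow> sec U v \<otimes>\<^bsub>sections SK U\<^esub> sec U w = sec U (v * w)"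
    and "\<And>v w. v \<in> K \<Longrightarrow> w \<in> K \<Longrightarrow> sec U v \<oplus>\<^bsub>sections SK U\<^esub> sec U w = sec U (v + w)"
    and "\<one>\<^bsub>sections SK U\<^esub> = sec U 1"
proof -
  have U': "U = {} \<or> U = {pt}" using U openin_SK by simp
  show "carrier (sections SK U) = sec U ` K"
  proof (cases "U = {}")
    case True
    hence "sec U = (\<lambda>_ _. undefined)" by (simp add: sec_def fun_eq_iff)
    hence "sec U ` K = {\<lambda>_. undefined}" using one_K by auto
    thus ?thesis using True by (auto simp: SK_simps structure_sections_def)
  next
    case False
    hence [simp]: "U = {pt}" using U' by simp
    have "s \<in> carrier (sections SK U) \<longleftrightarrow> s \<in> sec U ` K" for s
    proof
      assume "s \<in> carrier (sections SK U)"
      then obtain V a b where *: "s \<in> extensional {pt}" "pt \<in> V" "a \<in> K" "b \<in> K"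
        "\<forall>r\<in>V. b \<notin> r \<and> s r = fraction (ring_on K) DK r a b"
        by (auto simp: SK_simps structure_sections_def)
      hence "b \<noteq> 0" "s pt = frac (a / b)" using fraction_K by auto
      hence "s = sec U (a / b)" using * by (auto simp: sec_def extensional_def fun_eq_iff)
      thus "s \<in> sec U ` K" using * divide_K \<open>b \<noteq> 0\<close> by blast
    next
      assume "s \<in> sec U ` K"
      then obtain v where v: "v \<in> K" "s = sec U v" by blast
      have "\<forall>r\<in>{pt}. (1 :: 'k) \<notin> r \<and> s r = fraction (ring_on K) DK r v 1"
        using v one_K fraction_K[of v 1] by (simp add: sec_def)
      hence "\<exists>V. openin (zariski DK {pt}) V \<and> pt \<in> V \<and> V \<subseteq> {pt} \<and>
          (\<exists>a\<in>K. \<exists>b\<in>K. \<forall>r\<in>V. b \<notin> r \<and> s r = fraction (ring_on K) DK r a b)"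
        using v one_K openin_zariski_K by blast
      thus "s \<in> carrier (sections SK U)" using v by (auto simp: SK_simps structure_sections_def sec_def)
    qed
    thus ?thesis by blast
  qed
  show "sec U v \<otimes>\<^bsub>sections SK U\<^esub> sec U w = sec U (v * w)" if "v \<in> K" "w \<in> K" for v w
    using U' that by (auto simp: SK_simps structure_sections_def sec_def fraction_mult_K fun_eq_iff)
  show "sec U v \<oplus>\<^bsub>sections SK U\<^esub> sec U w = sec U (v + w)" if "v \<in> K" "w \<in> K" for v w
    using U' that by (auto simp: SK_simps structure_sections_def sec_def fraction_add_K fun_eq_iff)
  show "\<one>\<^bsub>sections SK U\<^esub> = sec U 1"
    using U' one_K by (auto simp: SK_simps structure_sections_def sec_def fraction_K fun_eq_iff)
qed

lemma sec_inj: "v \<in> K \<Longrightarrow> w \<in> K \<Longrightarrow> sec {pt} v = sec {pt} w \<longleftrightarrow> v = w"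
  using frac_inj by (auto simp: sec_def fun_eq_iff)

lemma scalar_SK: "scalar SK c = sec {pt} (\<kappa> c)"
  using \<kappa>_in one_K by (auto simp: SK_simps sec_def fraction_K fun_eq_iff)

lemma restr_SK: "W \<subseteq> U \<Longrightarrow> restr SK U W (sec U v) = sec W v"
  by (auto simp: SK_simps sec_def fun_eq_iff)

lemma germ_unit_SK:
  assumes v: "v \<in> K"
  shows "germ_unit SK {pt} pt (sec {pt} v) \<longleftrightarrow> v \<noteq> 0"
proof -
  have op: "openin (underlying SK) {pt}" by (simp add: openin_SK)
  have "germ_unit SK {pt} pt (sec {pt} v) \<longleftrightarrow> sec {pt} v \<in> Units (sections SK {pt})"
    unfolding germ_unit_def using op restr_SK[of "{pt}" "{pt}" v]
    by (auto simp: openin_SK intro!: exI[of _ "{pt}"])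
  also have "\<dots> \<longleftrightarrow> (\<exists>w\<in>K. w * v = 1)"
    using v sections_SK[OF op] sec_inj mult_K one_K by (auto simp: Units_def mult.commute)
  also have "\<dots> \<longleftrightarrow> v \<noteq> 0"
    using divide_K[OF one_K v] by (auto intro!: bexI[of _ "1 / v"])
  finally show ?thesis .
qed

definition nbhd :: "'p \<Rightarrow> 'p set \<Rightarrow> 'k set set" where
  "nbhd z V = (if z \<in> V then {pt} else {})"

definition mor :: "('p, 's, 'f) ringed_space \<Rightarrow> 'p \<Rightarrow> ('p set \<Rightarrow> 's \<Rightarrow> 'k)
    \<Rightarrow> ('k set \<Rightarrow> 'p) \<times> ('p set \<Rightarrow> 's \<Rightarrow> 'k set \<Rightarrow> ('k \<times> 'k) set)" where
  "mor Y z \<phi> = (\<lambda>p\<in>{pt}. z,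
     \<lambda>V\<in>{V. openin (underlying Y) V}. \<lambda>s\<in>carrier (sections Y V). sec (nbhd z V) (\<phi> V s))"

text \<open>
  The data of a \<open>K\<close>-valued point: \<open>\<phi> V s\<close> is the value of the section \<open>s\<close> at \<open>z\<close>. That sections with
  nonzero value are units near \<open>z\<close> is the locality of the morphism.
\<close>

definition evaluation :: "('p, 's, 'f) ringed_space \<Rightarrow> 'p \<Rightarrow> ('p set \<Rightarrow> 's \<Rightarrow> 'k) \<Rightarrow> bool" where
  "evaluation Y z \<phi> \<longleftrightarrow> z \<in> points Y \<and>
     (\<forall>V. openin (underlying Y) V \<longrightarrow> z \<in> V \<longrightarrow>
        (\<forall>s\<in>carrier (sections Y V). \<phi> V s \<in> K \<and> (\<phi> V s \<noteq> 0 \<longrightarrow> germ_unit Y V z s) \<and>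
           (\<forall>t\<in>carrier (sections Y V). \<phi> V (s \<otimes>\<^bsub>sections Y V\<^esub> t) = \<phi> V s * \<phi> V t \<and>
              \<phi> V (s \<oplus>\<^bsub>sections Y V\<^esub> t) = \<phi> V s + \<phi> V t) \<and>
           (\<forall>W. openin (underlying Y) W \<longrightarrow> z \<in> W \<longrightarrow> W \<subseteq> V \<longrightarrow> \<phi> W (restr Y V W s) = \<phi> V s)) \<and>
        \<phi> V \<one>\<^bsub>sections Y V\<^esub> = 1) \<and>
     (\<forall>c. \<phi> (points Y) (scalar Y c) = \<kappa> c)"

lemma evaluation_germ_unit:
  assumes \<phi>: "evaluation Y z \<phi>" and V: "openin (underlying Y) V" "z \<in> V"
    and s: "s \<in> carrier (sections Y V)"
  shows "\<phi> V s \<noteq> 0 \<longleftrightarrow> germ_unit Y V z s"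
proof
  assume "\<phi> V s \<noteq> 0"
  thus "germ_unit Y V z s" using assms by (simp add: evaluation_def)
next
  assume "germ_unit Y V z s"
  then obtain W where W: "openin (underlying Y) W" "z \<in> W" "W \<subseteq> V" "restr Y V W s \<in> Units (sections Y W)"
    by (auto simp: germ_unit_def)
  have "restr Y V W s \<in> carrier (sections Y W) \<and> (\<exists>t\<in>carrier (sections Y W).
      t \<otimes>\<^bsub>sections Y W\<^esub> restr Y V W s = \<one>\<^bsub>sections Y W\<^esub> \<and>
      restr Y V W s \<otimes>\<^bsub>sections Y W\<^esub> t = \<one>\<^bsub>sections Y W\<^esub>)"
    using W(4) unfolding Units_def by (rule CollectD)
  then obtain t where t: "restr Y V W s \<in> carrier (sections Y W)" "t \<in> carrier (sections Y W)"
    "restr Y V W s \<otimes>\<^bsub>sections Y W\<^esub> t = \<one>\<^bsub>sections Y W\<^esub>"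
    by (elim conjE bexE)
  have "\<phi> W (restr Y V W s \<otimes>\<^bsub>sections Y W\<^esub> t) = \<phi> W (restr Y V W s) * \<phi> W t"
    using \<phi> W(1,2) t(1,2) by (simp add: evaluation_def)
  moreover have "\<phi> W \<one>\<^bsub>sections Y W\<^esub> = 1" using \<phi> W(1,2) by (simp add: evaluation_def)
  moreover have "\<phi> W (restr Y V W s) = \<phi> V s" using \<phi> W(1-3) V s by (simp add: evaluation_def)
  ultimately have "\<phi> V s * \<phi> W t = 1" unfolding t(3) by simp
  thus "\<phi> V s \<noteq> 0" by auto
qed

lemma preimage_mor: "preimage SK (\<lambda>p\<in>{pt}. z) V = nbhd z V"
  by (auto simp: preimage_def points_SK nbhd_def)

lemma openin_nbhd: "openin (underlying SK) (nbhd z V)"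
  by (simp add: openin_SK nbhd_def)

text \<open>
  Over an open set without \<open>z\<close> the morphism takes values in the zero ring, where all equations hold.
\<close>

lemma mor_in_Mor:
  assumes Y: "sections_closed Y" and \<phi>: "evaluation Y z \<phi>"
  shows "mor Y z \<phi> \<in> Mor SK Y"
proof -
  define f where "f = (\<lambda>p\<in>{pt}. z)"
  define h where "h = (\<lambda>V\<in>{V. openin (underlying Y) V}. \<lambda>s\<in>carrier (sections Y V). sec (nbhd z V) (\<phi> V s))"
  have z: "z \<in> points Y" using \<phi> by (simp add: evaluation_def)
  have pre: "preimage SK f V = nbhd z V" for V unfolding f_def by (rule preimage_mor)
  have h: "h V s = sec (nbhd z V) (\<phi> V s)" if "openin (underlying Y) V" "s \<in> carrier (sections Y V)" for V s
    using that by (simp add: h_def)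
  have empty: "sec {} v = sec {} w" for v w by (simp add: sec_def fun_eq_iff)
  have ring_hom: "h V \<in> ring_hom (sections Y V) (sections SK (nbhd z V))" if V: "openin (underlying Y) V" for V
  proof (cases "z \<in> V")
    case True
    show ?thesis
    proof (rule ring_hom_memI)
      show "h V s \<in> carrier (sections SK (nbhd z V))" if "s \<in> carrier (sections Y V)" for s
        using \<phi> V True that by (auto simp: h sections_SK[OF openin_nbhd] evaluation_def)
    next
      fix s t assume st: "s \<in> carrier (sections Y V)" "t \<in> carrier (sections Y V)"
      hence cl: "s \<otimes>\<^bsub>sections Y V\<^esub> t \<in> carrier (sections Y V)" "s \<oplus>\<^bsub>sections Y V\<^esub> t \<in> carrier (sections Y V)"
        using Y V by (auto simp: sections_closed_def)
      have v: "\<phi> V s \<in> K" "\<phi> V t \<in> K" "\<phi> V (s \<otimes>\<^bsub>sections Y V\<^esub> t) = \<phi> V s * \<phi> V t"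
        "\<phi> V (s \<oplus>\<^bsub>sections Y V\<^esub> t) = \<phi> V s + \<phi> V t"
        using \<phi> V True st by (auto simp: evaluation_def)
      show "h V (s \<otimes>\<^bsub>sections Y V\<^esub> t) = h V s \<otimes>\<^bsub>sections SK (nbhd z V)\<^esub> h V t"
        and "h V (s \<oplus>\<^bsub>sections Y V\<^esub> t) = h V s \<oplus>\<^bsub>sections SK (nbhd z V)\<^esub> h V t"
        using st cl v V by (simp_all add: h sections_SK[OF openin_nbhd])
    next
      have "\<one>\<^bsub>sections Y V\<^esub> \<in> carrier (sections Y V)" using Y V by (auto simp: sections_closed_def)
      thus "h V \<one>\<^bsub>sections Y V\<^esub> = \<one>\<^bsub>sections SK (nbhd z V)\<^esub>"
        using \<phi> V True by (simp add: h sections_SK[OF openin_nbhd] evaluation_def)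
    qed
  next
    case False
    hence [simp]: "nbhd z V = {}" by (simp add: nbhd_def)
    have all: "h V s = sec {} 1" if "s \<in> carrier (sections Y V)" for s using h[OF V that] empty by simp
    have op: "openin (underlying SK) {}" by simp
    have *: "sec {} 1 = sec {} 1 \<otimes>\<^bsub>sections SK {}\<^esub> sec {} 1" "sec {} 1 = sec {} 1 \<oplus>\<^bsub>sections SK {}\<^esub> sec {} 1"
      unfolding sections_SK(2,3)[OF op one_K one_K] by (rule empty)+
    show ?thesis
      unfolding \<open>nbhd z V = {}\<close>
    proof (rule ring_hom_memI)
      fix s t assume st: "s \<in> carrier (sections Y V)" "t \<in> carrier (sections Y V)"
      hence cl: "s \<otimes>\<^bsub>sections Y V\<^esub> t \<in> carrier (sections Y V)" "s \<oplus>\<^bsub>sections Y V\<^esub> t \<in> carrier (sections Y V)"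
        using Y V by (auto simp: sections_closed_def)
      show "h V (s \<otimes>\<^bsub>sections Y V\<^esub> t) = h V s \<otimes>\<^bsub>sections SK {}\<^esub> h V t"
        and "h V (s \<oplus>\<^bsub>sections Y V\<^esub> t) = h V s \<oplus>\<^bsub>sections SK {}\<^esub> h V t"
        unfolding all[OF st(1)] all[OF st(2)] all[OF cl(1)] all[OF cl(2)] by (rule *)+
    next
      show "h V s \<in> carrier (sections SK {})" if "s \<in> carrier (sections Y V)" for s
        using all[OF that] sections_SK(1)[OF op] one_K by auto
      have "\<one>\<^bsub>sections Y V\<^esub> \<in> carrier (sections Y V)" using Y V by (auto simp: sections_closed_def)
      thus "h V \<one>\<^bsub>sections Y V\<^esub> = \<one>\<^bsub>sections SK {}\<^esub>"
        using all sections_SK(4)[OF op] by simp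
    qed
  qed
  have "(f, h) \<in> Mor SK Y"
    unfolding Mor_def mem_Collect_eq prod.case pre
  proof (intro conjI allI impI ballI)
    show "f \<in> extensional (points SK)" by (simp add: f_def points_SK)
    show "continuous_map (underlying SK) (underlying Y) f"
      unfolding continuous_map_def using z by (auto simp: points_SK f_def openin_SK)
    show "h \<in> extensional {V. openin (underlying Y) V}" by (simp add: h_def)
  next
    fix V assume V: "openin (underlying Y) V"
    show "h V \<in> extensional (carrier (sections Y V))" using V by (simp add: h_def)
    show "h V \<in> ring_hom (sections Y V) (sections SK (nbhd z V))" by (rule ring_hom[OF V])
  next
    fix V W s assume *: "openin (underlying Y) V" "openin (underlying Y) W" "W \<subseteq> V" "s \<in> carrier (sections Y V)"
    hence "restr Y V W s \<in> carrier (sections Y W)" using Y by (auto simp: sections_closed_def)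
    hence "h W (restr Y V W s) = sec (nbhd z W) (\<phi> W (restr Y V W s))" using * by (simp add: h)
    also have "\<dots> = sec (nbhd z W) (\<phi> V s)"
      using \<phi> * empty by (cases "z \<in> W") (auto simp: evaluation_def nbhd_def)
    also have "\<dots> = restr SK (nbhd z V) (nbhd z W) (sec (nbhd z V) (\<phi> V s))"
      using * by (intro restr_SK[symmetric]) (auto simp: nbhd_def)
    finally show "h W (restr Y V W s) = restr SK (nbhd z V) (nbhd z W) (h V s)" using * by (simp add: h)
  next
    fix c
    have "scalar Y c \<in> carrier (sections Y (points Y))" using Y by (simp add: sections_closed_def)
    thus "h (points Y) (scalar Y c) = scalar SK c"
      using \<phi> z by (simp add: h nbhd_def scalar_SK evaluation_def)
  next
    fix V s x assume *: "openin (underlying Y) V" "s \<in> carrier (sections Y V)" "x \<in> nbhd z V"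
      and u: "germ_unit SK (nbhd z V) x (h V s)"
    have zV: "z \<in> V" and x: "x = pt" using *(3) by (auto simp: nbhd_def split: if_splits)
    have "\<phi> V s \<in> K" using \<phi> * zV by (auto simp: evaluation_def)
    hence "\<phi> V s \<noteq> 0" using u germ_unit_SK zV x * by (simp add: h nbhd_def)
    thus "germ_unit Y V (f x) s" using \<phi> * zV x by (auto simp: evaluation_def f_def)
  qed
  thus ?thesis unfolding mor_def f_def h_def .
qed

text \<open>
  The value of a section is read off from its image in the ring of sections over the single point.
\<close>

lemma Mor_cases:
  assumes "g \<in> Mor SK Y"
  obtains z \<phi> where "evaluation Y z \<phi>" "g = mor Y z \<phi>"
proof -
  obtain f h where g: "g = (f, h)" by force
  note fh = assms[unfolded g Mor_def mem_Collect_eq prod.case]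
  define z where "z = f pt"
  have f: "f = (\<lambda>p\<in>{pt}. z)" using fh by (auto simp: points_SK z_def extensional_def fun_eq_iff)
  have pre: "preimage SK f V = nbhd z V" for V unfolding f by (rule preimage_mor)
  define \<phi> where "\<phi> V s = (SOME v. v \<in> K \<and> h V s = sec (nbhd z V) v)" for V s
  have hom: "h V \<in> ring_hom (sections Y V) (sections SK (nbhd z V))" if "openin (underlying Y) V" for V
    using fh that by (simp add: pre)
  have \<phi>: "\<phi> V s \<in> K \<and> h V s = sec (nbhd z V) (\<phi> V s)"
    if "openin (underlying Y) V" "s \<in> carrier (sections Y V)" for V s
  proof -
    have "h V s \<in> carrier (sections SK (nbhd z V))" using ring_hom_closed[OF hom] that by blast
    hence "\<exists>v. v \<in> K \<and> h V s = sec (nbhd z V) v" unfolding sections_SK[OF openin_nbhd] by blast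
    thus ?thesis unfolding \<phi>_def by (rule someI_ex)
  qed
  have \<phi>I: "\<phi> V s = v" if "z \<in> V" "v \<in> K" "h V s = sec (nbhd z V) v" for V s v
  proof -
    have "\<exists>v. v \<in> K \<and> h V s = sec (nbhd z V) v" using that(2,3) by blast
    hence "\<phi> V s \<in> K \<and> h V s = sec (nbhd z V) (\<phi> V s)" unfolding \<phi>_def by (rule someI_ex)
    thus ?thesis using that sec_inj by (auto simp: nbhd_def)
  qed
  have z: "z \<in> points Y"
    using fh unfolding continuous_map_def by (auto simp: points_SK z_def)
  have "evaluation Y z \<phi>"
    unfolding evaluation_def
  proof (intro conjI allI impI ballI z)
    fix V s assume *: "openin (underlying Y) V" "z \<in> V" "s \<in> carrier (sections Y V)"
    note hs = \<phi>[OF *(1,3)]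
    show "\<phi> V s \<in> K" using hs by simp
    show "germ_unit Y V z s" if "\<phi> V s \<noteq> 0"
    proof -
      have "germ_unit SK (nbhd z V) pt (h V s)" using germ_unit_SK hs that * by (simp add: nbhd_def)
      moreover have "pt \<in> nbhd z V" using * by (simp add: nbhd_def)
      ultimately have "germ_unit Y V (f pt) s" using fh * by (simp add: pre)
      thus ?thesis by (simp add: z_def)
    qed
    show "\<phi> W (restr Y V W s) = \<phi> V s" if W: "openin (underlying Y) W" "z \<in> W" "W \<subseteq> V" for W
    proof (rule \<phi>I)
      have "h W (restr Y V W s) = restr SK (nbhd z V) (nbhd z W) (h V s)" using fh * W by (simp add: pre)
      also have "\<dots> = sec (nbhd z W) (\<phi> V s)"
        unfolding hs[THEN conjunct2] using W * by (intro restr_SK) (auto simp: nbhd_def)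
      finally show "h W (restr Y V W s) = sec (nbhd z W) (\<phi> V s)" .
    qed (use hs W in auto)
  next
    fix V s t assume *: "openin (underlying Y) V" "z \<in> V" "s \<in> carrier (sections Y V)" "t \<in> carrier (sections Y V)"
    show "\<phi> V (s \<otimes>\<^bsub>sections Y V\<^esub> t) = \<phi> V s * \<phi> V t"
      using ring_hom_mult[OF hom[OF *(1)] *(3,4)] \<phi>[OF *(1,3)] \<phi>[OF *(1,4)] *
      by (intro \<phi>I) (auto simp: sections_SK[OF openin_nbhd] mult_K)
    show "\<phi> V (s \<oplus>\<^bsub>sections Y V\<^esub> t) = \<phi> V s + \<phi> V t"
      using ring_hom_add[OF hom[OF *(1)] *(3,4)] \<phi>[OF *(1,3)] \<phi>[OF *(1,4)] *
      by (intro \<phi>I) (auto simp: sections_SK[OF openin_nbhd] add_K)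
  next
    fix V assume *: "openin (underlying Y) V" "z \<in> V"
    show "\<phi> V \<one>\<^bsub>sections Y V\<^esub> = 1"
      using ring_hom_one[OF hom[OF *(1)]] * one_K by (intro \<phi>I) (auto simp: sections_SK[OF openin_nbhd])
  next
    fix c show "\<phi> (points Y) (scalar Y c) = \<kappa> c"
    proof (rule \<phi>I[OF z \<kappa>_in])
      have "h (points Y) (scalar Y c) = scalar SK c" using fh by blast
      thus "h (points Y) (scalar Y c) = sec (nbhd z (points Y)) (\<kappa> c)"
        using z by (simp add: scalar_SK nbhd_def)
    qed
  qed
  moreover have "g = mor Y z \<phi>"
  proof -
    have h_eq: "h V s = (\<lambda>V\<in>{V. openin (underlying Y) V}. \<lambda>s\<in>carrier (sections Y V). sec (nbhd z V) (\<phi> V s)) V s" for V s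
    proof (cases "openin (underlying Y) V")
      case True
      have "h V \<in> extensional (carrier (sections Y V))" using fh True by simp
      thus ?thesis using \<phi>[OF True, of s] True extensional_arb[of "h V" "carrier (sections Y V)" s]
        by (cases "s \<in> carrier (sections Y V)") simp_all
    next
      case False
      have "h \<in> extensional {V. openin (underlying Y) V}" using fh by simp
      thus ?thesis using False by (simp add: extensional_def)
    qed
    have "h = (\<lambda>V\<in>{V. openin (underlying Y) V}. \<lambda>s\<in>carrier (sections Y V). sec (nbhd z V) (\<phi> V s))"
      by (rule ext, rule ext) (rule h_eq)
    thus ?thesis unfolding g mor_def f by (rule arg_cong)
  qed
  ultimately show ?thesis using that by blast
qed

lemma mor_eqD:
  assumes eq: "mor Y z \<phi> = mor Y z' \<phi>'" and \<phi>: "evaluation Y z \<phi>" "evaluation Y z' \<phi>'"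
  shows "z = z'"
    and "openin (underlying Y) V \<Longrightarrow> z \<in> V \<Longrightarrow> s \<in> carrier (sections Y V) \<Longrightarrow> \<phi> V s = \<phi>' V s"
proof -
  have "fst (mor Y z \<phi>) pt = fst (mor Y z' \<phi>') pt" using eq by simp
  thus z: "z = z'" by (simp add: mor_def)
  assume *: "openin (underlying Y) V" "z \<in> V" "s \<in> carrier (sections Y V)"
  have "snd (mor Y z \<phi>) V s = snd (mor Y z' \<phi>') V s" using eq by simp
  hence "sec {pt} (\<phi> V s) = sec {pt} (\<phi>' V s)" using * z by (simp add: mor_def nbhd_def)
  moreover have "\<phi> V s \<in> K" "\<phi>' V s \<in> K" using \<phi> * z by (auto simp: evaluation_def)
  ultimately show "\<phi> V s = \<phi>' V s" using sec_inj by blast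
qed

lemma mor_cong:
  assumes "\<And>V s. openin (underlying Y) V \<Longrightarrow> z \<in> V \<Longrightarrow> s \<in> carrier (sections Y V) \<Longrightarrow> \<phi> V s = \<phi>' V s"
  shows "mor Y z \<phi> = mor Y z \<phi>'"
  using assms by (auto simp: mor_def nbhd_def sec_def fun_eq_iff)

end

section \<open>The structure sheaf of a graded ring\<close>

text \<open>
  The set \<open>P\<close> of primes is arbitrary, so that the results apply to the homogeneous primes of a
  projective spectrum.
\<close>

locale graded_primes = cring R for R :: "'a ring" (structure) +
  fixes D :: "nat \<Rightarrow> 'a set" and P :: "'a set set"
  assumes D_carrier: "D i \<subseteq> carrier R"
    and D_add: "a \<in> D i \<Longrightarrow> b \<in> D i \<Longrightarrow> a \<oplus> b \<in> D i"
    and D_mult: "a \<in> D i \<Longrightarrow> b \<in> D j \<Longrightarrow> a \<otimes> b \<in> D (i + j)"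
    and D_one: "\<one> \<in> D 0" and D_zero: "\<zero> \<in> D i"
    and prime: "p \<in> P \<Longrightarrow> primeideal p R"
begin

abbreviation "F p a b \<equiv> fraction R D p a b"
abbreviation "hom_elems \<equiv> homogeneous D"
abbreviation "\<O> U \<equiv> structure_sections R D P U"
abbreviation "op U \<equiv> openin (zariski D P) U"

lemma D_closed: "a \<in> D i \<Longrightarrow> a \<in> carrier R"
  using D_carrier by blast

lemma hom_closed: "a \<in> hom_elems \<Longrightarrow> a \<in> carrier R"
  using D_carrier by (auto simp: homogeneous_def)

lemma D_hom: "a \<in> D i \<Longrightarrow> a \<in> hom_elems"
  by (auto simp: homogeneous_def)

lemma hom_mult: "a \<in> hom_elems \<Longrightarrow> b \<in> hom_elems \<Longrightarrow> a \<otimes> b \<in> hom_elems"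
  using D_mult by (fastforce simp: homogeneous_def)

lemma one_hom: "\<one> \<in> hom_elems"
  using D_one by (rule D_hom)

lemma one_notin: "p \<in> P \<Longrightarrow> \<one> \<notin> p"
  using primeideal.I_notcarr[OF prime] ideal.one_imp_carrier primeideal.axioms(1)[OF prime] by metis

lemma mult_notin:
  assumes "p \<in> P" "a \<in> carrier R" "b \<in> carrier R" "a \<notin> p" "b \<notin> p"
  shows "a \<otimes> b \<notin> p"
  using primeideal.I_prime[OF prime] assms by blast

lemma mult_in_left:
  assumes "p \<in> P" "a \<in> carrier R" "b \<in> p"
  shows "a \<otimes> b \<in> p"
  using ideal.I_l_closed[OF primeideal.axioms(1)[OF prime]] assms by blast

lemma mult_in_right:
  assumes "p \<in> P" "a \<in> p" "b \<in> carrier R"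
  shows "a \<otimes> b \<in> p"
  using ideal.I_r_closed[OF primeideal.axioms(1)[OF prime]] assms by blast

lemma mult_in_iff:
  assumes "p \<in> P" "a \<in> carrier R" "b \<in> carrier R"
  shows "a \<otimes> b \<in> p \<longleftrightarrow> a \<in> p \<or> b \<in> p"
  using mult_notin[OF assms] mult_in_left[OF assms(1,2), of b] mult_in_right[OF assms(1) _ assms(3), of a] by blast

subsection \<open>Fractions\<close>

text \<open>
  Equality of the fractions \<open>a/b\<close> and \<open>a'/b'\<close> in the homogeneous localisation at \<open>p\<close>.
\<close>

definition same :: "'a set \<Rightarrow> 'a \<Rightarrow> 'a \<Rightarrow> 'a \<Rightarrow> 'a \<Rightarrow> bool" where
  "same p a b a' b' \<longleftrightarrow> (\<exists>t\<in>hom_elems - p. t \<otimes> (a \<otimes> b') = t \<otimes> (a' \<otimes> b))"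

lemma same_refl: "p \<in> P \<Longrightarrow> same p a b a b"
  using one_hom one_notin by (auto simp: same_def)

lemma same_sym: "same p a b a' b' \<Longrightarrow> same p a' b' a b"
  unfolding same_def by (elim bexE, rule bexI, rule sym)

lemma same_trans:
  assumes p: "p \<in> P" and c: "a \<in> carrier R" "b \<in> carrier R" "a' \<in> carrier R" "b' \<in> hom_elems" "b' \<notin> p"
    "a'' \<in> carrier R" "b'' \<in> carrier R" and *: "same p a b a' b'" "same p a' b' a'' b''"
  shows "same p a b a'' b''"
proof -
  obtain t u where t: "t \<in> hom_elems" "t \<notin> p" "t \<otimes> (a \<otimes> b') = t \<otimes> (a' \<otimes> b)"
    and u: "u \<in> hom_elems" "u \<notin> p" "u \<otimes> (a' \<otimes> b'') = u \<otimes> (a'' \<otimes> b')"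
    using * by (auto simp: same_def)
  have cl: "t \<in> carrier R" "u \<in> carrier R" "b' \<in> carrier R" using t u c hom_closed by auto
  have "(t \<otimes> u \<otimes> b') \<otimes> (a \<otimes> b'') = (u \<otimes> b'') \<otimes> (t \<otimes> (a \<otimes> b'))"
    using cl c(1-3,6,7) by (simp add: m_ac)
  also have "\<dots> = (t \<otimes> b) \<otimes> (u \<otimes> (a' \<otimes> b''))" unfolding t(3) using cl c(1-3,6,7) by (simp add: m_ac)
  also have "\<dots> = (t \<otimes> u \<otimes> b') \<otimes> (a'' \<otimes> b)" unfolding u(3) using cl c(1-3,6,7) by (simp add: m_ac)
  finally have "(t \<otimes> u \<otimes> b') \<otimes> (a \<otimes> b'') = (t \<otimes> u \<otimes> b') \<otimes> (a'' \<otimes> b)" .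
  moreover have "t \<otimes> u \<otimes> b' \<in> hom_elems" using t u c by (intro hom_mult)
  moreover have "t \<otimes> u \<otimes> b' \<notin> p" using t u c cl p by (simp add: mult_notin)
  ultimately show ?thesis unfolding same_def by blast
qed

lemma frac_mem: "(a', b') \<in> F p a b \<longleftrightarrow> (\<exists>i. a' \<in> D i \<and> b' \<in> D i) \<and> b' \<notin> p \<and> same p a b a' b'"
  by (simp add: fraction_def same_def)

lemma frac_self: "p \<in> P \<Longrightarrow> a \<in> D i \<Longrightarrow> b \<in> D i \<Longrightarrow> b \<notin> p \<Longrightarrow> (a, b) \<in> F p a b"
  by (auto simp: frac_mem same_refl)

lemma frac_eq:
  assumes p: "p \<in> P" and ab: "a \<in> D i" "b \<in> D i" "b \<notin> p" and ab': "a' \<in> D j" "b' \<in> D j" "b' \<notin> p"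
  shows "F p a b = F p a' b' \<longleftrightarrow> same p a b a' b'"
proof
  assume "F p a b = F p a' b'"
  hence "(a', b') \<in> F p a b" using frac_self[OF p ab'] by simp
  thus "same p a b a' b'" by (simp add: frac_mem)
next
  assume s: "same p a b a' b'"
  have "(c, d) \<in> F p a b \<longleftrightarrow> (c, d) \<in> F p a' b'" for c d
  proof (cases "(\<exists>i. c \<in> D i \<and> d \<in> D i) \<and> d \<notin> p")
    case True
    hence cd: "c \<in> carrier R" "d \<in> carrier R" using D_closed by auto
    note ab_cl = ab(1,2)[THEN D_closed] ab'(1,2)[THEN D_closed]
    have "same p a b c d \<longleftrightarrow> same p a' b' c d"
      using same_trans[OF p ab_cl(3,4,1) D_hom[OF ab(2)] ab(3) cd same_sym[OF s]]
        same_trans[OF p ab_cl(1,2,3) D_hom[OF ab'(2)] ab'(3) cd s] by blast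
    thus ?thesis using True by (simp add: frac_mem)
  qed (auto simp: frac_mem)
  thus "F p a b = F p a' b'" by auto
qed

lemma same_mult:
  assumes p: "p \<in> P" and cl: "a \<in> carrier R" "b \<in> carrier R" "a' \<in> carrier R" "b' \<in> carrier R"
    "c \<in> carrier R" "d \<in> carrier R" "c' \<in> carrier R" "d' \<in> carrier R"
    and s: "same p a b a' b'" "same p c d c' d'"
  shows "same p (a \<otimes> c) (b \<otimes> d) (a' \<otimes> c') (b' \<otimes> d')"
proof -
  obtain t u where t: "t \<in> hom_elems" "t \<notin> p" "t \<otimes> (a \<otimes> b') = t \<otimes> (a' \<otimes> b)"
    and u: "u \<in> hom_elems" "u \<notin> p" "u \<otimes> (c \<otimes> d') = u \<otimes> (c' \<otimes> d)"
    using s by (auto simp: same_def)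
  have tu: "t \<in> carrier R" "u \<in> carrier R" using t u hom_closed by auto
  have "(t \<otimes> u) \<otimes> (a \<otimes> c \<otimes> (b' \<otimes> d')) = (t \<otimes> (a \<otimes> b')) \<otimes> (u \<otimes> (c \<otimes> d'))"
    using cl tu by (simp add: m_ac)
  also have "\<dots> = (t \<otimes> u) \<otimes> (a' \<otimes> c' \<otimes> (b \<otimes> d))" unfolding t(3) u(3) using cl tu by (simp add: m_ac)
  finally have "(t \<otimes> u) \<otimes> (a \<otimes> c \<otimes> (b' \<otimes> d')) = (t \<otimes> u) \<otimes> (a' \<otimes> c' \<otimes> (b \<otimes> d))" .
  moreover have "t \<otimes> u \<in> hom_elems - p" using hom_mult t u tu p mult_notin by simp
  ultimately show ?thesis unfolding same_def by (intro bexI[of _ "t \<otimes> u"])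
qed

lemma same_add:
  assumes p: "p \<in> P" and cl: "a \<in> carrier R" "b \<in> carrier R" "a' \<in> carrier R" "b' \<in> carrier R"
    "c \<in> carrier R" "d \<in> carrier R" "c' \<in> carrier R" "d' \<in> carrier R"
    and s: "same p a b a' b'" "same p c d c' d'"
  shows "same p (a \<otimes> d \<oplus> c \<otimes> b) (b \<otimes> d) (a' \<otimes> d' \<oplus> c' \<otimes> b') (b' \<otimes> d')"
proof -
  obtain t u where t: "t \<in> hom_elems" "t \<notin> p" "t \<otimes> (a \<otimes> b') = t \<otimes> (a' \<otimes> b)"
    and u: "u \<in> hom_elems" "u \<notin> p" "u \<otimes> (c \<otimes> d') = u \<otimes> (c' \<otimes> d)"
    using s by (auto simp: same_def)
  have tu: "t \<in> carrier R" "u \<in> carrier R" using t u hom_closed by auto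
  have "(t \<otimes> u) \<otimes> ((a \<otimes> d \<oplus> c \<otimes> b) \<otimes> (b' \<otimes> d'))
      = (u \<otimes> (d \<otimes> d')) \<otimes> (t \<otimes> (a \<otimes> b')) \<oplus> (t \<otimes> (b \<otimes> b')) \<otimes> (u \<otimes> (c \<otimes> d'))"
    using cl tu by (simp add: l_distr r_distr m_ac)
  also have "\<dots> = (t \<otimes> u) \<otimes> ((a' \<otimes> d' \<oplus> c' \<otimes> b') \<otimes> (b \<otimes> d))"
    unfolding t(3) u(3) using cl tu by (simp add: l_distr r_distr m_ac)
  finally have "(t \<otimes> u) \<otimes> ((a \<otimes> d \<oplus> c \<otimes> b) \<otimes> (b' \<otimes> d')) = (t \<otimes> u) \<otimes> ((a' \<otimes> d' \<oplus> c' \<otimes> b') \<otimes> (b \<otimes> d))" .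
  moreover have "t \<otimes> u \<in> hom_elems - p" using hom_mult t u tu p mult_notin by simp
  ultimately show ?thesis unfolding same_def by (intro bexI[of _ "t \<otimes> u"])
qed

lemma D_mult_add: "a \<in> D i \<Longrightarrow> b \<in> D i \<Longrightarrow> c \<in> D j \<Longrightarrow> d \<in> D j \<Longrightarrow> a \<otimes> d \<oplus> c \<otimes> b \<in> D (i + j)"
  using D_mult[of a i d j] D_mult[of c j b i] by (intro D_add) (auto simp: add.commute)

lemma frac_mult:
  assumes p: "p \<in> P" and ab: "a \<in> D i" "b \<in> D i" "b \<notin> p" and cd: "c \<in> D j" "d \<in> D j" "d \<notin> p"
  shows "fraction_mult R D p (F p a b) (F p c d) = F p (a \<otimes> c) (b \<otimes> d)"
  unfolding fraction_mult_def
proof (rule UN_pairs_constant)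
  show "(a, b) \<in> F p a b" "(c, d) \<in> F p c d" using frac_self p ab cd by auto
  fix a' b' c' d' assume *: "(a', b') \<in> F p a b" "(c', d') \<in> F p c d"
  then obtain k l where kl: "a' \<in> D k" "b' \<in> D k" "c' \<in> D l" "d' \<in> D l" "b' \<notin> p" "d' \<notin> p"
    and s: "same p a b a' b'" "same p c d c' d'" by (auto simp: frac_mem)
  note cl = ab(1,2)[THEN D_closed] cd(1,2)[THEN D_closed] kl(1-4)[THEN D_closed]
  have "same p (a \<otimes> c) (b \<otimes> d) (a' \<otimes> c') (b' \<otimes> d')" by (rule same_mult) (use cl p s in auto)
  moreover have "b \<otimes> d \<notin> p" "b' \<otimes> d' \<notin> p" using mult_notin p ab cd kl cl by auto
  ultimately have "F p (a \<otimes> c) (b \<otimes> d) = F p (a' \<otimes> c') (b' \<otimes> d')"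
    using frac_eq[OF p D_mult[OF ab(1) cd(1)] D_mult[OF ab(2) cd(2)] _ D_mult[OF kl(1,3)] D_mult[OF kl(2,4)]] by blast
  thus "F p (a' \<otimes> c') (b' \<otimes> d') = F p (a \<otimes> c) (b \<otimes> d)" by simp
qed

lemma frac_add:
  assumes p: "p \<in> P" and ab: "a \<in> D i" "b \<in> D i" "b \<notin> p" and cd: "c \<in> D j" "d \<in> D j" "d \<notin> p"
  shows "fraction_add R D p (F p a b) (F p c d) = F p (a \<otimes> d \<oplus> c \<otimes> b) (b \<otimes> d)"
  unfolding fraction_add_def
proof (rule UN_pairs_constant)
  show "(a, b) \<in> F p a b" "(c, d) \<in> F p c d" using frac_self p ab cd by auto
  fix a' b' c' d' assume *: "(a', b') \<in> F p a b" "(c', d') \<in> F p c d"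
  then obtain k l where kl: "a' \<in> D k" "b' \<in> D k" "c' \<in> D l" "d' \<in> D l" "b' \<notin> p" "d' \<notin> p"
    and s: "same p a b a' b'" "same p c d c' d'" by (auto simp: frac_mem)
  note cl = ab(1,2)[THEN D_closed] cd(1,2)[THEN D_closed] kl(1-4)[THEN D_closed]
  have "same p (a \<otimes> d \<oplus> c \<otimes> b) (b \<otimes> d) (a' \<otimes> d' \<oplus> c' \<otimes> b') (b' \<otimes> d')"
    by (rule same_add) (use cl p s in auto)
  moreover have "b \<otimes> d \<notin> p" "b' \<otimes> d' \<notin> p" using mult_notin p ab cd kl cl by auto
  ultimately have "F p (a \<otimes> d \<oplus> c \<otimes> b) (b \<otimes> d) = F p (a' \<otimes> d' \<oplus> c' \<otimes> b') (b' \<otimes> d')"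
    using frac_eq[OF p D_mult_add[OF ab(1,2) cd(1,2)] D_mult[OF ab(2) cd(2)] _
        D_mult_add[OF kl(1-4)] D_mult[OF kl(2,4)]] by blast
  thus "F p (a' \<otimes> d' \<oplus> c' \<otimes> b') (b' \<otimes> d') = F p (a \<otimes> d \<oplus> c \<otimes> b) (b \<otimes> d)" by simp
qed

subsection \<open>Sections\<close>

lemma op_basic: "a \<in> hom_elems \<Longrightarrow> op {p \<in> P. a \<notin> p}"
  unfolding zariski_def by (intro topology_generated_by_Basis) blast

lemma topspace_zariski: "topspace (zariski D P) = P"
  unfolding zariski_def topology_generated_by_topspace using one_hom one_notin by blast

lemma op_subset: "op U \<Longrightarrow> U \<subseteq> P"
  using openin_subset topspace_zariski by metis

definition local_frac :: "'a set set \<Rightarrow> ('a set \<Rightarrow> ('a \<times> 'a) set) \<Rightarrow> 'a set \<Rightarrow> bool" where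
  "local_frac U s p \<longleftrightarrow> (\<exists>V i a b. op V \<and> p \<in> V \<and> V \<subseteq> U \<and> a \<in> D i \<and> b \<in> D i \<and> (\<forall>r\<in>V. b \<notin> r \<and> s r = F r a b))"

lemma local_fracI:
  assumes "op V" "p \<in> V" "V \<subseteq> U" "a \<in> D i" "b \<in> D i"
    and "\<And>r. r \<in> V \<Longrightarrow> b \<notin> r \<and> s r = F r a b"
  shows "local_frac U s p"
  unfolding local_frac_def
  by (rule exI[of _ V], rule exI[of _ i], rule exI[of _ a], rule exI[of _ b]) (simp add: assms)

lemma carrier_O: "s \<in> carrier (\<O> U) \<longleftrightarrow> s \<in> extensional U \<and> (\<forall>p\<in>U. local_frac U s p)"
  unfolding structure_sections_def local_frac_def by (simp add: Bex_def)

lemma O_simps: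
  "s \<otimes>\<^bsub>\<O> U\<^esub> t = (\<lambda>p\<in>U. fraction_mult R D p (s p) (t p))"
  "s \<oplus>\<^bsub>\<O> U\<^esub> t = (\<lambda>p\<in>U. fraction_add R D p (s p) (t p))"
  "\<one>\<^bsub>\<O> U\<^esub> = (\<lambda>p\<in>U. F p \<one> \<one>)"
  by (simp_all add: structure_sections_def)

lemma sec_near:
  assumes "s \<in> carrier (\<O> U)" "p \<in> U"
  obtains V i a b where "op V" "p \<in> V" "V \<subseteq> U" "a \<in> D i" "b \<in> D i" "\<forall>r\<in>V. b \<notin> r \<and> s r = F r a b"
proof -
  have "local_frac U s p" using assms by (simp add: carrier_O)
  thus ?thesis unfolding local_frac_def using that by (elim exE conjE)
qed

lemma sec_at:
  assumes "s \<in> carrier (\<O> U)" "p \<in> U"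
  obtains i a b where "a \<in> D i" "b \<in> D i" "b \<notin> p" "s p = F p a b"
proof -
  obtain V i a b where "p \<in> V" "a \<in> D i" "b \<in> D i" "\<forall>r\<in>V. b \<notin> r \<and> s r = F r a b"
    using assms by (rule sec_near)
  thus ?thesis using that[of a i b] by simp
qed

lemma sec_near2:
  assumes s: "s \<in> carrier (\<O> U)" and t: "t \<in> carrier (\<O> U)" and p: "p \<in> U"
  obtains V i a b j c d where "op V" "p \<in> V" "V \<subseteq> U" "a \<in> D i" "b \<in> D i" "c \<in> D j" "d \<in> D j"
    "\<And>r. r \<in> V \<Longrightarrow> b \<notin> r \<and> d \<notin> r \<and> s r = F r a b \<and> t r = F r c d"
proof -
  obtain V i a b where 1: "op V" "p \<in> V" "V \<subseteq> U" "a \<in> D i" "b \<in> D i" "\<forall>r\<in>V. b \<notin> r \<and> s r = F r a b"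
    using s p by (rule sec_near)
  obtain W j c d where 2: "op W" "p \<in> W" "W \<subseteq> U" "c \<in> D j" "d \<in> D j" "\<forall>r\<in>W. d \<notin> r \<and> t r = F r c d"
    using t p by (rule sec_near)
  have "op (V \<inter> W)" using 1 2 by (intro openin_Int)
  thus ?thesis using 1 2 by (intro that[of "V \<inter> W" a i b c j d]) auto
qed

lemma O_mult_closed:
  assumes s: "s \<in> carrier (\<O> U)" and t: "t \<in> carrier (\<O> U)"
  shows "s \<otimes>\<^bsub>\<O> U\<^esub> t \<in> carrier (\<O> U)"
  unfolding carrier_O
proof (intro conjI ballI)
  fix p assume "p \<in> U"
  with s t obtain V i a b j c d where *: "op V" "p \<in> V" "V \<subseteq> U" "a \<in> D i" "b \<in> D i" "c \<in> D j" "d \<in> D j"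
    "\<And>r. r \<in> V \<Longrightarrow> b \<notin> r \<and> d \<notin> r \<and> s r = F r a b \<and> t r = F r c d"
    by (rule sec_near2) blast
  have "b \<otimes> d \<notin> r \<and> (s \<otimes>\<^bsub>\<O> U\<^esub> t) r = F r (a \<otimes> c) (b \<otimes> d)" if r: "r \<in> V" for r
  proof -
    have "r \<in> P" "r \<in> U" using op_subset[OF *(1)] r * by auto
    thus ?thesis using * r frac_mult[of r a i b c j d] mult_notin D_closed by (auto simp: O_simps)
  qed
  thus "local_frac U (s \<otimes>\<^bsub>\<O> U\<^esub> t) p"
    by (rule local_fracI[OF *(1-3) D_mult[OF *(4,6)] D_mult[OF *(5,7)]])
qed (simp add: O_simps)

lemma O_add_closed:
  assumes s: "s \<in> carrier (\<O> U)" and t: "t \<in> carrier (\<O> U)"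
  shows "s \<oplus>\<^bsub>\<O> U\<^esub> t \<in> carrier (\<O> U)"
  unfolding carrier_O
proof (intro conjI ballI)
  fix p assume "p \<in> U"
  with s t obtain V i a b j c d where *: "op V" "p \<in> V" "V \<subseteq> U" "a \<in> D i" "b \<in> D i" "c \<in> D j" "d \<in> D j"
    "\<And>r. r \<in> V \<Longrightarrow> b \<notin> r \<and> d \<notin> r \<and> s r = F r a b \<and> t r = F r c d"
    by (rule sec_near2) blast
  have "b \<otimes> d \<notin> r \<and> (s \<oplus>\<^bsub>\<O> U\<^esub> t) r = F r (a \<otimes> d \<oplus> c \<otimes> b) (b \<otimes> d)" if r: "r \<in> V" for r
  proof -
    have "r \<in> P" "r \<in> U" using op_subset[OF *(1)] r * by auto
    thus ?thesis using * r frac_add[of r a i b c j d] mult_notin D_closed by (auto simp: O_simps)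
  qed
  thus "local_frac U (s \<oplus>\<^bsub>\<O> U\<^esub> t) p"
    by (rule local_fracI[OF *(1-3) D_mult_add[OF *(4-7)] D_mult[OF *(5,7)]])
qed (simp add: O_simps)

lemma fraction_section:
  assumes U: "op U" and ab: "a \<in> D i" "b \<in> D i" and b: "\<And>p. p \<in> U \<Longrightarrow> b \<notin> p"
  shows "(\<lambda>p\<in>U. F p a b) \<in> carrier (\<O> U)"
  unfolding carrier_O
proof (intro conjI ballI)
  fix p assume "p \<in> U"
  thus "local_frac U (\<lambda>p\<in>U. F p a b) p"
    using assms by (intro local_fracI[OF U _ _ ab]) auto
qed simp

lemma O_restrict_closed:
  assumes s: "s \<in> carrier (\<O> U)" and V: "op V" "V \<subseteq> U"
  shows "restrict s V \<in> carrier (\<O> V)"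
  unfolding carrier_O
proof (intro conjI ballI)
  fix p assume p: "p \<in> V"
  have "p \<in> U" using p V by blast
  with s obtain W i a b where *: "op W" "p \<in> W" "W \<subseteq> U" "a \<in> D i" "b \<in> D i" "\<forall>r\<in>W. b \<notin> r \<and> s r = F r a b"
    by (rule sec_near)
  have "op (W \<inter> V)" using * V by (intro openin_Int)
  thus "local_frac V (restrict s V) p"
    using * p by (intro local_fracI[OF _ _ _ *(4,5), of "W \<inter> V"]) auto
qed simp

definition nonvanishing :: "('a set \<Rightarrow> ('a \<times> 'a) set) \<Rightarrow> 'a set \<Rightarrow> bool" where
  "nonvanishing s p \<longleftrightarrow> (\<exists>(a, b)\<in>s p. a \<notin> p)"

lemma nonvanishing_frac:
  assumes p: "p \<in> P" and ab: "a \<in> D i" "b \<in> D i" "b \<notin> p" and s: "s p = F p a b"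
  shows "nonvanishing s p \<longleftrightarrow> a \<notin> p"
proof
  assume "a \<notin> p"
  thus "nonvanishing s p" using frac_self[OF p ab] s by (auto simp: nonvanishing_def)
next
  assume "nonvanishing s p"
  then obtain a' b' where *: "(a', b') \<in> F p a b" "a' \<notin> p" unfolding nonvanishing_def s by blast
  then obtain t k where t: "t \<in> hom_elems" "t \<notin> p" "t \<otimes> (a \<otimes> b') = t \<otimes> (a' \<otimes> b)" "a' \<in> D k" "b' \<in> D k"
    by (auto simp: frac_mem same_def)
  note cl = hom_closed[OF t(1)] t(4,5)[THEN D_closed] ab(1,2)[THEN D_closed]
  show "a \<notin> p"
  proof
    assume "a \<in> p"
    hence "t \<otimes> (a \<otimes> b') \<in> p" using cl p by (simp add: mult_in_iff)
    hence "t \<otimes> (a' \<otimes> b) \<in> p" unfolding t(3) .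
    thus False using cl p t * ab by (simp add: mult_in_iff)
  qed
qed

lemma unit_nonvanishing:
  assumes u: "s \<in> Units (\<O> U)" and U: "op U" and p: "p \<in> U"
  shows "nonvanishing s p"
proof -
  have "s \<in> carrier (\<O> U) \<and> (\<exists>t\<in>carrier (\<O> U). t \<otimes>\<^bsub>\<O> U\<^esub> s = \<one>\<^bsub>\<O> U\<^esub> \<and> s \<otimes>\<^bsub>\<O> U\<^esub> t = \<one>\<^bsub>\<O> U\<^esub>)"
    using u unfolding Units_def by (rule CollectD)
  then obtain t where st: "s \<in> carrier (\<O> U)" "t \<in> carrier (\<O> U)" "s \<otimes>\<^bsub>\<O> U\<^esub> t = \<one>\<^bsub>\<O> U\<^esub>"
    by (elim conjE bexE)
  obtain i a b where ab: "a \<in> D i" "b \<in> D i" "b \<notin> p" "s p = F p a b" by (rule sec_at[OF st(1) p])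
  obtain j c d where cd: "c \<in> D j" "d \<in> D j" "d \<notin> p" "t p = F p c d" by (rule sec_at[OF st(2) p])
  have pP: "p \<in> P" using op_subset[OF U] p by blast
  note cl = ab(1,2)[THEN D_closed] cd(1,2)[THEN D_closed]
  have "(s \<otimes>\<^bsub>\<O> U\<^esub> t) p = F p (a \<otimes> c) (b \<otimes> d)"
    using frac_mult[OF pP ab(1-3) cd(1-3)] ab cd p by (simp add: O_simps)
  moreover have "(s \<otimes>\<^bsub>\<O> U\<^esub> t) p = F p \<one> \<one>" unfolding st(3) using p by (simp add: O_simps)
  ultimately have "F p (a \<otimes> c) (b \<otimes> d) = F p \<one> \<one>" by simp
  moreover have "b \<otimes> d \<notin> p" using mult_notin pP ab cd cl by blast
  ultimately have "same p (a \<otimes> c) (b \<otimes> d) \<one> \<one>"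
    using frac_eq[OF pP D_mult[OF ab(1) cd(1)] D_mult[OF ab(2) cd(2)] _ D_one D_one] one_notin[OF pP] by blast
  then obtain t where t: "t \<in> hom_elems" "t \<notin> p" "t \<otimes> (a \<otimes> c \<otimes> \<one>) = t \<otimes> (\<one> \<otimes> (b \<otimes> d))"
    by (auto simp: same_def)
  note tc = hom_closed[OF t(1)]
  have "a \<notin> p"
  proof
    assume "a \<in> p"
    hence "t \<otimes> (a \<otimes> c \<otimes> \<one>) \<in> p" using cl tc pP by (simp add: mult_in_iff)
    hence "t \<otimes> (\<one> \<otimes> (b \<otimes> d)) \<in> p" unfolding t(3) .
    thus False using cl tc pP t ab cd by (simp add: mult_in_iff)
  qed
  thus ?thesis using nonvanishing_frac[OF pP ab(1-3), of s] ab by simp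
qed

text \<open>
  The inverse of a nowhere vanishing section, obtained by swapping numerators and denominators in each
  class; the pairs whose numerator lies in \<open>p\<close> have to be dropped.
\<close>

definition inverse_section :: "'a set set \<Rightarrow> ('a set \<Rightarrow> ('a \<times> 'a) set) \<Rightarrow> ('a set \<Rightarrow> ('a \<times> 'a) set)" where
  "inverse_section U s = (\<lambda>p\<in>U. prod.swap ` {(a, b) \<in> s p. a \<notin> p})"

lemma swap_frac:
  assumes p: "p \<in> P" and ab: "a \<in> D i" "b \<in> D i" "a \<notin> p" "b \<notin> p"
  shows "prod.swap ` {(a', b') \<in> F p a b. a' \<notin> p} = F p b a"
proof -
  have "(b', a') \<in> prod.swap ` {(a', b') \<in> F p a b. a' \<notin> p} \<longleftrightarrow> (b', a') \<in> F p b a" for a' b'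
  proof -
    have m: "(b', a') \<in> prod.swap ` {(a', b') \<in> F p a b. a' \<notin> p} \<longleftrightarrow> (a', b') \<in> F p a b \<and> a' \<notin> p"
      by force
    have "b' \<notin> p" if same: "same p b a b' a'" and a': "a' \<notin> p" "a' \<in> D k" "b' \<in> D k" for k
    proof
      assume b': "b' \<in> p"
      obtain t where t: "t \<in> hom_elems" "t \<notin> p" "t \<otimes> (b \<otimes> a') = t \<otimes> (b' \<otimes> a)" using same unfolding same_def by blast
      note cl = hom_closed[OF t(1)] a'(2,3)[THEN D_closed] ab(1,2)[THEN D_closed]
      have "t \<otimes> (b' \<otimes> a) \<in> p" using cl b' p by (simp add: mult_in_iff)
      hence "t \<otimes> (b \<otimes> a') \<in> p" unfolding t(3) .
      thus False using cl p t(1,2) ab a' by (simp add: mult_in_iff)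
    qed
    moreover have "same p a b a' b' \<longleftrightarrow> same p b a b' a'" if "a' \<in> D k" "b' \<in> D k" for k
    proof -
      note cl = that[THEN D_closed] ab(1,2)[THEN D_closed]
      have "a \<otimes> b' = b' \<otimes> a" "a' \<otimes> b = b \<otimes> a'" using cl by (auto simp: m_comm)
      thus ?thesis unfolding same_def by (simp only: eq_commute[of "_ \<otimes> (b' \<otimes> a)"])
    qed
    ultimately show ?thesis unfolding m using frac_mem[of a' b' p a b] frac_mem[of b' a' p b a] by blast
  qed
  thus ?thesis by (auto simp: set_eq_iff)
qed

lemma inverse_section:
  assumes s: "s \<in> carrier (\<O> U)" and U: "op U" and nv: "\<And>p. p \<in> U \<Longrightarrow> nonvanishing s p"
  shows "inverse_section U s \<in> carrier (\<O> U)" "s \<otimes>\<^bsub>\<O> U\<^esub> inverse_section U s = \<one>\<^bsub>\<O> U\<^esub>"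
    "inverse_section U s \<otimes>\<^bsub>\<O> U\<^esub> s = \<one>\<^bsub>\<O> U\<^esub>"
proof -
  have at: "inverse_section U s p = F p b a" "a \<notin> p" if "p \<in> U" "a \<in> D i" "b \<in> D i" "b \<notin> p" "s p = F p a b" for p i a b
  proof -
    have p: "p \<in> P" using op_subset[OF U] that by blast
    show a: "a \<notin> p" using nv[OF that(1)] nonvanishing_frac[OF p that(2-4), of s] that(5) by simp
    show "inverse_section U s p = F p b a"
      using swap_frac[OF p that(2,3) a that(4)] that by (simp add: inverse_section_def)
  qed
  show "inverse_section U s \<in> carrier (\<O> U)"
    unfolding carrier_O
  proof (intro conjI ballI)
    fix p assume "p \<in> U"
    with s obtain V i a b where *: "op V" "p \<in> V" "V \<subseteq> U" "a \<in> D i" "b \<in> D i" "\<forall>r\<in>V. b \<notin> r \<and> s r = F r a b"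
      by (rule sec_near)
    have "a \<notin> r \<and> inverse_section U s r = F r b a" if "r \<in> V" for r
      using at[of r a i b] * that by blast
    thus "local_frac U (inverse_section U s) p"
      by (rule local_fracI[OF *(1-3,5,4)])
  qed (simp add: inverse_section_def)
  have one: "F p (a \<otimes> b) (b \<otimes> a) = F p \<one> \<one>" "F p (b \<otimes> a) (a \<otimes> b) = F p \<one> \<one>"
    if "p \<in> P" "a \<in> D i" "b \<in> D i" "a \<notin> p" "b \<notin> p" for p a b i
  proof -
    note cl = that(2,3)[THEN D_closed]
    have n: "a \<otimes> b \<notin> p" "b \<otimes> a \<notin> p" using mult_notin that cl by auto
    have "same p (a \<otimes> b) (b \<otimes> a) \<one> \<one>" "same p (b \<otimes> a) (a \<otimes> b) \<one> \<one>"
      unfolding same_def using cl one_hom one_notin[OF that(1)] by (auto intro!: bexI[of _ \<one>] simp: m_comm)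
    thus "F p (a \<otimes> b) (b \<otimes> a) = F p \<one> \<one>" "F p (b \<otimes> a) (a \<otimes> b) = F p \<one> \<one>"
      using frac_eq[OF that(1) D_mult[OF that(2,3)] D_mult[OF that(3,2)] n(2) D_one D_one]
        frac_eq[OF that(1) D_mult[OF that(3,2)] D_mult[OF that(2,3)] n(1) D_one D_one] one_notin[OF that(1)] by blast+
  qed
  have "fraction_mult R D p (s p) (inverse_section U s p) = F p \<one> \<one> \<and>
        fraction_mult R D p (inverse_section U s p) (s p) = F p \<one> \<one>" if p: "p \<in> U" for p
  proof -
    obtain i a b where ab: "a \<in> D i" "b \<in> D i" "b \<notin> p" "s p = F p a b" by (rule sec_at[OF s p])
    have pP: "p \<in> P" using op_subset[OF U] p by blast
    note a = at[OF p ab]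
    show ?thesis unfolding a(1) ab(4) frac_mult[OF pP ab(1-3) ab(2,1) a(2)] frac_mult[OF pP ab(2,1) a(2) ab(1-3)]
      using one[OF pP ab(1,2) a(2) ab(3)] by simp
  qed
  thus "s \<otimes>\<^bsub>\<O> U\<^esub> inverse_section U s = \<one>\<^bsub>\<O> U\<^esub>" "inverse_section U s \<otimes>\<^bsub>\<O> U\<^esub> s = \<one>\<^bsub>\<O> U\<^esub>"
    by (auto simp: O_simps fun_eq_iff)
qed

lemma op_nonvanishing:
  assumes s: "s \<in> carrier (\<O> U)"
  shows "op {p \<in> U. nonvanishing s p}"
proof (subst openin_subopen, intro ballI)
  fix p assume "p \<in> {p \<in> U. nonvanishing s p}"
  hence p: "p \<in> U" "nonvanishing s p" by auto
  obtain V i a b where *: "op V" "p \<in> V" "V \<subseteq> U" "a \<in> D i" "b \<in> D i" "\<forall>r\<in>V. b \<notin> r \<and> s r = F r a b"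
    using s p(1) by (rule sec_near)
  have VP: "V \<subseteq> P" using op_subset[OF *(1)] .
  have nv: "nonvanishing s r \<longleftrightarrow> a \<notin> r" if "r \<in> V" for r
    using nonvanishing_frac[OF subsetD[OF VP that] *(4,5), of s] * that by blast
  have "op (V \<inter> {r \<in> P. a \<notin> r})" using * D_hom by (intro openin_Int op_basic) auto
  moreover have "p \<in> V \<inter> {r \<in> P. a \<notin> r}" using p * nv VP by auto
  moreover have "V \<inter> {r \<in> P. a \<notin> r} \<subseteq> {p \<in> U. nonvanishing s p}" using nv * by auto
  ultimately show "\<exists>T. op T \<and> p \<in> T \<and> T \<subseteq> {p \<in> U. nonvanishing s p}" by blast
qed

end

section \<open>Quotients by groups of graded automorphisms\<close>

text \<open>
  \<open>Y\<close> is the quotient of the projective spectrum by the group \<open>H\<close>, given by the properties that determine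
  its morphisms: the points are orbits, the topology is the quotient topology, and the sections are the
  \<open>H\<close>-invariant ones. Stating them in this form covers the orbit space and, with \<open>H\<close> trivial and \<open>\<pi>\<close> the
  identity, the spectrum itself.
\<close>

locale graded_quotient = graded_primes R D P
  for R :: "'a ring" (structure) and D :: "nat \<Rightarrow> 'a set" and P :: "'a set set" +
  fixes H :: "'g set" and \<phi> :: "'g \<Rightarrow> 'a \<Rightarrow> 'a" and \<kappa> :: "'f \<Rightarrow> 'a"
    and \<pi> :: "'a set \<Rightarrow> 'r" and Y :: "('r, 'a set \<Rightarrow> ('a \<times> 'a) set, 'f) ringed_space"
  assumes \<phi>_D: "\<zeta> \<in> H \<Longrightarrow> a \<in> D i \<Longrightarrow> \<phi> \<zeta> a \<in> D i"
    and \<phi>_closed: "\<zeta> \<in> H \<Longrightarrow> a \<in> carrier R \<Longrightarrow> \<phi> \<zeta> a \<in> carrier R"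
    and \<phi>_mult: "\<zeta> \<in> H \<Longrightarrow> a \<in> carrier R \<Longrightarrow> b \<in> carrier R \<Longrightarrow> \<phi> \<zeta> (a \<otimes> b) = \<phi> \<zeta> a \<otimes> \<phi> \<zeta> b"
    and \<phi>_add: "\<zeta> \<in> H \<Longrightarrow> a \<in> carrier R \<Longrightarrow> b \<in> carrier R \<Longrightarrow> \<phi> \<zeta> (a \<oplus> b) = \<phi> \<zeta> a \<oplus> \<phi> \<zeta> b"
    and \<phi>_one: "\<zeta> \<in> H \<Longrightarrow> \<phi> \<zeta> \<one> = \<one>"
    and \<phi>_\<kappa>: "\<zeta> \<in> H \<Longrightarrow> \<phi> \<zeta> (\<kappa> c) = \<kappa> c"
    and \<kappa>_D: "\<kappa> c \<in> D 0"
    and act_P: "\<zeta> \<in> H \<Longrightarrow> p \<in> P \<Longrightarrow> {a \<in> carrier R. \<phi> \<zeta> a \<in> p} \<in> P"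
    and \<pi>_eq: "p \<in> P \<Longrightarrow> p' \<in> P \<Longrightarrow> \<pi> p = \<pi> p' \<longleftrightarrow> (\<exists>\<zeta>\<in>H. p' = {a \<in> carrier R. \<phi> \<zeta> a \<in> p})"
    and points_Y: "points Y = \<pi> ` P"
    and openin_Y: "openin (underlying Y) V \<longleftrightarrow>
      V \<subseteq> \<pi> ` P \<and> openin (zariski D P) {p \<in> P. \<pi> p \<in> V}"
    and sections_Y: "openin (underlying Y) V \<Longrightarrow> sections Y V =
      (structure_sections R D P {p \<in> P. \<pi> p \<in> V})
        \<lparr>carrier := {s \<in> carrier (structure_sections R D P {p \<in> P. \<pi> p \<in> V}). \<forall>\<zeta>\<in>H. \<forall>p\<in>P. \<pi> p \<in> V \<longrightarrow>
           s p = (\<Union>(a, b)\<in>s {a \<in> carrier R. \<phi> \<zeta> a \<in> p}. fraction R D p (\<phi> \<zeta> a) (\<phi> \<zeta> b))}\<rparr>"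
    and restr_Y: "openin (underlying Y) V \<Longrightarrow> openin (underlying Y) W \<Longrightarrow> W \<subseteq> V \<Longrightarrow>
      restr Y V W s = restrict s {p \<in> P. \<pi> p \<in> W}"
    and scalar_Y: "scalar Y c = (\<lambda>p\<in>P. fraction R D p (\<kappa> c) \<one>)"
begin

definition act :: "'g \<Rightarrow> 'a set \<Rightarrow> 'a set" where
  "act \<zeta> p = {a \<in> carrier R. \<phi> \<zeta> a \<in> p}"

definition pre :: "'r set \<Rightarrow> 'a set set" where
  "pre V = {p \<in> P. \<pi> p \<in> V}"

text \<open>
  Invariance of \<open>s\<close> under the automorphism of the structure sheaf given by \<open>\<zeta>\<close>, at the point \<open>p\<close>.
\<close>

definition inv_at :: "'g \<Rightarrow> ('a set \<Rightarrow> ('a \<times> 'a) set) \<Rightarrow> 'a set \<Rightarrow> bool" where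
  "inv_at \<zeta> s p \<longleftrightarrow> s p = (\<Union>(a, b)\<in>s (act \<zeta> p). F p (\<phi> \<zeta> a) (\<phi> \<zeta> b))"

abbreviation "opY V \<equiv> openin (underlying Y) V"

lemma act_in_P: "\<zeta> \<in> H \<Longrightarrow> p \<in> P \<Longrightarrow> act \<zeta> p \<in> P"
  unfolding act_def by (rule act_P)

lemma \<pi>_act: "\<zeta> \<in> H \<Longrightarrow> p \<in> P \<Longrightarrow> \<pi> (act \<zeta> p) = \<pi> p"
  using \<pi>_eq[of p "act \<zeta> p"] act_in_P[of \<zeta> p] by (auto simp: act_def)

lemma \<pi>_eqD: "p \<in> P \<Longrightarrow> p' \<in> P \<Longrightarrow> \<pi> p = \<pi> p' \<Longrightarrow> \<exists>\<zeta>\<in>H. p' = act \<zeta> p"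
  using \<pi>_eq[of p p'] by (simp add: act_def)

lemma pre_act: "\<zeta> \<in> H \<Longrightarrow> p \<in> pre V \<Longrightarrow> act \<zeta> p \<in> pre V"
  using act_in_P \<pi>_act by (auto simp: pre_def)

lemma mem_act: "a \<in> carrier R \<Longrightarrow> a \<in> act \<zeta> p \<longleftrightarrow> \<phi> \<zeta> a \<in> p"
  by (simp add: act_def)

lemma op_pre: "opY V \<Longrightarrow> op (pre V)"
  unfolding pre_def by (simp add: openin_Y)

lemma carrier_Y:
  assumes "opY V"
  shows "s \<in> carrier (sections Y V) \<longleftrightarrow> s \<in> carrier (\<O> (pre V)) \<and> (\<forall>\<zeta>\<in>H. \<forall>p\<in>pre V. inv_at \<zeta> s p)"
  unfolding sections_Y[OF assms] by (auto simp: pre_def inv_at_def act_def)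

lemma sections_Y_simps:
  assumes "opY V"
  shows "s \<otimes>\<^bsub>sections Y V\<^esub> t = s \<otimes>\<^bsub>\<O> (pre V)\<^esub> t" "s \<oplus>\<^bsub>sections Y V\<^esub> t = s \<oplus>\<^bsub>\<O> (pre V)\<^esub> t"
    "\<one>\<^bsub>sections Y V\<^esub> = \<one>\<^bsub>\<O> (pre V)\<^esub>"
  unfolding sections_Y[OF assms] by (simp_all add: pre_def)

lemma restr_Y': "opY V \<Longrightarrow> opY W \<Longrightarrow> W \<subseteq> V \<Longrightarrow> restr Y V W s = restrict s (pre W)"
  unfolding pre_def by (rule restr_Y)

lemma same_transport:
  assumes \<zeta>: "\<zeta> \<in> H" and cl: "a \<in> carrier R" "b \<in> carrier R" "a' \<in> carrier R" "b' \<in> carrier R"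
    and s: "same (act \<zeta> p) a b a' b'"
  shows "same p (\<phi> \<zeta> a) (\<phi> \<zeta> b) (\<phi> \<zeta> a') (\<phi> \<zeta> b')"
proof -
  obtain t where t: "t \<in> hom_elems" "t \<notin> act \<zeta> p" "t \<otimes> (a \<otimes> b') = t \<otimes> (a' \<otimes> b)"
    using s unfolding same_def by blast
  note tc = hom_closed[OF t(1)]
  have "\<phi> \<zeta> (t \<otimes> (a \<otimes> b')) = \<phi> \<zeta> (t \<otimes> (a' \<otimes> b))" unfolding t(3) ..
  hence "\<phi> \<zeta> t \<otimes> (\<phi> \<zeta> a \<otimes> \<phi> \<zeta> b') = \<phi> \<zeta> t \<otimes> (\<phi> \<zeta> a' \<otimes> \<phi> \<zeta> b)"
    using \<phi>_mult[OF \<zeta>] tc cl by simp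
  moreover have "\<phi> \<zeta> t \<in> hom_elems" using t(1) \<phi>_D[OF \<zeta>] by (auto simp: homogeneous_def)
  moreover have "\<phi> \<zeta> t \<notin> p" using t(2) mem_act[OF tc] by simp
  ultimately show ?thesis unfolding same_def by blast
qed

lemma transport_frac:
  assumes \<zeta>: "\<zeta> \<in> H" and p: "p \<in> P" and ab: "a \<in> D i" "b \<in> D i" "b \<notin> act \<zeta> p"
  shows "(\<Union>(a', b')\<in>F (act \<zeta> p) a b. F p (\<phi> \<zeta> a') (\<phi> \<zeta> b')) = F p (\<phi> \<zeta> a) (\<phi> \<zeta> b)"
proof (rule UN_constant_nonempty)
  show "(a, b) \<in> F (act \<zeta> p) a b" by (rule frac_self[OF act_in_P[OF \<zeta> p] ab])
  fix u assume u: "u \<in> F (act \<zeta> p) a b"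
  obtain a' b' where ab': "u = (a', b')" by force
  then obtain j where j: "a' \<in> D j" "b' \<in> D j" "b' \<notin> act \<zeta> p" "same (act \<zeta> p) a b a' b'"
    using u by (auto simp: frac_mem)
  have "same p (\<phi> \<zeta> a) (\<phi> \<zeta> b) (\<phi> \<zeta> a') (\<phi> \<zeta> b')"
    by (rule same_transport[OF \<zeta> D_closed[OF ab(1)] D_closed[OF ab(2)] D_closed[OF j(1)] D_closed[OF j(2)] j(4)])
  moreover have "\<phi> \<zeta> b \<notin> p" "\<phi> \<zeta> b' \<notin> p"
    using ab(3) j(3) mem_act D_closed[OF ab(2)] D_closed[OF j(2)] by auto
  ultimately have "F p (\<phi> \<zeta> a) (\<phi> \<zeta> b) = F p (\<phi> \<zeta> a') (\<phi> \<zeta> b')"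
    using frac_eq[OF p \<phi>_D[OF \<zeta> ab(1)] \<phi>_D[OF \<zeta> ab(2)] _ \<phi>_D[OF \<zeta> j(1)] \<phi>_D[OF \<zeta> j(2)]] by simp
  thus "(case u of (a', b') \<Rightarrow> F p (\<phi> \<zeta> a') (\<phi> \<zeta> b')) = F p (\<phi> \<zeta> a) (\<phi> \<zeta> b)"
    by (simp add: ab')
qed

text \<open>
  For a section given near \<open>act \<zeta> p\<close> by \<open>a/b\<close>, invariance says that it is given at \<open>p\<close> by the transported
  fraction.
\<close>

lemma inv_at_iff:
  assumes "\<zeta> \<in> H" "p \<in> P" "a \<in> D i" "b \<in> D i" "b \<notin> act \<zeta> p" "s (act \<zeta> p) = F (act \<zeta> p) a b"
  shows "inv_at \<zeta> s p \<longleftrightarrow> s p = F p (\<phi> \<zeta> a) (\<phi> \<zeta> b)"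
  unfolding inv_at_def assms(6) transport_frac[OF assms(1-5)] ..

lemma \<phi>_notin: "\<zeta> \<in> H \<Longrightarrow> b \<in> D i \<Longrightarrow> b \<notin> act \<zeta> p \<Longrightarrow> \<phi> \<zeta> b \<notin> p"
  using mem_act[OF D_closed] by blast

lemma Y_sec_at:
  assumes V: "opY V" and s: "s \<in> carrier (sections Y V)" and \<zeta>: "\<zeta> \<in> H" and p: "p \<in> pre V"
  obtains i a b where "a \<in> D i" "b \<in> D i" "b \<notin> act \<zeta> p" "s (act \<zeta> p) = F (act \<zeta> p) a b"
    "s p = F p (\<phi> \<zeta> a) (\<phi> \<zeta> b)"
proof -
  have s': "s \<in> carrier (\<O> (pre V))" "inv_at \<zeta> s p" using s \<zeta> p by (auto simp: carrier_Y[OF V])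
  obtain i a b where ab: "a \<in> D i" "b \<in> D i" "b \<notin> act \<zeta> p" "s (act \<zeta> p) = F (act \<zeta> p) a b"
    using s'(1) pre_act[OF \<zeta> p] by (rule sec_at)
  moreover have "p \<in> P" using p by (simp add: pre_def)
  ultimately show ?thesis using that s'(2) inv_at_iff[OF \<zeta>] by blast
qed

lemma Y_mult_closed:
  assumes V: "opY V" and s: "s \<in> carrier (sections Y V)" and t: "t \<in> carrier (sections Y V)"
  shows "s \<otimes>\<^bsub>sections Y V\<^esub> t \<in> carrier (sections Y V)"
  unfolding sections_Y_simps[OF V] carrier_Y[OF V]
proof (intro conjI ballI)
  show "s \<otimes>\<^bsub>\<O> (pre V)\<^esub> t \<in> carrier (\<O> (pre V))" using s t by (intro O_mult_closed) (auto simp: carrier_Y[OF V])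
  fix \<zeta> p assume \<zeta>: "\<zeta> \<in> H" and p: "p \<in> pre V"
  obtain i a b where ab: "a \<in> D i" "b \<in> D i" "b \<notin> act \<zeta> p" "s (act \<zeta> p) = F (act \<zeta> p) a b"
    "s p = F p (\<phi> \<zeta> a) (\<phi> \<zeta> b)" by (rule Y_sec_at[OF V s \<zeta> p])
  obtain j c d where cd: "c \<in> D j" "d \<in> D j" "d \<notin> act \<zeta> p" "t (act \<zeta> p) = F (act \<zeta> p) c d"
    "t p = F p (\<phi> \<zeta> c) (\<phi> \<zeta> d)" by (rule Y_sec_at[OF V t \<zeta> p])
  have pP: "p \<in> P" and ap: "act \<zeta> p \<in> pre V" "act \<zeta> p \<in> P"
    using p pre_act[OF \<zeta> p] by (auto simp: pre_def)
  have "(s \<otimes>\<^bsub>\<O> (pre V)\<^esub> t) (act \<zeta> p) = F (act \<zeta> p) (a \<otimes> c) (b \<otimes> d)"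
    using ap(1) by (simp add: O_simps ab(4) cd(4) frac_mult[OF ap(2) ab(1-3) cd(1-3)])
  moreover have "(s \<otimes>\<^bsub>\<O> (pre V)\<^esub> t) p = F p (\<phi> \<zeta> (a \<otimes> c)) (\<phi> \<zeta> (b \<otimes> d))"
    using p ab cd D_closed
    by (simp add: O_simps ab(5) cd(5) \<phi>_mult[OF \<zeta>]
      frac_mult[OF pP \<phi>_D[OF \<zeta> ab(1)] \<phi>_D[OF \<zeta> ab(2)] \<phi>_notin[OF \<zeta> ab(2,3)]
        \<phi>_D[OF \<zeta> cd(1)] \<phi>_D[OF \<zeta> cd(2)] \<phi>_notin[OF \<zeta> cd(2,3)]])
  moreover have "b \<otimes> d \<notin> act \<zeta> p" using mult_notin[OF ap(2)] ab cd D_closed by simp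
  ultimately show "inv_at \<zeta> (s \<otimes>\<^bsub>\<O> (pre V)\<^esub> t) p"
    using inv_at_iff[OF \<zeta> pP D_mult[OF ab(1) cd(1)] D_mult[OF ab(2) cd(2)]] by simp
qed

lemma Y_add_closed:
  assumes V: "opY V" and s: "s \<in> carrier (sections Y V)" and t: "t \<in> carrier (sections Y V)"
  shows "s \<oplus>\<^bsub>sections Y V\<^esub> t \<in> carrier (sections Y V)"
  unfolding sections_Y_simps[OF V] carrier_Y[OF V]
proof (intro conjI ballI)
  show "s \<oplus>\<^bsub>\<O> (pre V)\<^esub> t \<in> carrier (\<O> (pre V))" using s t by (intro O_add_closed) (auto simp: carrier_Y[OF V])
  fix \<zeta> p assume \<zeta>: "\<zeta> \<in> H" and p: "p \<in> pre V"
  obtain i a b where ab: "a \<in> D i" "b \<in> D i" "b \<notin> act \<zeta> p" "s (act \<zeta> p) = F (act \<zeta> p) a b"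
    "s p = F p (\<phi> \<zeta> a) (\<phi> \<zeta> b)" by (rule Y_sec_at[OF V s \<zeta> p])
  obtain j c d where cd: "c \<in> D j" "d \<in> D j" "d \<notin> act \<zeta> p" "t (act \<zeta> p) = F (act \<zeta> p) c d"
    "t p = F p (\<phi> \<zeta> c) (\<phi> \<zeta> d)" by (rule Y_sec_at[OF V t \<zeta> p])
  have pP: "p \<in> P" and ap: "act \<zeta> p \<in> pre V" "act \<zeta> p \<in> P"
    using p pre_act[OF \<zeta> p] by (auto simp: pre_def)
  have "(s \<oplus>\<^bsub>\<O> (pre V)\<^esub> t) (act \<zeta> p) = F (act \<zeta> p) (a \<otimes> d \<oplus> c \<otimes> b) (b \<otimes> d)"
    using ap(1) by (simp add: O_simps ab(4) cd(4) frac_add[OF ap(2) ab(1-3) cd(1-3)])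
  moreover have "(s \<oplus>\<^bsub>\<O> (pre V)\<^esub> t) p = F p (\<phi> \<zeta> (a \<otimes> d \<oplus> c \<otimes> b)) (\<phi> \<zeta> (b \<otimes> d))"
    using p ab cd D_closed
    by (simp add: O_simps ab(5) cd(5) \<phi>_mult[OF \<zeta>] \<phi>_add[OF \<zeta>]
      frac_add[OF pP \<phi>_D[OF \<zeta> ab(1)] \<phi>_D[OF \<zeta> ab(2)] \<phi>_notin[OF \<zeta> ab(2,3)]
        \<phi>_D[OF \<zeta> cd(1)] \<phi>_D[OF \<zeta> cd(2)] \<phi>_notin[OF \<zeta> cd(2,3)]])
  moreover have "b \<otimes> d \<notin> act \<zeta> p" using mult_notin[OF ap(2)] ab cd D_closed by simp
  ultimately show "inv_at \<zeta> (s \<oplus>\<^bsub>\<O> (pre V)\<^esub> t) p"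
    using inv_at_iff[OF \<zeta> pP D_mult_add[OF ab(1,2) cd(1,2)] D_mult[OF ab(2) cd(2)]] by simp
qed

lemma invariant_fraction:
  assumes V: "opY V" and ab: "a \<in> D i" "b \<in> D i" and inv: "\<And>\<zeta>. \<zeta> \<in> H \<Longrightarrow> \<phi> \<zeta> a = a \<and> \<phi> \<zeta> b = b"
    and b: "\<And>p. p \<in> pre V \<Longrightarrow> b \<notin> p"
  shows "(\<lambda>p\<in>pre V. F p a b) \<in> carrier (sections Y V)"
  unfolding carrier_Y[OF V]
proof (intro conjI ballI)
  show "(\<lambda>p\<in>pre V. F p a b) \<in> carrier (\<O> (pre V))" using op_pre[OF V] ab b by (rule fraction_section)
  fix \<zeta> p assume \<zeta>: "\<zeta> \<in> H" and p: "p \<in> pre V"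
  have "p \<in> P" using p by (simp add: pre_def)
  moreover have "b \<notin> act \<zeta> p" using b[OF pre_act[OF \<zeta> p]] .
  ultimately show "inv_at \<zeta> (\<lambda>p\<in>pre V. F p a b) p"
    using inv_at_iff[OF \<zeta> _ ab] pre_act[OF \<zeta> p] p inv[OF \<zeta>] by simp
qed

lemma Y_one_closed: "opY V \<Longrightarrow> \<one>\<^bsub>sections Y V\<^esub> \<in> carrier (sections Y V)"
  unfolding sections_Y_simps O_simps using \<phi>_one one_notin
  by (intro invariant_fraction[OF _ D_one D_one]) (auto simp: pre_def)

lemma opY_points: "opY (points Y)" by simp

lemma pre_points: "pre (points Y) = P"
  by (auto simp: pre_def points_Y)

lemma Y_scalar_closed: "scalar Y c \<in> carrier (sections Y (points Y))"
  using invariant_fraction[OF opY_points \<kappa>_D[of c] D_one] \<phi>_one \<phi>_\<kappa> one_notin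
  unfolding scalar_Y pre_points by simp

lemma Y_restr_closed:
  assumes V: "opY V" and s: "s \<in> carrier (sections Y V)" and W: "opY W" "W \<subseteq> V"
  shows "restr Y V W s \<in> carrier (sections Y W)"
  unfolding restr_Y'[OF V W] carrier_Y[OF W(1)]
proof (intro conjI ballI)
  have sub: "pre W \<subseteq> pre V" using W by (auto simp: pre_def)
  show "restrict s (pre W) \<in> carrier (\<O> (pre W))"
    using s op_pre[OF W(1)] sub by (intro O_restrict_closed) (auto simp: carrier_Y[OF V])
  fix \<zeta> p assume \<zeta>: "\<zeta> \<in> H" and p: "p \<in> pre W"
  have "inv_at \<zeta> s p" using s \<zeta> p sub by (auto simp: carrier_Y[OF V])
  thus "inv_at \<zeta> (restrict s (pre W)) p" using p pre_act[OF \<zeta> p] by (simp add: inv_at_def)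
qed

lemma sections_closed_Y: "sections_closed Y"
  unfolding sections_closed_def
  using Y_one_closed Y_mult_closed Y_add_closed Y_restr_closed Y_scalar_closed by simp

lemma nonvanishing_act:
  assumes V: "opY V" and s: "s \<in> carrier (sections Y V)" and \<zeta>: "\<zeta> \<in> H" and p: "p \<in> pre V"
  shows "nonvanishing s (act \<zeta> p) \<longleftrightarrow> nonvanishing s p"
proof -
  obtain i a b where ab: "a \<in> D i" "b \<in> D i" "b \<notin> act \<zeta> p" "s (act \<zeta> p) = F (act \<zeta> p) a b"
    "s p = F p (\<phi> \<zeta> a) (\<phi> \<zeta> b)" by (rule Y_sec_at[OF V s \<zeta> p])
  have pP: "p \<in> P" using p by (simp add: pre_def)
  show ?thesis
    using nonvanishing_frac[OF act_in_P[OF \<zeta> pP] ab(1-3), of s] ab(4,5) mem_act[OF D_closed[OF ab(1)]]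
      nonvanishing_frac[OF pP \<phi>_D[OF \<zeta> ab(1)] \<phi>_D[OF \<zeta> ab(2)] \<phi>_notin[OF \<zeta> ab(2,3)], of s] by simp
qed

text \<open>
  The set where an invariant section does not vanish is open and \<open>H\<close>-stable, and the inverse there is
  again invariant.
\<close>

lemma germ_unit_Y:
  assumes V: "opY V" and s: "s \<in> carrier (sections Y V)" and p: "p \<in> pre V"
  shows "germ_unit Y V (\<pi> p) s \<longleftrightarrow> nonvanishing s p"
proof
  assume "germ_unit Y V (\<pi> p) s"
  then obtain W where W: "opY W" "\<pi> p \<in> W" "W \<subseteq> V" "restr Y V W s \<in> Units (sections Y W)"
    by (auto simp: germ_unit_def)
  have "restr Y V W s \<in> Units (\<O> (pre W))"
    using W(4) carrier_Y[OF W(1)] unfolding Units_def sections_Y_simps[OF W(1)] by fastforce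
  moreover have pW: "p \<in> pre W" using W p by (simp add: pre_def)
  ultimately have "nonvanishing (restr Y V W s) p" using op_pre[OF W(1)] by (intro unit_nonvanishing)
  thus "nonvanishing s p" using pW by (simp add: nonvanishing_def restr_Y'[OF V W(1,3)])
next
  assume nv: "nonvanishing s p"
  define U where "U = {p \<in> pre V. nonvanishing s p}"
  define W where "W = \<pi> ` U"
  have sO: "s \<in> carrier (\<O> (pre V))" using s by (simp add: carrier_Y[OF V])
  have UP: "U \<subseteq> P" by (auto simp: U_def pre_def)
  have preW: "pre W = U"
  proof (intro equalityI subsetI)
    fix r assume "r \<in> pre W"
    then obtain r' where r': "r \<in> P" "r' \<in> U" "\<pi> r' = \<pi> r" by (auto simp: pre_def W_def)
    then obtain \<zeta> where \<zeta>: "\<zeta> \<in> H" "r = act \<zeta> r'" using \<pi>_eqD[of r' r] UP by auto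
    thus "r \<in> U" using r' nonvanishing_act[OF V s \<zeta>(1)] pre_act[OF \<zeta>(1)] by (auto simp: U_def)
  qed (use UP in \<open>auto simp: pre_def W_def\<close>)
  have W: "opY W" using op_nonvanishing[OF sO] preW UP unfolding openin_Y pre_def[symmetric] by (auto simp: W_def U_def)
  have WV: "W \<subseteq> V" by (auto simp: W_def U_def pre_def)
  have \<pi>p: "\<pi> p \<in> W" using p nv by (auto simp: W_def U_def)
  define t where "t = restr Y V W s"
  have t: "t \<in> carrier (sections Y W)" unfolding t_def by (rule Y_restr_closed[OF V s W WV])
  have tO: "t \<in> carrier (\<O> (pre W))" using t by (simp add: carrier_Y[OF W])
  have tnv: "nonvanishing t r" if "r \<in> pre W" for r
    using that unfolding t_def restr_Y'[OF V W WV] nonvanishing_def preW by (simp add: U_def nonvanishing_def)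
  note inv = inverse_section[OF tO op_pre[OF W] tnv]
  have "inverse_section (pre W) t \<in> carrier (sections Y W)"
    unfolding carrier_Y[OF W]
  proof (intro conjI ballI inv)
    fix \<zeta> r assume \<zeta>: "\<zeta> \<in> H" and r: "r \<in> pre W"
    obtain i a b where ab: "a \<in> D i" "b \<in> D i" "b \<notin> act \<zeta> r" "t (act \<zeta> r) = F (act \<zeta> r) a b"
      "t r = F r (\<phi> \<zeta> a) (\<phi> \<zeta> b)" by (rule Y_sec_at[OF W t \<zeta> r])
    have rP: "r \<in> P" and ar: "act \<zeta> r \<in> pre W" "act \<zeta> r \<in> P"
      using r pre_act[OF \<zeta> r] by (auto simp: pre_def)
    have a: "a \<notin> act \<zeta> r" using nonvanishing_frac[OF ar(2) ab(1-3), of t] ab(4) tnv[OF ar(1)] by simp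
    have "inverse_section (pre W) t (act \<zeta> r) = F (act \<zeta> r) b a"
      using ar swap_frac[OF ar(2) ab(1,2) a ab(3)] by (simp add: inverse_section_def ab(4))
    moreover have "inverse_section (pre W) t r = F r (\<phi> \<zeta> b) (\<phi> \<zeta> a)"
      using r swap_frac[OF rP \<phi>_D[OF \<zeta> ab(1)] \<phi>_D[OF \<zeta> ab(2)] \<phi>_notin[OF \<zeta> ab(1) a] \<phi>_notin[OF \<zeta> ab(2,3)]]
      by (simp add: inverse_section_def ab(5))
    ultimately show "inv_at \<zeta> (inverse_section (pre W) t) r"
      using inv_at_iff[OF \<zeta> rP ab(2,1) a] by simp
  qed
  hence "t \<in> Units (sections Y W)"
    using inv(2,3) t unfolding Units_def sections_Y_simps[OF W] by blast
  thus "germ_unit Y V (\<pi> p) s" unfolding germ_unit_def t_def using W WV \<pi>p by blast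
qed

subsection \<open>Values at geometric points\<close>

text \<open>
  A ring homomorphism \<open>e\<close> into a field whose vanishing on homogeneous elements defines \<open>p\<close>. It need not
  have kernel \<open>p\<close>; it is the evaluation of polynomials at a representative of a projective point.
\<close>

definition geom :: "'a set \<Rightarrow> ('a \<Rightarrow> 'k :: field) \<Rightarrow> bool" where
  "geom p e \<longleftrightarrow> p \<in> P \<and> e \<one> = 1 \<and> (\<forall>a\<in>hom_elems. a \<in> p \<longleftrightarrow> e a = 0) \<and>
     (\<forall>a\<in>carrier R. \<forall>b\<in>carrier R. e (a \<otimes> b) = e a * e b \<and> e (a \<oplus> b) = e a + e b)"

definition val :: "('a \<Rightarrow> 'k :: field) \<Rightarrow> ('a \<times> 'a) set \<Rightarrow> 'k" where
  "val e M = (SOME v. \<exists>a b. (a, b) \<in> M \<and> v = e a / e b)"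

lemma geomD:
  assumes "geom p e"
  shows "p \<in> P" "e \<one> = 1" "\<And>a i. a \<in> D i \<Longrightarrow> a \<in> p \<longleftrightarrow> e a = 0"
    "\<And>a b. a \<in> carrier R \<Longrightarrow> b \<in> carrier R \<Longrightarrow> e (a \<otimes> b) = e a * e b"
    "\<And>a b. a \<in> carrier R \<Longrightarrow> b \<in> carrier R \<Longrightarrow> e (a \<oplus> b) = e a + e b"
  using assms D_hom by (auto simp: geom_def)

lemma val_frac:
  assumes g: "geom p e" and ab: "a \<in> D i" "b \<in> D i" "b \<notin> p"
  shows "val e (F p a b) = e a / e b"
proof -
  have uniq: "v = e a / e b" if ab': "(a', b') \<in> F p a b" and v: "v = e a' / e b'" for v a' b'
  proof -
    obtain j t where j: "a' \<in> D j" "b' \<in> D j" "b' \<notin> p" "t \<in> hom_elems" "t \<notin> p" "t \<otimes> (a \<otimes> b') = t \<otimes> (a' \<otimes> b)"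
      using ab' unfolding frac_mem same_def by blast
    note cl = hom_closed[OF j(4)] ab(1,2)[THEN D_closed] j(1,2)[THEN D_closed]
    have "e (t \<otimes> (a \<otimes> b')) = e (t \<otimes> (a' \<otimes> b))" unfolding j(6) ..
    hence "e t * (e a * e b') = e t * (e a' * e b)" using geomD(4)[OF g] cl by simp
    moreover have "e t \<noteq> 0" using g j(4,5) by (auto simp: geom_def)
    moreover have "e b \<noteq> 0" "e b' \<noteq> 0" using geomD(3)[OF g] ab j by blast+
    ultimately show ?thesis by (simp add: v field_simps)
  qed
  have "\<exists>v. \<exists>a' b'. (a', b') \<in> F p a b \<and> v = e a' / e b'"
    using frac_self[OF geomD(1)[OF g] ab] by blast
  hence "\<exists>a' b'. (a', b') \<in> F p a b \<and> val e (F p a b) = e a' / e b'" unfolding val_def by (rule someI_ex)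
  thus ?thesis using uniq by blast
qed

lemma val_sections:
  assumes g: "geom p e" and V: "opY V" and p: "p \<in> pre V"
    and s: "s \<in> carrier (sections Y V)" and t: "t \<in> carrier (sections Y V)"
  shows "val e ((s \<otimes>\<^bsub>sections Y V\<^esub> t) p) = val e (s p) * val e (t p)"
    and "val e ((s \<oplus>\<^bsub>sections Y V\<^esub> t) p) = val e (s p) + val e (t p)"
proof -
  have st: "s \<in> carrier (\<O> (pre V))" "t \<in> carrier (\<O> (pre V))" using s t by (auto simp: carrier_Y[OF V])
  obtain i a b where ab: "a \<in> D i" "b \<in> D i" "b \<notin> p" "s p = F p a b" by (rule sec_at[OF st(1) p])
  obtain j c d where cd: "c \<in> D j" "d \<in> D j" "d \<notin> p" "t p = F p c d" by (rule sec_at[OF st(2) p])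
  note gD = geomD[OF g]
  note cl = ab(1,2)[THEN D_closed] cd(1,2)[THEN D_closed]
  have nz: "e b \<noteq> 0" "e d \<noteq> 0" using gD(3) ab cd by blast+
  have n: "b \<otimes> d \<notin> p" using mult_notin[OF gD(1)] cl ab cd by simp
  have v: "val e (s p) = e a / e b" "val e (t p) = e c / e d"
    unfolding ab(4) cd(4) by (rule val_frac[OF g ab(1-3)], rule val_frac[OF g cd(1-3)])
  have "(s \<otimes>\<^bsub>sections Y V\<^esub> t) p = F p (a \<otimes> c) (b \<otimes> d)"
    using p by (simp add: sections_Y_simps[OF V] O_simps ab(4) cd(4) frac_mult[OF gD(1) ab(1-3) cd(1-3)])
  thus "val e ((s \<otimes>\<^bsub>sections Y V\<^esub> t) p) = val e (s p) * val e (t p)"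
    using val_frac[OF g D_mult[OF ab(1) cd(1)] D_mult[OF ab(2) cd(2)] n] cl by (simp add: v gD)
  have "(s \<oplus>\<^bsub>sections Y V\<^esub> t) p = F p (a \<otimes> d \<oplus> c \<otimes> b) (b \<otimes> d)"
    using p by (simp add: sections_Y_simps[OF V] O_simps ab(4) cd(4) frac_add[OF gD(1) ab(1-3) cd(1-3)])
  thus "val e ((s \<oplus>\<^bsub>sections Y V\<^esub> t) p) = val e (s p) + val e (t p)"
    using val_frac[OF g D_mult_add[OF ab(1,2) cd(1,2)] D_mult[OF ab(2) cd(2)] n] cl nz
    by (simp add: v gD field_simps)
qed

lemma val_nonzero:
  assumes g: "geom p e" and V: "opY V" and p: "p \<in> pre V" and s: "s \<in> carrier (sections Y V)"
  shows "val e (s p) \<noteq> 0 \<longleftrightarrow> germ_unit Y V (\<pi> p) s"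
proof -
  have s': "s \<in> carrier (\<O> (pre V))" using s by (auto simp: carrier_Y[OF V])
  obtain i a b where ab: "a \<in> D i" "b \<in> D i" "b \<notin> p" "s p = F p a b" by (rule sec_at[OF s' p])
  have "val e (s p) = e a / e b" unfolding ab(4) by (rule val_frac[OF g ab(1-3)])
  moreover have "e b \<noteq> 0" using geomD(3)[OF g] ab by blast
  ultimately have "val e (s p) \<noteq> 0 \<longleftrightarrow> a \<notin> p" using geomD(3)[OF g ab(1)] by simp
  thus ?thesis using nonvanishing_frac[OF geomD(1)[OF g] ab(1-3), of s] ab(4) germ_unit_Y[OF V s p] by simp
qed

lemma val_act:
  assumes g: "geom p e" and \<zeta>: "\<zeta> \<in> H" and g': "geom (act \<zeta> p) e'"
    and e': "\<And>a i. a \<in> D i \<Longrightarrow> e' a = e (\<phi> \<zeta> a)"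
    and V: "opY V" and p: "p \<in> pre V" and s: "s \<in> carrier (sections Y V)"
  shows "val e' (s (act \<zeta> p)) = val e (s p)"
proof -
  obtain i a b where ab: "a \<in> D i" "b \<in> D i" "b \<notin> act \<zeta> p" "s (act \<zeta> p) = F (act \<zeta> p) a b"
    "s p = F p (\<phi> \<zeta> a) (\<phi> \<zeta> b)" by (rule Y_sec_at[OF V s \<zeta> p])
  have "val e' (s (act \<zeta> p)) = e' a / e' b" unfolding ab(4) by (rule val_frac[OF g' ab(1-3)])
  also have "\<dots> = e (\<phi> \<zeta> a) / e (\<phi> \<zeta> b)" using e' ab by simp
  also have "\<dots> = val e (s p)"
    unfolding ab(5) by (rule val_frac[OF g \<phi>_D[OF \<zeta> ab(1)] \<phi>_D[OF \<zeta> ab(2)] \<phi>_notin[OF \<zeta> ab(2,3)], symmetric])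
  finally show ?thesis .
qed

lemma val_fraction:
  assumes g: "geom p e" and p: "p \<in> pre V" and ab: "a \<in> D i" "b \<in> D i" "b \<notin> p"
  shows "val e ((\<lambda>p\<in>pre V. F p a b) p) = e a / e b"
  using val_frac[OF g ab] p by simp

end

locale graded_quotient_points = graded_quotient R D P H \<phi> \<kappa> \<pi> Y + spec_of_field K \<kappa>K
  for R :: "'a ring" (structure) and D :: "nat \<Rightarrow> 'a set" and P :: "'a set set"
    and H :: "'g set" and \<phi> :: "'g \<Rightarrow> 'a \<Rightarrow> 'a" and \<kappa> :: "'f \<Rightarrow> 'a"
    and \<pi> :: "'a set \<Rightarrow> 'r" and Y :: "('r, 'a set \<Rightarrow> ('a \<times> 'a) set, 'f) ringed_space"
    and K :: "'k :: field set" and \<kappa>K :: "'f \<Rightarrow> 'k"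
begin

definition geom_mor :: "'a set \<Rightarrow> ('a \<Rightarrow> 'k) \<Rightarrow> ('k set \<Rightarrow> 'r) \<times> ('r set \<Rightarrow> ('a set \<Rightarrow> ('a \<times> 'a) set) \<Rightarrow> 'k set \<Rightarrow> ('k \<times> 'k) set)" where
  "geom_mor p e = mor Y (\<pi> p) (\<lambda>V s. val e (s p))"

text \<open>
  If the values at a geometric point lie in \<open>K\<close>, they define a \<open>K\<close>-valued point of the quotient.
\<close>

lemma evaluation_val:
  assumes g: "geom p e" and e\<kappa>: "\<And>c. e (\<kappa> c) = \<kappa>K c"
    and K: "\<And>V s. opY V \<Longrightarrow> p \<in> pre V \<Longrightarrow> s \<in> carrier (sections Y V) \<Longrightarrow> val e (s p) \<in> K"
  shows "evaluation Y (\<pi> p) (\<lambda>V s. val e (s p))"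
proof -
  note gD = geomD[OF g]
  have pre: "p \<in> pre V \<longleftrightarrow> \<pi> p \<in> V" for V using gD(1) by (simp add: pre_def)
  show ?thesis
    unfolding evaluation_def pre[symmetric]
  proof (intro conjI allI impI ballI)
    show "p \<in> pre (points Y)" using gD(1) pre_points by blast
  next
    fix V s assume *: "opY V" "p \<in> pre V" "s \<in> carrier (sections Y V)"
    show "val e (s p) \<in> K" by (rule K[OF *])
    show "germ_unit Y V (\<pi> p) s" if "val e (s p) \<noteq> 0" using val_nonzero[OF g *] that by simp
    show "val e (restr Y V W s p) = val e (s p)" if "opY W" "p \<in> pre W" "W \<subseteq> V" for W
      using that by (simp add: restr_Y'[OF *(1)])
  next
    fix V s t assume *: "opY V" "p \<in> pre V" "s \<in> carrier (sections Y V)" "t \<in> carrier (sections Y V)"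
    show "val e ((s \<otimes>\<^bsub>sections Y V\<^esub> t) p) = val e (s p) * val e (t p)"
      "val e ((s \<oplus>\<^bsub>sections Y V\<^esub> t) p) = val e (s p) + val e (t p)"
      by (rule val_sections[OF g *])+
  next
    fix V assume *: "opY V" "p \<in> pre V"
    show "val e (\<one>\<^bsub>sections Y V\<^esub> p) = 1"
      using *(2) val_frac[OF g D_one D_one one_notin[OF gD(1)]] gD(2) by (simp add: sections_Y_simps[OF *(1)] O_simps)
  next
    fix c show "val e (scalar Y c p) = \<kappa>K c"
      using gD(1,2) val_frac[OF g \<kappa>_D D_one one_notin[OF gD(1)]] e\<kappa> by (simp add: scalar_Y)
  qed
qed

end

section \<open>Evaluating polynomials\<close>

definition monom_eval :: "(nat \<Rightarrow> 'b :: comm_monoid_mult) \<Rightarrow> (nat \<Rightarrow>\<^sub>0 nat) \<Rightarrow> 'b" where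
  "monom_eval v m = (\<Prod>i\<in>Poly_Mapping.keys m. v i ^ Poly_Mapping.lookup m i)"

lemma monom_eval_superset:
  assumes "finite A" "Poly_Mapping.keys m \<subseteq> A"
  shows "monom_eval v m = (\<Prod>i\<in>A. v i ^ Poly_Mapping.lookup m i)"
  unfolding monom_eval_def using assms by (intro prod.mono_neutral_left) (auto simp: in_keys_iff)

lemma monom_eval_0 [simp]: "monom_eval v 0 = 1"
  by (simp add: monom_eval_def)

lemma monom_eval_add: "monom_eval v (m + m') = monom_eval v m * monom_eval v m'"
proof -
  let ?A = "Poly_Mapping.keys m \<union> Poly_Mapping.keys m'"
  have "Poly_Mapping.keys (m + m') \<subseteq> ?A" by (rule Poly_Mapping.keys_add)
  thus ?thesis
    by (simp add: monom_eval_superset[of ?A] lookup_add power_add prod.distrib)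
qed

lemma monom_eval_single: "monom_eval v (Poly_Mapping.single i k) = v i ^ k"
  by (simp add: monom_eval_def)

lemma monom_eval_mult: "monom_eval (\<lambda>i. v i * w i) m = monom_eval v m * monom_eval w m"
  by (simp add: monom_eval_def power_mult_distrib prod.distrib)

lemma monom_eval_cong: "(\<And>i. i \<in> Poly_Mapping.keys m \<Longrightarrow> v i = w i) \<Longrightarrow> monom_eval v m = monom_eval w m"
  by (simp add: monom_eval_def)

definition mpoly_eval :: "('a :: comm_ring_1 \<Rightarrow> 'b :: comm_ring_1) \<Rightarrow> (nat \<Rightarrow> 'b) \<Rightarrow> 'a mpoly \<Rightarrow> 'b" where
  "mpoly_eval h v P = (\<Sum>m\<in>Poly_Mapping.keys P. h (Poly_Mapping.lookup P m) * monom_eval v m)"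

lemma mpoly_sum_single: "(\<Sum>m\<in>Poly_Mapping.keys P. Poly_Mapping.single m (Poly_Mapping.lookup P m)) = P"
proof (rule poly_mapping_eqI)
  fix k
  have "Poly_Mapping.lookup (\<Sum>m\<in>Poly_Mapping.keys P. Poly_Mapping.single m (Poly_Mapping.lookup P m)) k =
      (\<Sum>m\<in>Poly_Mapping.keys P. if m = k then Poly_Mapping.lookup P m else 0)"
    unfolding lookup_sum by (intro sum.cong) (auto simp: lookup_single when_def)
  also have "\<dots> = Poly_Mapping.lookup P k" by (simp add: sum.delta in_keys_iff)
  finally show "Poly_Mapping.lookup (\<Sum>m\<in>Poly_Mapping.keys P. Poly_Mapping.single m (Poly_Mapping.lookup P m)) k
      = Poly_Mapping.lookup P k" .
qed

locale coeff_hom =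
  fixes h :: "'a :: comm_ring_1 \<Rightarrow> 'b :: comm_ring_1"
  assumes h_0: "h 0 = 0" and h_1: "h 1 = 1" and h_add: "h (x + y) = h x + h y" and h_mult: "h (x * y) = h x * h y"
begin

lemma eval_superset:
  assumes "finite A" "Poly_Mapping.keys P \<subseteq> A"
  shows "mpoly_eval h v P = (\<Sum>m\<in>A. h (Poly_Mapping.lookup P m) * monom_eval v m)"
  unfolding mpoly_eval_def using assms by (intro sum.mono_neutral_left) (auto simp: in_keys_iff h_0)

lemma eval_0 [simp]: "mpoly_eval h v 0 = 0"
  by (simp add: mpoly_eval_def)

lemma eval_add: "mpoly_eval h v (P + Q) = mpoly_eval h v P + mpoly_eval h v Q"
proof -
  let ?A = "Poly_Mapping.keys P \<union> Poly_Mapping.keys Q"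
  have "Poly_Mapping.keys (P + Q) \<subseteq> ?A" by (rule Poly_Mapping.keys_add)
  thus ?thesis by (simp add: eval_superset[of ?A] lookup_add h_add distrib_right sum.distrib)
qed

lemma eval_sum: "mpoly_eval h v (sum g I) = (\<Sum>i\<in>I. mpoly_eval h v (g i))"
  by (induction I rule: infinite_finite_induct) (auto simp: eval_add)

lemma eval_single: "mpoly_eval h v (Poly_Mapping.single m c) = h c * monom_eval v m"
  by (simp add: mpoly_eval_def h_0)

lemma eval_1 [simp]: "mpoly_eval h v 1 = 1"
  using eval_single[of v 0 1] by (simp add: h_1)

lemma eval_mult: "mpoly_eval h v (P * Q) = mpoly_eval h v P * mpoly_eval h v Q"
proof -
  let ?s = "\<lambda>P m. Poly_Mapping.single m (Poly_Mapping.lookup P m)"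
  have "P * Q = (\<Sum>m\<in>Poly_Mapping.keys P. ?s P m) * (\<Sum>m\<in>Poly_Mapping.keys Q. ?s Q m)"
    by (simp only: mpoly_sum_single)
  also have "\<dots> = (\<Sum>m\<in>Poly_Mapping.keys P. \<Sum>m'\<in>Poly_Mapping.keys Q.
      Poly_Mapping.single (m + m') (Poly_Mapping.lookup P m * Poly_Mapping.lookup Q m'))"
    by (simp add: sum_product mult_single)
  finally have "mpoly_eval h v (P * Q) = (\<Sum>m\<in>Poly_Mapping.keys P. \<Sum>m'\<in>Poly_Mapping.keys Q.
      (h (Poly_Mapping.lookup P m) * monom_eval v m) * (h (Poly_Mapping.lookup Q m') * monom_eval v m'))"
    by (simp add: eval_sum eval_single h_mult monom_eval_add ac_simps)
  also have "\<dots> = mpoly_eval h v P * mpoly_eval h v Q"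
    unfolding mpoly_eval_def by (rule sum_product[symmetric])
  finally show ?thesis .
qed

lemma eval_power: "mpoly_eval h v (P ^ k) = mpoly_eval h v P ^ k"
  by (induction k) (auto simp: eval_mult)

lemma eval_prod: "mpoly_eval h v (prod g I) = (\<Prod>i\<in>I. mpoly_eval h v (g i))"
  by (induction I rule: infinite_finite_induct) (auto simp: eval_mult)

lemma eval_uminus: "mpoly_eval h v (- P) = - mpoly_eval h v P"
  using eval_add[of v P "- P"] by (simp add: eq_neg_iff_add_eq_0 add.commute)

lemma eval_diff: "mpoly_eval h v (P - Q) = mpoly_eval h v P - mpoly_eval h v Q"
  using eval_add[of v P "- Q"] by (simp add: eval_uminus)

lemma eval_Var [simp]: "mpoly_eval h v (Var i) = v i"
  by (simp add: Var_def eval_single h_1 monom_eval_single)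

lemma eval_Const [simp]: "mpoly_eval h v (Const c) = h c"
  by (simp add: Const_def eval_single)

lemma eval_scale_vars:
  "mpoly_eval h v (scale_vars \<zeta> P) = mpoly_eval h (\<lambda>i. h (\<zeta> i) * v i) P"
proof -
  have h_prod: "h (prod g I) = (\<Prod>i\<in>I. h (g i))" for g :: "nat \<Rightarrow> 'a" and I
    by (induction I rule: infinite_finite_induct) (auto simp: h_1 h_mult)
  have h_power: "h (c ^ k) = h c ^ k" for c k by (induction k) (auto simp: h_1 h_mult)
  have "h (monom_eval \<zeta> m) = monom_eval (\<lambda>i. h (\<zeta> i)) m" for m
    by (simp add: monom_eval_def h_prod h_power)
  thus ?thesis
    unfolding scale_vars_def monom_eval_def[symmetric] eval_sum eval_single
    by (simp add: h_mult mpoly_eval_def[of h "\<lambda>i. h (\<zeta> i) * v i"] monom_eval_mult mult.assoc)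
qed

end

interpretation Const_hom: coeff_hom "Const :: 'a :: comm_ring_1 \<Rightarrow> 'a mpoly"
  by unfold_locales (simp_all add: Const_def single_add mult_single)

lemma Const_power: "Const c ^ m = (Const (c ^ m) :: 'a :: comm_ring_1 mpoly)"
  by (induction m) (auto simp: Const_hom.h_1 Const_hom.h_mult)

lemma Const_prod: "(\<Prod>i\<in>J. Const (g i)) = (Const (prod g J) :: 'a :: comm_ring_1 mpoly)"
  by (induction J rule: infinite_finite_induct) (auto simp: Const_hom.h_1 Const_hom.h_mult)

lemma monom_eval_Var: "monom_eval Var m = (Poly_Mapping.single m 1 :: 'a :: comm_ring_1 mpoly)"
proof -
  have pow: "Var i ^ k = (Poly_Mapping.single (Poly_Mapping.single i k) 1 :: 'a mpoly)" for i k
    by (induction k) (auto simp: Var_def mult_single single_add[symmetric])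
  have "(\<Prod>i\<in>I. Var i ^ Poly_Mapping.lookup m i) =
      (Poly_Mapping.single (\<Sum>i\<in>I. Poly_Mapping.single i (Poly_Mapping.lookup m i)) 1 :: 'a mpoly)" for I
    by (induction I rule: infinite_finite_induct) (auto simp: pow mult_single)
  moreover have "(\<Sum>i\<in>Poly_Mapping.keys m. Poly_Mapping.single i (Poly_Mapping.lookup m i)) = m"
  proof (rule poly_mapping_eqI)
    fix k
    have "Poly_Mapping.lookup (\<Sum>i\<in>Poly_Mapping.keys m. Poly_Mapping.single i (Poly_Mapping.lookup m i)) k =
        (\<Sum>i\<in>Poly_Mapping.keys m. if i = k then Poly_Mapping.lookup m i else 0)"
      unfolding lookup_sum by (intro sum.cong) (auto simp: lookup_single when_def)
    thus "Poly_Mapping.lookup (\<Sum>i\<in>Poly_Mapping.keys m. Poly_Mapping.single i (Poly_Mapping.lookup m i)) k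
        = Poly_Mapping.lookup m k" by (simp add: sum.delta in_keys_iff)
  qed
  ultimately show ?thesis by (simp add: monom_eval_def)
qed

lemma scale_vars_eval: "scale_vars \<zeta> P = mpoly_eval Const (\<lambda>i. Const (\<zeta> i) * Var i) P"
proof -
  have "monom_eval (\<lambda>i. Const (\<zeta> i)) m = Const (monom_eval \<zeta> m)" for m
  proof -
    have h_power: "Const (c ^ k) = Const c ^ k" for c :: 'a and k
      by (induction k) (auto simp: Const_hom.h_1 Const_hom.h_mult)
    have "Const (prod g I) = (\<Prod>i\<in>I. Const (g i))" for g :: "nat \<Rightarrow> 'a" and I
      by (induction I rule: infinite_finite_induct) (auto simp: Const_hom.h_1 Const_hom.h_mult)
    thus ?thesis by (simp add: monom_eval_def h_power)
  qed
  thus ?thesis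
    unfolding scale_vars_def monom_eval_def[symmetric] mpoly_eval_def monom_eval_mult monom_eval_Var
    by (simp add: Const_def mult_single)
qed

lemma scale_vars_add: "scale_vars \<zeta> (P + Q) = scale_vars \<zeta> P + scale_vars \<zeta> Q"
  and scale_vars_mult: "scale_vars \<zeta> (P * Q) = scale_vars \<zeta> P * scale_vars \<zeta> Q"
  and scale_vars_1: "scale_vars \<zeta> 1 = 1"
  and scale_vars_Const: "scale_vars \<zeta> (Const c) = Const c"
  and scale_vars_Var: "scale_vars \<zeta> (Var i) = Const (\<zeta> i) * Var i"
  unfolding scale_vars_eval by (simp_all add: Const_hom.eval_add Const_hom.eval_mult)

lemma scale_vars_sum: "scale_vars \<zeta> (sum g I) = (\<Sum>i\<in>I. scale_vars \<zeta> (g i))"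
  and scale_vars_prod: "scale_vars \<zeta> (prod g I) = (\<Prod>i\<in>I. scale_vars \<zeta> (g i))"
  and scale_vars_power: "scale_vars \<zeta> (P ^ k) = scale_vars \<zeta> P ^ k"
  unfolding scale_vars_eval by (simp_all add: Const_hom.eval_sum Const_hom.eval_prod Const_hom.eval_power)

lemma lookup_scale_vars: "Poly_Mapping.lookup (scale_vars \<zeta> P) m = Poly_Mapping.lookup P m * monom_eval \<zeta> m"
proof -
  have "Poly_Mapping.lookup (scale_vars \<zeta> P) m =
      (\<Sum>k\<in>Poly_Mapping.keys P. if k = m then Poly_Mapping.lookup P k * monom_eval \<zeta> k else 0)"
    unfolding scale_vars_def monom_eval_def[symmetric] lookup_sum
    by (intro sum.cong) (auto simp: lookup_single when_def)
  thus ?thesis by (simp add: sum.delta in_keys_iff)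
qed

lemma keys_scale_vars: "Poly_Mapping.keys (scale_vars \<zeta> P) \<subseteq> Poly_Mapping.keys P"
  by (auto simp: in_keys_iff lookup_scale_vars)

lemma scale_vars_scale_vars:
  assumes "P \<in> mpolys I" "\<And>i. i \<in> I \<Longrightarrow> \<zeta> i * \<eta> i = \<xi> i"
  shows "scale_vars \<zeta> (scale_vars \<eta> P) = scale_vars \<xi> P"
proof (rule poly_mapping_eqI)
  fix m
  show "Poly_Mapping.lookup (scale_vars \<zeta> (scale_vars \<eta> P)) m = Poly_Mapping.lookup (scale_vars \<xi> P) m"
  proof (cases "m \<in> Poly_Mapping.keys P")
    case True
    hence "Poly_Mapping.keys m \<subseteq> I" using assms(1) by (simp add: mpolys_def)
    hence "monom_eval \<xi> m = monom_eval (\<lambda>i. \<zeta> i * \<eta> i) m"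
      by (intro monom_eval_cong assms(2)[symmetric]) blast
    thus ?thesis by (simp add: lookup_scale_vars monom_eval_mult ac_simps)
  qed (simp add: lookup_scale_vars in_keys_iff)
qed

lemma scale_vars_id:
  assumes "P \<in> mpolys I" "\<And>i. i \<in> I \<Longrightarrow> \<zeta> i = 1"
  shows "scale_vars \<zeta> P = P"
proof (rule poly_mapping_eqI)
  fix m
  show "Poly_Mapping.lookup (scale_vars \<zeta> P) m = Poly_Mapping.lookup P m"
  proof (cases "m \<in> Poly_Mapping.keys P")
    case True
    hence "monom_eval \<zeta> m = monom_eval (\<lambda>i. 1) m"
      using assms by (intro monom_eval_cong) (auto simp: mpolys_def)
    thus ?thesis by (simp add: lookup_scale_vars monom_eval_def)
  qed (simp add: lookup_scale_vars in_keys_iff)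
qed

subsection \<open>Subrings of polynomials\<close>

lemma mpolys_add: "P \<in> mpolys I \<Longrightarrow> Q \<in> mpolys I \<Longrightarrow> P + Q \<in> mpolys I"
  using Poly_Mapping.keys_add[of P Q] by (auto simp: mpolys_def)

lemma mpolys_mult:
  assumes "P \<in> mpolys I" "Q \<in> mpolys I"
  shows "P * Q \<in> mpolys I"
  unfolding mpolys_def
proof (intro CollectI ballI)
  fix m assume "m \<in> Poly_Mapping.keys (P * Q)"
  then obtain a b where "m = a + b" "a \<in> Poly_Mapping.keys P" "b \<in> Poly_Mapping.keys Q"
    using Poly_Mapping.keys_mult[of P Q] by blast
  thus "Poly_Mapping.keys m \<subseteq> I"
    using assms Poly_Mapping.keys_add[of a b] unfolding mpolys_def by blast
qed

lemma mpolys_uminus: "P \<in> mpolys I \<Longrightarrow> - P \<in> mpolys I"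
  by (auto simp: mpolys_def in_keys_iff)

lemma mpolys_diff: "P \<in> mpolys I \<Longrightarrow> Q \<in> mpolys I \<Longrightarrow> P - Q \<in> mpolys I"
  using mpolys_add[of P I "- Q"] mpolys_uminus[of Q I] by simp

lemma mpolys_0 [simp]: "0 \<in> mpolys I" and mpolys_1 [simp]: "1 \<in> mpolys I" and mpolys_Const [simp]: "Const c \<in> mpolys I"
  by (auto simp: mpolys_def Const_def)

lemma mpolys_Var: "i \<in> I \<Longrightarrow> Var i \<in> mpolys I"
  by (auto simp: mpolys_def Var_def)

lemma mpolys_single: "Poly_Mapping.keys m \<subseteq> I \<Longrightarrow> Poly_Mapping.single m c \<in> mpolys I"
  by (auto simp: mpolys_def)

lemma mpolys_power: "P \<in> mpolys I \<Longrightarrow> P ^ k \<in> mpolys I"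
  by (induction k) (auto intro: mpolys_mult)

lemma mpolys_sum: "(\<And>j. j \<in> J \<Longrightarrow> g j \<in> mpolys I) \<Longrightarrow> sum g J \<in> mpolys I"
  by (induction J rule: infinite_finite_induct) (auto intro: mpolys_add)

lemma mpolys_prod: "(\<And>j. j \<in> J \<Longrightarrow> g j \<in> mpolys I) \<Longrightarrow> prod g J \<in> mpolys I"
  by (induction J rule: infinite_finite_induct) (auto intro: mpolys_mult)

lemma mpolys_scale_vars: "P \<in> mpolys I \<Longrightarrow> scale_vars \<zeta> P \<in> mpolys I"
  using keys_scale_vars[of \<zeta> P] by (auto simp: mpolys_def)

lemma cring_mpolys: "cring (ring_on (mpolys I :: 'a :: comm_ring_1 mpoly set))"
  by (intro ring_on_cring mpolys_add mpolys_mult mpolys_uminus) auto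

lemma eval_cong_mpolys:
  assumes "P \<in> mpolys I" "\<And>i. i \<in> I \<Longrightarrow> v i = w i"
  shows "mpoly_eval h v P = mpoly_eval h w P"
  unfolding mpoly_eval_def using assms
  by (intro sum.cong refl arg_cong2[where f = "(*)"] monom_eval_cong) (auto simp: mpolys_def)

subsection \<open>Homogeneous polynomials\<close>

definition homog :: "nat \<Rightarrow> 'a :: comm_ring_1 mpoly \<Rightarrow> bool" where
  "homog d P \<longleftrightarrow> (\<forall>m\<in>Poly_Mapping.keys P. mono_degree m = d)"

lemma mono_degree_superset:
  assumes "finite A" "Poly_Mapping.keys m \<subseteq> A"
  shows "mono_degree m = (\<Sum>i\<in>A. Poly_Mapping.lookup m i)"
  unfolding mono_degree_def using assms by (intro sum.mono_neutral_left) (auto simp: in_keys_iff)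

lemma mono_degree_add: "mono_degree (m + m') = mono_degree m + mono_degree m'"
proof -
  let ?A = "Poly_Mapping.keys m \<union> Poly_Mapping.keys m'"
  have "Poly_Mapping.keys (m + m') \<subseteq> ?A" by (rule Poly_Mapping.keys_add)
  thus ?thesis by (simp add: mono_degree_superset[of ?A] lookup_add sum.distrib)
qed

lemma mono_degree_single: "mono_degree (Poly_Mapping.single i k) = k"
  by (simp add: mono_degree_def)

lemma homog_add: "homog d P \<Longrightarrow> homog d Q \<Longrightarrow> homog d (P + Q)"
  using Poly_Mapping.keys_add[of P Q] by (auto simp: homog_def)

lemma homog_mult:
  assumes "homog d P" "homog e Q"
  shows "homog (d + e) (P * Q)"
  unfolding homog_def
proof
  fix m assume "m \<in> Poly_Mapping.keys (P * Q)"
  then obtain a b where "m = a + b" "a \<in> Poly_Mapping.keys P" "b \<in> Poly_Mapping.keys Q"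
    using Poly_Mapping.keys_mult[of P Q] by blast
  thus "mono_degree m = d + e" using assms by (simp add: homog_def mono_degree_add)
qed

lemma homog_0 [simp]: "homog d 0" and homog_1 [simp]: "homog 0 1" and homog_Const [simp]: "homog 0 (Const c)"
  by (auto simp: homog_def Const_def mono_degree_def split: if_splits)

lemma homog_Var [simp]: "homog 1 (Var i)"
  by (auto simp: homog_def Var_def mono_degree_single)

lemma homog_single: "homog (mono_degree m) (Poly_Mapping.single m c)"
  by (auto simp: homog_def)

lemma homog_uminus: "homog d P \<Longrightarrow> homog d (- P)"
  by (auto simp: homog_def in_keys_iff)

lemma homog_diff: "homog d P \<Longrightarrow> homog d Q \<Longrightarrow> homog d (P - Q)"
  using homog_add[of d P "- Q"] homog_uminus[of d Q] by simp

lemma homog_power: "homog d P \<Longrightarrow> homog (k * d) (P ^ k)"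
  by (induction k) (auto intro: homog_mult)

lemma homog_sum: "(\<And>j. j \<in> J \<Longrightarrow> homog d (g j)) \<Longrightarrow> homog d (sum g J)"
  by (induction J rule: infinite_finite_induct) (auto intro: homog_add)

lemma homog_prod: "(\<And>j. j \<in> J \<Longrightarrow> homog 1 (g j)) \<Longrightarrow> homog (card J) (prod g J)"
proof (induction J rule: infinite_finite_induct)
  case (insert j J)
  have "homog (1 + card J) (g j * prod g J)" using insert by (intro homog_mult) auto
  thus ?case using insert by simp
qed auto

lemma homog_scale_vars: "homog d P \<Longrightarrow> homog d (scale_vars \<zeta> P)"
  using keys_scale_vars[of \<zeta> P] by (auto simp: homog_def)

definition hcomp :: "nat \<Rightarrow> 'a :: comm_ring_1 mpoly \<Rightarrow> 'a mpoly" where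
  "hcomp d P = (\<Sum>m | m \<in> Poly_Mapping.keys P \<and> mono_degree m = d. Poly_Mapping.single m (Poly_Mapping.lookup P m))"

lemma homog_hcomp: "homog d (hcomp d P)"
  unfolding hcomp_def using homog_single by (intro homog_sum) auto

lemma mpolys_hcomp: "P \<in> mpolys I \<Longrightarrow> hcomp d P \<in> mpolys I"
  unfolding hcomp_def by (intro mpolys_sum mpolys_single) (auto simp: mpolys_def)

lemma sum_hcomp: "(\<Sum>d\<in>mono_degree ` Poly_Mapping.keys P. hcomp d P) = P"
proof -
  have "(\<Sum>d\<in>mono_degree ` Poly_Mapping.keys P. hcomp d P) =
      (\<Sum>m\<in>Poly_Mapping.keys P. Poly_Mapping.single m (Poly_Mapping.lookup P m))"
    unfolding hcomp_def by (rule sum.group) auto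
  thus ?thesis by (simp add: mpoly_sum_single)
qed

text \<open>
  The polynomial \<open>t \<mapsto> P (t x)\<close>. Its coefficients are the values at \<open>x\<close> of the homogeneous components of
  \<open>P\<close>, so its kernel is a homogeneous ideal, in contrast to the kernel of the evaluation at \<open>x\<close>.
\<close>

definition line_eval :: "('a :: comm_ring_1 \<Rightarrow> 'k :: comm_ring_1) \<Rightarrow> (nat \<Rightarrow> 'k) \<Rightarrow> 'a mpoly \<Rightarrow> 'k Polynomial.poly" where
  "line_eval h x = mpoly_eval (\<lambda>c. [:h c:]) (\<lambda>i. Polynomial.monom (x i) 1)"

lemma (in coeff_hom) line_hom: "coeff_hom (\<lambda>c. [:h c:])"
  by unfold_locales (simp_all add: h_0 h_1 h_add h_mult one_pCons)

lemma monom_eval_line: "monom_eval (\<lambda>i. Polynomial.monom (x i) 1) m = Polynomial.monom (monom_eval x m) (mono_degree m)"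
proof -
  have "(\<Prod>i\<in>I. Polynomial.monom (x i) 1 ^ Poly_Mapping.lookup m i) =
      Polynomial.monom (\<Prod>i\<in>I. x i ^ Poly_Mapping.lookup m i) (\<Sum>i\<in>I. Poly_Mapping.lookup m i)" for I
    by (induction I rule: infinite_finite_induct) (auto simp: Polynomial.monom_power Polynomial.mult_monom)
  thus ?thesis by (simp add: monom_eval_def mono_degree_def)
qed

lemma line_eval_sum:
  "line_eval h x P = (\<Sum>m\<in>Poly_Mapping.keys P. Polynomial.monom (h (Poly_Mapping.lookup P m) * monom_eval x m) (mono_degree m))"
  unfolding line_eval_def mpoly_eval_def monom_eval_line by (simp add: smult_monom)

lemma line_eval_homog:
  assumes "homog d P"
  shows "line_eval h x P = Polynomial.monom (mpoly_eval h x P) d"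
proof -
  have "line_eval h x P = (\<Sum>m\<in>Poly_Mapping.keys P. Polynomial.monom (h (Poly_Mapping.lookup P m) * monom_eval x m) d)"
    unfolding line_eval_sum using assms by (intro sum.cong) (auto simp: homog_def)
  also have "\<dots> = Polynomial.monom (mpoly_eval h x P) d"
    unfolding mpoly_eval_def by (induction rule: infinite_finite_induct) (auto simp: add_monom[symmetric])
  finally show ?thesis .
qed

lemma (in coeff_hom) coeff_line_eval: "Polynomial.coeff (line_eval h x P) d = mpoly_eval h x (hcomp d P)"
proof -
  have "mpoly_eval h x (hcomp d P) = (\<Sum>m | m \<in> Poly_Mapping.keys P \<and> mono_degree m = d. h (Poly_Mapping.lookup P m) * monom_eval x m)"
    unfolding hcomp_def eval_sum eval_single ..
  also have "\<dots> = (\<Sum>m\<in>Poly_Mapping.keys P. if mono_degree m = d then h (Poly_Mapping.lookup P m) * monom_eval x m else 0)"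
    by (intro sum.mono_neutral_cong_left) auto
  finally show ?thesis unfolding line_eval_sum by (simp add: coeff_sum)
qed

lemma (in coeff_hom) eval_homog_scale:
  assumes "homog d P"
  shows "mpoly_eval h (\<lambda>i. t * x i) P = t ^ d * mpoly_eval h x P"
proof -
  have "monom_eval (\<lambda>i. t) m = t ^ mono_degree m" for m
    by (simp add: monom_eval_def mono_degree_def power_sum)
  thus ?thesis unfolding mpoly_eval_def monom_eval_mult sum_distrib_left
    using assms by (intro sum.cong) (auto simp: homog_def ac_simps)
qed

lemma homog_pos_Var_decomp:
  assumes "homog d P" "d > 0" "P \<in> mpolys I"
  shows "\<exists>Q. (\<forall>m\<in>Poly_Mapping.keys P. \<exists>i\<in>I. Q m \<in> mpolys I \<and> Poly_Mapping.single m (Poly_Mapping.lookup P m) = Var i * Q m)"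
proof -
  have "\<exists>Q. \<exists>i\<in>I. Q \<in> mpolys I \<and> Poly_Mapping.single m (Poly_Mapping.lookup P m) = Var i * Q"
    if m: "m \<in> Poly_Mapping.keys P" for m
  proof -
    have "mono_degree m > 0" using assms m by (auto simp: homog_def)
    hence "Poly_Mapping.keys m \<noteq> {}" by (auto simp: mono_degree_def)
    then obtain i where i: "i \<in> Poly_Mapping.keys m" by blast
    define m' where "m' = m - Poly_Mapping.single i 1"
    have mm: "m = Poly_Mapping.single i 1 + m'"
      using i by (intro poly_mapping_eqI) (auto simp: m'_def lookup_add lookup_minus lookup_single in_keys_iff when_def)
    have I: "Poly_Mapping.keys m \<subseteq> I" using assms m by (auto simp: mpolys_def)
    have "Poly_Mapping.keys m' \<subseteq> Poly_Mapping.keys m" by (auto simp: m'_def in_keys_iff lookup_minus)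
    hence "Poly_Mapping.single m' (Poly_Mapping.lookup P m) \<in> mpolys I" using I by (intro mpolys_single) auto
    moreover have "Poly_Mapping.single m c = Var i * Poly_Mapping.single m' c" for c :: 'a
      by (subst mm) (simp add: Var_def mult_single)
    ultimately show ?thesis using i I by blast
  qed
  thus ?thesis by metis
qed

section \<open>The homogeneous coordinate ring of the hypersurface\<close>

locale dwork =
  fixes n :: nat and lam :: "'f :: field"
begin

abbreviation "V \<equiv> mpolys {..n} :: 'f mpoly set"
abbreviation "f \<equiv> dwork_poly n lam"
abbreviation "A \<equiv> dwork_ring n lam"
abbreviation "D \<equiv> dwork_grading n lam"
abbreviation "cl \<equiv> quot_class {..n} {dwork_poly n lam}"
abbreviation "Rn \<equiv> ring_on (mpolys {..n} :: 'f mpoly set)"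
definition "I = genideal Rn {f}"

lemma f_V: "f \<in> V"
  unfolding dwork_poly_def
  by (intro mpolys_add mpolys_mult mpolys_sum mpolys_prod mpolys_power mpolys_Const mpolys_Var) auto

lemma homog_f: "homog (n + 1) f"
proof -
  have "homog (n + 1) (\<Sum>i\<le>n. Var i ^ (n + 1) :: 'f mpoly)"
    using homog_power[OF homog_Var, of "n + 1"] by (intro homog_sum) simp
  moreover have "homog (0 + card {..n}) (Const lam * (\<Prod>i\<le>n. Var i))"
    by (intro homog_mult homog_Const homog_prod homog_Var)
  ultimately show ?thesis unfolding dwork_poly_def by (intro homog_add) simp_all
qed

sublocale Rn: cring Rn by (rule cring_mpolys)

lemma I_eq: "I = {S * f | S. S \<in> V}"
  using Rn.cgenideal_eq_genideal[of f] f_V by (auto simp: I_def cgenideal_def)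

sublocale I: ideal I Rn
  unfolding I_def by (rule Rn.genideal_ideal) (simp add: f_V)

lemma A_eq: "A = Rn Quot I"
  by (simp add: quot_alg_def I_def)

lemma cl_eq: "cl P = {S * f + P | S. S \<in> V}"
  unfolding quot_class_def I_def[symmetric] a_r_coset_def' I_eq by auto

lemma cl_hom: "cl \<in> ring_hom Rn A"
proof -
  have "(+>\<^bsub>Rn\<^esub>) I \<in> ring_hom Rn (Rn Quot I)" by (rule I.rcos_ring_hom)
  moreover have "(+>\<^bsub>Rn\<^esub>) I = cl" by (auto simp: quot_class_def I_def fun_eq_iff)
  ultimately show ?thesis by (simp add: A_eq)
qed

lemma carrier_A: "carrier A = cl ` V"
  unfolding A_eq FactRing_def A_RCOSETS_def' quot_class_def I_def by auto

lemma A_cring: "cring A"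
  unfolding A_eq by (rule I.quotient_is_cring) (rule Rn.is_cring)

sublocale A: cring A by (rule A_cring)

lemma cl_mult: "P \<in> V \<Longrightarrow> Q \<in> V \<Longrightarrow> cl (P * Q) = cl P \<otimes>\<^bsub>A\<^esub> cl Q"
  and cl_add: "P \<in> V \<Longrightarrow> Q \<in> V \<Longrightarrow> cl (P + Q) = cl P \<oplus>\<^bsub>A\<^esub> cl Q"
  using ring_hom_mult[OF cl_hom, of P Q] ring_hom_add[OF cl_hom, of P Q] by auto

lemma cl_1: "cl 1 = \<one>\<^bsub>A\<^esub>"
  using ring_hom_one[OF cl_hom] by simp

lemma cl_closed: "P \<in> V \<Longrightarrow> cl P \<in> carrier A"
  by (simp add: carrier_A)

lemma cl_0: "cl 0 = \<zero>\<^bsub>A\<^esub>"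
  unfolding cl_eq A_eq FactRing_def by (auto simp: I_eq)

lemma cl_eq_iff:
  assumes "P \<in> V" "Q \<in> V"
  shows "cl P = cl Q \<longleftrightarrow> (\<exists>S\<in>V. P = S * f + Q)"
proof
  assume "cl P = cl Q"
  moreover have "P \<in> cl P" unfolding cl_eq using mpolys_0 by (intro CollectI exI[of _ 0]) simp
  ultimately show "\<exists>S\<in>V. P = S * f + Q" unfolding cl_eq[of Q] by blast
next
  assume "\<exists>S\<in>V. P = S * f + Q"
  then obtain S where S: "S \<in> V" "P = S * f + Q" by blast
  have "S' * f + P \<in> cl Q" if "S' \<in> V" for S'
    using S that mpolys_add[of S' _ S] by (auto simp: cl_eq distrib_right add.assoc intro!: exI[of _ "S' + S"])
  moreover have "S' * f + Q \<in> cl P" if "S' \<in> V" for S'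
    using S that mpolys_diff[of S' _ S] by (auto simp: cl_eq algebra_simps intro!: exI[of _ "S' - S"])
  ultimately show "cl P = cl Q" unfolding cl_eq[of P] cl_eq[of Q] by blast
qed

lemma cl_sum_in_ideal:
  assumes M: "ideal M A" and g: "\<And>j. j \<in> S \<Longrightarrow> g j \<in> V \<and> cl (g j) \<in> M"
  shows "cl (sum g S) \<in> M"
  using g
proof (induction S rule: infinite_finite_induct)
  case (insert j S)
  have "cl (g j + sum g S) = cl (g j) \<oplus>\<^bsub>A\<^esub> cl (sum g S)"
    using insert.prems by (intro cl_add mpolys_sum) auto
  also have "\<dots> \<in> M"
    using insert by (intro additive_subgroup.a_closed[OF ideal.axioms(1)[OF M]]) auto
  finally show ?case using insert by simp
qed (auto simp: cl_0 intro: additive_subgroup.zero_closed[OF ideal.axioms(1)[OF M]])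

lemma D_eq: "D d = cl ` {P \<in> V. homog d P}"
  by (simp add: dwork_grading_def homog_def)

lemma homogeneous_D: "homogeneous D = {cl P | P d. P \<in> V \<and> homog d P}"
  by (auto simp: homogeneous_def D_eq)

subsection \<open>Functions on the ring\<close>

text \<open>
  Representatives of a coset are chosen arbitrarily; the value is meaningful when \<open>e\<close> is constant on
  cosets.
\<close>

definition on_class :: "('f mpoly \<Rightarrow> 'b) \<Rightarrow> 'f mpoly set \<Rightarrow> 'b" where
  "on_class e c = e (SOME P. P \<in> c)"

lemma on_class:
  assumes "P \<in> V" "\<And>S. S \<in> V \<Longrightarrow> e (S * f + P) = e P"
  shows "on_class e (cl P) = e P"
proof -
  have "P \<in> cl P" unfolding cl_eq using mpolys_0 by (intro CollectI exI[of _ 0]) simp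
  hence "(SOME Q. Q \<in> cl P) \<in> cl P" by (rule someI)
  then obtain S where "S \<in> V" "(SOME Q. Q \<in> cl P) = S * f + P" unfolding cl_eq by blast
  thus ?thesis using assms by (simp add: on_class_def)
qed

text \<open>
  The points of the projective spectrum of the homogeneous coordinate ring.
\<close>

definition Pts :: "'f mpoly set set set" where
  "Pts = {p. primeideal p A \<and> genideal A (p \<inter> homogeneous D) = p \<and> \<not> (\<Union>d \<in> {0<..}. D d) \<subseteq> p}"

lemma Pts_prime: "p \<in> Pts \<Longrightarrow> primeideal p A"
  by (simp add: Pts_def)

lemma Pts_ideal: "p \<in> Pts \<Longrightarrow> ideal p A"
  using Pts_prime primeideal.axioms(1) by blast

lemma Pts_eqI:
  assumes "p \<in> Pts" "p' \<in> Pts" "\<And>P d. P \<in> V \<Longrightarrow> homog d P \<Longrightarrow> cl P \<in> p \<longleftrightarrow> cl P \<in> p'"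
  shows "p = p'"
proof -
  have eq: "p \<inter> homogeneous D = p' \<inter> homogeneous D" using assms(3) by (auto simp: homogeneous_D)
  have "p = genideal A (p \<inter> homogeneous D)" using assms(1) by (simp add: Pts_def)
  also have "\<dots> = genideal A (p' \<inter> homogeneous D)" by (simp only: eq)
  also have "\<dots> = p'" using assms(2) by (simp add: Pts_def)
  finally show ?thesis .
qed

lemma graded_primes_A: "graded_primes A D Pts"
proof (intro graded_primes.intro graded_primes_axioms.intro A_cring)
  show "D i \<subseteq> carrier A" for i by (auto simp: D_eq carrier_A)
  show "a \<oplus>\<^bsub>A\<^esub> b \<in> D i" if "a \<in> D i" "b \<in> D i" for a b i
    using that by (auto simp: D_eq cl_add[symmetric] intro!: imageI mpolys_add homog_add)
  show "a \<otimes>\<^bsub>A\<^esub> b \<in> D (i + j)" if "a \<in> D i" "b \<in> D j" for a b i j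
    using that by (auto simp: D_eq cl_mult[symmetric] intro!: imageI mpolys_mult homog_mult)
  show "\<one>\<^bsub>A\<^esub> \<in> D 0" by (auto simp: D_eq cl_1[symmetric] intro!: imageI)
  show "\<zero>\<^bsub>A\<^esub> \<in> D i" for i by (auto simp: D_eq cl_0[symmetric] intro!: imageI)
qed (rule Pts_prime)

sublocale graded_primes A D Pts by (rule graded_primes_A)

lemma cl_D: "P \<in> V \<Longrightarrow> homog d P \<Longrightarrow> cl P \<in> D d"
  by (auto simp: D_eq)

lemma cl_in_prime_mult: "p \<in> Pts \<Longrightarrow> P \<in> V \<Longrightarrow> Q \<in> V \<Longrightarrow> cl (P * Q) \<in> p \<longleftrightarrow> cl P \<in> p \<or> cl Q \<in> p"
  by (simp add: cl_mult mult_in_iff cl_closed)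

lemma cl_in_prime_add: "p \<in> Pts \<Longrightarrow> P \<in> V \<Longrightarrow> Q \<in> V \<Longrightarrow> cl P \<in> p \<Longrightarrow> cl Q \<in> p \<Longrightarrow> cl (P + Q) \<in> p"
  using additive_subgroup.a_closed[OF ideal.axioms(1)[OF Pts_ideal]] by (simp add: cl_add)

lemma cl_in_prime_power: "p \<in> Pts \<Longrightarrow> P \<in> V \<Longrightarrow> cl (P ^ k) \<in> p \<Longrightarrow> cl P \<in> p"
proof (induction k)
  case 0
  thus ?case using one_notin[of p] by (simp add: cl_1)
next
  case (Suc k)
  thus ?case using cl_in_prime_mult[of p P "P ^ k"] mpolys_power[of P] by auto
qed

text \<open>
  Every monomial of positive degree is divisible by a variable.
\<close>

lemma Pts_Var:
  assumes p: "p \<in> Pts"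
  shows "\<exists>i\<le>n. cl (Var i) \<notin> p"
proof (rule ccontr)
  assume "\<not> ?thesis"
  hence all: "cl (Var i) \<in> p" if "i \<le> n" for i using that by blast
  have "D d \<subseteq> p" if d: "d > 0" for d
  proof
    fix c assume "c \<in> D d"
    then obtain P where P: "P \<in> V" "homog d P" "c = cl P" by (auto simp: D_eq)
    have "\<exists>Q. \<forall>m\<in>Poly_Mapping.keys P. \<exists>i\<in>{..n}. Q m \<in> V \<and>
        Poly_Mapping.single m (Poly_Mapping.lookup P m) = Var i * Q m"
      by (rule homog_pos_Var_decomp[OF P(2) d P(1)])
    then obtain Q where Q: "\<forall>m\<in>Poly_Mapping.keys P. \<exists>i\<in>{..n}. Q m \<in> V \<and>
        Poly_Mapping.single m (Poly_Mapping.lookup P m) = Var i * Q m" ..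
    have "cl (\<Sum>m\<in>Poly_Mapping.keys P. Poly_Mapping.single m (Poly_Mapping.lookup P m)) \<in> p"
    proof (rule cl_sum_in_ideal[OF Pts_ideal[OF p]])
      fix m assume "m \<in> Poly_Mapping.keys P"
      then obtain i where i: "i \<le> n" "Q m \<in> V" "Poly_Mapping.single m (Poly_Mapping.lookup P m) = Var i * Q m"
        using Q by blast
      thus "Poly_Mapping.single m (Poly_Mapping.lookup P m) \<in> V \<and> cl (Poly_Mapping.single m (Poly_Mapping.lookup P m)) \<in> p"
        using all[OF i(1)] cl_in_prime_mult[OF p mpolys_Var i(2)] mpolys_mult[OF mpolys_Var i(2)] by simp
    qed
    thus "c \<in> p" by (simp add: mpoly_sum_single P)
  qed
  thus False using p by (auto simp: Pts_def)
qed

subsection \<open>The action\<close>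

lemma groupD:
  assumes "\<zeta> \<in> dwork_group n" "i \<le> n"
  shows "\<zeta> i ^ (n + 1) = 1" "\<zeta> i \<noteq> 0"
  using assms by (auto simp: dwork_group_def power_0_left) 

lemma scale_f: "\<zeta> \<in> dwork_group n \<Longrightarrow> scale_vars \<zeta> f = f"
proof -
  assume \<zeta>: "\<zeta> \<in> dwork_group n"
  have "scale_vars \<zeta> f = (\<Sum>i\<le>n. Const (\<zeta> i ^ (n + 1)) * Var i ^ (n + 1)) + Const lam * (Const (\<Prod>i\<le>n. \<zeta> i) * (\<Prod>i\<le>n. Var i))"
    unfolding dwork_poly_def scale_vars_add scale_vars_sum scale_vars_mult scale_vars_prod scale_vars_power
      scale_vars_Var scale_vars_Const power_mult_distrib prod.distrib Const_power Const_prod ..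
  also have "(\<Sum>i\<le>n. Const (\<zeta> i ^ (n + 1)) * Var i ^ (n + 1)) = (\<Sum>i\<le>n. Var i ^ (n + 1) :: 'f mpoly)"
    using groupD(1)[OF \<zeta>] by (intro sum.cong) (auto simp: Const_hom.h_1 simp del: power_Suc)
  also have "(\<Prod>i\<le>n. \<zeta> i) = 1" using \<zeta> by (simp add: dwork_group_def)
  finally show ?thesis by (simp add: dwork_poly_def Const_hom.h_1)
qed

definition ginv :: "(nat \<Rightarrow> 'f) \<Rightarrow> nat \<Rightarrow> 'f" where
  "ginv \<zeta> = (\<lambda>i\<in>{..n}. inverse (\<zeta> i))"

definition gmul :: "(nat \<Rightarrow> 'f) \<Rightarrow> (nat \<Rightarrow> 'f) \<Rightarrow> nat \<Rightarrow> 'f" where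
  "gmul \<zeta> \<eta> = (\<lambda>i\<in>{..n}. \<zeta> i * \<eta> i)"

definition gone :: "nat \<Rightarrow> 'f" where
  "gone = (\<lambda>i\<in>{..n}. 1)"

lemma ginv_group: "\<zeta> \<in> dwork_group n \<Longrightarrow> ginv \<zeta> \<in> dwork_group n"
proof -
  assume \<zeta>: "\<zeta> \<in> dwork_group n"
  have "(\<Prod>i\<le>n. ginv \<zeta> i) = inverse (\<Prod>i\<le>n. \<zeta> i)"
    unfolding prod_inversef[symmetric] by (intro prod.cong) (auto simp: ginv_def)
  moreover have "ginv \<zeta> i ^ (n + 1) = 1" if "i \<le> n" for i
    using groupD(1)[OF \<zeta> that] that by (simp add: ginv_def power_inverse del: power_Suc)
  ultimately show ?thesis using \<zeta> by (simp add: dwork_group_def ginv_def del: power_Suc)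
qed

lemma gmul_group: "\<zeta> \<in> dwork_group n \<Longrightarrow> \<eta> \<in> dwork_group n \<Longrightarrow> gmul \<zeta> \<eta> \<in> dwork_group n"
  by (simp add: dwork_group_def gmul_def power_mult_distrib prod.distrib del: power_Suc)

lemma gone_group: "gone \<in> dwork_group n"
  by (simp add: dwork_group_def gone_def)

definition \<phi> :: "(nat \<Rightarrow> 'f) \<Rightarrow> 'f mpoly set \<Rightarrow> 'f mpoly set" where
  "\<phi> \<zeta> = (`) (scale_vars \<zeta>)"

lemma scale_inv:
  assumes "\<zeta> \<in> dwork_group n" "P \<in> V"
  shows "scale_vars \<zeta> (scale_vars (ginv \<zeta>) P) = P" "scale_vars (ginv \<zeta>) (scale_vars \<zeta> P) = P"
proof -
  have "scale_vars \<zeta> (scale_vars (ginv \<zeta>) P) = scale_vars (\<lambda>_. 1) P"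
    using groupD(2)[OF assms(1)] by (intro scale_vars_scale_vars[OF assms(2)]) (auto simp: ginv_def)
  thus "scale_vars \<zeta> (scale_vars (ginv \<zeta>) P) = P" using scale_vars_id[OF assms(2)] by simp
  have "scale_vars (ginv \<zeta>) (scale_vars \<zeta> P) = scale_vars (\<lambda>_. 1) P"
    using groupD(2)[OF assms(1)] by (intro scale_vars_scale_vars[OF assms(2)]) (auto simp: ginv_def)
  thus "scale_vars (ginv \<zeta>) (scale_vars \<zeta> P) = P" using scale_vars_id[OF assms(2)] by simp
qed

lemma \<phi>_cl:
  assumes \<zeta>: "\<zeta> \<in> dwork_group n" and P: "P \<in> V"
  shows "\<phi> \<zeta> (cl P) = cl (scale_vars \<zeta> P)"
proof -
  have "\<phi> \<zeta> (cl P) = {scale_vars \<zeta> S * f + scale_vars \<zeta> P | S. S \<in> V}"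
  proof -
    have "\<phi> \<zeta> (cl P) = (\<lambda>S. scale_vars \<zeta> (S * f + P)) ` V" unfolding \<phi>_def cl_eq by blast
    also have "\<dots> = (\<lambda>S. scale_vars \<zeta> S * f + scale_vars \<zeta> P) ` V"
      by (simp add: scale_vars_add scale_vars_mult scale_f[OF \<zeta>])
    finally show ?thesis by blast
  qed
  also have "\<dots> = {S * f + scale_vars \<zeta> P | S. S \<in> V}"
  proof (intro equalityI subsetI; elim CollectE exE conjE)
    fix x S assume "x = scale_vars \<zeta> S * f + scale_vars \<zeta> P" "S \<in> V"
    thus "x \<in> {S * f + scale_vars \<zeta> P | S. S \<in> V}" using mpolys_scale_vars by blast
  next
    fix x S assume "x = S * f + scale_vars \<zeta> P" "S \<in> V"
    thus "x \<in> {scale_vars \<zeta> S * f + scale_vars \<zeta> P | S. S \<in> V}"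
      using scale_inv(1)[OF \<zeta>, of S] mpolys_scale_vars[of S _ "ginv \<zeta>"]
      by (intro CollectI exI[of _ "scale_vars (ginv \<zeta>) S"]) simp
  qed
  finally show ?thesis unfolding cl_eq .
qed

lemma \<phi>_hom:
  assumes \<zeta>: "\<zeta> \<in> dwork_group n"
  shows "\<phi> \<zeta> \<in> ring_hom A A"
proof (rule ring_hom_memI)
  show "\<phi> \<zeta> a \<in> carrier A" if "a \<in> carrier A" for a
  proof -
    obtain P where "a = cl P" "P \<in> V" using \<open>a \<in> carrier A\<close> by (auto simp: carrier_A)
    thus ?thesis by (simp add: \<phi>_cl[OF \<zeta>] mpolys_scale_vars cl_closed)
  qed
  show "\<phi> \<zeta> (a \<otimes>\<^bsub>A\<^esub> b) = \<phi> \<zeta> a \<otimes>\<^bsub>A\<^esub> \<phi> \<zeta> b" if "a \<in> carrier A" "b \<in> carrier A" for a b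
  proof -
    obtain P Q where "a = cl P" "b = cl Q" "P \<in> V" "Q \<in> V"
      using \<open>a \<in> carrier A\<close> \<open>b \<in> carrier A\<close> by (auto simp: carrier_A)
    thus ?thesis using \<phi>_cl[OF \<zeta>]
      by (simp add: cl_mult[symmetric] mpolys_mult mpolys_scale_vars scale_vars_mult)
  qed
  show "\<phi> \<zeta> (a \<oplus>\<^bsub>A\<^esub> b) = \<phi> \<zeta> a \<oplus>\<^bsub>A\<^esub> \<phi> \<zeta> b" if "a \<in> carrier A" "b \<in> carrier A" for a b
  proof -
    obtain P Q where "a = cl P" "b = cl Q" "P \<in> V" "Q \<in> V"
      using \<open>a \<in> carrier A\<close> \<open>b \<in> carrier A\<close> by (auto simp: carrier_A)
    thus ?thesis using \<phi>_cl[OF \<zeta>]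
      by (simp add: cl_add[symmetric] mpolys_add mpolys_scale_vars scale_vars_add)
  qed
  show "\<phi> \<zeta> \<one>\<^bsub>A\<^esub> = \<one>\<^bsub>A\<^esub>" using \<phi>_cl[OF \<zeta>, of 1] by (simp add: cl_1 scale_vars_1)
qed

lemma \<phi>_D: "\<zeta> \<in> dwork_group n \<Longrightarrow> a \<in> D i \<Longrightarrow> \<phi> \<zeta> a \<in> D i"
proof -
  assume *: "\<zeta> \<in> dwork_group n" "a \<in> D i"
  then obtain P where "a = cl P" "P \<in> V" "homog i P" by (auto simp: D_eq)
  thus ?thesis by (simp add: \<phi>_cl[OF *(1)] mpolys_scale_vars homog_scale_vars cl_D)
qed

lemma \<phi>_inv:
  assumes "\<zeta> \<in> dwork_group n" "a \<in> carrier A"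
  shows "\<phi> \<zeta> (\<phi> (ginv \<zeta>) a) = a" "\<phi> (ginv \<zeta>) (\<phi> \<zeta> a) = a"
proof -
  obtain P where P: "a = cl P" "P \<in> V" using assms(2) by (auto simp: carrier_A)
  show "\<phi> \<zeta> (\<phi> (ginv \<zeta>) a) = a" "\<phi> (ginv \<zeta>) (\<phi> \<zeta> a) = a"
    using P scale_inv[OF assms(1)] \<phi>_cl[OF assms(1)] \<phi>_cl[OF ginv_group[OF assms(1)]]
    by (simp_all add: mpolys_scale_vars)
qed

definition gact :: "(nat \<Rightarrow> 'f) \<Rightarrow> 'f mpoly set set \<Rightarrow> 'f mpoly set set" where
  "gact \<zeta> p = {a \<in> carrier A. \<phi> \<zeta> a \<in> p}"

lemma preimage_ideal:
  assumes \<zeta>: "\<zeta> \<in> dwork_group n" and M: "ideal M A"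
  shows "ideal (gact \<zeta> M) A"
proof -
  have "ring_hom_ring A A (\<phi> \<zeta>)"
    using \<phi>_hom[OF \<zeta>] A.ring_axioms by (intro ring_hom_ringI2)
  hence "ideal {r \<in> carrier A. \<phi> \<zeta> r \<in> M} A" using M by (rule ring_hom_ring.ideal_vimage)
  thus ?thesis by (simp add: gact_def)
qed

text \<open>
  The preimage of a homogeneous prime under a graded automorphism; the inverse automorphism is used to
  see that it is generated by homogeneous elements.
\<close>

lemma gact_Pts:
  assumes \<zeta>: "\<zeta> \<in> dwork_group n" and p: "p \<in> Pts"
  shows "gact \<zeta> p \<in> Pts"
proof -
  note h = \<phi>_hom[OF \<zeta>]
  have id: "ideal (gact \<zeta> p) A" by (rule preimage_ideal[OF \<zeta> Pts_ideal[OF p]])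
  have "primeideal (gact \<zeta> p) A"
  proof (rule primeidealI[OF id A_cring])
    show "carrier A \<noteq> gact \<zeta> p"
    proof
      assume "carrier A = gact \<zeta> p"
      hence "\<one>\<^bsub>A\<^esub> \<in> gact \<zeta> p" by auto
      thus False using one_notin[OF p] ring_hom_one[OF h] by (simp add: gact_def)
    qed
    fix a b assume "a \<in> carrier A" "b \<in> carrier A" "a \<otimes>\<^bsub>A\<^esub> b \<in> gact \<zeta> p"
    thus "a \<in> gact \<zeta> p \<or> b \<in> gact \<zeta> p"
      using ring_hom_mult[OF h] ring_hom_closed[OF h] mult_in_iff[OF p] by (auto simp: gact_def)
  qed
  moreover have "genideal A (gact \<zeta> p \<inter> homogeneous D) = gact \<zeta> p"
  proof
    let ?G = "genideal A (gact \<zeta> p \<inter> homogeneous D)"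
    show "?G \<subseteq> gact \<zeta> p" by (rule A.genideal_minimal[OF id]) blast
    have sub: "gact \<zeta> p \<inter> homogeneous D \<subseteq> carrier A" by (auto simp: gact_def)
    have idG: "ideal ?G A" by (rule A.genideal_ideal[OF sub])
    have "ideal (gact (ginv \<zeta>) ?G) A" by (rule preimage_ideal[OF ginv_group[OF \<zeta>] idG])
    moreover have "p \<inter> homogeneous D \<subseteq> gact (ginv \<zeta>) ?G"
    proof
      fix a assume a: "a \<in> p \<inter> homogeneous D"
      then obtain d where d: "a \<in> D d" by (auto simp: homogeneous_def)
      have aA: "a \<in> carrier A" using d by (rule D_closed)
      have "\<phi> (ginv \<zeta>) a \<in> D d" by (rule \<phi>_D[OF ginv_group[OF \<zeta>] d])
      hence "\<phi> (ginv \<zeta>) a \<in> gact \<zeta> p \<inter> homogeneous D"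
        using a \<phi>_inv(1)[OF \<zeta> aA] D_closed D_hom by (simp add: gact_def)
      hence "\<phi> (ginv \<zeta>) a \<in> ?G" using A.genideal_self[OF sub] by blast
      thus "a \<in> gact (ginv \<zeta>) ?G" using aA by (simp add: gact_def)
    qed
    ultimately have "genideal A (p \<inter> homogeneous D) \<subseteq> gact (ginv \<zeta>) ?G" by (rule A.genideal_minimal)
    hence p_sub: "p \<subseteq> gact (ginv \<zeta>) ?G" using p by (simp add: Pts_def)
    show "gact \<zeta> p \<subseteq> ?G"
    proof
      fix a assume a: "a \<in> gact \<zeta> p"
      hence "\<phi> \<zeta> a \<in> gact (ginv \<zeta>) ?G" using p_sub by (auto simp: gact_def)
      thus "a \<in> ?G" using \<phi>_inv(2)[OF \<zeta>, of a] a by (simp add: gact_def)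
    qed
  qed
  moreover have "\<not> (\<Union>d \<in> {0<..}. D d) \<subseteq> gact \<zeta> p"
  proof
    assume sub: "(\<Union>d \<in> {0<..}. D d) \<subseteq> gact \<zeta> p"
    have "(\<Union>d \<in> {0<..}. D d) \<subseteq> p"
    proof
      fix a assume "a \<in> (\<Union>d \<in> {0<..}. D d)"
      then obtain d where d: "d > 0" "a \<in> D d" by auto
      have "\<phi> (ginv \<zeta>) a \<in> D d" by (rule \<phi>_D[OF ginv_group[OF \<zeta>] d(2)])
      hence "\<phi> (ginv \<zeta>) a \<in> gact \<zeta> p" using sub d by blast
      thus "a \<in> p" using \<phi>_inv(1)[OF \<zeta> D_closed[OF d(2)]] by (simp add: gact_def)
    qed
    thus False using p by (simp add: Pts_def)
  qed
  ultimately show ?thesis by (simp add: Pts_def)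
qed

end

section \<open>Geometric points\<close>

text \<open>
  A polynomial of degree below \<open>|E|\<close> in each variable that vanishes on the grid \<open>E\<^sup>S\<close> is zero. Induction
  on the variables: for fixed values of the others, the coefficients of the powers of one variable are
  those of a polynomial with too many roots.
\<close>

lemma grid_vanishing:
  fixes E :: "'k :: idom set" and S :: "'i set"
  assumes "finite S" "r \<le> card E" "finite E"
    and "\<And>y. y \<in> PiE S (\<lambda>_. E) \<Longrightarrow> (\<Sum>a\<in>PiE S (\<lambda>_. {..<r}). c a * (\<Prod>j\<in>S. y j ^ a j)) = 0"
    and "a \<in> PiE S (\<lambda>_. {..<r})"
  shows "c a = 0"
  using assms(1,4,5)
proof (induction S arbitrary: c a rule: finite_induct)
  case empty
  thus ?case using empty(1)[of "\<lambda>_. undefined"] by auto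
next
  case (insert j S)
  define M where "M = PiE S (\<lambda>_. {..<r})"
  have step: "(\<Sum>a\<in>M. c (a(j := b)) * (\<Prod>i\<in>S. y i ^ a i)) = 0" if y: "y \<in> PiE S (\<lambda>_. E)" and b: "b < r" for y b
  proof -
    define g where "g b = (\<Sum>a\<in>M. c (a(j := b)) * (\<Prod>i\<in>S. y i ^ a i))" for b
    define R where "R = (\<Sum>b<r. Polynomial.monom (g b) b)"
    have "Polynomial.poly R t = 0" if t: "t \<in> E" for t
    proof -
      have yt: "y(j := t) \<in> PiE (insert j S) (\<lambda>_. E)" using y t by (auto simp: PiE_iff extensional_def)
      have inj: "inj_on (\<lambda>(b, a). a(j := b)) ({..<r} \<times> M)"
      proof (rule inj_onI)
        fix u v assume uv: "u \<in> {..<r} \<times> M" "v \<in> {..<r} \<times> M" "(case u of (b, a) \<Rightarrow> a(j := b)) = (case v of (b, a) \<Rightarrow> a(j := b))"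
        obtain b a b' a' where [simp]: "u = (b, a)" "v = (b', a')" by force
        have eq: "a(j := b) = a'(j := b')" using uv by simp
        have "a i = a' i" for i
        proof (cases "i = j")
          case True
          thus ?thesis using uv insert.hyps by (auto simp: M_def PiE_iff extensional_def)
        next
          case False
          thus ?thesis using fun_cong[OF eq, of i] by simp
        qed
        moreover have "b = b'" using fun_cong[OF eq, of j] by simp
        ultimately show "u = v" by auto
      qed
      have "0 = (\<Sum>a\<in>PiE (insert j S) (\<lambda>_. {..<r}). c a * (\<Prod>i\<in>insert j S. (y(j := t)) i ^ a i))"
        using insert.prems(1)[OF yt] by simp
      also have "PiE (insert j S) (\<lambda>_. {..<r}) = (\<lambda>(b, a). a(j := b)) ` ({..<r} \<times> M)"
        unfolding M_def by (rule PiE_insert_eq)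
      also have "(\<Sum>a\<in>(\<lambda>(b, a). a(j := b)) ` ({..<r} \<times> M). c a * (\<Prod>i\<in>insert j S. (y(j := t)) i ^ a i))
          = (\<Sum>(b, a)\<in>{..<r} \<times> M. c (a(j := b)) * (t ^ b * (\<Prod>i\<in>S. y i ^ a i)))"
        unfolding sum.reindex[OF inj]
      proof (intro sum.cong refl)
        fix u assume "u \<in> {..<r} \<times> M"
        obtain b a where [simp]: "u = (b, a)" by force
        have "(\<Prod>i\<in>S. (y(j := t)) i ^ (a(j := b)) i) = (\<Prod>i\<in>S. y i ^ a i)"
          using insert.hyps by (intro prod.cong) auto
        thus "((\<lambda>a. c a * (\<Prod>i\<in>insert j S. (y(j := t)) i ^ a i)) \<circ> (\<lambda>(b, a). a(j := b))) u
            = (case u of (b, a) \<Rightarrow> c (a(j := b)) * (t ^ b * (\<Prod>i\<in>S. y i ^ a i)))"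
          using insert.hyps by simp
      qed
      also have "\<dots> = (\<Sum>b<r. \<Sum>a\<in>M. c (a(j := b)) * (t ^ b * (\<Prod>i\<in>S. y i ^ a i)))"
        by (rule sum.cartesian_product[symmetric])
      also have "\<dots> = Polynomial.poly R t"
        by (simp add: R_def g_def poly_sum poly_monom sum_distrib_left sum_distrib_right ac_simps)
      finally show ?thesis by simp
    qed
    hence "E \<subseteq> {t. Polynomial.poly R t = 0}" by blast
    moreover have "R = 0"
    proof (rule ccontr)
      assume R: "R \<noteq> 0"
      have "Polynomial.degree R < r"
        unfolding R_def using b by (intro degree_sum_less) (auto intro: le_less_trans[OF Polynomial.degree_monom_le])
      moreover have "card E \<le> card {t. Polynomial.poly R t = 0}"
        using \<open>E \<subseteq> _\<close> by (intro card_mono poly_roots_finite R)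
      ultimately show False using card_poly_roots_bound[OF R] assms(2) by simp
    qed
    ultimately have "Polynomial.coeff R b = 0" by simp
    thus ?thesis using b by (simp add: R_def coeff_sum g_def)
  qed
  obtain b a' where a: "a = a'(j := b)" "b < r" "a' \<in> M"
  proof -
    have "a \<in> (\<lambda>(b, a). a(j := b)) ` ({..<r} \<times> M)"
      using insert.prems(2) by (simp only: PiE_insert_eq M_def)
    then obtain u where "u \<in> {..<r} \<times> M" "a = (\<lambda>(b, a). a(j := b)) u" by (rule imageE)
    thus ?thesis using that[of "snd u" "fst u"] by (simp add: case_prod_beta mem_Times_iff)
  qed
  have "c (a'(j := b)) = 0"
    by (rule insert.IH[of "\<lambda>a. c (a(j := b))"])
       (rule step[OF _ a(2), unfolded M_def], assumption, rule a(3)[unfolded M_def])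
  thus ?case unfolding a(1) .
qed

interpretation ac: coeff_hom "to_ac :: 'f :: field \<Rightarrow> 'f alg_closure"
  by unfold_locales simp_all

context dwork
begin

abbreviation at_pt :: "(nat \<Rightarrow> 'f alg_closure) \<Rightarrow> 'f mpoly \<Rightarrow> 'f alg_closure" where
  "at_pt \<equiv> mpoly_eval to_ac"

text \<open>
  A nonzero point of the affine cone, that is, a vector of homogeneous coordinates of a geometric point
  of the hypersurface.
\<close>

definition cone_point :: "(nat \<Rightarrow> 'f alg_closure) \<Rightarrow> bool" where
  "cone_point x \<longleftrightarrow> (\<exists>i\<le>n. x i \<noteq> 0) \<and> at_pt x f = 0"

definition ev :: "(nat \<Rightarrow> 'f alg_closure) \<Rightarrow> 'f mpoly set \<Rightarrow> 'f alg_closure" where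
  "ev x = on_class (at_pt x)"

definition lev :: "(nat \<Rightarrow> 'f alg_closure) \<Rightarrow> 'f mpoly set \<Rightarrow> 'f alg_closure Polynomial.poly" where
  "lev x = on_class (line_eval to_ac x)"

text \<open>
  The homogeneous prime of the projective point with coordinates \<open>x\<close>: the functions that vanish on the
  line spanned by \<open>x\<close>.
\<close>

definition point_prime :: "(nat \<Rightarrow> 'f alg_closure) \<Rightarrow> 'f mpoly set set" where
  "point_prime x = {c \<in> carrier A. lev x c = 0}"

lemma at_f: "at_pt x f = (\<Sum>i\<le>n. x i ^ (n + 1)) + to_ac lam * (\<Prod>i\<le>n. x i)"
  by (simp add: dwork_poly_def ac.eval_add ac.eval_sum ac.eval_mult ac.eval_prod ac.eval_power del: power_Suc)

lemma ev_cl: "cone_point x \<Longrightarrow> P \<in> V \<Longrightarrow> ev x (cl P) = at_pt x P"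
  unfolding ev_def by (rule on_class) (auto simp: cone_point_def ac.eval_add ac.eval_mult)

interpretation line: coeff_hom "\<lambda>c. [:to_ac c :: 'f alg_closure:]" by (rule ac.line_hom)

lemma line_add: "line_eval to_ac x (P + Q) = line_eval to_ac x P + line_eval to_ac x Q"
  and line_mult: "line_eval to_ac x (P * Q) = line_eval to_ac x P * line_eval to_ac x Q"
  and line_1: "line_eval to_ac x 1 = 1"
  for x :: "nat \<Rightarrow> 'f alg_closure"
  unfolding line_eval_def by (rule line.eval_add, rule line.eval_mult, rule line.eval_1)

lemma line_f: "cone_point x \<Longrightarrow> line_eval to_ac x f = 0"
  by (simp add: line_eval_homog[OF homog_f] cone_point_def)

lemma lev_cl: "cone_point x \<Longrightarrow> P \<in> V \<Longrightarrow> lev x (cl P) = line_eval to_ac x P"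
  unfolding lev_def by (rule on_class) (simp_all add: line_add line_mult line_f)

lemma point_prime_cl: "cone_point x \<Longrightarrow> P \<in> V \<Longrightarrow> cl P \<in> point_prime x \<longleftrightarrow> line_eval to_ac x P = 0"
  by (simp add: point_prime_def cl_closed lev_cl)

lemma point_prime_homog: "cone_point x \<Longrightarrow> P \<in> V \<Longrightarrow> homog d P \<Longrightarrow> cl P \<in> point_prime x \<longleftrightarrow> at_pt x P = 0"
  by (simp add: point_prime_cl line_eval_homog)

lemma lev_hom:
  assumes x: "cone_point x"
  shows "ring_hom_ring A (ring_on UNIV) (lev x)"
proof -
  have "cring (ring_on (UNIV :: 'f alg_closure Polynomial.poly set))" by (rule ring_on_cring) auto
  hence r: "ring (ring_on (UNIV :: 'f alg_closure Polynomial.poly set))" by (simp add: cring_def)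
  have "lev x \<in> ring_hom A (ring_on UNIV)"
  proof (rule ring_hom_memI)
    fix a b assume "a \<in> carrier A" "b \<in> carrier A"
    then obtain P Q where "a = cl P" "b = cl Q" "P \<in> V" "Q \<in> V" by (auto simp: carrier_A)
    thus "lev x (a \<otimes>\<^bsub>A\<^esub> b) = lev x a \<otimes>\<^bsub>ring_on UNIV\<^esub> lev x b"
      "lev x (a \<oplus>\<^bsub>A\<^esub> b) = lev x a \<oplus>\<^bsub>ring_on UNIV\<^esub> lev x b"
      using x by (simp_all add: cl_mult[symmetric] cl_add[symmetric] lev_cl mpolys_mult mpolys_add line_mult line_add)
  next
    show "lev x \<one>\<^bsub>A\<^esub> = \<one>\<^bsub>ring_on UNIV\<^esub>"
      using x by (simp add: cl_1[symmetric] lev_cl line_1)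
  qed simp
  thus ?thesis using A.ring_axioms r by (intro ring_hom_ringI2)
qed

lemma point_prime_Pts:
  assumes x: "cone_point x"
  shows "point_prime x \<in> Pts"
proof -
  have "ideal (a_kernel A (ring_on UNIV) (lev x)) A" by (rule ring_hom_ring.kernel_is_ideal[OF lev_hom[OF x]])
  hence id: "ideal (point_prime x) A" unfolding a_kernel_def' point_prime_def by simp
  have mult: "lev x (a \<otimes>\<^bsub>A\<^esub> b) = lev x a * lev x b" if "a \<in> carrier A" "b \<in> carrier A" for a b
    using ring_hom_mult[OF ring_hom_ring.homh[OF lev_hom[OF x]] that] by simp
  have "primeideal (point_prime x) A"
  proof (rule primeidealI[OF id A_cring])
    have "\<one>\<^bsub>A\<^esub> \<notin> point_prime x" using x by (simp add: cl_1[symmetric] point_prime_cl line_1)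
    thus "carrier A \<noteq> point_prime x" by auto
    fix a b assume "a \<in> carrier A" "b \<in> carrier A" "a \<otimes>\<^bsub>A\<^esub> b \<in> point_prime x"
    thus "a \<in> point_prime x \<or> b \<in> point_prime x" by (simp add: point_prime_def mult)
  qed
  moreover have "genideal A (point_prime x \<inter> homogeneous D) = point_prime x"
  proof
    show "genideal A (point_prime x \<inter> homogeneous D) \<subseteq> point_prime x" by (rule A.genideal_minimal[OF id]) blast
    have sub: "point_prime x \<inter> homogeneous D \<subseteq> carrier A" by (auto simp: point_prime_def)
    show "point_prime x \<subseteq> genideal A (point_prime x \<inter> homogeneous D)"
    proof
      fix c assume c: "c \<in> point_prime x"
      then obtain P where P: "c = cl P" "P \<in> V" by (auto simp: point_prime_def carrier_A)
      have "line_eval to_ac x P = 0" using c P point_prime_cl[OF x] by simp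
      hence z: "at_pt x (hcomp d P) = 0" for d using ac.coeff_line_eval[of x P d] by simp
      have "cl (\<Sum>d\<in>mono_degree ` Poly_Mapping.keys P. hcomp d P) \<in> genideal A (point_prime x \<inter> homogeneous D)"
      proof (rule cl_sum_in_ideal[OF A.genideal_ideal[OF sub]])
        fix d
        have hV: "hcomp d P \<in> V" using P by (intro mpolys_hcomp)
        hence "cl (hcomp d P) \<in> point_prime x \<inter> homogeneous D"
          using point_prime_homog[OF x hV homog_hcomp] z cl_D[OF hV homog_hcomp] D_hom by blast
        thus "hcomp d P \<in> V \<and> cl (hcomp d P) \<in> genideal A (point_prime x \<inter> homogeneous D)"
          using hV A.genideal_self[OF sub] by blast
      qed
      thus "c \<in> genideal A (point_prime x \<inter> homogeneous D)" by (simp add: sum_hcomp P)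
    qed
  qed
  moreover have "\<not> (\<Union>d \<in> {0<..}. D d) \<subseteq> point_prime x"
  proof -
    obtain i where i: "i \<le> n" "x i \<noteq> 0" using x by (auto simp: cone_point_def)
    have iV: "Var i \<in> V" using i by (intro mpolys_Var) simp
    have "cl (Var i) \<notin> point_prime x" using point_prime_homog[OF x iV homog_Var] i by simp
    moreover have "cl (Var i) \<in> D 1" by (rule cl_D[OF iV homog_Var])
    ultimately show ?thesis by auto
  qed
  ultimately show ?thesis by (simp add: Pts_def)
qed

lemma at_scale: "at_pt x (scale_vars \<zeta> P) = at_pt (\<lambda>i. to_ac (\<zeta> i) * x i) P"
  by (rule ac.eval_scale_vars)

lemma cone_point_act:
  assumes "\<zeta> \<in> dwork_group n" "cone_point x"
  shows "cone_point (\<lambda>i. to_ac (\<zeta> i) * x i)"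
  using assms groupD(2)[OF assms(1)] at_scale[of x \<zeta> f] by (auto simp: cone_point_def scale_f)

lemma gact_point_prime:
  assumes \<zeta>: "\<zeta> \<in> dwork_group n" and x: "cone_point x"
  shows "gact \<zeta> (point_prime x) = point_prime (\<lambda>i. to_ac (\<zeta> i) * x i)"
proof (rule Pts_eqI)
  show "gact \<zeta> (point_prime x) \<in> Pts" by (rule gact_Pts[OF \<zeta> point_prime_Pts[OF x]])
  show "point_prime (\<lambda>i. to_ac (\<zeta> i) * x i) \<in> Pts" by (rule point_prime_Pts[OF cone_point_act[OF \<zeta> x]])
  fix P d assume P: "P \<in> V" "homog d P"
  have "cl P \<in> gact \<zeta> (point_prime x) \<longleftrightarrow> cl (scale_vars \<zeta> P) \<in> point_prime x"
    using P by (simp add: gact_def cl_closed \<phi>_cl[OF \<zeta>])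
  also have "\<dots> \<longleftrightarrow> at_pt (\<lambda>i. to_ac (\<zeta> i) * x i) P = 0"
    using point_prime_homog[OF x mpolys_scale_vars[OF P(1)] homog_scale_vars[OF P(2)]] by (simp add: at_scale)
  also have "\<dots> \<longleftrightarrow> cl P \<in> point_prime (\<lambda>i. to_ac (\<zeta> i) * x i)" using point_prime_homog[OF cone_point_act[OF \<zeta> x] P] by simp
  finally show "cl P \<in> gact \<zeta> (point_prime x) \<longleftrightarrow> cl P \<in> point_prime (\<lambda>i. to_ac (\<zeta> i) * x i)" .
qed

lemma cone_point_scale: "cone_point x \<Longrightarrow> t \<noteq> 0 \<Longrightarrow> cone_point (\<lambda>i. t * x i)"
  by (auto simp: cone_point_def ac.eval_homog_scale[OF homog_f])

lemma point_prime_scale: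
  assumes x: "cone_point x" and t: "t \<noteq> 0"
  shows "point_prime (\<lambda>i. t * x i) = point_prime x"
proof (rule Pts_eqI[OF point_prime_Pts[OF cone_point_scale[OF assms]] point_prime_Pts[OF x]])
  fix P d assume P: "P \<in> V" "homog d P"
  show "cl P \<in> point_prime (\<lambda>i. t * x i) \<longleftrightarrow> cl P \<in> point_prime x"
    using point_prime_homog[OF x P] point_prime_homog[OF cone_point_scale[OF assms] P] t by (simp add: ac.eval_homog_scale[OF P(2)])
qed

lemma cone_point_cong: "(\<And>i. i \<le> n \<Longrightarrow> x i = y i) \<Longrightarrow> cone_point x \<longleftrightarrow> cone_point y"
  using eval_cong_mpolys[OF f_V, of x y] by (auto simp: cone_point_def)

lemma point_prime_cong:
  assumes "\<And>i. i \<le> n \<Longrightarrow> x i = y i" "cone_point x"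
  shows "point_prime x = point_prime y"
proof -
  have y: "cone_point y" using assms cone_point_cong by blast
  show ?thesis
  proof (rule Pts_eqI[OF point_prime_Pts[OF assms(2)] point_prime_Pts[OF y]])
    fix P d assume P: "P \<in> V" "homog d P"
    have "at_pt x P = at_pt y P" using assms(1) by (intro eval_cong_mpolys[OF P(1)]) simp
    thus "cl P \<in> point_prime x \<longleftrightarrow> cl P \<in> point_prime y" using point_prime_homog[OF y P] point_prime_homog[OF assms(2) P] by simp
  qed
qed

subsection \<open>Closed points are geometric points\<close>

text \<open>
  The relations force the coordinates, normalised by \<open>x\<^sub>i\<^sub>0 = 1\<close>, into the finite set \<open>E\<close> of solutions of
  \<open>x\<^sup>r = x\<close>, so only the finitely many points \<open>T\<close> of the grid \<open>E\<^sup>n\<close> come into question. By means of the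
  relations every form can be reduced modulo \<open>p\<close> to exponents below \<open>r\<close>; hence a form that
  vanishes on \<open>T\<close> lies in \<open>p\<close> (\<open>kernel\<close>).
  If at every point of \<open>T\<close> some form in \<open>p\<close> did not vanish, then these could be combined to a form \<open>G\<close> in \<open>p\<close>
  that is \<open>1\<close> on all of \<open>T\<close>. Then \<open>G\<close> agrees on \<open>T\<close> with a power of the variable \<open>i0\<close>, which would lie in
  \<open>p\<close>. So all forms in \<open>p\<close> vanish at some \<open>x\<close> in \<open>T\<close>. Conversely, let \<open>P\<close> be a form that vanishes at \<open>x\<close>,
  and \<open>W\<close> the difference of its \<open>(r - 1)\<close>-th power and the power of the variable \<open>i0\<close> of the same degree.
  Then \<open>P W\<close> vanishes on \<open>T\<close> and lies in \<open>p\<close>, but \<open>W\<close> does not, as it is \<open>-1\<close> at \<open>x\<close>; so \<open>P\<close> lies in \<open>p\<close>.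
\<close>

lemma closed_point:
  fixes r :: nat and i0 :: nat
  assumes p: "p \<in> Pts" and i0: "i0 \<le> n" "cl (Var i0) \<notin> p"
    and r: "r > 1" "card {x :: 'f alg_closure. x ^ r = x} = r"
    and frob: "\<And>c :: 'f. c ^ r = c" "\<And>x y :: 'f alg_closure. (x + y) ^ r = x ^ r + y ^ r"
    and rel: "\<And>j. j \<le> n \<Longrightarrow> cl (Var j ^ r - Var j * Var i0 ^ (r - 1)) \<in> p"
  shows "\<exists>x. cone_point x \<and> x i0 = 1 \<and> point_prime x = p"
proof -
  define E where "E = {x :: 'f alg_closure. x ^ r = x}"
  have finE: "finite E" unfolding E_def by (rule finite_power_eq_self[OF r(1)])
  have E1: "1 \<in> E" by (simp add: E_def)
  \<comment> \<open>The arithmetic takes place in the preimage of \<open>p\<close> in the polynomial ring.\<close>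
  define M where "M = {P \<in> V. cl P \<in> p}"
  have M_add: "P + Q \<in> M" if "P \<in> M" "Q \<in> M" for P Q
    using that cl_in_prime_add[OF p] mpolys_add by (auto simp: M_def)
  have M_mult: "P * Q \<in> M" if "P \<in> M" "Q \<in> V" for P Q
    using that cl_in_prime_mult[OF p] mpolys_mult by (auto simp: M_def)
  have M_0: "0 \<in> M"
    using additive_subgroup.zero_closed[OF ideal.axioms(1)[OF Pts_ideal[OF p]]] by (simp add: M_def cl_0)
  have M_diff: "P - Q \<in> M" if "P \<in> M" "Q \<in> M" for P Q
  proof -
    have "- 1 \<in> V" by (intro mpolys_uminus mpolys_1)
    thus ?thesis using M_add[OF that(1) M_mult[OF that(2), of "- 1"]] by simp
  qed
  have M_sum: "sum g S \<in> M" if "\<And>s. s \<in> S \<Longrightarrow> g s \<in> M" for g and S :: "'s set"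
    using that by (induction S rule: infinite_finite_induct) (auto intro: M_0 M_add)
  have M_trans: "P - R \<in> M" if "P - Q \<in> M" "Q - R \<in> M" for P Q R
    using M_add[OF that] by simp
  have M_mult2: "P * P' - Q * Q' \<in> M" if "P - Q \<in> M" "P' - Q' \<in> M" "P' \<in> V" "Q \<in> V" for P P' Q Q'
  proof -
    have "P * P' - Q * Q' = (P - Q) * P' + (P' - Q') * Q" by (simp add: algebra_simps)
    thus ?thesis using M_add[OF M_mult[OF that(1,3)] M_mult[OF that(2,4)]] by simp
  qed
  have M_prod: "(\<Prod>s\<in>S. g s) - (\<Prod>s\<in>S. g' s) \<in> M"
    if "\<And>s. s \<in> S \<Longrightarrow> g s - g' s \<in> M \<and> g s \<in> V \<and> g' s \<in> V" for g g' and S :: "nat set"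
    using that
  proof (induction S rule: infinite_finite_induct)
    case (insert s S)
    hence "g s * (\<Prod>s\<in>S. g s) - g' s * (\<Prod>s\<in>S. g' s) \<in> M"
      by (intro M_mult2 mpolys_prod) auto
    thus ?case using insert by simp
  qed (auto simp: M_0)
  have VarV: "Var j \<in> V" if "j \<le> n" for j using that by (intro mpolys_Var) simp
  define s where "s = r - 1"
  have s: "r = Suc s" "s > 0" using r by (auto simp: s_def)
  \<comment> \<open>\<open>red e\<close> is the exponent below \<open>r\<close> with the same power function on \<open>E\<close>.\<close>
  define red where "red e = (if e = 0 then 0 else Suc ((e - 1) mod s))" for e :: nat
  have red_lt: "red e < r" for e using mod_less_divisor[OF s(2), of "e - 1"] by (simp add: red_def s)
  have red_le: "red e \<le> e" for e
    using mod_less_eq_dividend[of "e - 1" s] by (cases e) (auto simp: red_def)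
  have red_add: "red (Suc e + s) = red (Suc e)" for e by (simp add: red_def)
  have reduce: "Var j ^ e - Var j ^ red e * Var i0 ^ (e - red e) \<in> M" if j: "j \<le> n" for j e
  proof (induction e rule: less_induct)
    case (less e)
    show ?case
    proof (cases "e < r")
      case True
      hence "red e = e" by (cases e) (auto simp: red_def s)
      thus ?thesis using M_0 by simp
    next
      case False
      define d where "d = e - r"
      have d: "e = Suc d + s" using False s by (simp add: d_def)
      have "Var j ^ r - Var j * Var i0 ^ s \<in> M"
        using rel[OF j] j i0 by (auto simp: M_def s_def intro!: mpolys_diff mpolys_power mpolys_mult VarV)
      hence "(Var j ^ r - Var j * Var i0 ^ s) * Var j ^ d \<in> M"
        using j by (intro M_mult mpolys_power VarV)
      moreover have "Var j ^ e - Var j ^ Suc d * Var i0 ^ s = (Var j ^ r - Var j * Var i0 ^ s) * (Var j ^ d :: 'f mpoly)"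
        by (simp add: d s power_add algebra_simps)
      ultimately have 1: "Var j ^ e - Var j ^ Suc d * Var i0 ^ s \<in> M" by simp
      have "(Var j ^ Suc d - Var j ^ red (Suc d) * Var i0 ^ (Suc d - red (Suc d))) * Var i0 ^ s \<in> M"
        using i0 s d by (intro M_mult less.IH mpolys_power VarV) auto
      moreover have "e - red e = (Suc d - red (Suc d)) + s"
        using red_le[of "Suc d"] by (simp only: d red_add)
      hence "Var i0 ^ (e - red e) = Var i0 ^ (Suc d - red (Suc d)) * (Var i0 ^ s :: 'f mpoly)"
        by (simp only: power_add)
      moreover have "red e = red (Suc d)" by (simp only: d red_add)
      ultimately have "Var j ^ Suc d * Var i0 ^ s - Var j ^ red e * Var i0 ^ (e - red e) \<in> M"
        by (simp only: left_diff_distrib mult.assoc)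
      thus ?thesis by (rule M_trans[OF 1])
    qed
  qed
  define S where "S = {..n} - {i0}"
  define T where "T = {x \<in> PiE {..n} (\<lambda>_. E). x i0 = 1}"
  \<comment> \<open>The monomial of degree \<open>d\<close> with exponents \<open>a\<close>, made homogeneous by the variable \<open>i0\<close>.\<close>
  define N where "N d a = (\<Prod>j\<in>S. Var j ^ a j) * (Var i0 ^ (d - sum a S) :: 'f mpoly)" for d and a :: "nat \<Rightarrow> nat"
  have NV: "N d a \<in> V" for d a
    unfolding N_def using i0 by (intro mpolys_mult mpolys_prod mpolys_power VarV) (auto simp: S_def)
  have at_N: "at_pt x (N d a) = (\<Prod>j\<in>S. x j ^ a j)" if "x i0 = 1" for x d a
    using that by (simp add: N_def ac.eval_mult ac.eval_prod ac.eval_power)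
  define ra where "ra m = (\<lambda>j\<in>S. red (Poly_Mapping.lookup m j))" for m :: "nat \<Rightarrow>\<^sub>0 nat"
  have ra_PiE: "ra m \<in> PiE S (\<lambda>_. {..<r})" for m using red_lt by (auto simp: ra_def)
  have at_pow: "x ^ red e = x ^ e" if x: "x \<in> E" for x e
  proof -
    have step: "x ^ (Suc d + s) = x ^ Suc d" for d
    proof -
      have "x ^ (Suc d + s) = x ^ d * x ^ r" by (simp add: s flip: power_add)
      also have "x ^ r = x" using x by (simp add: E_def)
      finally show ?thesis by (simp add: mult.commute)
    qed
    have *: "x ^ (Suc d + s * l) = x ^ Suc d" for d l
    proof (induction l)
      case (Suc l)
      have "Suc d + s * Suc l = Suc (d + s * l) + s" by simp
      hence "x ^ (Suc d + s * Suc l) = x ^ Suc (d + s * l)" using step by metis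
      thus ?case using Suc.IH by (simp only: add_Suc)
    qed simp
    show ?thesis
    proof (cases e)
      case (Suc d)
      have "e = Suc (d mod s) + s * (d div s)" using Suc by simp
      hence "x ^ e = x ^ (Suc (d mod s) + s * (d div s))" by (rule arg_cong)
      also have "\<dots> = x ^ Suc (d mod s)" by (rule *)
      finally show ?thesis by (auto simp: red_def Suc)
    qed (simp add: red_def)
  qed
  have mono_red: "Poly_Mapping.single m c - Const c * N (mono_degree m) (ra m) \<in> M"
    if m: "Poly_Mapping.keys m \<subseteq> {..n}" for m and c :: 'f
  proof -
    have split: "{..n} = insert i0 S" "i0 \<notin> S" "finite S" using i0 by (auto simp: S_def)
    have "(\<Prod>j\<in>{..n}. Var j ^ Poly_Mapping.lookup m j) = (Poly_Mapping.single m 1 :: 'f mpoly)"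
      using m by (subst monom_eval_superset[symmetric]) (auto simp: monom_eval_Var)
    hence eq: "Poly_Mapping.single m c = Const c * ((\<Prod>j\<in>S. Var j ^ Poly_Mapping.lookup m j) * Var i0 ^ Poly_Mapping.lookup m i0)"
      unfolding split(1) prod.insert[OF split(3,2)]
      by (simp add: Const_def mult_single mult.commute)
    have deg: "mono_degree m = (\<Sum>j\<in>S. Poly_Mapping.lookup m j) + Poly_Mapping.lookup m i0"
    proof -
      have "mono_degree m = (\<Sum>j\<in>{..n}. Poly_Mapping.lookup m j)"
        using m by (intro mono_degree_superset) auto
      thus ?thesis unfolding split(1) sum.insert[OF split(3,2)] by simp
    qed
    have "(\<Prod>j\<in>S. Var j ^ Poly_Mapping.lookup m j) - (\<Prod>j\<in>S. Var j ^ red (Poly_Mapping.lookup m j) * Var i0 ^ (Poly_Mapping.lookup m j - red (Poly_Mapping.lookup m j))) \<in> M"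
      using i0 reduce by (intro M_prod conjI mpolys_mult mpolys_power VarV) (auto simp: S_def)
    moreover have "(\<Prod>j\<in>S. Var j ^ red (Poly_Mapping.lookup m j) * Var i0 ^ (Poly_Mapping.lookup m j - red (Poly_Mapping.lookup m j)))
        = (\<Prod>j\<in>S. Var j ^ ra m j) * (Var i0 ^ (\<Sum>j\<in>S. Poly_Mapping.lookup m j - red (Poly_Mapping.lookup m j)) :: 'f mpoly)"
      by (simp add: prod.distrib power_sum ra_def)
    ultimately have "((\<Prod>j\<in>S. Var j ^ Poly_Mapping.lookup m j) - (\<Prod>j\<in>S. Var j ^ ra m j) * Var i0 ^ (\<Sum>j\<in>S. Poly_Mapping.lookup m j - red (Poly_Mapping.lookup m j)))
        * (Const c * Var i0 ^ Poly_Mapping.lookup m i0) \<in> M"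
      using i0 by (intro M_mult mpolys_mult mpolys_power VarV) auto
    moreover have "(\<Sum>j\<in>S. Poly_Mapping.lookup m j - red (Poly_Mapping.lookup m j)) + Poly_Mapping.lookup m i0 = mono_degree m - sum (ra m) S"
    proof -
      have "(\<Sum>j\<in>S. Poly_Mapping.lookup m j - red (Poly_Mapping.lookup m j)) + sum (ra m) S = (\<Sum>j\<in>S. Poly_Mapping.lookup m j)"
        unfolding sum.distrib[symmetric] using red_le by (intro sum.cong) (auto simp: ra_def)
      thus ?thesis unfolding deg by linarith
    qed
    moreover have "(U1 - U2 * w ^ k2) * (C * w ^ k1) = C * (U1 * w ^ k1) - C * (U2 * w ^ (k2 + k1))"
      for U1 U2 w C :: "'f mpoly" and k1 k2 by (simp add: algebra_simps power_add)
    ultimately show ?thesis unfolding eq N_def by simp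
  qed
  have kernel: "P \<in> M" if P: "P \<in> V" "homog d P" and van: "\<And>x. x \<in> T \<Longrightarrow> at_pt x P = 0" for P d
  proof -
    let ?A = "PiE S (\<lambda>_. {..<r})"
    define c where "c a = (\<Sum>m | m \<in> Poly_Mapping.keys P \<and> ra m = a. Poly_Mapping.lookup P m)" for a
    define P' where "P' = (\<Sum>m\<in>Poly_Mapping.keys P. Const (Poly_Mapping.lookup P m) * N d (ra m))"
    have "(\<Sum>m\<in>Poly_Mapping.keys P. Poly_Mapping.single m (Poly_Mapping.lookup P m) - Const (Poly_Mapping.lookup P m) * N d (ra m)) \<in> M"
    proof (rule M_sum)
      fix m assume "m \<in> Poly_Mapping.keys P"
      hence "Poly_Mapping.keys m \<subseteq> {..n}" "mono_degree m = d" using P by (auto simp: mpolys_def homog_def)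
      thus "Poly_Mapping.single m (Poly_Mapping.lookup P m) - Const (Poly_Mapping.lookup P m) * N d (ra m) \<in> M"
        using mono_red by blast
    qed
    hence PP': "P - P' \<in> M" by (simp add: P'_def sum_subtractf mpoly_sum_single)
    have finA: "finite ?A" by (intro finite_PiE) (auto simp: S_def)
    have group: "(\<Sum>a\<in>?A. \<Sum>m | m \<in> Poly_Mapping.keys P \<and> ra m = a. G m) = (\<Sum>m\<in>Poly_Mapping.keys P. G m)" for G :: "_ \<Rightarrow> 'b :: comm_monoid_add"
      using ra_PiE finA by (intro sum.group) auto
    have "P' = (\<Sum>a\<in>?A. \<Sum>m | m \<in> Poly_Mapping.keys P \<and> ra m = a. Const (Poly_Mapping.lookup P m) * N d (ra m))"
      unfolding P'_def by (rule group[symmetric])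
    also have "\<dots> = (\<Sum>a\<in>?A. Const (c a) * N d a)"
    proof (intro sum.cong refl)
      fix a
      have Const_sum: "Const (sum g Z) = (\<Sum>z\<in>Z. Const (g z) :: 'f mpoly)" for g and Z :: "(nat \<Rightarrow>\<^sub>0 nat) set"
        by (induction Z rule: infinite_finite_induct) (auto simp: Const_hom.h_0 Const_hom.h_add)
      show "(\<Sum>m | m \<in> Poly_Mapping.keys P \<and> ra m = a. Const (Poly_Mapping.lookup P m) * N d (ra m)) = Const (c a) * N d a"
        unfolding c_def Const_sum sum_distrib_right by (intro sum.cong) auto
    qed
    finally have P'_eq: "P' = (\<Sum>a\<in>?A. Const (c a) * N d a)" .
    have "c a = 0" if a: "a \<in> ?A" for a
    proof -
      have "to_ac (c a) = 0"
      proof (rule grid_vanishing[where S = S and E = E and r = r and c = "\<lambda>a. to_ac (c a)", OF _ _ finE _ a])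
        show "finite S" by (simp add: S_def)
        show "r \<le> card E" using r by (simp add: E_def)
        fix y assume y: "y \<in> PiE S (\<lambda>_. E)"
        define x where "x = y(i0 := 1)"
        have xT: "x \<in> T" using y i0 E1 by (auto simp: x_def T_def S_def PiE_iff extensional_def)
        have xE: "x j \<in> E" if "j \<in> S" for j using xT that by (auto simp: T_def S_def)
        have x1: "x i0 = 1" by (simp add: x_def)
        have mono_at: "monom_eval x m = (\<Prod>j\<in>S. x j ^ ra m j)" if m: "m \<in> Poly_Mapping.keys P" for m
        proof -
          have sp: "{..n} = insert i0 S" "i0 \<notin> S" "finite S" using i0 by (auto simp: S_def)
          have "Poly_Mapping.keys m \<subseteq> {..n}" using m P by (auto simp: mpolys_def)
          hence "monom_eval x m = (\<Prod>j\<in>{..n}. x j ^ Poly_Mapping.lookup m j)" by (intro monom_eval_superset) auto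
          also have "\<dots> = (\<Prod>j\<in>S. x j ^ Poly_Mapping.lookup m j)"
            unfolding sp(1) prod.insert[OF sp(3,2)] x1 by simp
          also have "\<dots> = (\<Prod>j\<in>S. x j ^ ra m j)"
            using at_pow xE by (intro prod.cong) (auto simp: ra_def)
          finally show ?thesis .
        qed
        have "0 = (\<Sum>m\<in>Poly_Mapping.keys P. to_ac (Poly_Mapping.lookup P m) * (\<Prod>j\<in>S. x j ^ ra m j))"
          using van[OF xT] mono_at unfolding mpoly_eval_def by simp
        also have "\<dots> = (\<Sum>a\<in>?A. \<Sum>m | m \<in> Poly_Mapping.keys P \<and> ra m = a. to_ac (Poly_Mapping.lookup P m) * (\<Prod>j\<in>S. x j ^ ra m j))"
          by (rule group[symmetric])
        also have "\<dots> = (\<Sum>a\<in>?A. to_ac (c a) * (\<Prod>j\<in>S. y j ^ a j))"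
        proof (intro sum.cong refl)
          fix a
          have "(\<Prod>j\<in>S. y j ^ a j) = (\<Prod>j\<in>S. x j ^ a j)"
            by (intro prod.cong) (auto simp: x_def S_def)
          thus "(\<Sum>m | m \<in> Poly_Mapping.keys P \<and> ra m = a. to_ac (Poly_Mapping.lookup P m) * (\<Prod>j\<in>S. x j ^ ra m j)) = to_ac (c a) * (\<Prod>j\<in>S. y j ^ a j)"
            unfolding c_def to_ac_sum sum_distrib_right by (intro sum.cong) auto
        qed
        finally show "(\<Sum>a\<in>?A. to_ac (c a) * (\<Prod>j\<in>S. y j ^ a j)) = 0" by simp
      qed
      thus ?thesis by simp
    qed
    hence "P' = 0" unfolding P'_eq by (simp add: Const_hom.h_0)
    thus "P \<in> M" using PP' by simp
  qed
  have at_E: "at_pt x P ^ r = at_pt x P" if "x \<in> T" "P \<in> V" for x P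
  proof -
    have sum_frob: "(\<Sum>z\<in>Z. g z) ^ r = (\<Sum>z\<in>Z. g z ^ r)" for g :: "(nat \<Rightarrow>\<^sub>0 nat) \<Rightarrow> 'f alg_closure" and Z
      using r by (induction Z rule: infinite_finite_induct) (auto simp: frob(2) power_0_left)
    have "monom_eval x m ^ r = monom_eval x m" if "m \<in> Poly_Mapping.keys P" for m
    proof -
      have "monom_eval x m ^ r = (\<Prod>i\<in>Poly_Mapping.keys m. (x i ^ r) ^ Poly_Mapping.lookup m i)"
        by (auto simp: monom_eval_def prod_power_distrib power_mult[symmetric] mult.commute intro!: prod.cong)
      also have "\<dots> = monom_eval x m"
        unfolding monom_eval_def
      proof (intro prod.cong refl)
        fix i assume "i \<in> Poly_Mapping.keys m"
        hence "i \<le> n" using that \<open>P \<in> V\<close> by (auto simp: mpolys_def)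
        hence "x i ^ r = x i" using \<open>x \<in> T\<close> by (auto simp: T_def E_def)
        thus "(x i ^ r) ^ Poly_Mapping.lookup m i = x i ^ Poly_Mapping.lookup m i" by simp
      qed
      finally show ?thesis .
    qed
    moreover have "to_ac c ^ r = to_ac c" for c :: 'f using frob(1)[of c] by (metis to_ac_power)
    ultimately show ?thesis unfolding mpoly_eval_def sum_frob power_mult_distrib by simp
  qed
  have "\<exists>x\<in>T. \<forall>P d. P \<in> M \<longrightarrow> homog d P \<longrightarrow> at_pt x P = 0"
  proof (rule ccontr)
    assume "\<not> ?thesis"
    hence bad: "\<exists>P d. P \<in> M \<and> homog d P \<and> at_pt x P \<noteq> 0" if "x \<in> T" for x using that by blast
    have "\<exists>G d. G \<in> M \<and> homog d G \<and> (\<forall>x\<in>T. at_pt x G = 0 \<or> at_pt x G = 1) \<and> (\<forall>x\<in>T'. at_pt x G = 1)"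
      if "finite T'" "T' \<subseteq> T" for T'
      using that
    proof (induction T' rule: finite_induct)
      case empty
      show ?case using M_0 by (intro exI[of _ 0] exI[of _ 0]) auto
    next
      case (insert y T')
      then obtain G1 d1 where G1: "G1 \<in> M" "homog d1 G1" "\<forall>x\<in>T. at_pt x G1 = 0 \<or> at_pt x G1 = 1" "\<forall>x\<in>T'. at_pt x G1 = 1"
        by auto
      obtain P e where P: "P \<in> M" "homog e P" "at_pt y P \<noteq> 0" using bad[of y] insert by auto
      have PV: "P \<in> V" "G1 \<in> V" using P G1 by (auto simp: M_def)
      \<comment> \<open>The values of \<open>P\<close> on \<open>T\<close> lie in \<open>E\<close>, so the power takes only the values \<open>0\<close> and \<open>1\<close>.\<close>
      define G2 where "G2 = P ^ (r - 1)"
      define d2 where "d2 = (r - 1) * e"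
      have "P ^ (r - 1) = P * P ^ (r - 2)" using r by (simp flip: power_Suc add: numeral_2_eq_2 Suc_diff_Suc)
      hence "G2 \<in> M" unfolding G2_def using P(1) PV by (simp only:) (intro M_mult mpolys_power)
      hence G2: "G2 \<in> M" "G2 \<in> V" "homog d2 G2"
        using homog_power[OF P(2)] by (auto simp: M_def G2_def d2_def)
      have at_G2: "at_pt x G2 = (if at_pt x P = 0 then 0 else 1)" if "x \<in> T" for x
      proof (cases "at_pt x P = 0")
        case True
        thus ?thesis using r by (simp add: G2_def ac.eval_power power_0_left)
      next
        case False
        have "at_pt x P * at_pt x P ^ (r - 1) = at_pt x P * 1"
          using at_E[OF that PV(1)] r by (simp flip: power_Suc)
        thus ?thesis using False by (simp add: G2_def ac.eval_power)
      qed
      \<comment> \<open>This is \<open>1 - (1 - G1) (1 - G2)\<close>, made homogeneous.\<close>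
      define G where "G = G1 * Var i0 ^ d2 + (G2 * Var i0 ^ d1 - G1 * G2)"
      have hp: "homog j (Var i0 ^ j :: 'f mpoly)" for j using homog_power[OF homog_Var, of j i0] by simp
      have "homog (d1 + d2) (G2 * Var i0 ^ d1)" using homog_mult[OF G2(3) hp[of d1]] by (simp add: add.commute)
      hence "homog (d1 + d2) G"
        unfolding G_def by (intro homog_add homog_diff homog_mult[OF G1(2) hp] homog_mult[OF G1(2) G2(3)])
      moreover have "G \<in> M"
        unfolding G_def using G1 G2 PV i0 by (intro M_add M_diff M_mult mpolys_power VarV) auto
      moreover have "at_pt x G = at_pt x G1 + at_pt x G2 - at_pt x G1 * at_pt x G2" if "x \<in> T" for x
        using that by (simp add: G_def ac.eval_add ac.eval_diff ac.eval_mult ac.eval_power T_def)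
      hence "(\<forall>x\<in>T. at_pt x G = 0 \<or> at_pt x G = 1) \<and> (\<forall>x\<in>insert y T'. at_pt x G = 1)"
        using G1(3,4) at_G2 P(3) insert.prems by auto
      ultimately show ?case by blast
    qed
    moreover have "finite T"
    proof (rule finite_subset)
      show "T \<subseteq> PiE {..n} (\<lambda>_. E)" by (auto simp: T_def)
      show "finite (PiE {..n} (\<lambda>_. E))" using finE by (intro finite_PiE) auto
    qed
    ultimately obtain G d where G: "G \<in> M" "homog d G" "\<forall>x\<in>T. at_pt x G = 1" by blast
    have hp: "homog d (Var i0 ^ d :: 'f mpoly)" using homog_power[OF homog_Var, of d i0] by simp
    have GV: "G \<in> V" "Var i0 ^ d \<in> V" using G i0 by (auto simp: M_def intro!: mpolys_power VarV)
    have "Var i0 ^ d - G \<in> M"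
    proof (rule kernel)
      show "Var i0 ^ d - G \<in> V" "homog d (Var i0 ^ d - G)" using GV G hp by (auto intro: mpolys_diff homog_diff)
      fix x assume "x \<in> T"
      thus "at_pt x (Var i0 ^ d - G) = 0" using G by (simp add: ac.eval_diff ac.eval_power T_def)
    qed
    hence "(Var i0 ^ d - G) + G \<in> M" using G M_add by blast
    hence "cl (Var i0 ^ d) \<in> p" by (simp add: M_def)
    thus False using cl_in_prime_power[OF p VarV[OF i0(1)]] i0(2) by blast
  qed
  then obtain x where xT: "x \<in> T" and xM: "\<And>P d. P \<in> M \<Longrightarrow> homog d P \<Longrightarrow> at_pt x P = 0" by blast
  have x1: "x i0 = 1" using xT by (simp add: T_def)
  have "cl f = cl 0" using cl_eq_iff[OF f_V mpolys_0] by (auto intro!: bexI[of _ 1])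
  hence "f \<in> M" using M_0 f_V by (simp add: M_def)
  hence "at_pt x f = 0" using xM homog_f by blast
  hence x: "cone_point x" using x1 i0 by (auto simp: cone_point_def)
  have "point_prime x = p"
  proof (rule Pts_eqI[OF point_prime_Pts[OF x] p])
    fix P d assume P: "P \<in> V" "homog d P"
    show "cl P \<in> point_prime x \<longleftrightarrow> cl P \<in> p"
    proof
      assume "cl P \<in> p"
      hence "at_pt x P = 0" using xM P by (auto simp: M_def)
      thus "cl P \<in> point_prime x" using point_prime_homog[OF x P] by simp
    next
      assume "cl P \<in> point_prime x"
      hence xP: "at_pt x P = 0" using point_prime_homog[OF x P] by simp
      define W where "W = P ^ (r - 1) - Var i0 ^ ((r - 1) * d)"
      have hW: "homog ((r - 1) * d) W"
        unfolding W_def using homog_power[OF P(2)] homog_power[OF homog_Var, of "(r - 1) * d" i0] by (intro homog_diff) auto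
      have WV: "W \<in> V" unfolding W_def using P i0 by (intro mpolys_diff mpolys_power VarV)
      have "P * W \<in> M"
      proof (rule kernel)
        show "P * W \<in> V" using P WV by (intro mpolys_mult)
        show "homog (d + (r - 1) * d) (P * W)" using P hW by (intro homog_mult)
        fix y assume y: "y \<in> T"
        have "at_pt y P * at_pt y P ^ (r - 1) = at_pt y P"
          using at_E[OF y P(1)] r by (simp flip: power_Suc)
        thus "at_pt y (P * W) = 0"
          using y by (simp add: W_def ac.eval_mult ac.eval_diff ac.eval_power T_def algebra_simps)
      qed
      hence "cl P \<in> p \<or> cl W \<in> p" using cl_in_prime_mult[OF p P(1) WV] by (simp add: M_def)
      moreover have "cl W \<notin> p"
      proof
        assume "cl W \<in> p"
        hence "at_pt x W = 0" using xM hW WV by (auto simp: M_def)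
        thus False using xP x1 r by (simp add: W_def ac.eval_diff ac.eval_power power_0_left)
      qed
      ultimately show "cl P \<in> p" by blast
    qed
  qed
  thus ?thesis using x x1 by blast
qed

end

section \<open>Finite fields and their multiplicative characters\<close>

lemma only_prime_divisor:
  assumes p: "prime (p :: nat)" and "m > 0" and "\<And>l. prime l \<Longrightarrow> l dvd m \<Longrightarrow> l = p"
  shows "\<exists>j. m = p ^ j"
  using assms(2,3)
proof (induction m rule: less_induct)
  case (less m)
  show ?case
  proof (cases "m = 1")
    case True
    thus ?thesis by (intro exI[of _ 0]) simp
  next
    case False
    then obtain l where l: "prime l" "l dvd m" using prime_factor_nat by blast
    hence "p dvd m" using less.prems by simp
    then obtain m' where m': "m = p * m'" ..
    have "m' < m" "m' > 0" using m' less.prems(1) prime_gt_1_nat[OF p] by auto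
    moreover have "l' = p" if "prime l'" "l' dvd m'" for l' using less.prems(2)[of l'] that m' by simp
    ultimately obtain j where "m' = p ^ j" using less.IH by blast
    thus ?thesis using m' by (intro exI[of _ "Suc j"]) simp
  qed
qed

text \<open>
  Cauchy's theorem, from a Sylow subgroup of order \<open>l\<close>.
\<close>

lemma cauchy_element:
  assumes G: "group G" "finite (carrier G)" and l: "prime l" "l dvd card (carrier G)"
  shows "\<exists>x\<in>carrier G. x \<noteq> \<one>\<^bsub>G\<^esub> \<and> x [^]\<^bsub>G\<^esub> l = \<one>\<^bsub>G\<^esub>"
proof -
  obtain m where "card (carrier G) = l * m" using l by (auto elim: dvdE)
  hence "Coset.order G = l ^ 1 * m" by (simp add: Coset.order_def)
  then obtain H where H: "subgroup H G" "card H = l ^ 1"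
    using Sylow.sylow_thm[of l G 1 m] l(1) G by blast
  have finH: "finite H" using H(1) G(2) finite_subset subgroup.subset by blast
  have "\<one>\<^bsub>G\<^esub> \<in> H" using H(1) by (rule subgroup.one_closed)
  moreover have "card H > 1" using H(2) prime_gt_1_nat[OF l(1)] by simp
  ultimately obtain x where x: "x \<in> H" "x \<noteq> \<one>\<^bsub>G\<^esub>"
    by (metis card_1_singleton_iff One_nat_def finH is_singletonI' is_singleton_altdef less_irrefl empty_iff)
  let ?H = "G\<lparr>carrier := H\<rparr>"
  have gH: "group ?H" using subgroup.subgroup_is_group[OF H(1) G(1)] .
  have "x [^]\<^bsub>?H\<^esub> Coset.order ?H = \<one>\<^bsub>?H\<^esub>"
    using group.pow_order_eq_1[OF gH] x by simp
  moreover have "Coset.order ?H = l" using H(2) by (simp add: Coset.order_def)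
  moreover have "x [^]\<^bsub>?H\<^esub> l = x [^]\<^bsub>G\<^esub> l" by (simp add: nat_pow_def)
  ultimately show ?thesis using x H(1) subgroup.subset by fastforce
qed

lemma prime_CHAR_finite: "prime CHAR('f :: {field, finite})"
  using prime_CHAR_semidom[where ?'a = 'f] finite_imp_CHAR_pos[OF finite[of "UNIV :: 'f set"]] by simp

text \<open>
  By Cauchy's theorem a prime divisor \<open>l\<close> of the order kills some nonzero element of the additive group,
  so it is zero in the field.
\<close>

lemma finite_field_card_prime_power: "\<exists>m>0. CARD('f :: {field, finite}) = CHAR('f) ^ m"
proof -
  let ?p = "CHAR('f)"
  let ?G = "add_monoid (ring_on (UNIV :: 'f set))"
  have F: "field (ring_on (UNIV :: 'f set))" by (rule ring_on_field) auto
  hence "abelian_group (ring_on (UNIV :: 'f set))"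
    by (simp add: field_def domain_def cring_def ring_def)
  hence G: "group ?G" by (rule abelian_group.a_group)
  have pow: "x [^]\<^bsub>?G\<^esub> (k :: nat) = of_nat k * x" for x :: 'f and k
    by (induction k) (auto simp: nat_pow_def algebra_simps)
  have "l = ?p" if l: "prime l" "l dvd CARD('f)" for l
  proof -
    have "finite (carrier ?G)" "l dvd card (carrier ?G)" using l by simp_all
    from cauchy_element[OF G this(1) l(1) this(2)]
    obtain x :: 'f where x: "x \<noteq> 0" "of_nat l * x = 0" unfolding pow by auto
    hence "of_nat l = (0 :: 'f)" by simp
    hence "?p dvd l" by (simp add: of_nat_eq_0_iff_char_dvd)
    thus "l = ?p" using primes_dvd_imp_eq[OF prime_CHAR_finite[where ?'f = 'f] l(1)] by simp
  qed
  moreover have "CARD('f) > 0" by (simp add: card_gt_0_iff)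
  ultimately obtain m where m: "CARD('f) = ?p ^ m"
    using only_prime_divisor[OF prime_CHAR_finite] by blast
  have "card {0, 1 :: 'f} \<le> CARD('f)" by (intro card_mono) auto
  hence "m > 0" using m by (cases m) auto
  thus ?thesis using m by blast
qed

subsection \<open>Duality\<close>

text \<open>
  A group of diagonal matrices, written as a set of extensional vectors.
\<close>

definition torus_group :: "nat \<Rightarrow> (nat \<Rightarrow> 'f :: field) set \<Rightarrow> bool" where
  "torus_group n T \<longleftrightarrow> T \<subseteq> extensional {..n} \<and> (\<lambda>i\<in>{..n}. 1) \<in> T \<and> (\<forall>\<tau>\<in>T. \<forall>i\<le>n. \<tau> i \<noteq> 0) \<and>
     (\<forall>\<tau>\<in>T. (\<lambda>i\<in>{..n}. inverse (\<tau> i)) \<in> T) \<and> (\<forall>\<tau>\<in>T. \<forall>\<sigma>\<in>T. (\<lambda>i\<in>{..n}. \<tau> i * \<sigma> i) \<in> T)"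

lemma torus_group_finite: "torus_group n (T :: (nat \<Rightarrow> 'f :: {field, finite}) set) \<Longrightarrow> finite T"
proof -
  assume "torus_group n T"
  hence "T \<subseteq> PiE {..n} (\<lambda>_. UNIV)" by (auto simp: torus_group_def PiE_def)
  moreover have "finite (PiE {..n} (\<lambda>_. UNIV :: 'f set))" by (intro finite_PiE) auto
  ultimately show "finite T" by (rule finite_subset)
qed

text \<open>
  An element of order \<open>p\<close> would have coordinates with \<open>(\<tau> i - 1) ^ p = \<tau> i ^ p - 1 = 0\<close>.
\<close>

lemma torus_group_card:
  assumes T: "torus_group n (T :: (nat \<Rightarrow> 'f :: {field, finite}) set)"
  shows "\<not> CHAR('f) dvd card T"
proof
  assume dvd: "CHAR('f) dvd card T"
  let ?p = "CHAR('f)"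
  define G where "G = \<lparr>carrier = T, monoid.mult = (\<lambda>(\<tau> :: nat \<Rightarrow> 'f) (\<sigma> :: nat \<Rightarrow> 'f). \<lambda>i\<in>{..n}. \<tau> i * \<sigma> i),
    one = (\<lambda>i\<in>{..n}. 1 :: 'f)\<rparr>"
  have G: "group G"
  proof (rule groupI)
    fix \<tau> assume \<tau>: "\<tau> \<in> carrier G"
    have "\<tau> i \<noteq> 0" if "i \<le> n" for i using \<tau> T that by (auto simp: G_def torus_group_def)
    hence "(\<lambda>i\<in>{..n}. (\<lambda>i\<in>{..n}. inverse (\<tau> i)) i * \<tau> i) = (\<lambda>i\<in>{..n}. 1)" by (intro restrict_ext) auto
    thus "\<exists>\<sigma>\<in>carrier G. \<sigma> \<otimes>\<^bsub>G\<^esub> \<tau> = \<one>\<^bsub>G\<^esub>"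
      using \<tau> T by (intro bexI[of _ "\<lambda>i\<in>{..n}. inverse (\<tau> i)"]) (auto simp: G_def torus_group_def)
    have "\<tau> \<in> extensional {..n}" using \<tau> T by (auto simp: G_def torus_group_def)
    thus "\<one>\<^bsub>G\<^esub> \<otimes>\<^bsub>G\<^esub> \<tau> = \<tau>" by (auto simp: G_def fun_eq_iff extensional_def)
  qed (use T in \<open>auto simp: G_def torus_group_def fun_eq_iff\<close>)
  have pow: "(x [^]\<^bsub>G\<^esub> k) i = x i ^ k" if "i \<le> n" for x k and i :: nat
    using that by (induction k) (auto simp: G_def nat_pow_def)
  obtain \<tau> where \<tau>: "\<tau> \<in> T" "\<tau> \<noteq> (\<lambda>i\<in>{..n}. 1)" "\<tau> [^]\<^bsub>G\<^esub> ?p = (\<lambda>i\<in>{..n}. 1)"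
    using cauchy_element[OF G _ prime_CHAR_finite[where ?'f = 'f]] torus_group_finite[OF T] dvd by (auto simp: G_def)
  have "\<tau> i = 1" if i: "i \<le> n" for i
  proof -
    have "\<tau> i ^ ?p = 1" using pow[OF i, of \<tau> ?p] \<tau>(3) i by simp
    moreover have "((\<tau> i - 1) + 1) ^ ?p = (\<tau> i - 1) ^ ?p + 1 ^ ?p"
      by (rule freshmans_dream[OF prime_CHAR_finite refl])
    ultimately have "(\<tau> i - 1) ^ ?p = 0" by simp
    thus ?thesis by simp
  qed
  moreover have "\<tau> \<in> extensional {..n}" using \<tau> T by (auto simp: torus_group_def)
  ultimately have "\<tau> = (\<lambda>i\<in>{..n}. 1)" by (auto simp: fun_eq_iff extensional_def)
  thus False using \<tau>(2) by blast
qed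

lemma geometric_sum_root_of_unity:
  fixes z :: "'k :: field"
  assumes "z ^ e = 1" "z \<noteq> 1"
  shows "(\<Sum>a<e. z ^ a) = 0"
  using geometric_sum[OF assms(2), of e] assms by simp

lemma finite_field_nonzero_power: 
  fixes t :: "'f :: {field, finite}"
  assumes "t \<noteq> 0" shows "t ^ (CARD('f) - 1) = 1"
proof -
  have "t * (\<Prod>y\<in>UNIV-{0}. t * y) = t * (\<Prod>y\<in>UNIV-{0}. y)"
    by (intro arg_cong2[where f = "(*)"] refl prod.reindex_bij_witness[of _ "\<lambda>y. y / t" "\<lambda>y. t * y"])
       (use assms in auto)
  thus ?thesis using assms by (simp add: prod.distrib)
qed

text \<open>
  A point \<open>w\<close> of the torus on which all characters trivial on \<open>T\<close> are trivial belongs to \<open>T\<close>, up to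
  inversion. The sum of all characters \<open>a\<close> at \<open>\<tau> w\<close> is zero if \<open>\<tau> w \<noteq> 1\<close>. If this holds for all \<open>\<tau> \<in> T\<close>,
  the sum over \<open>\<tau>\<close> and \<open>a\<close> of \<open>a (\<tau> w)\<close> vanishes. But a character that is nontrivial on \<open>T\<close> has sum zero
  over \<open>T\<close>, and the others are \<open>1\<close> at \<open>w\<close>; so the sum equals that for \<open>w = 1\<close>, which is the order of a
  subgroup of \<open>T\<close> times a power of \<open>e\<close>, and neither is divisible by the characteristic.
\<close>

theorem torus_duality:
  fixes T :: "(nat \<Rightarrow> 'f :: {field, finite}) set" and w :: "nat \<Rightarrow> 'f alg_closure"
  assumes T: "torus_group n T" and S: "S \<subseteq> {..n}" and e: "e = CARD('f) - 1"
    and w: "\<And>j. j \<in> S \<Longrightarrow> w j ^ e = 1"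
    and inv: "\<And>a. a \<in> PiE S (\<lambda>_. {..<e}) \<Longrightarrow> (\<And>\<tau>. \<tau> \<in> T \<Longrightarrow> (\<Prod>j\<in>S. \<tau> j ^ a j) = 1) \<Longrightarrow> (\<Prod>j\<in>S. w j ^ a j) = 1"
  shows "\<exists>\<tau>\<in>T. \<forall>j\<in>S. to_ac (\<tau> j) * w j = 1"
proof (rule ccontr)
  assume none: "\<not> ?thesis"
  have finS: "finite S" using S finite_subset by blast
  have finT: "finite T" by (rule torus_group_finite[OF T])
  let ?A = "PiE S (\<lambda>_. {..<e})"
  define \<chi> :: "(nat \<Rightarrow> 'f) \<Rightarrow> (nat \<Rightarrow> nat) \<Rightarrow> 'f alg_closure" where "\<chi> \<tau> a = (\<Prod>j\<in>S. to_ac (\<tau> j) ^ a j)" for \<tau> a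
  have \<tau>e: "to_ac (\<tau> j) ^ e = 1" if "\<tau> \<in> T" "j \<in> S" for \<tau> j
  proof -
    have "\<tau> j \<noteq> 0" using that T S by (auto simp: torus_group_def)
    hence "\<tau> j ^ e = 1" unfolding e by (rule finite_field_nonzero_power)
    thus ?thesis by (metis to_ac_power to_ac_1)
  qed
  have mult_e: "(\<Sum>a\<in>?A. \<Prod>j\<in>S. (z j) ^ a j) = (if \<forall>j\<in>S. z j = 1 then of_nat e ^ card S else 0)"
    if z: "\<And>j. j \<in> S \<Longrightarrow> z j ^ e = 1" for z :: "nat \<Rightarrow> 'f alg_closure"
  proof -
    have "(\<Sum>a\<in>?A. \<Prod>j\<in>S. (z j) ^ a j) = (\<Prod>j\<in>S. \<Sum>a<e. z j ^ a)"
      using finS by (intro prod_sum_PiE[symmetric]) auto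
    also have "\<dots> = (if \<forall>j\<in>S. z j = 1 then of_nat e ^ card S else 0)"
      using geometric_sum_root_of_unity z finS by (auto simp: prod_zero_iff)
    finally show ?thesis .
  qed
  have orth: "(\<Sum>\<tau>\<in>T. \<chi> \<tau> a) * (\<Prod>j\<in>S. w j ^ a j) = (\<Sum>\<tau>\<in>T. \<chi> \<tau> a)" if a: "a \<in> ?A" for a
  proof (cases "\<forall>\<tau>\<in>T. \<chi> \<tau> a = 1")
    case True
    have "(\<Prod>j\<in>S. \<tau> j ^ a j) = 1" if "\<tau> \<in> T" for \<tau>
    proof -
      have "to_ac (\<Prod>j\<in>S. \<tau> j ^ a j) = to_ac 1" using True that by (simp add: \<chi>_def to_ac_prod)
      thus ?thesis by (simp only: to_ac_eq_iff)
    qed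
    thus ?thesis using inv[OF a] by simp
  next
    case False
    then obtain \<sigma> where \<sigma>: "\<sigma> \<in> T" "\<chi> \<sigma> a \<noteq> 1" by blast
    define m where "m \<tau> = (\<lambda>i\<in>{..n}. \<sigma> i * \<tau> i)" for \<tau> :: "nat \<Rightarrow> 'f"
    have "inj_on m T"
    proof (rule inj_onI)
      fix x y assume xy: "x \<in> T" "y \<in> T" "m x = m y"
      have "x i = y i" for i
      proof (cases "i \<le> n")
        case True
        thus ?thesis using fun_cong[OF xy(3), of i] T \<sigma>(1) by (auto simp: m_def torus_group_def)
      next
        case False
        have "x \<in> extensional {..n}" "y \<in> extensional {..n}" using xy T by (auto simp: torus_group_def)
        thus ?thesis using False by (simp add: extensional_def)
      qed
      thus "x = y" by blast
    qed
    moreover have "m ` T \<subseteq> T" using T \<sigma>(1) by (auto simp: m_def torus_group_def)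
    ultimately have bij: "bij_betw m T T" using finT by (simp add: bij_betw_def endo_inj_surj)
    have "(\<Sum>\<tau>\<in>T. \<chi> \<tau> a) = (\<Sum>\<tau>\<in>T. \<chi> (m \<tau>) a)" using sum.reindex_bij_betw[OF bij, of "\<lambda>\<tau>. \<chi> \<tau> a"] by simp
    also have "\<dots> = (\<Sum>\<tau>\<in>T. \<chi> \<sigma> a * \<chi> \<tau> a)"
      using S by (intro sum.cong refl) (auto simp: \<chi>_def m_def power_mult_distrib prod.distrib[symmetric] intro!: prod.cong)
    also have "\<dots> = \<chi> \<sigma> a * (\<Sum>\<tau>\<in>T. \<chi> \<tau> a)" by (rule sum_distrib_left[symmetric])
    finally have "(\<Sum>\<tau>\<in>T. \<chi> \<tau> a) * (1 - \<chi> \<sigma> a) = 0" by (simp add: algebra_simps)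
    hence "(\<Sum>\<tau>\<in>T. \<chi> \<tau> a) = 0" using \<sigma>(2) by simp
    thus ?thesis by simp
  qed
  have "(\<Sum>\<tau>\<in>T. \<Sum>a\<in>?A. \<Prod>j\<in>S. (to_ac (\<tau> j) * w j) ^ a j) = (\<Sum>\<tau>\<in>T. 0)"
  proof (intro sum.cong refl)
    fix \<tau> assume \<tau>: "\<tau> \<in> T"
    have "(to_ac (\<tau> j) * w j) ^ e = 1" if "j \<in> S" for j using \<tau>e[OF \<tau> that] w[OF that] by (simp add: power_mult_distrib)
    moreover have "\<not> (\<forall>j\<in>S. to_ac (\<tau> j) * w j = 1)" using none \<tau> by blast
    ultimately show "(\<Sum>a\<in>?A. \<Prod>j\<in>S. (to_ac (\<tau> j) * w j) ^ a j) = 0"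
      using mult_e[of "\<lambda>j. to_ac (\<tau> j) * w j"] by (simp only: if_False)
  qed
  hence "0 = (\<Sum>a\<in>?A. \<Sum>\<tau>\<in>T. \<Prod>j\<in>S. (to_ac (\<tau> j) * w j) ^ a j)" by (subst sum.swap) simp
  also have "\<dots> = (\<Sum>a\<in>?A. (\<Sum>\<tau>\<in>T. \<chi> \<tau> a) * (\<Prod>j\<in>S. w j ^ a j))"
    by (simp add: \<chi>_def power_mult_distrib prod.distrib sum_distrib_right)
  also have "\<dots> = (\<Sum>a\<in>?A. \<Sum>\<tau>\<in>T. \<chi> \<tau> a)" using orth by (intro sum.cong) auto
  also have "\<dots> = (\<Sum>\<tau>\<in>T. \<Sum>a\<in>?A. \<Prod>j\<in>S. to_ac (\<tau> j) ^ a j)" unfolding \<chi>_def by (rule sum.swap)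
  also have "\<dots> = (\<Sum>\<tau>\<in>T. if \<forall>j\<in>S. to_ac (\<tau> j) = 1 then of_nat e ^ card S else 0)"
    using \<tau>e by (intro sum.cong refl mult_e) auto
  also have "\<dots> = (\<Sum>\<tau>\<in>{\<tau> \<in> T. \<forall>j\<in>S. to_ac (\<tau> j) = 1}. of_nat e ^ card S)"
    using finT by (intro sum.mono_neutral_cong_right) auto
  also have "\<dots> = of_nat (card {\<tau> \<in> T. \<forall>j\<in>S. \<tau> j = 1}) * of_nat e ^ card S"
  proof -
    have "to_ac c = 1 \<longleftrightarrow> c = 1" for c :: 'f using to_ac_eq_iff[of c 1] by simp
    thus ?thesis by simp
  qed
  finally have zero: "of_nat (card {\<tau> \<in> T. \<forall>j\<in>S. \<tau> j = 1}) * of_nat e ^ card S = (0 :: 'f alg_closure)" by simp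
  have "torus_group n {\<tau> \<in> T. \<forall>j\<in>S. \<tau> j = 1}"
    using T S unfolding torus_group_def by (auto simp: subset_iff)
  hence "\<not> CHAR('f) dvd card {\<tau> \<in> T. \<forall>j\<in>S. \<tau> j = 1}" by (rule torus_group_card)
  hence "of_nat (card {\<tau> \<in> T. \<forall>j\<in>S. \<tau> j = 1}) \<noteq> (0 :: 'f alg_closure)"
    by (simp add: of_nat_eq_0_iff_char_dvd)
  moreover have "of_nat e \<noteq> (0 :: 'f alg_closure)"
  proof
    assume "of_nat e = (0 :: 'f alg_closure)"
    hence "CHAR('f) dvd e" by (simp add: of_nat_eq_0_iff_char_dvd)
    moreover obtain m where "m > 0" "CARD('f) = CHAR('f) ^ m" using finite_field_card_prime_power by blast
    hence "CHAR('f) dvd CARD('f)" by simp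
    moreover have "CARD('f) = Suc e" using e by (simp add: card_gt_0_iff)
    ultimately have "CHAR('f) dvd 1" using dvd_diff_nat[of "CHAR('f)" "Suc e" e] by simp
    thus False using prime_CHAR_finite[where ?'f = 'f] by simp
  qed
  ultimately show False using zero by simp
qed

subsection \<open>Homomorphisms between finite subfields\<close>

lemma finite_field_power_card:
  fixes c :: "'f :: {field, finite}"
  shows "c ^ CARD('f) = c"
proof (cases "c = 0")
  case False
  have "CARD('f) = Suc (CARD('f) - 1)" by (simp add: card_gt_0_iff)
  hence "c ^ CARD('f) = c * c ^ (CARD('f) - 1)" by (metis power_Suc)
  thus ?thesis using finite_field_nonzero_power[OF False] by simp
qed (simp add: power_0_left card_gt_0_iff)

lemma finite_field_power_card_power:
  fixes c :: "'f :: {field, finite}"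
  shows "c ^ CARD('f) ^ j = c"
  by (induction j) (simp_all add: power_mult finite_field_power_card)

lemma frobenius_add:
  fixes x y :: "'f :: {field, finite} alg_closure"
  shows "(x + y) ^ CARD('f) ^ j = x ^ CARD('f) ^ j + y ^ CARD('f) ^ j"
proof -
  obtain m where m: "CARD('f) = CHAR('f) ^ m" using finite_field_card_prime_power by blast
  show ?thesis
    by (rule freshmans_dream'[where n = "m * j"]) (simp_all add: prime_CHAR_finite m power_mult)
qed

lemma frobenius_sum:
  fixes g :: "'i \<Rightarrow> 'f :: {field, finite} alg_closure"
  shows "(\<Sum>i\<in>I. g i) ^ CARD('f) ^ j = (\<Sum>i\<in>I. g i ^ CARD('f) ^ j)"
  by (induction I rule: infinite_finite_induct) (auto simp: frobenius_add power_0_left card_gt_0_iff)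

lemma card_power_gt_1: "j > 0 \<Longrightarrow> CARD('f :: {field, finite}) ^ j > 1"
proof -
  have "card {0, 1 :: 'f} \<le> CARD('f)" by (intro card_mono) auto
  thus "j > 0 \<Longrightarrow> CARD('f) ^ j > 1" by (intro one_less_power) auto
qed

text \<open>
  Both sides have \<open>q\<close> elements.
\<close>

lemma frobenius_fixed: "{x :: 'f :: {field, finite} alg_closure. x ^ CARD('f) = x} = range to_ac"
proof (rule card_subset_eq[symmetric])
  let ?q = "CARD('f)"
  have q: "?q > 1" using card_power_gt_1[of 1, where ?'f = 'f] by simp
  show "finite {x :: 'f alg_closure. x ^ ?q = x}" by (rule finite_power_eq_self[OF q])
  show "range to_ac \<subseteq> {x :: 'f alg_closure. x ^ ?q = x}"
    using finite_field_power_card by (auto simp flip: to_ac_power)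
  obtain m where m: "m > 0" "?q = CHAR('f) ^ m" using finite_field_card_prime_power by blast
  have "card {x :: 'f alg_closure. x ^ ?q = x} = ?q"
    using prime_CHAR_finite[where ?'f = 'f] m by (intro card_frobenius_fixed[where a = m]) simp_all
  moreover have "card (range (to_ac :: 'f \<Rightarrow> _)) = ?q" by (rule card_image[OF inj_to_ac])
  ultimately show "card (range (to_ac :: 'f \<Rightarrow> _)) = card {x :: 'f alg_closure. x ^ ?q = x}" by simp
qed

lemma map_poly_frobenius_mult:
  fixes P Q :: "'f :: {field, finite} alg_closure Polynomial.poly"
  shows "Polynomial.map_poly (\<lambda>x. x ^ CARD('f)) (P * Q) =
    Polynomial.map_poly (\<lambda>x. x ^ CARD('f)) P * Polynomial.map_poly (\<lambda>x. x ^ CARD('f)) Q"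
proof (rule Polynomial.poly_eqI)
  fix k
  have 0: "(0 :: 'f alg_closure) ^ CARD('f) = 0" by (simp add: power_0_left card_gt_0_iff)
  show "Polynomial.coeff (Polynomial.map_poly (\<lambda>x. x ^ CARD('f)) (P * Q)) k =
    Polynomial.coeff (Polynomial.map_poly (\<lambda>x. x ^ CARD('f)) P * Polynomial.map_poly (\<lambda>x. x ^ CARD('f)) Q) k"
    using frobenius_sum[of "\<lambda>i. Polynomial.coeff P i * Polynomial.coeff Q (k - i)" "{..k}" 1]
    by (simp add: coeff_map_poly[of "\<lambda>x. x ^ CARD('f)", OF 0] Polynomial.coeff_mult power_mult_distrib)
qed

lemma frobenius_inj:
  fixes x y :: "'f :: {field, finite} alg_closure"
  assumes "x ^ CARD('f) ^ j = y ^ CARD('f) ^ j"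
  shows "x = y"
proof -
  have "((x - y) + y) ^ CARD('f) ^ j = (x - y) ^ CARD('f) ^ j + y ^ CARD('f) ^ j" by (rule frobenius_add)
  hence "(x - y) ^ CARD('f) ^ j = 0" using assms by simp
  thus ?thesis by simp
qed

text \<open>
  \<open>\<Gamma>\<close> is the graph of a homomorphism from a finite field \<open>L\<close>, linear over the base field. A generator \<open>\<beta>\<close>
  of the cyclic group of \<open>L\<close> is a root of the product \<open>R\<close> of the \<open>X - \<beta> ^ q ^ i\<close>, which has coefficients in the
  base field, as it is fixed by the \<open>q\<close>-Frobenius. So the image of \<open>\<beta>\<close> is also a root of \<open>R\<close>, that is, a
  conjugate of \<open>\<beta>\<close>, and this determines the homomorphism.
\<close>

theorem finite_correspondence_is_frobenius:
  fixes \<Gamma> :: "('f :: {field, finite} alg_closure \<times> 'f alg_closure) set"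
  assumes fin: "finite (fst ` \<Gamma>)"
    and const: "\<And>c. (to_ac c, to_ac c) \<in> \<Gamma>"
    and add: "\<And>a b a' b'. (a, b) \<in> \<Gamma> \<Longrightarrow> (a', b') \<in> \<Gamma> \<Longrightarrow> (a + a', b + b') \<in> \<Gamma>"
    and mult: "\<And>a b a' b'. (a, b) \<in> \<Gamma> \<Longrightarrow> (a', b') \<in> \<Gamma> \<Longrightarrow> (a * a', b * b') \<in> \<Gamma>"
    and zero: "\<And>a b. (a, b) \<in> \<Gamma> \<Longrightarrow> a = 0 \<longleftrightarrow> b = 0"
  shows "\<exists>j. \<forall>(a, b)\<in>\<Gamma>. b = a ^ CARD('f) ^ j"
proof -
  let ?q = "CARD('f)"
  define L where "L = fst ` \<Gamma>"
  have neg: "(- a, - b) \<in> \<Gamma>" if "(a, b) \<in> \<Gamma>" for a b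
    using mult[OF const[of "-1"] that] by simp
  have uniq: "b = b'" if "(a, b) \<in> \<Gamma>" "(a, b') \<in> \<Gamma>" for a b b'
    using zero[OF add[OF that(1) neg[OF that(2)]]] by simp
  have 01: "(0, 0) \<in> \<Gamma>" "(1, 1) \<in> \<Gamma>" using const[of 0] const[of 1] by simp_all
  have L_mult: "x * y \<in> L" if "x \<in> L" "y \<in> L" for x y using that mult by (force simp: L_def)
  have "field (ring_on L)"
  proof (rule ring_on_field)
    show "0 \<in> L" "1 \<in> L" using 01 by (force simp: L_def)+
    show "x + y \<in> L" if "x \<in> L" "y \<in> L" for x y using that add by (force simp: L_def)
    show "x * y \<in> L" if "x \<in> L" "y \<in> L" for x y using that by (rule L_mult)
    show "- x \<in> L" if "x \<in> L" for x using that neg by (force simp: L_def)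
    show "inverse x \<in> L" if x: "x \<in> L" for x
    proof (cases "x = 0")
      case False
      have "inj_on (\<lambda>y. x * y) L" using False by (auto simp: inj_on_def)
      moreover have "(\<lambda>y. x * y) ` L \<subseteq> L" using x L_mult by blast
      ultimately have "(\<lambda>y. x * y) ` L = L" using fin by (simp add: endo_inj_surj L_def)
      moreover have "1 \<in> L" using 01 by (force simp: L_def)
      ultimately obtain y where "y \<in> L" "x * y = 1" by (metis imageE)
      thus ?thesis using False by (metis inverse_unique)
    qed (use x in simp)
  qed
  then obtain \<beta> where \<beta>: "\<beta> \<in> L" "\<beta> \<noteq> 0" "L - {0} = range (\<lambda>i :: nat. \<beta> ^ i)"
    using finite_subfield_cyclic[of L] fin by (auto simp: L_def)
  then obtain \<beta>' where \<beta>': "(\<beta>, \<beta>') \<in> \<Gamma>" by (auto simp: L_def)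
  have pow: "(\<beta> ^ i, \<beta>' ^ i) \<in> \<Gamma>" for i by (induction i) (use 01 mult \<beta>' in auto)
  have poly: "(Polynomial.poly (Polynomial.map_poly to_ac R) \<beta>, Polynomial.poly (Polynomial.map_poly to_ac R) \<beta>') \<in> \<Gamma>" for R
    by (induction R) (use 01 in \<open>auto simp: map_poly_pCons intro!: add mult const \<beta>'\<close>)
  obtain l where l: "l > 0" "\<beta> ^ ?q ^ l = \<beta>"
  proof -
    have "range (\<lambda>i :: nat. \<beta> ^ ?q ^ i) \<subseteq> L" using \<beta>(3) by blast
    hence "finite (range (\<lambda>i :: nat. \<beta> ^ ?q ^ i))" using fin finite_subset L_def by blast
    hence "\<not> inj (\<lambda>i :: nat. \<beta> ^ ?q ^ i)" using finite_imageD infinite_UNIV_nat by blast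
    then obtain i j where ij: "i \<noteq> j" "\<beta> ^ ?q ^ i = \<beta> ^ ?q ^ j" by (auto simp: inj_def)
    have "\<exists>l>0. \<beta> ^ ?q ^ l = \<beta>" if "i < j" "\<beta> ^ ?q ^ i = \<beta> ^ ?q ^ j" for i j
    proof -
      have "j = (j - i) + i" using that by simp
      hence "\<beta> ^ ?q ^ j = (\<beta> ^ ?q ^ (j - i)) ^ ?q ^ i" by (metis power_add power_mult)
      hence "\<beta> = \<beta> ^ ?q ^ (j - i)" using that by (intro frobenius_inj[of \<beta> i]) simp
      thus ?thesis using that by (intro exI[of _ "j - i"]) simp
    qed
    thus ?thesis using that ij by (metis linorder_neqE_nat)
  qed
  define R where "R = (\<Prod>i<l. [:- (\<beta> ^ ?q ^ i), 1:])"
  have R_frob: "Polynomial.map_poly (\<lambda>x. x ^ ?q) R = R"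
  proof -
    have one: "Polynomial.map_poly (\<lambda>x :: 'f alg_closure. x ^ ?q) 1 = 1"
      by (simp add: one_pCons map_poly_pCons card_gt_0_iff)
    have "Polynomial.map_poly (\<lambda>x. x ^ ?q) (\<Prod>i\<in>I. [:- (\<beta> ^ ?q ^ i), 1:]) = (\<Prod>i\<in>I. [:- (\<beta> ^ ?q ^ Suc i), 1:])" for I
    proof (induction I rule: infinite_finite_induct)
      case (insert i I)
      have m1: "(- x) ^ ?q = - (x ^ ?q)" for x :: "'f alg_closure"
        using frobenius_add[of x "- x" 1] by (simp add: power_0_left card_gt_0_iff eq_neg_iff_add_eq_0 add.commute)
      have "Polynomial.map_poly (\<lambda>x. x ^ ?q) [:- (\<beta> ^ ?q ^ i), 1:] = [:- (\<beta> ^ ?q ^ Suc i), 1:]"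
        by (simp add: map_poly_pCons card_gt_0_iff m1 power_mult[symmetric] mult.commute)
      thus ?case by (simp only: prod.insert[OF insert.hyps] map_poly_frobenius_mult insert.IH)
    qed (simp_all add: one)
    hence "Polynomial.map_poly (\<lambda>x. x ^ ?q) R = (\<Prod>i<l. [:- (\<beta> ^ ?q ^ Suc i), 1:])" by (simp add: R_def)
    also have "\<dots> = R"
    proof -
      obtain l' where l': "l = Suc l'" using l by (cases l) auto
      have "(\<Prod>i<l. [:- (\<beta> ^ ?q ^ Suc i), 1:]) = (\<Prod>i<l'. [:- (\<beta> ^ ?q ^ Suc i), 1:]) * [:- \<beta>, 1:]"
        unfolding l' using l(2) by (simp add: l')
      also have "\<dots> = R" unfolding R_def l' prod.lessThan_Suc_shift by (simp add: mult.commute)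
      finally show ?thesis .
    qed
    finally show ?thesis .
  qed
  have "Polynomial.coeff R i \<in> range to_ac" for i
  proof -
    have 0: "(0 :: 'f alg_closure) ^ ?q = 0" by (simp add: power_0_left card_gt_0_iff)
    have "Polynomial.coeff (Polynomial.map_poly (\<lambda>x. x ^ ?q) R) i = Polynomial.coeff R i" by (simp only: R_frob)
    hence "Polynomial.coeff R i ^ ?q = Polynomial.coeff R i" by (simp add: coeff_map_poly[of "\<lambda>x. x ^ CARD('f)", OF 0])
    thus ?thesis using frobenius_fixed by blast
  qed
  hence R_eq: "Polynomial.map_poly to_ac (Polynomial.map_poly of_ac R) = R"
    by (intro Polynomial.poly_eqI) (simp add: coeff_map_poly to_ac_of_ac)
  have "Polynomial.poly R \<beta> = 0" using l(1) by (auto simp: R_def poly_prod intro!: bexI[of _ 0])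
  hence "Polynomial.poly R \<beta>' = 0" using poly[of "Polynomial.map_poly of_ac R"] zero unfolding R_eq by blast
  then obtain j where j: "\<beta>' = \<beta> ^ ?q ^ j" by (auto simp: R_def poly_prod)
  have "b = a ^ ?q ^ j" if ab: "(a, b) \<in> \<Gamma>" for a b
  proof (cases "a = 0")
    case True
    thus ?thesis using zero[OF ab] by (simp add: power_0_left card_gt_0_iff)
  next
    case False
    have "a \<in> L - {0}" using ab False by (force simp: L_def)
    then obtain i where i: "a = \<beta> ^ i" using \<beta>(3) by blast
    hence "b = \<beta>' ^ i" using uniq[OF ab] pow[of i] by simp
    thus ?thesis by (simp add: i j power_mult[symmetric] mult.commute)
  qed
  thus ?thesis by blast
qed

section \<open>Rational points and Frobenius-stable orbits\<close>

text \<open>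
  A quotient of the hypersurface by a subgroup \<open>H\<close> of the diagonal group, over the field \<open>K\<close> with \<open>q ^ k\<close>
  elements. It is used for the trivial group and for the whole group.
\<close>

locale dwork_points = dwork n lam +
    Q: graded_quotient_points "dwork_ring n lam" "dwork_grading n lam" "dwork.Pts n lam" H "dwork.\<phi>"
      "dwork_scalar n lam" \<pi> Y "{x :: 'f alg_closure. x ^ CARD('f) ^ k = x}" to_ac
  for n :: nat and lam :: "'f :: {field, finite}" and H :: "(nat \<Rightarrow> 'f) set" and k :: nat
    and \<pi> :: "'f mpoly set set \<Rightarrow> 'r"
    and Y :: "('r, 'f mpoly set set \<Rightarrow> ('f mpoly set \<times> 'f mpoly set) set, 'f) ringed_space" +
  assumes H_sub: "H \<subseteq> dwork_group n" and H_one: "gone \<in> H"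
    and H_inv: "\<zeta> \<in> H \<Longrightarrow> ginv \<zeta> \<in> H" and H_mul: "\<zeta> \<in> H \<Longrightarrow> \<eta> \<in> H \<Longrightarrow> gmul \<zeta> \<eta> \<in> H"
    and k_pos: "k > 0"
begin

abbreviation "K \<equiv> {x :: 'f alg_closure. x ^ CARD('f) ^ k = x}"
abbreviation "value x s \<equiv> Q.val (ev x) (s (point_prime x))"

lemma act_eq: "Q.act \<zeta> p = gact \<zeta> p"
  by (simp add: Q.act_def gact_def)

lemma geom_point_prime:
  assumes x: "cone_point x"
  shows "Q.geom (point_prime x) (ev x)"
  unfolding Q.geom_def
proof (intro conjI ballI)
  show "point_prime x \<in> Pts" by (rule point_prime_Pts[OF x])
  show "ev x \<one>\<^bsub>A\<^esub> = 1" using x by (simp add: cl_1[symmetric] ev_cl)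
next
  fix a assume "a \<in> homogeneous D"
  then obtain P d where "a = cl P" "P \<in> V" "homog d P" by (auto simp: homogeneous_D)
  thus "a \<in> point_prime x \<longleftrightarrow> ev x a = 0" using point_prime_homog[OF x] ev_cl[OF x] by simp
next
  fix a b assume "a \<in> carrier A" "b \<in> carrier A"
  then obtain P P' where *: "a = cl P" "P \<in> V" "b = cl P'" "P' \<in> V" by (auto simp: carrier_A)
  show "ev x (a \<otimes>\<^bsub>A\<^esub> b) = ev x a * ev x b" "ev x (a \<oplus>\<^bsub>A\<^esub> b) = ev x a + ev x b"
    using * x by (simp_all add: cl_mult[symmetric] cl_add[symmetric] ev_cl mpolys_mult mpolys_add ac.eval_mult ac.eval_add)
qed

lemma Y_sec:
  assumes "Q.opY U" "s \<in> carrier (sections Y U)" "p \<in> Q.pre U"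
  obtains i a b where "a \<in> D i" "b \<in> D i" "b \<notin> p" "s p = fraction A D p a b"
proof -
  have "s \<in> carrier (structure_sections A D Pts (Q.pre U))" using assms(1,2) by (simp add: Q.carrier_Y)
  thus ?thesis using assms(3) that by (rule sec_at)
qed

lemma value_scale:
  assumes x: "cone_point x" and t: "t \<noteq> 0" and y: "\<And>i. i \<le> n \<Longrightarrow> y i = t * x i"
    and U: "Q.opY U" "point_prime x \<in> Q.pre U" "s \<in> carrier (sections Y U)"
  shows "value y s = value x s"
proof -
  have gy: "cone_point y" using cone_point_scale[OF x t] cone_point_cong[of y "\<lambda>i. t * x i"] y by simp
  have point_prime: "point_prime y = point_prime x" using point_prime_scale[OF x t] point_prime_cong[of y "\<lambda>i. t * x i"] y gy by simp
  obtain i a b where ab: "a \<in> D i" "b \<in> D i" "b \<notin> point_prime x" "s (point_prime x) = fraction A D (point_prime x) a b"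
    using U(1,3,2) by (rule Y_sec)
  have ev: "ev y c = t ^ i * ev x c" if "c \<in> D i" for c
  proof -
    obtain P where P: "c = cl P" "P \<in> V" "homog i P"
      using \<open>c \<in> D i\<close> unfolding D_eq by blast
    have "at_pt y P = at_pt (\<lambda>i. t * x i) P" using y by (intro eval_cong_mpolys[OF P(2)]) simp
    also have "\<dots> = t ^ i * at_pt x P" by (rule ac.eval_homog_scale[OF P(3)])
    finally show ?thesis using P gy x by (simp add: ev_cl)
  qed
  show ?thesis
    using Q.val_frac[OF geom_point_prime[OF x] ab(1-3)] Q.val_frac[OF geom_point_prime[OF gy, unfolded point_prime] ab(1-3)]
      ev[OF ab(1)] ev[OF ab(2)] t unfolding point_prime ab(4) by simp
qed

lemma value_act:
  assumes x: "cone_point x" and \<zeta>: "\<zeta> \<in> H" and U: "Q.opY U" "point_prime x \<in> Q.pre U" "s \<in> carrier (sections Y U)"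
  shows "value (\<lambda>i. to_ac (\<zeta> i) * x i) s = value x s"
proof -
  have \<zeta>': "\<zeta> \<in> dwork_group n" using \<zeta> H_sub by blast
  have point_prime: "point_prime (\<lambda>i. to_ac (\<zeta> i) * x i) = Q.act \<zeta> (point_prime x)" by (simp only: act_eq gact_point_prime[OF \<zeta>' x])
  have gx: "cone_point (\<lambda>i. to_ac (\<zeta> i) * x i)" by (rule cone_point_act[OF \<zeta>' x])
  have "ev (\<lambda>i. to_ac (\<zeta> i) * x i) a = ev x (\<phi> \<zeta> a)" if "a \<in> D i" for a i
  proof -
    obtain P where P: "a = cl P" "P \<in> V" using \<open>a \<in> D i\<close> by (auto simp: D_eq)
    thus ?thesis using gx x by (simp add: \<phi>_cl[OF \<zeta>'] ev_cl mpolys_scale_vars at_scale)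
  qed
  hence "Q.val (ev (\<lambda>i. to_ac (\<zeta> i) * x i)) (s (Q.act \<zeta> (point_prime x))) = value x s"
    using geom_point_prime[OF gx] unfolding point_prime by (intro Q.val_act[OF geom_point_prime[OF x] \<zeta> _ _ U(1,2,3)])
  thus ?thesis unfolding point_prime .
qed

lemma at_frobenius: "at_pt (\<lambda>i. x i ^ CARD('f) ^ j) P = at_pt x P ^ CARD('f) ^ j"
proof -
  have "at_pt x P ^ CARD('f) ^ j = (\<Sum>m\<in>Poly_Mapping.keys P. to_ac (Poly_Mapping.lookup P m) ^ CARD('f) ^ j * monom_eval x m ^ CARD('f) ^ j)"
    unfolding mpoly_eval_def frobenius_sum by (simp add: power_mult_distrib)
  also have "\<dots> = at_pt (\<lambda>i. x i ^ CARD('f) ^ j) P"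
    unfolding mpoly_eval_def
  proof (intro sum.cong refl arg_cong2[where f = "(*)"])
    fix m
    show "to_ac (Poly_Mapping.lookup P m) ^ CARD('f) ^ j = to_ac (Poly_Mapping.lookup P m)"
      by (simp add: finite_field_power_card_power flip: to_ac_power)
    show "monom_eval x m ^ CARD('f) ^ j = monom_eval (\<lambda>i. x i ^ CARD('f) ^ j) m"
      by (simp add: monom_eval_def prod_power_distrib power_mult[symmetric] mult.commute)
  qed
  finally show ?thesis by simp
qed

lemma cone_point_frobenius: "cone_point x \<Longrightarrow> cone_point (\<lambda>i. x i ^ CARD('f) ^ j)"
  by (auto simp: cone_point_def at_frobenius)

lemma point_prime_frobenius:
  assumes x: "cone_point x"
  shows "point_prime (\<lambda>i. x i ^ CARD('f) ^ j) = point_prime x"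
proof (rule Pts_eqI[OF point_prime_Pts[OF cone_point_frobenius[OF x]] point_prime_Pts[OF x]])
  fix P d assume P: "P \<in> V" "homog d P"
  show "cl P \<in> point_prime (\<lambda>i. x i ^ CARD('f) ^ j) \<longleftrightarrow> cl P \<in> point_prime x"
    using point_prime_homog[OF x P] point_prime_homog[OF cone_point_frobenius[OF x] P] by (simp add: at_frobenius)
qed

lemma value_frobenius:
  assumes x: "cone_point x" and U: "Q.opY U" "point_prime x \<in> Q.pre U" "s \<in> carrier (sections Y U)"
  shows "value (\<lambda>i. x i ^ CARD('f) ^ j) s = value x s ^ CARD('f) ^ j"
proof -
  let ?y = "\<lambda>i. x i ^ CARD('f) ^ j"
  note gy = cone_point_frobenius[OF x, of j] and point_prime = point_prime_frobenius[OF x, of j]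
  obtain i a b where ab: "a \<in> D i" "b \<in> D i" "b \<notin> point_prime x" "s (point_prime x) = fraction A D (point_prime x) a b"
    using U(1,3,2) by (rule Y_sec)
  have ev: "ev ?y c = ev x c ^ CARD('f) ^ j" if "c \<in> D i" for c
  proof -
    obtain P where P: "c = cl P" "P \<in> V" using \<open>c \<in> D i\<close> by (auto simp: D_eq)
    thus ?thesis using gy x by (simp add: ev_cl at_frobenius)
  qed
  show ?thesis
    using Q.val_frac[OF geom_point_prime[OF x] ab(1-3)] Q.val_frac[OF geom_point_prime[OF gy, unfolded point_prime] ab(1-3)]
      ev[OF ab(1)] ev[OF ab(2)] unfolding point_prime ab(4) by (simp add: power_divide)
qed

lemma value_cong:
  assumes "cone_point x" "\<And>i. i \<le> n \<Longrightarrow> y i = x i" "Q.opY U" "point_prime x \<in> Q.pre U" "s \<in> carrier (sections Y U)"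
  shows "value y s = value x s"
  using assms by (intro value_scale[of x 1]) auto

lemma in_pre: "cone_point x \<Longrightarrow> point_prime x \<in> Q.pre U \<longleftrightarrow> \<pi> (point_prime x) \<in> U"
  using point_prime_Pts by (simp add: Q.pre_def)

subsection \<open>The rational point of a Frobenius-stable orbit\<close>

text \<open>
  \<open>x\<close> represents an \<open>H\<close>-orbit that is stable under the \<open>Q\<close>-Frobenius, with the scalar factor already
  removed.
\<close>

definition stable :: "(nat \<Rightarrow> 'f) \<Rightarrow> (nat \<Rightarrow> 'f alg_closure) \<Rightarrow> bool" where
  "stable \<zeta> x \<longleftrightarrow> \<zeta> \<in> H \<and> cone_point x \<and> (\<forall>i\<le>n. x i ^ CARD('f) ^ k = to_ac (\<zeta> i) * x i)"

definition orbit_point where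
  "orbit_point x = Q.geom_mor (point_prime x) (ev x)"

text \<open>
  The \<open>Q\<close>-th power of the value at \<open>x\<close> is the value at \<open>F x = \<zeta> x\<close>, hence at \<open>x\<close>.
\<close>

lemma stable_value:
  assumes x: "stable \<zeta> x" and U: "Q.opY U" "point_prime x \<in> Q.pre U" "s \<in> carrier (sections Y U)"
  shows "value x s \<in> K"
proof -
  have gx: "cone_point x" and \<zeta>: "\<zeta> \<in> H" using x by (auto simp: stable_def)
  have \<zeta>': "\<zeta> \<in> dwork_group n" using \<zeta> H_sub by blast
  have "point_prime x = gact \<zeta> (point_prime x)"
    using gact_point_prime[OF \<zeta>' gx] point_prime_frobenius[OF gx, of k]
      point_prime_cong[of "\<lambda>i. x i ^ CARD('f) ^ k" "\<lambda>i. to_ac (\<zeta> i) * x i"] x cone_point_frobenius[OF gx] by (simp add: stable_def)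
  hence ppx: "point_prime (\<lambda>i. to_ac (\<zeta> i) * x i) = point_prime x" by (simp only: gact_point_prime[OF \<zeta>' gx])
  have "value x s ^ CARD('f) ^ k = value (\<lambda>i. x i ^ CARD('f) ^ k) s" by (rule value_frobenius[OF gx U, symmetric])
  also have "\<dots> = value (\<lambda>i. to_ac (\<zeta> i) * x i) s"
    using x U by (intro value_cong[OF cone_point_act[OF \<zeta>' gx]]) (auto simp: stable_def ppx)
  also have "\<dots> = value x s" by (rule value_act[OF gx \<zeta> U])
  finally show ?thesis by simp
qed

lemma evaluation_value:
  assumes x: "cone_point x" and K: "\<And>U s. Q.opY U \<Longrightarrow> point_prime x \<in> Q.pre U \<Longrightarrow> s \<in> carrier (sections Y U) \<Longrightarrow> value x s \<in> K"
  shows "Q.evaluation Y (\<pi> (point_prime x)) (\<lambda>U s. value x s)"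
  using K x by (intro Q.evaluation_val[OF geom_point_prime[OF x]]) (simp_all add: ev_cl)

lemma rational_points_eq: "rational_points Y k = Mor (Spec (ring_on K) to_ac) Y"
  by (simp add: rational_points_def ext_field_def)

lemma orbit_point_rational:
  assumes x: "stable \<zeta> x"
  shows "orbit_point x \<in> rational_points Y k"
proof -
  have "cone_point x" using x by (simp add: stable_def)
  hence "Q.evaluation Y (\<pi> (point_prime x)) (\<lambda>U s. value x s)" using stable_value[OF x] by (rule evaluation_value)
  thus ?thesis unfolding rational_points_eq orbit_point_def Q.geom_mor_def
    by (rule Q.mor_in_Mor[OF Q.sections_closed_Y])
qed

lemma orbit_point_eqI:
  assumes x: "cone_point x" and t: "t \<noteq> 0" and h: "h \<in> H" and y: "\<And>i. i \<le> n \<Longrightarrow> y i = t * (to_ac (h i) * x i)"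
  shows "orbit_point y = orbit_point x"
proof -
  have h': "h \<in> dwork_group n" using h H_sub by blast
  let ?z = "\<lambda>i. to_ac (h i) * x i"
  have z: "cone_point ?z" by (rule cone_point_act[OF h' x])
  have gy: "cone_point y" using cone_point_scale[OF z t] cone_point_cong[of y "\<lambda>i. t * ?z i"] y by simp
  have ppz: "point_prime ?z = Q.act h (point_prime x)" by (simp only: act_eq gact_point_prime[OF h' x])
  have ppy: "point_prime y = point_prime ?z" using point_prime_scale[OF z t] point_prime_cong[of y "\<lambda>i. t * ?z i"] y gy by simp
  have \<pi>: "\<pi> (point_prime y) = \<pi> (point_prime x)" unfolding ppy ppz by (rule Q.\<pi>_act[OF h point_prime_Pts[OF x]])
  show ?thesis
    unfolding orbit_point_def Q.geom_mor_def \<pi>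
  proof (rule Q.mor_cong)
    fix U s assume U: "Q.opY U" "\<pi> (point_prime x) \<in> U" "s \<in> carrier (sections Y U)"
    have px: "point_prime x \<in> Q.pre U" using U(2) in_pre[OF x] by simp
    have pz: "point_prime ?z \<in> Q.pre U" unfolding ppz by (rule Q.pre_act[OF h px])
    have "value y s = value ?z s" using y by (intro value_scale[OF z t _ U(1) pz U(3)])
    also have "\<dots> = value x s" by (rule value_act[OF x h U(1) px U(3)])
    finally show "value y s = value x s" .
  qed
qed

subsection \<open>Invariant fractions separate orbits\<close>

text \<open>
  The image in the quotient of the open set where the \<open>i\<close>-th variable does not vanish.
\<close>

definition chart :: "nat \<Rightarrow> 'r set" where
  "chart i = \<pi> ` {p \<in> Pts. cl (Var i) \<notin> p}"

text \<open>
  The forms of degree \<open>d\<close> that give invariant fractions with denominator \<open>Var i ^ d\<close>. The denominator is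
  itself invariant because \<open>\<zeta> i ^ (q - 1) = 1\<close>.
\<close>

definition inv_form :: "nat \<Rightarrow> 'f mpoly \<Rightarrow> bool" where
  "inv_form d P \<longleftrightarrow> P \<in> V \<and> homog d P \<and> (\<forall>\<zeta>\<in>H. scale_vars \<zeta> P = P) \<and> (CARD('f) - 1) dvd d"

definition inv_section :: "nat \<Rightarrow> nat \<Rightarrow> 'f mpoly \<Rightarrow> 'f mpoly set set \<Rightarrow> ('f mpoly set \<times> 'f mpoly set) set" where
  "inv_section i d P = (\<lambda>p\<in>Q.pre (chart i). fraction A D p (cl P) (cl (Var i ^ d)))"

lemma scale_Var_power:
  assumes "\<zeta> \<in> H" "j \<le> n" "(CARD('f) - 1) dvd d"
  shows "scale_vars \<zeta> (Var j ^ d) = Var j ^ d"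
proof -
  have "\<zeta> j \<noteq> 0" using groupD(2) H_sub assms(1,2) by blast
  hence "\<zeta> j ^ (CARD('f) - 1) = 1" by (rule finite_field_nonzero_power)
  moreover obtain c where "d = (CARD('f) - 1) * c" using assms(3) ..
  ultimately have "\<zeta> j ^ d = 1" by (simp add: power_mult)
  thus ?thesis
    by (simp add: scale_vars_power scale_vars_Var power_mult_distrib Const_power Const_hom.h_1)
qed

lemma inv_form_Var_power: "j \<le> n \<Longrightarrow> (CARD('f) - 1) dvd d \<Longrightarrow> inv_form d (Var j ^ d)"
  using scale_Var_power homog_power[OF homog_Var, of d j]
  by (auto simp: inv_form_def intro!: mpolys_power mpolys_Var)

lemma inv_form_mult: "inv_form d P \<Longrightarrow> inv_form d' P' \<Longrightarrow> inv_form (d + d') (P * P')"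
  by (auto simp: inv_form_def scale_vars_mult intro: mpolys_mult homog_mult)

lemma inv_form_add: "inv_form d P \<Longrightarrow> inv_form d P' \<Longrightarrow> inv_form d (P + P')"
  by (auto simp: inv_form_def scale_vars_add intro: mpolys_add homog_add)

lemma gact_Var:
  assumes "\<zeta> \<in> H" "i \<le> n"
  shows "cl (Var i) \<in> gact \<zeta> p \<longleftrightarrow> cl (Const (\<zeta> i) * Var i) \<in> p"
proof -
  have "\<zeta> \<in> dwork_group n" "Var i \<in> V" using assms H_sub by (auto intro: mpolys_Var)
  thus ?thesis by (simp add: gact_def \<phi>_cl cl_closed scale_vars_Var)
qed

lemma chart_iff:
  assumes i: "i \<le> n" and p: "p \<in> Pts"
  shows "p \<in> Q.pre (chart i) \<longleftrightarrow> cl (Var i) \<notin> p"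
proof
  assume "cl (Var i) \<notin> p" thus "p \<in> Q.pre (chart i)" using p by (auto simp: Q.pre_def chart_def)
next
  assume "p \<in> Q.pre (chart i)"
  then obtain p' where p': "p' \<in> Pts" "cl (Var i) \<notin> p'" "\<pi> p' = \<pi> p" by (auto simp: Q.pre_def chart_def)
  then obtain \<zeta> where \<zeta>: "\<zeta> \<in> H" "p = Q.act \<zeta> p'" using Q.\<pi>_eqD[OF p'(1) p] by blast
  have iV: "Var i \<in> V" using i by (intro mpolys_Var) simp
  have \<zeta>': "\<zeta> \<in> dwork_group n" using \<zeta> H_sub by blast
  have "cl (Const (\<zeta> i)) \<notin> p'"
  proof
    assume "cl (Const (\<zeta> i)) \<in> p'"
    hence "cl (Const (inverse (\<zeta> i)) * Const (\<zeta> i)) \<in> p'"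
      using cl_in_prime_mult[OF p'(1), of "Const (inverse (\<zeta> i))" "Const (\<zeta> i)"] by simp
    moreover have "Const (inverse (\<zeta> i)) * Const (\<zeta> i) = (1 :: 'f mpoly)"
      using groupD(2)[OF \<zeta>' i] by (simp flip: Const_hom.h_mult add: Const_hom.h_1)
    ultimately show False using one_notin[OF p'(1)] by (simp add: cl_1)
  qed
  thus "cl (Var i) \<notin> p" using p'(2) gact_Var[OF \<zeta>(1) i, of p'] cl_in_prime_mult[OF p'(1) _ iV, of "Const (\<zeta> i)"]
    by (simp add: \<zeta>(2) act_eq)
qed

lemma pre_chart: "i \<le> n \<Longrightarrow> Q.pre (chart i) = {p \<in> Pts. cl (Var i) \<notin> p}"
  using chart_iff[of i] Q.pre_def by auto

lemma opY_chart:
  assumes i: "i \<le> n"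
  shows "Q.opY (chart i)"
proof -
  have "cl (Var i) \<in> D 1" using i by (intro cl_D mpolys_Var homog_Var) simp
  hence "cl (Var i) \<in> homogeneous D" by (rule D_hom)
  hence "openin (zariski D Pts) {p \<in> Pts. cl (Var i) \<notin> p}" by (rule op_basic)
  thus ?thesis using pre_chart[OF i] unfolding Q.openin_Y Q.pre_def by (auto simp: chart_def)
qed

lemma Var_power_D: "i \<le> n \<Longrightarrow> cl (Var i ^ d) \<in> D d"
  using homog_power[OF homog_Var, of d i] by (intro cl_D) (auto intro: mpolys_power mpolys_Var)

lemma Var_power_notin:
  assumes "i \<le> n" "p \<in> Q.pre (chart i)"
  shows "cl (Var i ^ d) \<notin> p"
proof
  assume *: "cl (Var i ^ d) \<in> p"
  have "p \<in> Pts" "cl (Var i) \<notin> p" "Var i \<in> V" using assms pre_chart[OF assms(1)] by (auto intro: mpolys_Var)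
  thus False using cl_in_prime_power[of p "Var i" d] * by blast
qed

lemma inv_form_D: "inv_form d P \<Longrightarrow> cl P \<in> D d"
  by (auto simp: inv_form_def intro: cl_D)

lemma inv_section:
  assumes i: "i \<le> n" and P: "inv_form d P"
  shows "inv_section i d P \<in> carrier (sections Y (chart i))"
  unfolding inv_section_def
proof (rule Q.invariant_fraction[OF opY_chart[OF i] inv_form_D[OF P] Var_power_D[OF i]])
  fix \<zeta> assume \<zeta>: "\<zeta> \<in> H"
  hence "\<zeta> \<in> dwork_group n" using H_sub by blast
  moreover have "Var i ^ d \<in> V" using i by (auto intro: mpolys_power mpolys_Var)
  ultimately show "\<phi> \<zeta> (cl P) = cl P \<and> \<phi> \<zeta> (cl (Var i ^ d)) = cl (Var i ^ d)"
    using P scale_Var_power[OF \<zeta> i, of d] \<zeta> by (simp add: inv_form_def \<phi>_cl)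
next
  show "cl (Var i ^ d) \<notin> p" if "p \<in> Q.pre (chart i)" for p by (rule Var_power_notin[OF i that])
qed

lemma value_inv_section:
  assumes i: "i \<le> n" and P: "inv_form d P" and x: "cone_point x" "x i \<noteq> 0"
  shows "value x (inv_section i d P) = at_pt x P / x i ^ d"
proof -
  have iV: "Var i \<in> V" using i by (intro mpolys_Var) simp
  have p: "point_prime x \<in> Q.pre (chart i)"
    using chart_iff[OF i point_prime_Pts[OF x(1)]] point_prime_homog[OF x(1) iV homog_Var] x(2) by simp
  have "value x (inv_section i d P) = ev x (cl P) / ev x (cl (Var i ^ d))"
    unfolding inv_section_def
    by (rule Q.val_fraction[OF geom_point_prime[OF x(1)] p inv_form_D[OF P] Var_power_D[OF i] Var_power_notin[OF i p]])
  thus ?thesis using x(1) P mpolys_power[OF iV, of d] by (simp add: ev_cl inv_form_def ac.eval_power)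
qed

lemma torus_H: "torus_group n {(\<lambda>i\<in>{..n}. t * \<zeta> i) | t \<zeta>. t \<noteq> 0 \<and> \<zeta> \<in> H}" (is "torus_group n ?T")
  unfolding torus_group_def
proof (intro conjI ballI allI impI)
  show "?T \<subseteq> extensional {..n}" by auto
  have "(\<lambda>i\<in>{..n}. 1) = (\<lambda>i\<in>{..n}. 1 * gone i)" by (intro restrict_ext) (simp add: gone_def)
  thus "(\<lambda>i\<in>{..n}. 1) \<in> ?T" using H_one by (intro CollectI exI[of _ 1] exI[of _ gone]) simp
next
  fix \<tau> i assume "\<tau> \<in> ?T" "i \<le> n"
  moreover have "\<zeta> i \<noteq> 0" if "\<zeta> \<in> H" for \<zeta> using groupD(2)[OF _ \<open>i \<le> n\<close>] H_sub that by blast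
  ultimately show "\<tau> i \<noteq> 0" by auto
next
  fix \<tau> assume "\<tau> \<in> ?T"
  then obtain t \<zeta> where *: "\<tau> = (\<lambda>i\<in>{..n}. t * \<zeta> i)" "t \<noteq> 0" "\<zeta> \<in> H" by blast
  have "(\<lambda>i\<in>{..n}. inverse (\<tau> i)) = (\<lambda>i\<in>{..n}. inverse t * ginv \<zeta> i)"
    by (intro restrict_ext) (simp add: * ginv_def)
  thus "(\<lambda>i\<in>{..n}. inverse (\<tau> i)) \<in> ?T" using * H_inv by (intro CollectI exI[of _ "inverse t"] exI[of _ "ginv \<zeta>"]) simp
next
  fix \<tau> \<sigma> assume "\<tau> \<in> ?T" "\<sigma> \<in> ?T"
  then obtain t \<zeta> u \<eta> where *: "\<tau> = (\<lambda>i\<in>{..n}. t * \<zeta> i)" "t \<noteq> 0" "\<zeta> \<in> H"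
    "\<sigma> = (\<lambda>i\<in>{..n}. u * \<eta> i)" "u \<noteq> 0" "\<eta> \<in> H" by blast
  have "(\<lambda>i\<in>{..n}. \<tau> i * \<sigma> i) = (\<lambda>i\<in>{..n}. (t * u) * gmul \<zeta> \<eta> i)"
    by (intro restrict_ext) (simp add: * gmul_def)
  thus "(\<lambda>i\<in>{..n}. \<tau> i * \<sigma> i) \<in> ?T" using * H_mul by (intro CollectI exI[of _ "t * u"] exI[of _ "gmul \<zeta> \<eta>"]) simp
qed

text \<open>
  The vectors \<open>x\<close> and \<open>y\<close> have the same support \<open>S\<close>. Invariant monomials whose degree is a multiple of
  \<open>q - 1\<close>, divided by a power of a coordinate in \<open>S\<close>, are invariant fractions; they are just the monomials
  invariant under the group of all \<open>t \<zeta>\<close> with \<open>t\<close> in the base field and \<open>\<zeta> \<in> H\<close>. So the vector \<open>w\<close> of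
  quotients of normalised coordinates is killed by all characters that are trivial on that group, and
  duality provides an element of it that carries \<open>x\<close> to \<open>y\<close> up to a scalar.
\<close>

theorem values_separate:
  assumes x: "cone_point x" and y: "cone_point y" and \<pi>: "\<pi> (point_prime x) = \<pi> (point_prime y)"
    and val: "\<And>U s. Q.opY U \<Longrightarrow> point_prime x \<in> Q.pre U \<Longrightarrow> s \<in> carrier (sections Y U) \<Longrightarrow> value x s = value y s"
  shows "\<exists>t h. t \<noteq> 0 \<and> h \<in> H \<and> (\<forall>i\<le>n. y i = t * (to_ac (h i) * x i))"
proof -
  define e where "e = CARD('f) - 1"
  define S where "S = {j. j \<le> n \<and> x j \<noteq> 0}"
  have VV: "Var j \<in> V" if "j \<le> n" for j using that by (intro mpolys_Var) simp
  have x0: "x j = 0 \<longleftrightarrow> point_prime x \<notin> Q.pre (chart j)" and y0: "y j = 0 \<longleftrightarrow> point_prime y \<notin> Q.pre (chart j)" if "j \<le> n" for j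
    using chart_iff[OF that point_prime_Pts[OF x]] point_prime_homog[OF x VV[OF that] homog_Var]
      chart_iff[OF that point_prime_Pts[OF y]] point_prime_homog[OF y VV[OF that] homog_Var] by simp_all
  have xy0: "x j = 0 \<longleftrightarrow> y j = 0" if "j \<le> n" for j
    using x0[OF that] y0[OF that] in_pre[OF x] in_pre[OF y] \<pi> by simp
  obtain i where i: "i \<le> n" "x i \<noteq> 0" using x by (auto simp: cone_point_def)
  have yi: "y i \<noteq> 0" using xy0 i by simp
  have at: "at_pt x P / x i ^ d = at_pt y P / y i ^ d" if "inv_form d P" for P d
    using val[OF opY_chart[OF i(1)] _ inv_section[OF i(1) that]] x0[OF i(1)] i
      value_inv_section[OF i(1) that x i(2)] value_inv_section[OF i(1) that y yi] by simp
  define w where "w j = (x j * y i) / (y j * x i)" for j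
  have finS: "finite S" by (simp add: S_def)
  have "\<exists>\<tau>\<in>{(\<lambda>i\<in>{..n}. t * \<zeta> i) | t \<zeta>. t \<noteq> 0 \<and> \<zeta> \<in> H}. \<forall>j\<in>S. to_ac (\<tau> j) * w j = 1"
  proof (rule torus_duality[OF torus_H])
    show "S \<subseteq> {..n}" by (auto simp: S_def)
    show "e = CARD('f) - 1" by (rule e_def)
    fix j assume j: "j \<in> S"
    have "inv_form e (Var j ^ e)" using j by (intro inv_form_Var_power) (auto simp: S_def e_def)
    from at[OF this] show "w j ^ e = 1"
      using i yi j xy0 by (auto simp: S_def w_def ac.eval_power power_divide power_mult_distrib field_simps)
  next
    fix a assume a: "a \<in> PiE S (\<lambda>_. {..<e})"
      and inv: "\<And>\<tau>. \<tau> \<in> {(\<lambda>i\<in>{..n}. t * \<zeta> i) | t \<zeta>. t \<noteq> 0 \<and> \<zeta> \<in> H} \<Longrightarrow> (\<Prod>j\<in>S. \<tau> j ^ a j) = 1"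
    define d where "d = sum a S"
    have inv': "t ^ d * (\<Prod>j\<in>S. \<zeta> j ^ a j) = 1" if "t \<noteq> 0" "\<zeta> \<in> H" for t \<zeta>
    proof -
      have "(\<Prod>j\<in>S. (\<lambda>i\<in>{..n}. t * \<zeta> i) j ^ a j) = 1" using \<open>t \<noteq> 0\<close> \<open>\<zeta> \<in> H\<close> by (intro inv) blast
      also have "(\<Prod>j\<in>S. (\<lambda>i\<in>{..n}. t * \<zeta> i) j ^ a j) = (\<Prod>j\<in>S. t ^ a j * \<zeta> j ^ a j)"
        by (intro prod.cong) (auto simp: S_def power_mult_distrib)
      also have "\<dots> = t ^ d * (\<Prod>j\<in>S. \<zeta> j ^ a j)" by (simp add: prod.distrib d_def power_sum)
      finally show ?thesis .
    qed
    have h1: "(\<Prod>j\<in>S. \<zeta> j ^ a j) = 1" if "\<zeta> \<in> H" for \<zeta> using inv'[of 1 \<zeta>] \<open>\<zeta> \<in> H\<close> by simp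
    \<comment> \<open>The scalars in the group force the degree to be a multiple of \<open>q - 1\<close>.\<close>
    have "e dvd d"
    proof (rule roots_of_unity_exponent_dvd[of "UNIV - {0 :: 'f}"])
      show "card (UNIV - {0 :: 'f}) = e" by (simp add: e_def card_Diff_singleton)
      show "0 < e" using card_power_gt_1[of 1, where ?'f = 'f] by (simp add: e_def)
      fix c :: 'f assume "c \<in> UNIV - {0}"
      thus "c ^ e = 1" "c ^ d = 1" using finite_field_nonzero_power[of c] inv'[OF _ H_one, of c] h1[OF H_one]
        by (simp_all add: e_def)
    qed simp
    define P where "P = (\<Prod>j\<in>S. Var j ^ a j :: 'f mpoly)"
    have "inv_form d P"
      unfolding inv_form_def
    proof (intro conjI ballI)
      show "P \<in> V" unfolding P_def by (intro mpolys_prod mpolys_power VV) (simp add: S_def)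
      have "homog (sum a F) (\<Prod>j\<in>F. Var j ^ a j :: 'f mpoly)" if "finite F" for F
        using that
      proof induction
        case (insert j F)
        thus ?case using homog_mult[OF homog_power[OF homog_Var, of "a j" j] insert.IH] by simp
      qed simp
      thus "homog d P" using finS by (simp add: P_def d_def)
      show "(CARD('f) - 1) dvd d" using \<open>e dvd d\<close> by (simp add: e_def)
      fix \<zeta> assume \<zeta>: "\<zeta> \<in> H"
      have "scale_vars \<zeta> P = (\<Prod>j\<in>S. Const (\<zeta> j ^ a j) * Var j ^ a j)"
        unfolding P_def scale_vars_prod scale_vars_power scale_vars_Var power_mult_distrib Const_power ..
      also have "\<dots> = (\<Prod>j\<in>S. Const (\<zeta> j ^ a j)) * P" by (simp add: P_def prod.distrib)
      finally show "scale_vars \<zeta> P = P" by (simp add: Const_prod h1[OF \<zeta>] Const_hom.h_1)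
    qed
    hence "at_pt x P / x i ^ d = at_pt y P / y i ^ d" by (rule at)
    moreover have "at_pt z P = (\<Prod>j\<in>S. z j ^ a j)" for z by (simp add: P_def ac.eval_prod ac.eval_power)
    ultimately have eq: "(\<Prod>j\<in>S. x j ^ a j) / x i ^ d = (\<Prod>j\<in>S. y j ^ a j) / y i ^ d" by simp
    have "(\<Prod>j\<in>S. w j ^ a j) = (\<Prod>j\<in>S. x j ^ a j) * y i ^ d / ((\<Prod>j\<in>S. y j ^ a j) * x i ^ d)"
      by (simp add: w_def power_divide power_mult_distrib prod.distrib prod_dividef d_def power_sum)
    moreover have "(\<Prod>j\<in>S. y j ^ a j) \<noteq> 0" using xy0 finS by (auto simp: S_def)
    ultimately show "(\<Prod>j\<in>S. w j ^ a j) = 1" using eq i yi by (simp add: field_simps)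
  qed
  then obtain t h where th: "t \<noteq> 0" "h \<in> H" "\<And>j. j \<in> S \<Longrightarrow> to_ac (t * h j) * w j = 1"
    by (auto simp: S_def)
  have "y j = (to_ac t * y i / x i) * (to_ac (h j) * x j)" if j: "j \<le> n" for j
  proof (cases "x j = 0")
    case True
    thus ?thesis using xy0[OF j] by simp
  next
    case False
    thus ?thesis using th(3)[of j] j xy0[OF j] i yi by (simp add: S_def w_def field_simps)
  qed
  moreover have "to_ac t * y i / x i \<noteq> 0" using th(1) i yi by simp
  ultimately show ?thesis using th(2) by blast
qed

subsection \<open>Every rational point comes from a Frobenius-stable orbit\<close>

lemma Var_V: "i \<le> n \<Longrightarrow> Var i \<in> V" and Var_power_V: "i \<le> n \<Longrightarrow> Var i ^ d \<in> V"
  by (auto intro: mpolys_Var mpolys_power)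

lemma inv_section_mult:
  assumes i: "i \<le> n" and P: "inv_form d P" and P': "inv_form d' P'"
  shows "inv_section i (d + d') (P * P') = inv_section i d P \<otimes>\<^bsub>sections Y (chart i)\<^esub> inv_section i d' P'"
  unfolding Q.sections_Y_simps[OF opY_chart[OF i]] O_simps inv_section_def
proof (rule restrict_ext)
  fix p assume p: "p \<in> Q.pre (chart i)"
  have pP: "p \<in> Pts" using p by (simp add: Q.pre_def)
  have "fraction_mult A D p (fraction A D p (cl P) (cl (Var i ^ d))) (fraction A D p (cl P') (cl (Var i ^ d')))
    = fraction A D p (cl P \<otimes>\<^bsub>A\<^esub> cl P') (cl (Var i ^ d) \<otimes>\<^bsub>A\<^esub> cl (Var i ^ d'))"
    by (rule frac_mult[OF pP inv_form_D[OF P] Var_power_D[OF i] Var_power_notin[OF i p]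
        inv_form_D[OF P'] Var_power_D[OF i] Var_power_notin[OF i p]])
  thus "fraction A D p (cl (P * P')) (cl (Var i ^ (d + d'))) = fraction_mult A D p
      ((\<lambda>p\<in>Q.pre (chart i). fraction A D p (cl P) (cl (Var i ^ d))) p)
      ((\<lambda>p\<in>Q.pre (chart i). fraction A D p (cl P') (cl (Var i ^ d'))) p)"
    using p P P' Var_power_V[OF i] by (simp add: power_add cl_mult inv_form_def)
qed

lemma inv_section_add:
  assumes i: "i \<le> n" and P: "inv_form d P" and P': "inv_form d P'"
  shows "inv_section i d (P + P') = inv_section i d P \<oplus>\<^bsub>sections Y (chart i)\<^esub> inv_section i d P'"
  unfolding Q.sections_Y_simps[OF opY_chart[OF i]] O_simps inv_section_def
proof (rule restrict_ext)
  fix p assume p: "p \<in> Q.pre (chart i)"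
  let ?B = "Var i ^ d :: 'f mpoly"
  have pP: "p \<in> Pts" using p by (simp add: Q.pre_def)
  have V: "P \<in> V" "P' \<in> V" "?B \<in> V" using P P' Var_power_V[OF i] by (auto simp: inv_form_def)
  note D = inv_form_D[OF P] Var_power_D[OF i, of d] Var_power_notin[OF i p, of d]
  note D' = inv_form_D[OF P'] Var_power_D[OF i, of d] Var_power_notin[OF i p, of d]
  have "fraction_add A D p (fraction A D p (cl P) (cl ?B)) (fraction A D p (cl P') (cl ?B))
    = fraction A D p (cl P \<otimes>\<^bsub>A\<^esub> cl ?B \<oplus>\<^bsub>A\<^esub> cl P' \<otimes>\<^bsub>A\<^esub> cl ?B) (cl ?B \<otimes>\<^bsub>A\<^esub> cl ?B)"
    by (rule frac_add[OF pP D D'])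
  also have "\<dots> = fraction A D p (cl (P + P')) (cl ?B)"
  proof (subst frac_eq[OF pP D_mult_add[OF D(1,2) D'(1,2)] D_mult[OF D(2) D(2)] _ inv_form_D[OF inv_form_add[OF P P']] D(2,3)])
    show "cl ?B \<otimes>\<^bsub>A\<^esub> cl ?B \<notin> p" using mult_notin[OF pP _ _ D(3) D(3)] cl_closed[OF V(3)] by simp
    have "(P * ?B + P' * ?B) * ?B = (P + P') * (?B * ?B)" by (simp add: algebra_simps)
    hence "cl ((P * ?B + P' * ?B) * ?B) = cl ((P + P') * (?B * ?B))" by (rule arg_cong)
    hence "(cl P \<otimes>\<^bsub>A\<^esub> cl ?B \<oplus>\<^bsub>A\<^esub> cl P' \<otimes>\<^bsub>A\<^esub> cl ?B) \<otimes>\<^bsub>A\<^esub> cl ?B = cl (P + P') \<otimes>\<^bsub>A\<^esub> (cl ?B \<otimes>\<^bsub>A\<^esub> cl ?B)"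
      using V by (simp only: cl_mult cl_add mpolys_mult mpolys_add)
    thus "same p (cl P \<otimes>\<^bsub>A\<^esub> cl ?B \<oplus>\<^bsub>A\<^esub> cl P' \<otimes>\<^bsub>A\<^esub> cl ?B) (cl ?B \<otimes>\<^bsub>A\<^esub> cl ?B) (cl (P + P')) (cl ?B)"
      unfolding same_def using one_hom one_notin[OF pP] by (intro bexI[of _ "\<one>\<^bsub>A\<^esub>"]) auto
  qed
  finally show "fraction A D p (cl (P + P')) (cl ?B) = fraction_add A D p
      ((\<lambda>p\<in>Q.pre (chart i). fraction A D p (cl P) (cl ?B)) p)
      ((\<lambda>p\<in>Q.pre (chart i). fraction A D p (cl P') (cl ?B)) p)"
    using p by simp
qed

lemma inv_section_one:
  assumes i: "i \<le> n"
  shows "inv_section i d (Var i ^ d) = \<one>\<^bsub>sections Y (chart i)\<^esub>"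
  unfolding Q.sections_Y_simps[OF opY_chart[OF i]] O_simps inv_section_def
proof (rule restrict_ext)
  fix p assume p: "p \<in> Q.pre (chart i)"
  have pP: "p \<in> Pts" using p by (simp add: Q.pre_def)
  have "same p (cl (Var i ^ d)) (cl (Var i ^ d)) \<one>\<^bsub>A\<^esub> \<one>\<^bsub>A\<^esub>"
    unfolding same_def using one_hom one_notin[OF pP] A.m_comm[OF _ A.one_closed] cl_closed[OF Var_power_V[OF i]]
    by (intro bexI[of _ "\<one>\<^bsub>A\<^esub>"]) simp_all
  thus "fraction A D p (cl (Var i ^ d)) (cl (Var i ^ d)) = fraction A D p \<one>\<^bsub>A\<^esub> \<one>\<^bsub>A\<^esub>"
    using frac_eq[OF pP Var_power_D[OF i] Var_power_D[OF i] Var_power_notin[OF i p] D_one D_one one_notin[OF pP]] by simp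
qed

lemma inv_section_nonvanishing:
  assumes i: "i \<le> n" and P: "inv_form d P" and p: "p \<in> Q.pre (chart i)"
  shows "germ_unit Y (chart i) (\<pi> p) (inv_section i d P) \<longleftrightarrow> cl P \<notin> p"
proof -
  have pP: "p \<in> Pts" using p by (simp add: Q.pre_def)
  have "inv_section i d P p = fraction A D p (cl P) (cl (Var i ^ d))" using p by (simp add: inv_section_def)
  hence "nonvanishing (inv_section i d P) p \<longleftrightarrow> cl P \<notin> p"
    by (rule nonvanishing_frac[OF pP inv_form_D[OF P] Var_power_D[OF i] Var_power_notin[OF i p]])
  thus ?thesis using Q.germ_unit_Y[OF opY_chart[OF i] inv_section[OF i P] p] by simp
qed

text \<open>
  Let \<open>u\<close> be the value of \<open>x\<^sub>j\<^sup>e / x\<^sub>i\<^sup>e\<close> with \<open>e = q - 1\<close>. It lies in \<open>K\<close>, so \<open>u\<^sup>Q = u\<close>, and the section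
  \<open>(x\<^sub>j ^ (e Q) - x\<^sub>j ^ e * x\<^sub>i ^ N) / x\<^sub>i ^ (e Q)\<close>, where \<open>e + N = e Q\<close>, has value zero. Hence it is not a unit at \<open>p\<close>, and its
  numerator \<open>x\<^sub>j\<^sup>e (x\<^sub>j\<^sup>N - x\<^sub>i\<^sup>N)\<close> lies in \<open>p\<close>.
\<close>

lemma rational_equation:
  assumes E: "Q.evaluation Y (\<pi> p) \<psi>" and p: "p \<in> Pts" and i: "i \<le> n" "cl (Var i) \<notin> p" and j: "j \<le> n"
    and N: "N = (CARD('f) - 1) * (CARD('f) ^ k - 1)"
  shows "cl (Var j) \<in> p \<or> cl (Var j ^ N - Var i ^ N) \<in> p"
proof -
  let ?U = "chart i"
  define e where "e = CARD('f) - 1"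
  define Q where "Q = CARD('f) ^ k"
  have Q1: "Q > 1" unfolding Q_def using k_pos by (rule card_power_gt_1)
  have pU: "p \<in> Q.pre ?U" using chart_iff[OF i(1) p] i(2) by simp
  hence zU: "\<pi> p \<in> ?U" by (simp add: Q.pre_def)
  note opU = opY_chart[OF i(1)] and sec = inv_section[OF i(1)]
  define u where "u d P = \<psi> ?U (inv_section i d P)" for d P
  have u_mult: "u (d + d') (P * P') = u d P * u d' P'" if "inv_form d P" "inv_form d' P'" for d d' P P'
    unfolding u_def inv_section_mult[OF i(1) that] using E opU zU sec[OF that(1)] sec[OF that(2)]
    by (simp add: Q.evaluation_def)
  have u_add: "u d (P + P') = u d P + u d P'" if "inv_form d P" "inv_form d P'" for d P P'
    unfolding u_def inv_section_add[OF i(1) that] using E opU zU sec[OF that(1)] sec[OF that(2)]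
    by (simp add: Q.evaluation_def)
  have u_one: "u d (Var i ^ d) = 1" for d
    unfolding u_def inv_section_one[OF i(1)] using E opU zU by (simp add: Q.evaluation_def)
  have u_zero: "u d P = 0 \<longleftrightarrow> cl P \<in> p" if "inv_form d P" for d P
    using Q.evaluation_germ_unit[OF E opU zU sec[OF that]] inv_section_nonvanishing[OF i(1) that pU] by (simp add: u_def)
  have form: "inv_form (e * m) (Var l ^ (e * m))" if "l \<le> n" for l m
    using that by (intro inv_form_Var_power) (simp_all add: e_def)
  have form_e: "inv_form e (Var l ^ e)" if "l \<le> n" for l using form[OF that, of 1] by simp
  have pow: "u (e * m) (Var j ^ (e * m)) = u e (Var j ^ e) ^ m" for m
  proof (induction m)
    case 0
    have "u 0 (Var j ^ 0) = 1" using u_one[of 0] by simp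
    thus ?case by simp
  next
    case (Suc m)
    have "u (e + e * m) (Var j ^ e * Var j ^ (e * m)) = u e (Var j ^ e) * u (e * m) (Var j ^ (e * m))"
      by (rule u_mult[OF form_e[OF j] form[OF j]])
    thus ?case using Suc by (simp add: power_add)
  qed
  have "u e (Var j ^ e) \<in> K"
    using E opU zU sec[OF form_e[OF j]] by (simp add: Q.evaluation_def u_def)
  hence uQ: "u e (Var j ^ e) ^ Q = u e (Var j ^ e)" by (simp add: Q_def)
  define B where "B = (Var j ^ e * Var i ^ N :: 'f mpoly)"
  have eQ: "e + N = e * Q" using Q1 by (cases Q) (simp_all add: N e_def Q_def[symmetric])
  have N': "N = e * (Q - 1)" by (simp add: N e_def Q_def)
  have formB: "inv_form (e * Q) B"
    unfolding B_def eQ[symmetric] using form[OF i(1), of "Q - 1"] by (intro inv_form_mult form_e j) (simp add: N')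
  have uB: "u (e * Q) B = u e (Var j ^ e)"
    unfolding B_def eQ[symmetric]
    using u_mult[OF form_e[OF j] form[OF i(1), of "Q - 1"]] u_one by (simp add: N')
  define C where "C = (Var j ^ (e * Q) - B :: 'f mpoly)"
  have formC: "inv_form (e * Q) C"
  proof -
    have scale_neg: "scale_vars \<zeta> (- B) = - scale_vars \<zeta> B" for \<zeta>
      using scale_vars_add[of \<zeta> B "- B"] scale_vars_Const[of \<zeta> 0] by (simp add: Const_def add_eq_0_iff)
    have "inv_form (e * Q) (- B)" using formB scale_neg mpolys_uminus[of B] homog_uminus[of "e * Q" B]
      by (simp add: inv_form_def)
    thus ?thesis unfolding C_def using inv_form_add[OF form[OF j, of Q], of "- B"] by simp
  qed
  have "u (e * Q) (C + B) = u (e * Q) C + u (e * Q) B" by (rule u_add[OF formC formB])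
  moreover have "C + B = Var j ^ (e * Q)" by (simp add: C_def)
  ultimately have "u (e * Q) C = 0" using pow[of Q] uQ uB by simp
  hence "cl C \<in> p" by (simp add: u_zero[OF formC])
  moreover have "C = Var j ^ e * (Var j ^ N - Var i ^ N)"
    unfolding C_def B_def eQ[symmetric] by (simp add: power_add right_diff_distrib)
  ultimately have "cl (Var j ^ e) \<in> p \<or> cl (Var j ^ N - Var i ^ N) \<in> p"
    using cl_in_prime_mult[OF p Var_power_V[OF j] mpolys_diff[OF Var_power_V[OF j] Var_power_V[OF i(1)]]] by simp
  thus ?thesis using cl_in_prime_power[OF p Var_V[OF j]] by blast
qed

text \<open>
  Choose a power \<open>r\<close> of \<open>q\<close> with \<open>N dvd r - 1\<close>; this is possible as \<open>N\<close> is prime to \<open>q\<close>. Then the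
  equations of the previous lemma become those of \<open>closed_point\<close>.
\<close>

lemma rational_point_geometric:
  assumes E: "Q.evaluation Y (\<pi> p) \<psi>" and p: "p \<in> Pts"
  shows "\<exists>x r. cone_point x \<and> point_prime x = p \<and> r > 1 \<and> (\<exists>l. r = CARD('f) ^ l) \<and> (\<forall>j\<le>n. x j ^ r = x j)"
proof -
  obtain i where i: "i \<le> n" "cl (Var i) \<notin> p" using Pts_Var[OF p] by blast
  let ?q = "CARD('f)"
  define N where "N = (?q - 1) * (?q ^ k - 1)"
  define l where "l = totient N"
  define r where "r = ?q ^ l"
  have q1: "?q > 1" "?q ^ k > 1" using card_power_gt_1[of 1, where ?'f = 'f] card_power_gt_1[OF k_pos, where ?'f = 'f] by auto
  hence N0: "N > 0" by (simp add: N_def)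
  hence l0: "l > 0" by (simp add: l_def)
  have r1: "r > 1" unfolding r_def using l0 by (rule card_power_gt_1)
  have "coprime ?q N"
  proof -
    have "coprime ?q (?q - 1)" using q1(1) by (intro coprime_diff_one_right_nat) simp
    moreover have "coprime (?q ^ k) (?q ^ k - 1)" using q1(2) by (intro coprime_diff_one_right_nat) simp
    hence "coprime ?q (?q ^ k - 1)" using k_pos by simp
    ultimately show ?thesis by (simp add: N_def)
  qed
  hence "[?q ^ l = 1] (mod N)" unfolding l_def by (rule euler_theorem)
  hence "N dvd r - 1" using r1 by (simp add: r_def cong_altdef_nat)
  then obtain m where m: "r - 1 = N * m" ..
  have "cl (Var j ^ r - Var j * Var i ^ (r - 1)) \<in> p" if j: "j \<le> n" for j
  proof -
    define G where "G = (\<Sum>a<m. (Var i ^ N :: 'f mpoly) ^ (m - Suc a) * (Var j ^ N) ^ a)"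
    have GV: "G \<in> V" unfolding G_def by (intro mpolys_sum mpolys_mult mpolys_power Var_V i(1) j)
    have "r = Suc (r - 1)" using r1 by simp
    hence "(Var j :: 'f mpoly) ^ r = Var j * Var j ^ (r - 1)" by (metis power_Suc)
    hence "Var j ^ r - Var j * Var i ^ (r - 1) = Var j * ((Var j ^ N) ^ m - (Var i ^ N :: 'f mpoly) ^ m)"
      by (simp only: m power_mult right_diff_distrib)
    also have "\<dots> = (Var j * (Var j ^ N - Var i ^ N)) * G"
      unfolding power_diff_sumr2 G_def by (simp add: mult.assoc)
    finally have eq: "Var j ^ r - Var j * Var i ^ (r - 1) = (Var j * (Var j ^ N - Var i ^ N)) * G" .
    have V: "Var j \<in> V" "Var j ^ N - Var i ^ N \<in> V" by (intro mpolys_diff mpolys_power Var_V i(1) j)+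
    have "cl (Var j * (Var j ^ N - Var i ^ N)) \<in> p"
      using rational_equation[OF E p i j N_def] cl_in_prime_mult[OF p V] by simp
    thus ?thesis unfolding eq using cl_in_prime_mult[OF p mpolys_mult[OF V] GV] by simp
  qed
  note rel = this
  have "card {x :: 'f alg_closure. x ^ r = x} = r"
  proof -
    obtain m' where m': "m' > 0" "?q = CHAR('f) ^ m'" using finite_field_card_prime_power by blast
    have "r = CHAR('f alg_closure) ^ (m' * l)" by (simp add: r_def m'(2) power_mult)
    thus ?thesis using prime_CHAR_finite[where ?'f = 'f] m'(1) l0 
      by (intro card_frobenius_fixed[where a = "m' * l"]) simp_all
  qed
  moreover have "c ^ r = c" for c :: 'f unfolding r_def by (rule finite_field_power_card_power)
  moreover have "(x + y) ^ r = x ^ r + y ^ r" for x y :: "'f alg_closure" unfolding r_def by (rule frobenius_add)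
  ultimately obtain x where x: "cone_point x" "x i = 1" "point_prime x = p" using closed_point[OF p i r1 _ _ _ rel] by blast
  have "x j ^ r = x j" if j: "j \<le> n" for j
  proof -
    let ?P = "Var j ^ r - Var j * Var i ^ (r - 1) :: 'f mpoly"
    have PV: "?P \<in> V" by (intro mpolys_diff mpolys_mult mpolys_power Var_V i(1) j)
    have "homog (1 + (r - 1) * 1) (Var j * Var i ^ (r - 1) :: 'f mpoly)" by (intro homog_mult homog_power homog_Var)
    moreover have "homog (r * 1) (Var j ^ r :: 'f mpoly)" by (intro homog_power homog_Var)
    ultimately have "homog r ?P" using r1 by (intro homog_diff) simp_all
    moreover have "cl ?P \<in> point_prime x" unfolding x(3) by (rule rel[OF j])
    ultimately have "at_pt x ?P = 0" using point_prime_homog[OF x(1) PV] by blast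
    thus ?thesis using ac.eval_add[of x ?P "Var j * Var i ^ (r - 1)"] x(2) by (simp add: ac.eval_power ac.eval_mult)
  qed
  thus ?thesis using x r1 r_def by blast
qed

text \<open>
  The pairs of the value at the geometric point \<open>x\<close> and the value prescribed by the morphism form a
  correspondence as in \<open>finite_correspondence_is_frobenius\<close>: both are nonzero exactly for the sections
  that are units at \<open>p\<close>, and the values at \<open>x\<close> lie in a finite field, as the coordinates do. So the
  morphism is evaluation at a Frobenius conjugate \<open>y\<close> of \<open>x\<close>. Its values lie in \<open>K\<close>, so \<open>y\<close> and \<open>F y\<close> have
  the same values and lie in one orbit.
\<close>

theorem rational_point_is_orbit_point:
  assumes g: "g \<in> rational_points Y k"
  shows "\<exists>\<zeta> x. stable \<zeta> x \<and> x \<in> extensional {..n} \<and> g = orbit_point x"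
proof -
  let ?q = "CARD('f)"
  obtain z \<psi> where E: "Q.evaluation Y z \<psi>" and g_eq: "g = Q.mor Y z \<psi>"
    using g unfolding rational_points_eq by (rule Q.Mor_cases)
  have "z \<in> \<pi> ` Pts" using E Q.points_Y by (simp add: Q.evaluation_def)
  then obtain p where p: "p \<in> Pts" "z = \<pi> p" by blast
  note E = E[unfolded p(2)]
  obtain x r where x: "cone_point x" "point_prime x = p" "r > 1" "\<exists>l. r = ?q ^ l" "\<And>j. j \<le> n \<Longrightarrow> x j ^ r = x j"
    using rational_point_geometric[OF E p(1)] by blast
  obtain l where l: "r = ?q ^ l" using x(4) ..
  note pre = in_pre[OF x(1), unfolded x(2)]
  define \<Gamma> where "\<Gamma> = {(value x s, \<psi> U s) | U s. Q.opY U \<and> p \<in> Q.pre U \<and> s \<in> carrier (sections Y U)}"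
  have \<Gamma>I: "(value x s, \<psi> U s) \<in> \<Gamma>" if "Q.opY U" "p \<in> Q.pre U" "s \<in> carrier (sections Y U)" for U s
    unfolding \<Gamma>_def using that by blast
  \<comment> \<open>Two sections can be compared after restriction to the intersection of their domains.\<close>
  have common: "\<exists>U s s'. Q.opY U \<and> p \<in> Q.pre U \<and> s \<in> carrier (sections Y U) \<and> s' \<in> carrier (sections Y U) \<and>
      a = value x s \<and> b = \<psi> U s \<and> a' = value x s' \<and> b' = \<psi> U s'" if ab: "(a, b) \<in> \<Gamma>" "(a', b') \<in> \<Gamma>" for a b a' b'
  proof -
    obtain U s where s: "Q.opY U" "p \<in> Q.pre U" "s \<in> carrier (sections Y U)" "a = value x s" "b = \<psi> U s"
      using ab(1) unfolding \<Gamma>_def by blast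
    obtain U' s' where s': "Q.opY U'" "p \<in> Q.pre U'" "s' \<in> carrier (sections Y U')" "a' = value x s'" "b' = \<psi> U' s'"
      using ab(2) unfolding \<Gamma>_def by blast
    let ?W = "U \<inter> U'"
    have W: "Q.opY ?W" "p \<in> Q.pre ?W" using s(1,2) s'(1,2) by (auto simp: Q.pre_def)
    have "restr Y U ?W s \<in> carrier (sections Y ?W)" "restr Y U' ?W s' \<in> carrier (sections Y ?W)"
      using Q.Y_restr_closed[OF s(1,3) W(1)] Q.Y_restr_closed[OF s'(1,3) W(1)] by auto
    moreover have "value x (restr Y U ?W s) = a" "value x (restr Y U' ?W s') = a'"
      using W(2) x(2) s(4) s'(4) Q.restr_Y'[OF s(1) W(1)] Q.restr_Y'[OF s'(1) W(1)] by simp_all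
    moreover have "\<psi> ?W (restr Y U ?W s) = b" "\<psi> ?W (restr Y U' ?W s') = b'"
      using E s s' W pre by (auto simp: Q.evaluation_def)
    ultimately show ?thesis using W by metis
  qed
  have "\<exists>j. \<forall>(a, b)\<in>\<Gamma>. b = a ^ ?q ^ j"
  proof (rule finite_correspondence_is_frobenius)
    have "fst ` \<Gamma> \<subseteq> {v :: 'f alg_closure. v ^ r = v}"
    proof
      fix v assume "v \<in> fst ` \<Gamma>"
      then obtain U s where s: "Q.opY U" "p \<in> Q.pre U" "s \<in> carrier (sections Y U)" "v = value x s"
        unfolding \<Gamma>_def by force
      have "v ^ r = value (\<lambda>i. x i ^ ?q ^ l) s" unfolding s(4) l
        using s x(2) by (intro value_frobenius[OF x(1), symmetric]) simp_all
      also have "\<dots> = v" unfolding s(4) using s x l by (intro value_cong) auto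
      finally show "v \<in> {v. v ^ r = v}" by simp
    qed
    thus "finite (fst ` \<Gamma>)" using finite_power_eq_self[OF x(3)] finite_subset by blast
  next
    fix c
    have "p \<in> Q.pre (points Y)" using Q.pre_points p(1) by simp
    moreover have "value x (scalar Y c) = to_ac c"
      using Q.val_frac[OF geom_point_prime[OF x(1)] Q.\<kappa>_D D_one one_notin[OF point_prime_Pts[OF x(1)]]] point_prime_Pts[OF x(1)] x(1) geom_point_prime[OF x(1)]
      by (simp add: Q.scalar_Y ev_cl Q.geomD(2))
    moreover have "\<psi> (points Y) (scalar Y c) = to_ac c" using E by (simp add: Q.evaluation_def)
    ultimately show "(to_ac c, to_ac c) \<in> \<Gamma>"
      using \<Gamma>I[OF Q.opY_points _ Q.Y_scalar_closed, of c] by simp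
  next
    fix a b a' b' assume ab: "(a, b) \<in> \<Gamma>" "(a', b') \<in> \<Gamma>"
    obtain U s s' where s: "Q.opY U" "p \<in> Q.pre U" "s \<in> carrier (sections Y U)" "s' \<in> carrier (sections Y U)"
      "a = value x s" "b = \<psi> U s" "a' = value x s'" "b' = \<psi> U s'" using common[OF ab] by blast
    have cl: "s \<oplus>\<^bsub>sections Y U\<^esub> s' \<in> carrier (sections Y U)" "s \<otimes>\<^bsub>sections Y U\<^esub> s' \<in> carrier (sections Y U)"
      by (rule Q.Y_add_closed[OF s(1,3,4)], rule Q.Y_mult_closed[OF s(1,3,4)])
    have v: "value x (s \<oplus>\<^bsub>sections Y U\<^esub> s') = a + a'" "value x (s \<otimes>\<^bsub>sections Y U\<^esub> s') = a * a'"
      using Q.val_sections[OF geom_point_prime[OF x(1)] s(1) _ s(3,4)] s(2) unfolding x(2) s by simp_all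
    have w: "\<psi> U (s \<oplus>\<^bsub>sections Y U\<^esub> s') = b + b'" "\<psi> U (s \<otimes>\<^bsub>sections Y U\<^esub> s') = b * b'"
      using E s pre by (simp_all add: Q.evaluation_def)
    show "(a + a', b + b') \<in> \<Gamma>" using \<Gamma>I[OF s(1,2) cl(1)] by (simp only: v w)
    show "(a * a', b * b') \<in> \<Gamma>" using \<Gamma>I[OF s(1,2) cl(2)] by (simp only: v w)
  next
    fix a b assume "(a, b) \<in> \<Gamma>"
    then obtain U s where s: "Q.opY U" "p \<in> Q.pre U" "s \<in> carrier (sections Y U)" "a = value x s" "b = \<psi> U s"
      unfolding \<Gamma>_def by blast
    have "a \<noteq> 0 \<longleftrightarrow> germ_unit Y U (\<pi> p) s"
      using Q.val_nonzero[OF geom_point_prime[OF x(1)] s(1) _ s(3)] s(2) unfolding s(4) x(2) by simp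
    moreover have "b \<noteq> 0 \<longleftrightarrow> germ_unit Y U (\<pi> p) s"
      unfolding s(5) using pre s(2) by (intro Q.evaluation_germ_unit[OF E s(1) _ s(3)]) simp
    ultimately show "a = 0 \<longleftrightarrow> b = 0" by blast
  qed
  then obtain j where j: "\<And>a b. (a, b) \<in> \<Gamma> \<Longrightarrow> b = a ^ ?q ^ j" by blast
  define y where "y = (\<lambda>i. x i ^ ?q ^ j)"
  have gy: "cone_point y" and ppy: "point_prime y = p" unfolding y_def using cone_point_frobenius[OF x(1)] point_prime_frobenius[OF x(1)] x(2) by auto
  have \<psi>: "\<psi> U s = value y s" if "Q.opY U" "p \<in> Q.pre U" "s \<in> carrier (sections Y U)" for U s
    using j[OF \<Gamma>I[OF that]] value_frobenius[OF x(1) that(1) _ that(3), of j] that(2) x(2) by (simp add: y_def)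
  have yK: "value y s \<in> K" if "Q.opY U" "p \<in> Q.pre U" "s \<in> carrier (sections Y U)" for U s
    unfolding \<psi>[OF that, symmetric] using E that pre by (simp add: Q.evaluation_def)
  have g_y: "g = orbit_point y"
    unfolding g_eq p(2) orbit_point_def Q.geom_mor_def ppy
    using \<psi> pre by (intro Q.mor_cong) (simp add: ppy)
  let ?Fy = "\<lambda>i. y i ^ ?q ^ k"
  have ppF: "point_prime ?Fy = p" using point_prime_frobenius[OF gy, of k] ppy by simp
  have "\<exists>t h. t \<noteq> 0 \<and> h \<in> H \<and> (\<forall>i\<le>n. ?Fy i = t * (to_ac (h i) * y i))"
  proof (rule values_separate[OF gy cone_point_frobenius[OF gy]])
    show "\<pi> (point_prime y) = \<pi> (point_prime ?Fy)" by (simp only: ppy ppF)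
    fix U s assume U: "Q.opY U" "point_prime y \<in> Q.pre U" "s \<in> carrier (sections Y U)"
    show "value y s = value ?Fy s" using value_frobenius[OF gy U, of k] yK[OF U(1) _ U(3)] U(2) ppy by simp
  qed
  then obtain t h where th: "t \<noteq> 0" "h \<in> H" "\<And>i. i \<le> n \<Longrightarrow> ?Fy i = t * (to_ac (h i) * y i)" by blast
  have Q1: "?q ^ k > 1" using k_pos by (rule card_power_gt_1)
  \<comment> \<open>Rescaling by \<open>u\<close> absorbs the scalar \<open>t\<close>.\<close>
  obtain u where u: "u ^ (?q ^ k - 1) = inverse t" using nth_root_exists[of "?q ^ k - 1" "inverse t"] Q1 by auto
  have u0: "u \<noteq> 0" using u th(1) Q1 by (auto simp: power_0_left)
  have uQ: "u ^ ?q ^ k * t = u"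
  proof -
    have "?q ^ k = Suc (?q ^ k - 1)" using Q1 by simp
    hence "u ^ ?q ^ k = u * u ^ (?q ^ k - 1)" by (metis power_Suc)
    thus ?thesis using u th(1) by simp
  qed
  define w where "w = (\<lambda>i\<in>{..n}. u * y i)"
  have gw: "cone_point w" using cone_point_scale[OF gy u0] cone_point_cong[of w "\<lambda>i. u * y i"] by (simp add: w_def)
  have "w i ^ ?q ^ k = to_ac (h i) * w i" if i: "i \<le> n" for i
  proof -
    have "w i ^ ?q ^ k = u ^ ?q ^ k * ?Fy i" using i by (simp add: w_def power_mult_distrib)
    also have "\<dots> = (u ^ ?q ^ k * t) * (to_ac (h i) * y i)" unfolding th(3)[OF i] by (simp add: mult.assoc)
    also have "\<dots> = to_ac (h i) * w i" unfolding uQ using i by (simp add: w_def mult.left_commute)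
    finally show ?thesis .
  qed
  hence "stable h w" using gw th(2) by (simp add: stable_def)
  moreover have "orbit_point w = orbit_point y"
    using orbit_point_eqI[OF gy u0 H_one, of w] by (simp add: w_def gone_def)
  moreover have "w \<in> extensional {..n}" by (simp add: w_def)
  ultimately show ?thesis using g_y by metis
qed

lemma orbit_point_eqD:
  assumes x: "stable \<zeta> x" and y: "stable \<eta> y" and eq: "orbit_point x = orbit_point y"
  shows "\<exists>t h. t \<noteq> 0 \<and> h \<in> H \<and> (\<forall>i\<le>n. y i = t * (to_ac (h i) * x i))"
proof -
  have g: "cone_point x" "cone_point y" using x y by (auto simp: stable_def)
  have Ex: "Q.evaluation Y (\<pi> (point_prime x)) (\<lambda>U s. value x s)" by (rule evaluation_value[OF g(1)]) (rule stable_value[OF x])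
  have Ey: "Q.evaluation Y (\<pi> (point_prime y)) (\<lambda>U s. value y s)" by (rule evaluation_value[OF g(2)]) (rule stable_value[OF y])
  note eq = eq[unfolded orbit_point_def Q.geom_mor_def]
  show ?thesis
  proof (rule values_separate[OF g])
    show "\<pi> (point_prime x) = \<pi> (point_prime y)" by (rule Q.mor_eqD(1)[OF eq Ex Ey])
    fix U s assume "Q.opY U" "point_prime x \<in> Q.pre U" "s \<in> carrier (sections Y U)"
    thus "value x s = value y s" using in_pre[OF g(1)] by (intro Q.mor_eqD(2)[OF eq Ex Ey]) auto
  qed
qed

end

section \<open>Counting\<close>

lemma card_eq_image_times_fibre:
  assumes "finite B" "\<And>b. b \<in> B \<Longrightarrow> card {b' \<in> B. f b' = f b} = c"
  shows "card B = card (f ` B) * c"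
proof -
  have "card B = (\<Sum>y\<in>f ` B. card {b \<in> B. f b = y})"
    using sum.image_gen[OF assms(1), of "\<lambda>_. 1 :: nat" f] assms(1) by simp
  also have "\<dots> = (\<Sum>y\<in>f ` B. c)" using assms(2) by (intro sum.cong) auto
  finally show ?thesis by simp
qed

context dwork_points
begin

abbreviation "twist \<zeta> \<equiv> twisted_zeros n (to_ac lam) (CARD('f) ^ k) (\<lambda>i. to_ac (\<zeta> i))"

definition stable_pairs :: "((nat \<Rightarrow> 'f) \<times> (nat \<Rightarrow> 'f alg_closure)) set" where
  "stable_pairs = {(\<zeta>, x). stable \<zeta> x \<and> x \<in> extensional {..n}}"

lemma char_power: "\<exists>a>0. CARD('f) ^ k = CHAR('f alg_closure) ^ a"
proof -
  obtain m where "m > 0" "CARD('f) = CHAR('f) ^ m" using finite_field_card_prime_power by blast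
  thus ?thesis using k_pos by (intro exI[of _ "m * k"]) (simp add: power_mult)
qed

lemma prime_char: "prime CHAR('f alg_closure)"
  by (simp add: prime_CHAR_finite)

lemma Q_gt_1: "CARD('f) ^ k > 1"
  using k_pos by (rule card_power_gt_1)

lemma card_line: "c \<noteq> 0 \<Longrightarrow> card (twisted_line (CARD('f) ^ k) (c :: 'f alg_closure)) = CARD('f) ^ k"
  using char_power card_twisted_line[OF prime_char] by blast

lemma H_nonzero: "\<zeta> \<in> H \<Longrightarrow> i \<le> n \<Longrightarrow> \<zeta> i \<noteq> 0"
  using groupD(2) H_sub by blast

lemma H_ext: "\<zeta> \<in> H \<Longrightarrow> \<zeta> \<in> extensional {..n}"
  using H_sub by (auto simp: dwork_group_def)

lemma finite_H: "finite H"
proof (rule finite_subset)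
  show "H \<subseteq> PiE {..n} (\<lambda>_. UNIV)" using H_ext by (auto simp: PiE_def)
  show "finite (PiE {..n} (\<lambda>_. UNIV :: 'f set))" by (intro finite_PiE) auto
qed

lemma finite_twist: "\<zeta> \<in> H \<Longrightarrow> finite (twist \<zeta>)"
proof (rule finite_subset)
  assume \<zeta>: "\<zeta> \<in> H"
  show "twist \<zeta> \<subseteq> PiE {..n} (\<lambda>i. twisted_line (CARD('f) ^ k) (to_ac (\<zeta> i)))" by (auto simp: twisted_zeros_def)
  have "finite (twisted_line (CARD('f) ^ k) (to_ac (\<zeta> i)))" if "i \<le> n" for i
    using card_line[of "to_ac (\<zeta> i)"] H_nonzero[OF \<zeta> that] by (intro card_ge_0_finite) simp
  thus "finite (PiE {..n} (\<lambda>i. twisted_line (CARD('f) ^ k) (to_ac (\<zeta> i))))" by (intro finite_PiE) auto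
qed

lemma stable_pairs_eq: "stable_pairs = (SIGMA \<zeta>:H. twist \<zeta> - {\<lambda>i\<in>{..n}. 0})"
proof -
  have "(\<exists>i\<le>n. x i \<noteq> 0) \<longleftrightarrow> x \<noteq> (\<lambda>i\<in>{..n}. 0)" if "x \<in> extensional {..n}" for x :: "nat \<Rightarrow> 'f alg_closure"
    using that by (auto simp: fun_eq_iff extensional_def)
  hence "stable \<zeta> x \<and> x \<in> extensional {..n} \<longleftrightarrow> \<zeta> \<in> H \<and> x \<in> twist \<zeta> \<and> x \<noteq> (\<lambda>i\<in>{..n}. 0)" for \<zeta> x
    unfolding stable_def cone_point_def at_f twisted_zeros_def twisted_line_def PiE_def Pi_def by auto
  thus ?thesis by (auto simp: stable_pairs_def)
qed

lemma zero_twist: "(\<lambda>i\<in>{..n}. 0) \<in> twist \<zeta>"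
  using Q_gt_1 by (auto simp: twisted_zeros_def twisted_line_def power_0_left)

lemma finite_stable_pairs: "finite stable_pairs"
  unfolding stable_pairs_eq using finite_H finite_twist by auto

lemma card_stable_pairs: "card stable_pairs + card H = (\<Sum>\<zeta>\<in>H. card (twist \<zeta>))"
proof -
  have "card stable_pairs = (\<Sum>\<zeta>\<in>H. card (twist \<zeta> - {\<lambda>i\<in>{..n}. 0}))"
    unfolding stable_pairs_eq using finite_H finite_twist by (intro card_SigmaI) auto
  moreover have "card (twist \<zeta> - {\<lambda>i\<in>{..n}. 0}) + 1 = card (twist \<zeta>)" if "\<zeta> \<in> H" for \<zeta>
    using card_Suc_Diff1[OF finite_twist[OF that] zero_twist] by simp
  hence "(\<Sum>\<zeta>\<in>H. card (twist \<zeta> - {\<lambda>i\<in>{..n}. 0}) + 1) = (\<Sum>\<zeta>\<in>H. card (twist \<zeta>))"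
    by (intro sum.cong refl)
  ultimately show ?thesis by (simp only: sum.distrib card_eq_sum)
qed

lemma rational_points_image: "rational_points Y k = (\<lambda>(\<zeta>, x). orbit_point x) ` stable_pairs"
  using rational_point_is_orbit_point orbit_point_rational by (fastforce simp: stable_pairs_def)

lemma card_roots:
  assumes "c \<noteq> (0 :: 'f alg_closure)"
  shows "finite {t. t ^ (CARD('f) ^ k - 1) = c}" "card {t. t ^ (CARD('f) ^ k - 1) = c} = CARD('f) ^ k - 1"
proof -
  let ?Q = "CARD('f) ^ k"
  have S: "?Q = Suc (?Q - 1)" using Q_gt_1 by simp
  have "t ^ ?Q = t * t ^ (?Q - 1)" for t :: "'f alg_closure" using S by (metis power_Suc)
  hence eq: "{t. t ^ (?Q - 1) = c} = twisted_line ?Q c - {0}"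
    using Q_gt_1 assms by (auto simp: twisted_line_def power_0_left)
  have fin: "finite (twisted_line ?Q c)" using card_line[OF assms] Q_gt_1 by (intro card_ge_0_finite) simp
  have "0 \<in> twisted_line ?Q c" using Q_gt_1 by (simp add: twisted_line_def power_0_left)
  thus "finite {t. t ^ (?Q - 1) = c}" "card {t. t ^ (?Q - 1) = c} = ?Q - 1"
    unfolding eq using fin card_line[OF assms] by (simp_all add: card_Diff_singleton)
qed

lemma power_Q_const: "to_ac c ^ CARD('f) ^ k = to_ac (c :: 'f)"
  by (simp add: finite_field_power_card_power flip: to_ac_power)

text \<open>
  The fibre consists of the pairs \<open>(\<zeta>, t h x0)\<close> with \<open>h \<in> H\<close> and a scalar \<open>t\<close> such that
  \<open>\<zeta> = t\<^sup>Q\<^sup>-\<^sup>1 \<zeta>0\<close> on the support \<open>S\<close> of \<open>x0\<close>. Let \<open>C h'\<close> be the set of the \<open>h \<in> H\<close> proportional to \<open>h'\<close> on \<open>S\<close>;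
  its size does not depend on \<open>h'\<close>. For the triples \<open>(h, \<zeta>, t)\<close> there are \<open>|H|\<close> choices of \<open>h\<close>, \<open>|C \<zeta>0|\<close>
  choices of \<open>\<zeta>\<close>, and then \<open>Q - 1\<close> of \<open>t\<close>. Two triples with the same \<open>\<zeta>\<close> give the same vector iff
  their \<open>h\<close> are proportional on \<open>S\<close> with the inverse factor between their \<open>t\<close>, so every pair arises from
  \<open>|C h|\<close> triples.
\<close>

lemma card_fibre:
  assumes x0: "stable \<zeta>0 x0" "x0 \<in> extensional {..n}"
  shows "card {(\<zeta>, x) \<in> stable_pairs. orbit_point x = orbit_point x0} = card H * (CARD('f) ^ k - 1)"
proof -
  let ?Q = "CARD('f) ^ k"
  let ?F = "{(\<zeta>, x) \<in> stable_pairs. orbit_point x = orbit_point x0}"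
  have g0: "cone_point x0" and \<zeta>0: "\<zeta>0 \<in> H" and F0: "\<And>i. i \<le> n \<Longrightarrow> x0 i ^ ?Q = to_ac (\<zeta>0 i) * x0 i"
    using x0 by (auto simp: stable_def)
  define S where "S = {i. i \<le> n \<and> x0 i \<noteq> 0}"
  obtain i0 where i0: "i0 \<in> S" using g0 by (auto simp: cone_point_def S_def)
  hence i0n: "i0 \<le> n" and x00: "x0 i0 \<noteq> 0" by (auto simp: S_def)
  have pw: "t ^ ?Q = t * t ^ (?Q - 1)" for t :: "'f alg_closure"
  proof -
    have "?Q = Suc (?Q - 1)" using Q_gt_1 by simp
    thus ?thesis by (metis power_Suc)
  qed
  define C where "C h' = {h \<in> H. \<forall>i\<in>S. h i * h' i0 = h i0 * h' i}" for h'
  have finC: "finite (C h')" for h' using finite_H by (simp add: C_def)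
  have cardC: "card (C h') = card (C gone)" if h': "h' \<in> H" for h'
  proof (rule bij_betw_same_card[OF bij_betw_byWitness[where f = "gmul (ginv h')" and f' = "gmul h'"]])
    have nz: "h' i \<noteq> 0" if "i \<le> n" for i using H_nonzero[OF h' that] .
    have c1: "gmul (ginv h') (gmul h' h) = h" "gmul h' (gmul (ginv h') h) = h" if "h \<in> H" for h
      using nz H_ext[OF that] by (auto simp: gmul_def ginv_def fun_eq_iff extensional_def)
    show "\<forall>h\<in>C h'. gmul h' (gmul (ginv h') h) = h" "\<forall>h\<in>C gone. gmul (ginv h') (gmul h' h) = h"
      using c1 by (auto simp: C_def)
    show "gmul (ginv h') ` C h' \<subseteq> C gone"
      using nz i0n H_mul[OF H_inv[OF h']] by (auto simp: C_def gmul_def ginv_def gone_def S_def field_simps)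
    show "gmul h' ` C gone \<subseteq> C h'"
      using i0n H_mul[OF h'] by (auto simp: C_def gmul_def gone_def S_def)
  qed
  define R where "R \<zeta> = {t. t ^ (?Q - 1) = to_ac (\<zeta> i0 / \<zeta>0 i0)}" for \<zeta>
  define B where "B = H \<times> (SIGMA \<zeta>:C \<zeta>0. R \<zeta>)"
  define \<psi> where "\<psi> = (\<lambda>(h, \<zeta>, t). (\<zeta> :: nat \<Rightarrow> 'f, \<lambda>i\<in>{..n}. t * (to_ac (h i :: 'f) * x0 i)))"
  have R0: "to_ac (\<zeta> i0 / \<zeta>0 i0) \<noteq> 0" if "\<zeta> \<in> C \<zeta>0" for \<zeta>
    using that H_nonzero[OF \<zeta>0 i0n] H_nonzero[OF _ i0n, of \<zeta>] by (simp add: C_def)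
  have Rt0: "t \<noteq> 0" if "\<zeta> \<in> C \<zeta>0" "t \<in> R \<zeta>" for \<zeta> t
    using R0[OF that(1)] that(2) Q_gt_1 by (auto simp: R_def power_0_left)
  have finB: "finite B" unfolding B_def using finite_H finC card_roots(1)[OF R0] by (auto simp: R_def)
  have "card B = card H * card (SIGMA \<zeta>:C \<zeta>0. R \<zeta>)" by (simp add: B_def card_cartesian_product)
  also have "card (SIGMA \<zeta>:C \<zeta>0. R \<zeta>) = (\<Sum>\<zeta>\<in>C \<zeta>0. card (R \<zeta>))"
    using finC card_roots(1)[OF R0] by (intro card_SigmaI) (auto simp: R_def)
  also have "\<dots> = (\<Sum>\<zeta>\<in>C \<zeta>0. ?Q - 1)" using card_roots(2)[OF R0] by (intro sum.cong) (auto simp: R_def)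
  also have "\<dots> = card (C gone) * (?Q - 1)" using cardC[OF \<zeta>0] by simp
  finally have cardB: "card B = card H * (?Q - 1) * card (C gone)" by (simp add: ac_simps)
  have image: "\<psi> ` B = ?F"
  proof (intro equalityI subsetI)
    fix y assume "y \<in> \<psi> ` B"
    then obtain h \<zeta> t where b: "h \<in> H" "\<zeta> \<in> C \<zeta>0" "t \<in> R \<zeta>"
      and y: "y = (\<zeta>, \<lambda>i\<in>{..n}. t * (to_ac (h i) * x0 i))" by (auto simp: B_def \<psi>_def)
    let ?x = "\<lambda>i\<in>{..n}. t * (to_ac (h i) * x0 i)"
    have t0: "t \<noteq> 0" by (rule Rt0[OF b(2,3)])
    have "cone_point (\<lambda>i. t * (to_ac (h i) * x0 i))" using b(1) H_sub by (intro cone_point_scale[OF cone_point_act[OF _ g0] t0]) auto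
    hence gx: "cone_point ?x" using cone_point_cong[of ?x "\<lambda>i. t * (to_ac (h i) * x0 i)"] by simp
    have "?x i ^ ?Q = to_ac (\<zeta> i) * ?x i" if i: "i \<le> n" for i
    proof (cases "x0 i = 0")
      case True
      thus ?thesis using i Q_gt_1 by (simp add: power_0_left)
    next
      case False
      have "\<zeta> i * \<zeta>0 i0 = \<zeta> i0 * \<zeta>0 i" using b(2) i False by (simp add: C_def S_def)
      hence "\<zeta> i = \<zeta> i0 / \<zeta>0 i0 * \<zeta>0 i" using H_nonzero[OF \<zeta>0 i0n] by (simp add: field_simps)
      hence "to_ac (\<zeta> i) = t ^ (?Q - 1) * to_ac (\<zeta>0 i)" using b(3) by (simp add: R_def)
      thus ?thesis using i F0[OF i] by (simp add: power_mult_distrib power_Q_const pw[of t])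
    qed
    hence "stable \<zeta> ?x" using gx b(2) by (simp add: stable_def C_def)
    moreover have "orbit_point ?x = orbit_point x0" by (rule orbit_point_eqI[OF g0 t0 b(1)]) simp
    ultimately show "y \<in> ?F" by (simp add: y stable_pairs_def)
  next
    fix y assume "y \<in> ?F"
    then obtain \<zeta> x where y: "y = (\<zeta>, x)" and x: "stable \<zeta> x" "x \<in> extensional {..n}" "orbit_point x0 = orbit_point x"
      by (auto simp: stable_pairs_def)
    obtain t h where th: "t \<noteq> 0" "h \<in> H" "\<And>i. i \<le> n \<Longrightarrow> x i = t * (to_ac (h i) * x0 i)"
      using orbit_point_eqD[OF x0(1) x(1,3)] by blast
    have \<zeta>: "\<zeta> \<in> H" and Fx: "\<And>i. i \<le> n \<Longrightarrow> x i ^ ?Q = to_ac (\<zeta> i) * x i" using x(1) by (auto simp: stable_def)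
    have key: "to_ac (\<zeta> i) = t ^ (?Q - 1) * to_ac (\<zeta>0 i)" if i: "i \<in> S" for i
    proof -
      have i': "i \<le> n" "x0 i \<noteq> 0" using i by (auto simp: S_def)
      have "t * t ^ (?Q - 1) * (to_ac (h i) * (to_ac (\<zeta>0 i) * x0 i)) = to_ac (\<zeta> i) * (t * (to_ac (h i) * x0 i))"
        using Fx[OF i'(1)] unfolding th(3)[OF i'(1)] power_mult_distrib power_Q_const F0[OF i'(1)] pw[of t] .
      thus ?thesis using th(1) H_nonzero[OF th(2) i'(1)] i'(2) by (simp add: ac_simps)
    qed
    have c: "to_ac (\<zeta> i0 / \<zeta>0 i0) = t ^ (?Q - 1)" using key[OF i0] H_nonzero[OF \<zeta>0 i0n] by simp
    have "\<zeta> i * \<zeta>0 i0 = \<zeta> i0 * \<zeta>0 i" if "i \<in> S" for i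
    proof -
      have "to_ac (\<zeta> i * \<zeta>0 i0) = to_ac (\<zeta> i0 * \<zeta>0 i)" using key[OF that] key[OF i0] by simp
      thus ?thesis by (simp only: to_ac_eq_iff)
    qed
    hence "\<zeta> \<in> C \<zeta>0" using \<zeta> by (simp add: C_def)
    moreover have "t \<in> R \<zeta>" using c by (simp add: R_def)
    moreover have "x = (\<lambda>i\<in>{..n}. t * (to_ac (h i) * x0 i))" using th(3) x(2) by (auto simp: fun_eq_iff extensional_def)
    ultimately have "(h, \<zeta>, t) \<in> B" "y = \<psi> (h, \<zeta>, t)" using th(2) by (simp_all add: B_def \<psi>_def y)
    thus "y \<in> \<psi> ` B" by blast
  qed
  have "card {b' \<in> B. \<psi> b' = \<psi> b} = card (C gone)" if "b \<in> B" for b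
  proof -
    obtain h1 \<zeta>1 t1 where b: "b = (h1, \<zeta>1, t1)" "h1 \<in> H" "\<zeta>1 \<in> C \<zeta>0" "t1 \<in> R \<zeta>1"
      using \<open>b \<in> B\<close> by (auto simp: B_def)
    note h1 = H_nonzero[OF b(2)]
    have t1: "t1 \<noteq> 0" by (rule Rt0[OF b(3,4)])
    define \<theta> where "\<theta> h = (h, \<zeta>1, t1 * to_ac (h1 i0 / h i0))" for h
    have "{b' \<in> B. \<psi> b' = \<psi> b} = \<theta> ` C h1"
    proof (intro equalityI subsetI)
      fix b' assume "b' \<in> {b' \<in> B. \<psi> b' = \<psi> b}"
      then obtain h \<zeta> t where b': "b' = (h, \<zeta>, t)" "h \<in> H" "\<zeta> \<in> C \<zeta>0" "t \<in> R \<zeta>"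
        and eq: "\<psi> (h, \<zeta>, t) = \<psi> (h1, \<zeta>1, t1)" by (auto simp: B_def b(1))
      have \<zeta>: "\<zeta> = \<zeta>1" using eq by (simp add: \<psi>_def)
      have fe: "(\<lambda>i\<in>{..n}. t * (to_ac (h i) * x0 i)) = (\<lambda>i\<in>{..n}. t1 * (to_ac (h1 i) * x0 i))"
        using eq by (simp add: \<psi>_def)
      have key: "t * to_ac (h i) = t1 * to_ac (h1 i)" if "i \<in> S" for i
        using fun_cong[OF fe, of i] that by (simp add: S_def)
      have t: "t = t1 * to_ac (h1 i0 / h i0)" using key[OF i0] H_nonzero[OF b'(2) i0n] by (simp add: field_simps)
      have "h i * h1 i0 = h i0 * h1 i" if "i \<in> S" for i
      proof -
        have "(t * t1) * to_ac (h i * h1 i0) = (t * to_ac (h i)) * (t1 * to_ac (h1 i0))" by simp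
        also have "\<dots> = (t * t1) * to_ac (h i0 * h1 i)" unfolding key[OF that] key[OF i0, symmetric] by simp
        finally have "to_ac (h i * h1 i0) = to_ac (h i0 * h1 i)" using t1 Rt0[OF b'(3,4)] by simp
        thus ?thesis by (simp only: to_ac_eq_iff)
      qed
      hence "h \<in> C h1" using b'(2) by (simp add: C_def)
      moreover have "b' = \<theta> h" by (simp only: b'(1) \<zeta> t \<theta>_def)
      ultimately show "b' \<in> \<theta> ` C h1" by blast
    next
      fix b' assume "b' \<in> \<theta> ` C h1"
      then obtain h where h: "h \<in> C h1" "b' = \<theta> h" by blast
      hence hH: "h \<in> H" and hc: "\<And>i. i \<in> S \<Longrightarrow> h i * h1 i0 = h i0 * h1 i" by (auto simp: C_def)
      \<comment> \<open>The factor lies in the base field, so its \<open>(Q - 1)\<close>-th power is \<open>1\<close>.\<close>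
      define d where "d = h1 i0 / h i0"
      have d0: "d \<noteq> 0" using h1[OF i0n] H_nonzero[OF hH i0n] by (simp add: d_def)
      have "to_ac d * to_ac d ^ (?Q - 1) = to_ac d" using power_Q_const[of d] pw[of "to_ac d"] by simp
      hence "to_ac d ^ (?Q - 1) = 1" using d0 by simp
      hence "t1 * to_ac d \<in> R \<zeta>1" using b(4) by (simp add: R_def power_mult_distrib)
      hence "b' \<in> B" using hH b(3) by (simp add: h(2) \<theta>_def B_def d_def)
      moreover have "(\<lambda>i\<in>{..n}. (t1 * to_ac d) * (to_ac (h i) * x0 i)) = (\<lambda>i\<in>{..n}. t1 * (to_ac (h1 i) * x0 i))"
      proof (rule restrict_ext)
        fix i assume i: "i \<in> {..n}"
        show "(t1 * to_ac d) * (to_ac (h i) * x0 i) = t1 * (to_ac (h1 i) * x0 i)"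
        proof (cases "x0 i = 0")
          case False
          hence "h i * h1 i0 = h i0 * h1 i" using i hc by (simp add: S_def)
          hence "d * h i = h1 i" using H_nonzero[OF hH i0n] by (simp add: d_def field_simps)
          hence "to_ac d * to_ac (h i) = to_ac (h1 i)" by (simp flip: to_ac_mult)
          thus ?thesis by (simp add: mult.assoc[symmetric]) 
        qed simp
      qed
      hence "\<psi> b' = \<psi> b" by (simp only: h(2) \<theta>_def b(1) \<psi>_def d_def prod.case)
      ultimately show "b' \<in> {b' \<in> B. \<psi> b' = \<psi> b}" by simp
    qed
    moreover have "inj_on \<theta> (C h1)" by (auto simp: inj_on_def \<theta>_def)
    ultimately show ?thesis using card_image cardC[OF b(2)] by metis
  qed
  hence "card B = card (\<psi> ` B) * card (C gone)" by (rule card_eq_image_times_fibre[OF finB])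
  hence "card ?F * card (C gone) = card H * (?Q - 1) * card (C gone)" by (simp only: cardB image)
  moreover have "gone \<in> C gone" using H_one i0n by (auto simp: C_def gone_def S_def)
  hence "card (C gone) > 0" using finC by (auto simp: card_gt_0_iff)
  ultimately show ?thesis by simp
qed

theorem orbit_count:
  "card H * (CARD('f) ^ k - 1) * card (rational_points Y k) + card H = (\<Sum>\<zeta>\<in>H. card (twist \<zeta>))"
proof -
  let ?f = "\<lambda>(\<zeta> :: nat \<Rightarrow> 'f, x). orbit_point x"
  have "card {b' \<in> stable_pairs. ?f b' = ?f b} = card H * (CARD('f) ^ k - 1)" if "b \<in> stable_pairs" for b
  proof -
    obtain \<zeta> x where b: "b = (\<zeta>, x)" by force
    have "{b' \<in> stable_pairs. ?f b' = ?f b} = {(\<zeta>, y) \<in> stable_pairs. orbit_point y = orbit_point x}"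
      by (auto simp: b)
    thus ?thesis using card_fibre[of \<zeta> x] that by (simp add: b stable_pairs_def)
  qed
  hence "card stable_pairs = card (?f ` stable_pairs) * (card H * (CARD('f) ^ k - 1))"
    by (rule card_eq_image_times_fibre[OF finite_stable_pairs])
  thus ?thesis using card_stable_pairs by (simp add: rational_points_image ac_simps)
qed

theorem rational_points_cong:
  "[card H * (CARD('f) ^ k - 1) * card (rational_points Y k) + card H
    = card H * card (twisted_zeros n (to_ac lam) (CARD('f) ^ k) (\<lambda>_. 1))] (mod CARD('f) ^ k)"
proof -
  obtain a where a: "a > 0" "CARD('f) ^ k = CHAR('f alg_closure) ^ a" using char_power by blast
  have "[card (twist \<zeta>) = card (twisted_zeros n (to_ac lam) (CARD('f) ^ k) (\<lambda>_. 1))] (mod CARD('f) ^ k)"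
    if \<zeta>: "\<zeta> \<in> H" for \<zeta>
  proof (rule twisted_zeros_cong[OF prime_char a(2,1)])
    have \<zeta>': "\<zeta> \<in> dwork_group n" using \<zeta> H_sub by blast
    show "to_ac lam ^ CARD('f) ^ k = to_ac lam" by (rule power_Q_const)
    show "to_ac (\<zeta> i) ^ CARD('f) ^ k = to_ac (\<zeta> i)" for i by (rule power_Q_const)
    show "to_ac (\<zeta> i) ^ (n + 1) = 1" if "i \<le> n" for i
      using groupD(1)[OF \<zeta>' that] by (metis to_ac_1 to_ac_power)
    have "to_ac (\<Prod>i\<le>n. \<zeta> i) = 1" using \<zeta>' by (simp add: dwork_group_def)
    thus "(\<Prod>i\<le>n. to_ac (\<zeta> i)) = 1" by (simp only: to_ac_prod)
  qed
  hence "[(\<Sum>\<zeta>\<in>H. card (twist \<zeta>)) = (\<Sum>\<zeta>\<in>H. card (twisted_zeros n (to_ac lam) (CARD('f) ^ k) (\<lambda>_. 1)))] (mod CARD('f) ^ k)"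
    by (rule cong_sum)
  thus ?thesis unfolding orbit_count by simp
qed

end

section \<open>The hypersurface and its quotient\<close>

context dwork
begin

lemma gact_gact:
  assumes "\<zeta> \<in> dwork_group n" "\<eta> \<in> dwork_group n"
  shows "gact \<zeta> (gact \<eta> p) = gact (gmul \<zeta> \<eta>) p"
proof -
  have "\<phi> \<eta> (\<phi> \<zeta> a) = \<phi> (gmul \<zeta> \<eta>) a" if a: "a \<in> carrier A" for a
  proof -
    obtain P where P: "a = cl P" "P \<in> V" using a by (auto simp: carrier_A)
    have "scale_vars \<eta> (scale_vars \<zeta> P) = scale_vars (gmul \<zeta> \<eta>) P"
      by (rule scale_vars_scale_vars[OF P(2)]) (simp add: gmul_def)
    thus ?thesis using P \<phi>_cl assms gmul_group[OF assms] mpolys_scale_vars[OF P(2)] by simp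
  qed
  moreover have "\<phi> \<zeta> a \<in> carrier A" if "a \<in> carrier A" for a using ring_hom_closed[OF \<phi>_hom[OF assms(1)] that] .
  ultimately show ?thesis unfolding gact_def by auto
qed

lemma \<phi>_gone:
  assumes "a \<in> carrier A"
  shows "\<phi> gone a = a"
proof -
  obtain P where P: "a = cl P" "P \<in> V" using assms by (auto simp: carrier_A)
  have "scale_vars gone P = P" by (rule scale_vars_id[OF P(2)]) (simp add: gone_def)
  thus ?thesis using P \<phi>_cl[OF gone_group P(2)] by simp
qed

lemma gact_gone: "p \<in> Pts \<Longrightarrow> gact gone p = p"
  using \<phi>_gone ideal.Icarr[OF Pts_ideal] by (auto simp: gact_def)

lemma gact_inverse:
  assumes "\<zeta> \<in> dwork_group n" "p \<in> Pts"
  shows "gact (ginv \<zeta>) (gact \<zeta> p) = p"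
proof -
  have "gmul (ginv \<zeta>) \<zeta> = gone" using groupD(2)[OF assms(1)] by (auto simp: gmul_def ginv_def gone_def fun_eq_iff)
  thus ?thesis using gact_gact[OF ginv_group[OF assms(1)] assms(1)] gact_gone[OF assms(2)] by simp
qed

abbreviation "hyp \<equiv> dwork_hypersurface n lam"

lemma X_simps: "underlying hyp = zariski D Pts" "sections hyp = structure_sections A D Pts"
  "restr hyp = (\<lambda>U W s. restrict s W)" "scalar hyp = (\<lambda>c. \<lambda>p\<in>Pts. fraction A D p (cl (Const c)) \<one>\<^bsub>A\<^esub>)"
  by (simp_all add: dwork_hypersurface_def Proj_def prime_space_def Pts_def)

lemma points_X: "points hyp = Pts"
  by (simp add: X_simps topspace_zariski)

lemma graded_quotientI:
  fixes H :: "(nat \<Rightarrow> 'f) set" and \<pi> :: "'f mpoly set set \<Rightarrow> 'r"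
    and Y :: "('r, 'f mpoly set set \<Rightarrow> ('f mpoly set \<times> 'f mpoly set) set, 'f) ringed_space"
  assumes H: "H \<subseteq> dwork_group n"
    and \<pi>: "\<And>p p'. p \<in> Pts \<Longrightarrow> p' \<in> Pts \<Longrightarrow> \<pi> p = \<pi> p' \<longleftrightarrow> (\<exists>\<zeta>\<in>H. p' = gact \<zeta> p)"
    and Y: "points Y = \<pi> ` Pts"
      "\<And>U. openin (underlying Y) U \<longleftrightarrow> U \<subseteq> \<pi> ` Pts \<and> openin (zariski D Pts) {p \<in> Pts. \<pi> p \<in> U}"
      "\<And>U. openin (underlying Y) U \<Longrightarrow> sections Y U = (structure_sections A D Pts {p \<in> Pts. \<pi> p \<in> U})
        \<lparr>carrier := {s \<in> carrier (structure_sections A D Pts {p \<in> Pts. \<pi> p \<in> U}). \<forall>\<zeta>\<in>H. \<forall>p\<in>Pts. \<pi> p \<in> U \<longrightarrow>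
           s p = (\<Union>(a, b)\<in>s (gact \<zeta> p). fraction A D p (\<phi> \<zeta> a) (\<phi> \<zeta> b))}\<rparr>"
      "\<And>U W s. openin (underlying Y) U \<Longrightarrow> openin (underlying Y) W \<Longrightarrow> W \<subseteq> U \<Longrightarrow>
        restr Y U W s = restrict s {p \<in> Pts. \<pi> p \<in> W}"
      "\<And>c. scalar Y c = (\<lambda>p\<in>Pts. fraction A D p (cl (Const c)) \<one>\<^bsub>A\<^esub>)"
  shows "graded_quotient A D Pts H \<phi> (\<lambda>c. cl (Const c)) \<pi> Y"
proof (intro graded_quotient.intro graded_quotient_axioms.intro graded_primes_A)
  fix \<zeta> assume "\<zeta> \<in> H"
  hence \<zeta>: "\<zeta> \<in> dwork_group n" using H by blast
  note h = \<phi>_hom[OF \<zeta>]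
  show "\<phi> \<zeta> a \<in> D i" if "a \<in> D i" for a i by (rule \<phi>_D[OF \<zeta> that])
  show "\<phi> \<zeta> a \<in> carrier A" if "a \<in> carrier A" for a by (rule ring_hom_closed[OF h that])
  show "\<phi> \<zeta> (a \<otimes>\<^bsub>A\<^esub> b) = \<phi> \<zeta> a \<otimes>\<^bsub>A\<^esub> \<phi> \<zeta> b" "\<phi> \<zeta> (a \<oplus>\<^bsub>A\<^esub> b) = \<phi> \<zeta> a \<oplus>\<^bsub>A\<^esub> \<phi> \<zeta> b"
    if "a \<in> carrier A" "b \<in> carrier A" for a b
    by (rule ring_hom_mult[OF h that], rule ring_hom_add[OF h that])
  show "\<phi> \<zeta> \<one>\<^bsub>A\<^esub> = \<one>\<^bsub>A\<^esub>" by (rule ring_hom_one[OF h])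
  show "\<phi> \<zeta> (cl (Const c)) = cl (Const c)" for c by (simp add: \<phi>_cl[OF \<zeta>] scale_vars_Const)
  show "{a \<in> carrier A. \<phi> \<zeta> a \<in> p} \<in> Pts" if "p \<in> Pts" for p
    using gact_Pts[OF \<zeta> that] by (simp add: gact_def)
next
  show "cl (Const c) \<in> D 0" for c by (intro cl_D mpolys_Const homog_Const)
qed (use \<pi> Y in \<open>simp_all add: gact_def\<close>)

text \<open>
  For the trivial group invariance of a section is automatic, as a class of fractions is the union of the
  classes of its members.
\<close>

lemma graded_quotient_X: "graded_quotient A D Pts {gone} \<phi> (\<lambda>c. cl (Const c)) (\<lambda>p. p) hyp"
proof (rule graded_quotientI)
  show "{gone} \<subseteq> dwork_group n" using gone_group by simp
  show "p = p' \<longleftrightarrow> (\<exists>\<zeta>\<in>{gone}. p' = gact \<zeta> p)" if "p \<in> Pts" for p p' using gact_gone[OF that] by auto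
  show "points hyp = (\<lambda>p. p) ` Pts" by (simp add: points_X)
  have sub: "{p \<in> Pts. p \<in> U} = U" if "U \<subseteq> Pts" for U using that by blast
  show "openin (underlying hyp) U \<longleftrightarrow> U \<subseteq> (\<lambda>p. p) ` Pts \<and> openin (zariski D Pts) {p \<in> Pts. p \<in> U}" for U
    using op_subset[of U] sub[of U] by (auto simp: X_simps)
  fix U assume U: "openin (underlying hyp) U"
  hence U': "U \<subseteq> Pts" using op_subset by (simp add: X_simps)
  have "s p = (\<Union>(a, b)\<in>s (gact gone p). fraction A D p (\<phi> gone a) (\<phi> gone b))"
    if s: "s \<in> carrier (structure_sections A D Pts U)" "p \<in> U" for s p
  proof -
    have p: "p \<in> Pts" using s(2) U' by blast
    obtain i a b where ab: "a \<in> D i" "b \<in> D i" "b \<notin> p" "s p = fraction A D p a b" by (rule sec_at[OF s])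
    have "(\<Union>(a', b')\<in>s p. fraction A D p (\<phi> gone a') (\<phi> gone b')) = s p"
    proof (rule UN_constant_nonempty)
      show "(a, b) \<in> s p" unfolding ab(4) by (rule frac_self[OF p ab(1-3)])
      fix u assume "u \<in> s p"
      then obtain a' b' i' where u: "u = (a', b')" "a' \<in> D i'" "b' \<in> D i'" "b' \<notin> p" "same p a b a' b'"
        unfolding ab(4) by (cases u) (auto simp: frac_mem)
      have "fraction A D p a' b' = s p" unfolding ab(4) using frac_eq[OF p ab(1-3) u(2-4)] u(5) by simp
      thus "(case u of (a', b') \<Rightarrow> fraction A D p (\<phi> gone a') (\<phi> gone b')) = s p"
        using u(1) \<phi>_gone[OF D_closed[OF u(2)]] \<phi>_gone[OF D_closed[OF u(3)]] by simp
    qed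
    thus ?thesis by (simp add: gact_gone[OF p])
  qed
  hence "{s \<in> carrier (structure_sections A D Pts U). \<forall>\<zeta>\<in>{gone}. \<forall>p\<in>Pts. p \<in> U \<longrightarrow>
      s p = (\<Union>(a, b)\<in>s (gact \<zeta> p). fraction A D p (\<phi> \<zeta> a) (\<phi> \<zeta> b))} = carrier (structure_sections A D Pts U)"
    by blast
  thus "sections hyp U = (structure_sections A D Pts {p \<in> Pts. p \<in> U})
      \<lparr>carrier := {s \<in> carrier (structure_sections A D Pts {p \<in> Pts. p \<in> U}). \<forall>\<zeta>\<in>{gone}. \<forall>p\<in>Pts. p \<in> U \<longrightarrow>
         s p = (\<Union>(a, b)\<in>s (gact \<zeta> p). fraction A D p (\<phi> \<zeta> a) (\<phi> \<zeta> b))}\<rparr>"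
    unfolding sub[OF U'] by (simp add: X_simps)
next
  fix U W s assume "openin (underlying hyp) W"
  hence "W \<subseteq> Pts" using op_subset by (simp add: X_simps)
  hence "{p \<in> Pts. p \<in> W} = W" by blast
  thus "restr hyp U W s = restrict s {p \<in> Pts. p \<in> W}" by (simp add: X_simps)
qed (simp add: X_simps)

abbreviation "acts \<equiv> dwork_action n lam ` dwork_group n"

lemma action_eq:
  "dwork_action n lam \<zeta> = ((\<lambda>p\<in>Pts. gact \<zeta> p), \<lambda>U\<in>{U. openin (underlying hyp) U}. \<lambda>s\<in>carrier (sections hyp U).
     \<lambda>p\<in>preimage hyp (\<lambda>p\<in>Pts. gact \<zeta> p) U. (\<Union>(a, b)\<in>s ((\<lambda>p\<in>Pts. gact \<zeta> p) p). fraction A D p (\<phi> \<zeta> a) (\<phi> \<zeta> b)))"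
  unfolding dwork_action_def Proj_map_def Let_def dwork_hypersurface_def[symmetric] points_X gact_def \<phi>_def ..

lemma orbit_eq: "p \<in> Pts \<Longrightarrow> orbit acts p = (\<lambda>\<zeta>. gact \<zeta> p) ` dwork_group n"
  by (force simp: orbit_def action_eq image_image)

lemma orbit_eq_iff:
  assumes p: "p \<in> Pts" and p': "p' \<in> Pts"
  shows "orbit acts p = orbit acts p' \<longleftrightarrow> (\<exists>\<zeta>\<in>dwork_group n. p' = gact \<zeta> p)"
proof
  assume "orbit acts p = orbit acts p'"
  moreover have "p' \<in> orbit acts p'"
    unfolding orbit_eq[OF p'] using gact_gone[OF p'] gone_group by (intro image_eqI[of _ _ gone]) simp_all
  ultimately show "\<exists>\<zeta>\<in>dwork_group n. p' = gact \<zeta> p" by (auto simp: orbit_eq[OF p])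
next
  have sub: "orbit acts (gact \<zeta> p) \<subseteq> orbit acts p" if \<zeta>: "\<zeta> \<in> dwork_group n" and p: "p \<in> Pts" for \<zeta> p
    unfolding orbit_eq[OF p] orbit_eq[OF gact_Pts[OF \<zeta> p]] using gact_gact[OF _ \<zeta>] gmul_group[OF _ \<zeta>] by auto
  assume "\<exists>\<zeta>\<in>dwork_group n. p' = gact \<zeta> p"
  then obtain \<zeta> where \<zeta>: "\<zeta> \<in> dwork_group n" "p' = gact \<zeta> p" by blast
  have "p = gact (ginv \<zeta>) p'" unfolding \<zeta>(2) by (rule gact_inverse[OF \<zeta>(1) p, symmetric])
  hence "orbit acts p \<subseteq> orbit acts p'" using sub[OF ginv_group[OF \<zeta>(1)] p'] by simp
  thus "orbit acts p = orbit acts p'" using sub[OF \<zeta>(1) p] \<zeta>(2) by blast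
qed

text \<open>
  An open set \<open>U\<close> of the orbit space has the stable open preimage \<open>\<Union>U\<close>, on which the automorphisms act.
\<close>

lemma graded_quotient_orbits:
  "graded_quotient A D Pts (dwork_group n) \<phi> (\<lambda>c. cl (Const c)) (orbit acts) (quotient_space hyp acts)"
proof (rule graded_quotientI[OF subset_refl orbit_eq_iff])
  let ?Y = "quotient_space hyp acts"
  have op: "openin (underlying ?Y) U \<longleftrightarrow> U \<subseteq> orbit acts ` Pts \<and> openin (zariski D Pts) {p \<in> Pts. orbit acts p \<in> U}" for U
    by (simp add: quotient_space_def openin_quotient_topology points_X X_simps(1) topspace_zariski)
  thus "openin (underlying ?Y) U \<longleftrightarrow> U \<subseteq> orbit acts ` Pts \<and> openin (zariski D Pts) {p \<in> Pts. orbit acts p \<in> U}" for U .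
  have "openin (underlying ?Y) (orbit acts ` Pts)"
  proof -
    have "{p \<in> Pts. orbit acts p \<in> orbit acts ` Pts} = Pts" by blast
    thus ?thesis unfolding op using openin_topspace[of "zariski D Pts"] by (simp add: topspace_zariski)
  qed
  thus "points ?Y = orbit acts ` Pts"
    using op[of "points ?Y"] openin_subset[of "underlying ?Y" "orbit acts ` Pts"] by (auto intro: openin_topspace)
  have self: "p \<in> orbit acts p" if "p \<in> Pts" for p
    unfolding orbit_eq[OF that] using gact_gone[OF that] gone_group by (intro image_eqI[of _ _ gone]) simp_all
  have Un: "\<Union>U = {p \<in> Pts. orbit acts p \<in> U}" if U: "openin (underlying ?Y) U" for U
  proof (intro equalityI subsetI)
    fix p assume "p \<in> \<Union>U"
    then obtain p' where p': "p' \<in> Pts" "orbit acts p' \<in> U" "p \<in> orbit acts p'" using U unfolding op by blast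
    then obtain \<zeta> where \<zeta>: "\<zeta> \<in> dwork_group n" "p = gact \<zeta> p'" by (auto simp: orbit_eq)
    hence p: "p \<in> Pts" using gact_Pts[OF \<zeta>(1) p'(1)] by simp
    thus "p \<in> {p \<in> Pts. orbit acts p \<in> U}" using orbit_eq_iff[OF p'(1) p] \<zeta> p' by auto
  qed (use self in blast)
  show "restr ?Y U W s = restrict s {p \<in> Pts. orbit acts p \<in> W}"
    if "openin (underlying ?Y) W" for U W s
    using Un[OF that] by (simp add: quotient_space_def X_simps)
  show "scalar ?Y c = (\<lambda>p\<in>Pts. fraction A D p (cl (Const c)) \<one>\<^bsub>A\<^esub>)" for c
    by (simp add: quotient_space_def X_simps)
  fix U assume U: "openin (underlying ?Y) U"
  define W where "W = {p \<in> Pts. orbit acts p \<in> U}"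
  have opW: "openin (underlying hyp) W" using U unfolding op W_def X_simps by blast
  have fixed: "snd (dwork_action n lam \<zeta>) W s = s \<longleftrightarrow>
      (\<forall>p\<in>Pts. orbit acts p \<in> U \<longrightarrow> s p = (\<Union>(a, b)\<in>s (gact \<zeta> p). fraction A D p (\<phi> \<zeta> a) (\<phi> \<zeta> b)))"
    if \<zeta>: "\<zeta> \<in> dwork_group n" and s: "s \<in> carrier (sections hyp W)" for \<zeta> s
  proof -
    have "orbit acts (gact \<zeta> p) = orbit acts p" if "p \<in> Pts" for p
      using orbit_eq_iff[OF that gact_Pts[OF \<zeta> that]] \<zeta> by auto
    hence pre: "preimage hyp (\<lambda>p\<in>Pts. gact \<zeta> p) W = W"
      using gact_Pts[OF \<zeta>] by (auto simp: preimage_def points_X W_def)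
    have "snd (dwork_action n lam \<zeta>) W s = (\<lambda>p\<in>W. \<Union>(a, b)\<in>s ((\<lambda>p\<in>Pts. gact \<zeta> p) p). fraction A D p (\<phi> \<zeta> a) (\<phi> \<zeta> b))"
      using opW s pre by (simp add: action_eq)
    also have "\<dots> = (\<lambda>p\<in>W. \<Union>(a, b)\<in>s (gact \<zeta> p). fraction A D p (\<phi> \<zeta> a) (\<phi> \<zeta> b))"
      by (intro restrict_ext) (simp add: W_def)
    finally have eq: "snd (dwork_action n lam \<zeta>) W s = (\<lambda>p\<in>W. \<Union>(a, b)\<in>s (gact \<zeta> p). fraction A D p (\<phi> \<zeta> a) (\<phi> \<zeta> b))" .
    have ext: "s \<in> extensional W" using s by (simp add: X_simps carrier_O)
    show ?thesis
    proof
      assume "snd (dwork_action n lam \<zeta>) W s = s"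
      hence "s p = (\<lambda>p\<in>W. \<Union>(a, b)\<in>s (gact \<zeta> p). fraction A D p (\<phi> \<zeta> a) (\<phi> \<zeta> b)) p" for p using eq by simp
      thus "\<forall>p\<in>Pts. orbit acts p \<in> U \<longrightarrow> s p = (\<Union>(a, b)\<in>s (gact \<zeta> p). fraction A D p (\<phi> \<zeta> a) (\<phi> \<zeta> b))"
        by (simp add: W_def)
    next
      assume *: "\<forall>p\<in>Pts. orbit acts p \<in> U \<longrightarrow> s p = (\<Union>(a, b)\<in>s (gact \<zeta> p). fraction A D p (\<phi> \<zeta> a) (\<phi> \<zeta> b))"
      show "snd (dwork_action n lam \<zeta>) W s = s"
      proof (rule extensionalityI[of _ W])
        show "snd (dwork_action n lam \<zeta>) W s \<in> extensional W" by (simp add: eq)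
        fix p assume "p \<in> W"
        thus "snd (dwork_action n lam \<zeta>) W s p = s p" using * unfolding eq by (simp add: W_def)
      qed (rule ext)
    qed
  qed
  have "{s \<in> carrier (sections hyp W). \<forall>(g, h)\<in>acts. h W s = s} =
    {s \<in> carrier (structure_sections A D Pts W). \<forall>\<zeta>\<in>dwork_group n. \<forall>p\<in>Pts. orbit acts p \<in> U \<longrightarrow>
       s p = (\<Union>(a, b)\<in>s (gact \<zeta> p). fraction A D p (\<phi> \<zeta> a) (\<phi> \<zeta> b))}"
  proof (rule Collect_cong, rule conj_cong)
    show "s \<in> carrier (sections hyp W) \<longleftrightarrow> s \<in> carrier (structure_sections A D Pts W)" for s by (simp add: X_simps)
    fix s assume s: "s \<in> carrier (structure_sections A D Pts W)"
    have "(\<forall>(g, h)\<in>acts. h W s = s) \<longleftrightarrow> (\<forall>\<zeta>\<in>dwork_group n. snd (dwork_action n lam \<zeta>) W s = s)"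
      by (simp add: case_prod_beta)
    also have "\<dots> \<longleftrightarrow> (\<forall>\<zeta>\<in>dwork_group n. \<forall>p\<in>Pts. orbit acts p \<in> U \<longrightarrow>
        s p = (\<Union>(a, b)\<in>s (gact \<zeta> p). fraction A D p (\<phi> \<zeta> a) (\<phi> \<zeta> b)))"
      using fixed s by (intro ball_cong refl) (simp add: X_simps)
    finally show "(\<forall>(g, h)\<in>acts. h W s = s) \<longleftrightarrow> (\<forall>\<zeta>\<in>dwork_group n. \<forall>p\<in>Pts. orbit acts p \<in> U \<longrightarrow>
        s p = (\<Union>(a, b)\<in>s (gact \<zeta> p). fraction A D p (\<phi> \<zeta> a) (\<phi> \<zeta> b)))" .
  qed
  moreover have "sections ?Y U = (sections hyp W)\<lparr>carrier := {s \<in> carrier (sections hyp W). \<forall>(g, h)\<in>acts. h W s = s}\<rparr>"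
    using Un[OF U] by (simp add: quotient_space_def W_def)
  ultimately show "sections ?Y U = (structure_sections A D Pts {p \<in> Pts. orbit acts p \<in> U})
      \<lparr>carrier := {s \<in> carrier (structure_sections A D Pts {p \<in> Pts. orbit acts p \<in> U}). \<forall>\<zeta>\<in>dwork_group n. \<forall>p\<in>Pts.
         orbit acts p \<in> U \<longrightarrow> s p = (\<Union>(a, b)\<in>s (gact \<zeta> p). fraction A D p (\<phi> \<zeta> a) (\<phi> \<zeta> b))}\<rparr>"
    unfolding W_def[symmetric] by (simp add: X_simps)
qed

end

lemma spec_of_ext_field:
  "spec_of_field {x :: 'f :: {field, finite} alg_closure. x ^ CARD('f) ^ k = x} to_ac"
proof (rule spec_of_field.intro)
  obtain m where m: "CARD('f) = CHAR('f) ^ m" using finite_field_card_prime_power by blast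
  show "field (ring_on {x :: 'f alg_closure. x ^ CARD('f) ^ k = x})"
    by (rule frobenius_fixed_field[where b = "m * k"]) (simp_all add: prime_CHAR_finite m power_mult)
  show "to_ac c \<in> {x :: 'f alg_closure. x ^ CARD('f) ^ k = x}" for c
    by (simp add: finite_field_power_card_power flip: to_ac_power)
qed

theorem corollary0p3:
  fixes lam :: "'f :: {field, finite}" and q n k :: nat
  assumes "q = CARD('f)"
    and "n \<ge> 1"
    and "smooth (dwork_hypersurface n lam)"
    and "k \<ge> 1"
  shows "[card (rational_points (dwork_hypersurface n lam) k)
        = card (rational_points
            (quotient_space (dwork_hypersurface n lam) (dwork_action n lam ` dwork_group n)) k)]
        (mod q ^ k)"
proof -
  interpret dwork n lam .
  let ?G = "dwork_group n :: (nat \<Rightarrow> 'f) set" and ?Q = "CARD('f) ^ k"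
  interpret hyp: dwork_points n lam "{gone}" k "\<lambda>p. p" hyp
    using graded_quotient_X spec_of_ext_field gone_group \<open>k \<ge> 1\<close>
    by (intro dwork_points.intro graded_quotient_points.intro dwork_points_axioms.intro)
       (auto simp: gone_def ginv_def gmul_def)
  interpret Y: dwork_points n lam ?G k "orbit acts" "quotient_space hyp acts"
    using graded_quotient_orbits spec_of_ext_field gone_group ginv_group gmul_group \<open>k \<ge> 1\<close>
    by (intro dwork_points.intro graded_quotient_points.intro dwork_points_axioms.intro) auto
  let ?M = "card (twisted_zeros n (to_ac lam) ?Q (\<lambda>_. 1))"
  let ?a = "card (rational_points hyp k)" and ?b = "card (rational_points (quotient_space hyp acts) k)"
  have "[card ?G * ((?Q - 1) * ?a + 1) = card ?G * ?M] (mod ?Q)"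
    using hyp.rational_points_cong by (intro cong_scalar_left) simp
  moreover have "[card ?G * ((?Q - 1) * ?b + 1) = card ?G * ?M] (mod ?Q)"
    using Y.rational_points_cong by (simp add: algebra_simps)
  ultimately have "[card ?G * ((?Q - 1) * ?a + 1) = card ?G * ((?Q - 1) * ?b + 1)] (mod ?Q)"
    using cong_sym cong_trans by blast
  moreover have "coprime (card ?G) ?Q"
  proof -
    have "torus_group n ?G"
      using gone_group ginv_group gmul_group groupD(2)
      by (auto simp: torus_group_def dwork_group_def gone_def ginv_def gmul_def)
    hence "\<not> CHAR('f) dvd card ?G" by (rule torus_group_card)
    hence "coprime CHAR('f) (card ?G)" by (intro prime_imp_coprime prime_CHAR_finite)
    moreover obtain m where "CARD('f) = CHAR('f) ^ m" using finite_field_card_prime_power by blast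
    ultimately show ?thesis by (simp add: coprime_commute flip: power_mult)
  qed
  ultimately have "[(?Q - 1) * ?a + 1 = (?Q - 1) * ?b + 1] (mod ?Q)" by (simp only: cong_mult_lcancel_nat)
  hence "[(?Q - 1) * ?a = (?Q - 1) * ?b] (mod ?Q)" by (simp only: cong_add_rcancel_nat)
  moreover have "coprime (?Q - 1) ?Q" using hyp.Q_gt_1 by (intro coprime_diff_one_left_nat) simp
  ultimately have "[?a = ?b] (mod ?Q)" by (simp only: cong_mult_lcancel_nat)
  thus ?thesis by (simp add: \<open>q = CARD('f)\<close>)
qed

end
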